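(* Let $R$ be a PID and let $A=\{A_n\}_{n\ge0}$ be a commutative or skew commutative Koszul monoid in $\prod_{n\ge0}\mathrm{Mod}_{\mathbb Z[\mathrm{GL}_n(R)]}$. Assume: (a) $\mathrm H_0(\mathrm{GL}_2(R);A_2)=0$; (b) the product map $\mathrm H_0(\mathrm{GL}_1(R);A_1)\otimes \mathrm H_1(\mathrm{GL}_2(R);A_2)\to \mathrm H_1(\mathrm{GL}_3(R);A_3)$ is surjective. Then: (a') the product map $\mathrm H_0(\mathrm{GL}_1(R);A_1)\otimes \mathrm H_i(\mathrm{GL}_{n-1}(R);A_{n-1})\to \mathrm H_i(\mathrm{GL}_n(R);A_n)$ is surjective for all $i\ge 0$ and $n\ge 2i+1$; (b') $\mathrm H_i(\mathrm{GL}_n(R);A_n)=0$ for all $i\ge0$ and $n\ge 2i+2$.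
   Context: The category $\prod_{n\ge0}\mathrm{Mod}_{\mathbb Z[\mathrm{GL}_n(R)]}$ is equivalent to the category of functors $M$ from the groupoid of finite-rank free $R$-modules and isomorphisms to abelian groups ($M_n=M(R^n)$). It is symmetric monoidal with $(M\otimes N)(X)=\bigoplus_{X_1\oplus X_2=X}M(X_1)\otimes_{\mathbb Z}N(X_2)$, the sum being over ordered pairs of free submodules of $X$ whose internal direct sum is $X$; equivalently $(M\otimes N)_n\cong\bigoplus_{i+j=n}\mathrm{Ind}_{\mathrm{GL}_i(R)\times \mathrm{GL}_j(R)}^{\mathrm{GL}_n(R)}M_i\otimes_{\mathbb Z}N_j$. The unit is $\mathbb Z$ concentrated in degree $0$. A monoid $A$ is skew commutative if $ab=(-1)^{nm}ba$ for $a\in A(X_1)$, $b\in A(X_2)$ with $X_1,X_2$ of ranks $n,m$, and commutative if $ab=ba$. A monoid $A$ is augmented if there is a surjection of monoids $A\to\mathbb Z$ with kernel supported in degrees $>0$. For right and left $A$-modules $M,N$, $M\otimes_AN$ is the coequalizer of $M\otimes A\otimes N\rightrightarrows M\otimes N$ and $\mathrm{Tor}^A_*$ denotes the left derived functors. An augmented monoid $A$ is Koszul if, for each $i\ge0$, $\mathrm{Tor}_i^A(\mathbb Z,\mathbb Z)$ is supported only in degree $i$. The product map $\mathrm H_i(\mathrm{GL}_n(R);A_n)\otimes\mathrm H_j(\mathrm{GL}_m(R);A_m)\to\mathrm H_{i+j}(\mathrm{GL}_{n+m}(R);A_{n+m})$ is the composite of the Künneth (cross product) map to $\mathrm H_{i+j}(\mathrm{GL}_n(R)\times\mathrm{GL}_m(R);A_n\otimes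 A_m)$ and the map induced by the block inclusion $\mathrm{GL}_n(R)\times\mathrm{GL}_m(R)\to\mathrm{GL}_{n+m}(R)$ and the multiplication $A_n\otimes A_m\to A_{n+m}$. *)

theory Defs
  imports "HOL-Algebra.Algebra" "Jordan_Normal_Form.VS_Connect"
begin

text \<open>
  Abelian groups are \<^const>\<open>comm_group\<close> records, hence written multiplicatively, as for
  \<^const>\<open>free_Abelian_group\<close> and \<^const>\<open>sum_group\<close> in the library; a sign \<open>(-1)^k\<close> is an exponent.
\<close>

definition presented :: "'s set \<Rightarrow> ('s \<Rightarrow>\<^sub>0 int) set \<Rightarrow> ('s \<Rightarrow>\<^sub>0 int) set monoid" where
  "presented S Rs = free_Abelian_group S Mod generate (free_Abelian_group S) Rs"

definition presented_gen :: "'s set \<Rightarrow> ('s \<Rightarrow>\<^sub>0 int) set \<Rightarrow> 's \<Rightarrow> ('s \<Rightarrow>\<^sub>0 int) set" where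
  "presented_gen S Rs s = generate (free_Abelian_group S) Rs #>\<^bsub>free_Abelian_group S\<^esub> frag_of s"

text \<open>The homomorphism out of a presented group with prescribed values on the generators. It
  evaluates one representative; this is used only when the values satisfy the relations.\<close>

definition presented_ext :: "('k, 'z) monoid_scheme \<Rightarrow> ('s \<Rightarrow> 'k) \<Rightarrow> ('s \<Rightarrow>\<^sub>0 int) set \<Rightarrow> 'k" where
  "presented_ext K b T =
     (let c = (SOME c. c \<in> T)
      in finprod K (\<lambda>s. b s [^]\<^bsub>K\<^esub> Poly_Mapping.lookup c s) (Poly_Mapping.keys c))"

definition tensor_rels :: "('a, 'y) monoid_scheme \<Rightarrow> ('b, 'z) monoid_scheme \<Rightarrow> (('a \<times> 'b) \<Rightarrow>\<^sub>0 int) set" where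
  "tensor_rels G H =
     {frag_of (x \<otimes>\<^bsub>G\<^esub> x', y) - frag_of (x, y) - frag_of (x', y) | x x' y.
        x \<in> carrier G \<and> x' \<in> carrier G \<and> y \<in> carrier H}
   \<union> {frag_of (x, y \<otimes>\<^bsub>H\<^esub> y') - frag_of (x, y) - frag_of (x, y') | x y y'.
        x \<in> carrier G \<and> y \<in> carrier H \<and> y' \<in> carrier H}"

definition tensor_group ::
    "('a, 'y) monoid_scheme \<Rightarrow> ('b, 'z) monoid_scheme \<Rightarrow> (('a \<times> 'b) \<Rightarrow>\<^sub>0 int) set monoid" where
  "tensor_group G H = presented (carrier G \<times> carrier H) (tensor_rels G H)"

definition tensor_elt ::
    "('a, 'y) monoid_scheme \<Rightarrow> ('b, 'z) monoid_scheme \<Rightarrow> 'a \<Rightarrow> 'b \<Rightarrow> (('a \<times> 'b) \<Rightarrow>\<^sub>0 int) set" where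
  "tensor_elt G H x y = presented_gen (carrier G \<times> carrier H) (tensor_rels G H) (x, y)"

definition tensor_lift ::
    "('k, 'z) monoid_scheme \<Rightarrow> ('a \<Rightarrow> 'b \<Rightarrow> 'k) \<Rightarrow> (('a \<times> 'b) \<Rightarrow>\<^sub>0 int) set \<Rightarrow> 'k" where
  "tensor_lift K b = presented_ext K (\<lambda>(x, y). b x y)"

definition cycles :: "(nat \<Rightarrow> 'c monoid) \<Rightarrow> (nat \<Rightarrow> 'c \<Rightarrow> 'c) \<Rightarrow> nat \<Rightarrow> 'c set" where
  "cycles C d p = (if p = 0 then carrier (C 0) else kernel (C p) (C (p - 1)) (d p))"

definition boundaries :: "(nat \<Rightarrow> 'c monoid) \<Rightarrow> (nat \<Rightarrow> 'c \<Rightarrow> 'c) \<Rightarrow> nat \<Rightarrow> 'c set" where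
  "boundaries C d p = d (Suc p) ` carrier (C (Suc p))"

definition homology :: "(nat \<Rightarrow> 'c monoid) \<Rightarrow> (nat \<Rightarrow> 'c \<Rightarrow> 'c) \<Rightarrow> nat \<Rightarrow> 'c set monoid" where
  "homology C d p = subgroup_generated (C p) (cycles C d p) Mod boundaries C d p"

definition homology_class :: "(nat \<Rightarrow> 'c monoid) \<Rightarrow> (nat \<Rightarrow> 'c \<Rightarrow> 'c) \<Rightarrow> nat \<Rightarrow> 'c \<Rightarrow> 'c set" where
  "homology_class C d p z = boundaries C d p #>\<^bsub>subgroup_generated (C p) (cycles C d p)\<^esub> z"

definition g_module :: "('g, 'y) monoid_scheme \<Rightarrow> ('m, 'z) monoid_scheme \<Rightarrow> ('g \<Rightarrow> 'm \<Rightarrow> 'm) \<Rightarrow> bool" where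
  "g_module G M \<rho> \<longleftrightarrow> group G \<and> comm_group M \<and>
     (\<forall>g\<in>carrier G. \<rho> g \<in> hom M M) \<and>
     (\<forall>x\<in>carrier M. \<rho> \<one>\<^bsub>G\<^esub> x = x) \<and>
     (\<forall>g\<in>carrier G. \<forall>h\<in>carrier G. \<forall>x\<in>carrier M. \<rho> (g \<otimes>\<^bsub>G\<^esub> h) x = \<rho> g (\<rho> h x))"

text \<open>
  The bar complex: chains of degree \<open>p\<close> are finite sums of symbols \<open>[g\<^sub>1|\<dots>|g\<^sub>p] m\<close>, additive in
  \<open>m\<close>, with faces
  \<open>[g\<^sub>2|\<dots>|g\<^sub>p] m\<close>, \<open>[g\<^sub>1|\<dots>|g\<^sub>i g\<^sub>i\<^sub>+\<^sub>1|\<dots>|g\<^sub>p] m\<close> for \<open>0 < i < p\<close>, and \<open>[g\<^sub>1|\<dots>|g\<^sub>p\<^sub>-\<^sub>1] g\<^sub>p m\<close>.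
\<close>

definition bar_words :: "('g, 'y) monoid_scheme \<Rightarrow> nat \<Rightarrow> 'g list set" where
  "bar_words G p = {w. length w = p \<and> set w \<subseteq> carrier G}"

definition bar_chains ::
    "('g, 'y) monoid_scheme \<Rightarrow> ('m, 'z) monoid_scheme \<Rightarrow> nat \<Rightarrow> ('g list \<Rightarrow> 'm) monoid" where
  "bar_chains G M p = sum_group (bar_words G p) (\<lambda>_. M)"

definition bar_symbol ::
    "('g, 'y) monoid_scheme \<Rightarrow> ('m, 'z) monoid_scheme \<Rightarrow> 'g list \<Rightarrow> 'm \<Rightarrow> 'g list \<Rightarrow> 'm" where
  "bar_symbol G M w m = (\<lambda>v\<in>bar_words G (length w). if v = w then m else \<one>\<^bsub>M\<^esub>)"

definition bar_ext ::
    "('g, 'y) monoid_scheme \<Rightarrow> nat \<Rightarrow> ('k, 'z) monoid_scheme \<Rightarrow> ('g list \<Rightarrow> 'm \<Rightarrow> 'k)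
       \<Rightarrow> ('g list \<Rightarrow> 'm) \<Rightarrow> 'k" where
  "bar_ext G p K f c = gfinprod K (\<lambda>w. f w (c w)) (bar_words G p)"

definition bar_face ::
    "('g, 'y) monoid_scheme \<Rightarrow> ('m, 'z) monoid_scheme \<Rightarrow> ('g \<Rightarrow> 'm \<Rightarrow> 'm) \<Rightarrow> nat
       \<Rightarrow> 'g list \<Rightarrow> 'm \<Rightarrow> 'g list \<Rightarrow> 'm" where
  "bar_face G M \<rho> i w m =
     (if i = 0 then bar_symbol G M (tl w) m
      else if i = length w then bar_symbol G M (butlast w) (\<rho> (last w) m)
      else bar_symbol G M (take (i - 1) w @ [w ! (i - 1) \<otimes>\<^bsub>G\<^esub> w ! i] @ drop (Suc i) w) m)"

definition bar_diff ::
    "('g, 'y) monoid_scheme \<Rightarrow> ('m, 'z) monoid_scheme \<Rightarrow> ('g \<Rightarrow> 'm \<Rightarrow> 'm) \<Rightarrow> nat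
       \<Rightarrow> ('g list \<Rightarrow> 'm) \<Rightarrow> 'g list \<Rightarrow> 'm" where
  "bar_diff G M \<rho> p =
     (let K = bar_chains G M (p - 1)
      in bar_ext G p K (\<lambda>w m. finprod K (\<lambda>i. bar_face G M \<rho> i w m [^]\<^bsub>K\<^esub> ((-1) ^ i :: int)) {..p}))"

definition group_homology ::
    "('g, 'y) monoid_scheme \<Rightarrow> ('m, 'z) monoid_scheme \<Rightarrow> ('g \<Rightarrow> 'm \<Rightarrow> 'm) \<Rightarrow> nat
       \<Rightarrow> ('g list \<Rightarrow> 'm) set monoid" where
  "group_homology G M \<rho> p = homology (bar_chains G M) (bar_diff G M \<rho>) p"

definition group_homology_class ::
    "('g, 'y) monoid_scheme \<Rightarrow> ('m, 'z) monoid_scheme \<Rightarrow> ('g \<Rightarrow> 'm \<Rightarrow> 'm) \<Rightarrow> nat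
       \<Rightarrow> ('g list \<Rightarrow> 'm) \<Rightarrow> ('g list \<Rightarrow> 'm) set" where
  "group_homology_class G M \<rho> p = homology_class (bar_chains G M) (bar_diff G M \<rho>) p"

text \<open>The map induced by a homomorphism \<open>\<phi> : G \<rightarrow> G'\<close> and a \<open>\<phi>\<close>-equivariant \<open>f : M \<rightarrow> M'\<close>.\<close>

definition group_homology_map ::
    "('g, 'y) monoid_scheme \<Rightarrow>
     ('g', 'y') monoid_scheme \<Rightarrow> ('m', 'z') monoid_scheme \<Rightarrow> ('g' \<Rightarrow> 'm' \<Rightarrow> 'm') \<Rightarrow>
     ('g \<Rightarrow> 'g') \<Rightarrow> ('m \<Rightarrow> 'm') \<Rightarrow> nat \<Rightarrow> ('g list \<Rightarrow> 'm) set \<Rightarrow> ('g' list \<Rightarrow> 'm') set" where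
  "group_homology_map G G' M' \<rho>' \<phi> f p S =
     group_homology_class G' M' \<rho>' p
       (bar_ext G p (bar_chains G' M' p) (\<lambda>w m. bar_symbol G' M' (map \<phi> w) (f m)) (SOME z. z \<in> S))"

definition tensor_act ::
    "('m, 'y) monoid_scheme \<Rightarrow> ('g \<Rightarrow> 'm \<Rightarrow> 'm) \<Rightarrow> ('n, 'z) monoid_scheme \<Rightarrow> ('h \<Rightarrow> 'n \<Rightarrow> 'n)
       \<Rightarrow> 'g \<times> 'h \<Rightarrow> (('m \<times> 'n) \<Rightarrow>\<^sub>0 int) set \<Rightarrow> (('m \<times> 'n) \<Rightarrow>\<^sub>0 int) set" where
  "tensor_act M \<rho> N \<sigma> =
     (\<lambda>(g, h). tensor_lift (tensor_group M N) (\<lambda>x y. tensor_elt M N (\<rho> g x) (\<sigma> h y)))"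

text \<open>All shuffles of the words \<open>(x\<^sub>1, e') \<dots> (x\<^sub>p, e')\<close> and \<open>(e, y\<^sub>1) \<dots> (e, y\<^sub>q)\<close>, with their signs:
  moving a letter \<open>y\<close> in front of the remaining \<open>k\<close> letters \<open>x\<close> contributes \<open>(-1)^k\<close>.\<close>

fun signed_shuffles :: "'g \<Rightarrow> 'h \<Rightarrow> 'g list \<Rightarrow> 'h list \<Rightarrow> (int \<times> ('g \<times> 'h) list) list" where
  "signed_shuffles e e' [] ys = [(1, map (\<lambda>y. (e, y)) ys)]"
| "signed_shuffles e e' (x # xs) [] = [(1, map (\<lambda>x. (x, e')) (x # xs))]"
| "signed_shuffles e e' (x # xs) (y # ys) =
     map (\<lambda>(s, w). (s, (x, e') # w)) (signed_shuffles e e' xs (y # ys))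
   @ map (\<lambda>(s, w). ((-1) ^ length (x # xs) * s, (e, y) # w)) (signed_shuffles e e' (x # xs) ys)"

definition cross_chain ::
    "('g, 'y) monoid_scheme \<Rightarrow> ('m, 'z) monoid_scheme \<Rightarrow> ('h, 'y') monoid_scheme \<Rightarrow> ('n, 'z') monoid_scheme
       \<Rightarrow> nat \<Rightarrow> nat \<Rightarrow> ('g list \<Rightarrow> 'm) \<Rightarrow> ('h list \<Rightarrow> 'n)
       \<Rightarrow> ('g \<times> 'h) list \<Rightarrow> (('m \<times> 'n) \<Rightarrow>\<^sub>0 int) set" where
  "cross_chain G M H N p q c c' =
     (let K = bar_chains (G \<times>\<times> H) (tensor_group M N) (p + q)
      in bar_ext G p K (\<lambda>w m. bar_ext H q K (\<lambda>v n.
           foldr (\<lambda>(s, u) a. bar_symbol (G \<times>\<times> H) (tensor_group M N) u (tensor_elt M N m n) [^]\<^bsub>K\<^esub> s \<otimes>\<^bsub>K\<^esub> a)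
             (signed_shuffles \<one>\<^bsub>G\<^esub> \<one>\<^bsub>H\<^esub> w v) \<one>\<^bsub>K\<^esub>) c') c)"

definition cross_product ::
    "('g, 'y) monoid_scheme \<Rightarrow> ('m, 'z) monoid_scheme \<Rightarrow> ('g \<Rightarrow> 'm \<Rightarrow> 'm) \<Rightarrow>
     ('h, 'y') monoid_scheme \<Rightarrow> ('n, 'z') monoid_scheme \<Rightarrow> ('h \<Rightarrow> 'n \<Rightarrow> 'n) \<Rightarrow> nat \<Rightarrow> nat \<Rightarrow>
     ((('g list \<Rightarrow> 'm) set \<times> ('h list \<Rightarrow> 'n) set) \<Rightarrow>\<^sub>0 int) set \<Rightarrow>
     (('g \<times> 'h) list \<Rightarrow> (('m \<times> 'n) \<Rightarrow>\<^sub>0 int) set) set" where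
  "cross_product G M \<rho> H N \<sigma> i j =
     tensor_lift (group_homology (G \<times>\<times> H) (tensor_group M N) (tensor_act M \<rho> N \<sigma>) (i + j))
       (\<lambda>S T. group_homology_class (G \<times>\<times> H) (tensor_group M N) (tensor_act M \<rho> N \<sigma>) (i + j)
                (cross_chain G M H N i j (SOME x. x \<in> S) (SOME y. y \<in> T)))"

definition GL :: "nat \<Rightarrow> ('r :: comm_ring_1) mat monoid" where
  "GL n = units_of (ring_mat TYPE('r) n ())"

definition block_sum :: "('r :: zero) mat \<Rightarrow> 'r mat \<Rightarrow> 'r mat" where
  "block_sum g h =
     four_block_mat g (0\<^sub>m (dim_row g) (dim_col h)) (0\<^sub>m (dim_row h) (dim_col g)) h"

text \<open>The isomorphism \<open>R\<^sup>m \<oplus> R\<^sup>n \<rightarrow> R\<^sup>n \<oplus> R\<^sup>m\<close>, \<open>(v, w) \<mapsto> (w, v)\<close>.\<close>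

definition block_swap :: "nat \<Rightarrow> nat \<Rightarrow> ('r :: {zero, one}) mat" where
  "block_swap n m = four_block_mat (0\<^sub>m n m) (1\<^sub>m n) (1\<^sub>m m) (0\<^sub>m m n)"

record ('r, 'm) gl_seq =
  Grp :: "nat \<Rightarrow> 'm monoid"
  Act :: "nat \<Rightarrow> 'r mat \<Rightarrow> 'm \<Rightarrow> 'm"

definition gl_object :: "('r :: comm_ring_1, 'm, 'z) gl_seq_scheme \<Rightarrow> bool" where
  "gl_object M \<longleftrightarrow> (\<forall>n. g_module (GL n) (Grp M n) (Act M n))"

definition gl_hom ::
    "('r :: comm_ring_1, 'm, 'y) gl_seq_scheme \<Rightarrow> ('r, 'n, 'z) gl_seq_scheme \<Rightarrow> (nat \<Rightarrow> 'm \<Rightarrow> 'n) \<Rightarrow> bool" where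
  "gl_hom M N f \<longleftrightarrow> (\<forall>n. f n \<in> hom (Grp M n) (Grp N n) \<and>
     (\<forall>g\<in>carrier (GL n). \<forall>x\<in>carrier (Grp M n). f n (Act M n g x) = Act N n g (f n x)))"

text \<open>Morphisms \<open>M \<otimes> N \<rightarrow> P\<close>, described (by the universal properties of the tensor product of
  abelian groups and of induction) as biadditive \<open>GL\<^sub>i \<times> GL\<^sub>j\<close>-equivariant maps
  \<open>M\<^sub>i \<times> N\<^sub>j \<rightarrow> P\<^sub>i\<^sub>+\<^sub>j\<close>.\<close>

definition gl_pairing ::
    "('r :: comm_ring_1, 'm, 'x) gl_seq_scheme \<Rightarrow> ('r, 'n, 'y) gl_seq_scheme \<Rightarrow> ('r, 'p, 'z) gl_seq_scheme
       \<Rightarrow> (nat \<Rightarrow> nat \<Rightarrow> 'm \<Rightarrow> 'n \<Rightarrow> 'p) \<Rightarrow> bool" where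
  "gl_pairing M N P f \<longleftrightarrow> (\<forall>i j.
     (\<forall>x\<in>carrier (Grp M i). f i j x \<in> hom (Grp N j) (Grp P (i + j))) \<and>
     (\<forall>y\<in>carrier (Grp N j). (\<lambda>x. f i j x y) \<in> hom (Grp M i) (Grp P (i + j))) \<and>
     (\<forall>g\<in>carrier (GL i). \<forall>h\<in>carrier (GL j). \<forall>x\<in>carrier (Grp M i). \<forall>y\<in>carrier (Grp N j).
        f i j (Act M i g x) (Act N j h y) = Act P (i + j) (block_sum g h) (f i j x y)))"

text \<open>
  The monoidal product, \<open>(M \<otimes> N)\<^sub>n = \<Oplus>\<^sub>i\<^sub>+\<^sub>j\<^sub>=\<^sub>n \<int>[GL\<^sub>n] \<otimes> (M\<^sub>i \<otimes> N\<^sub>j)\<close> with the outer tensor product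
  over \<open>\<int>[GL\<^sub>i \<times> GL\<^sub>j]\<close>; the generator \<open>(g, i, x, y)\<close> stands for \<open>g \<otimes> (x \<otimes> y)\<close> in the summand \<open>i\<close>.
\<close>

type_synonym ('r, 'm, 'n) day_gen = "'r mat \<times> nat \<times> 'm \<times> 'n"

definition day_gens ::
    "('r :: comm_ring_1, 'm, 'y) gl_seq_scheme \<Rightarrow> ('r, 'n, 'z) gl_seq_scheme \<Rightarrow> nat
       \<Rightarrow> ('r, 'm, 'n) day_gen set" where
  "day_gens M N n = {(g, i, x, y). g \<in> carrier (GL n) \<and> i \<le> n \<and>
     x \<in> carrier (Grp M i) \<and> y \<in> carrier (Grp N (n - i))}"

definition day_rels ::
    "('r :: comm_ring_1, 'm, 'y) gl_seq_scheme \<Rightarrow> ('r, 'n, 'z) gl_seq_scheme \<Rightarrow> nat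
       \<Rightarrow> (('r, 'm, 'n) day_gen \<Rightarrow>\<^sub>0 int) set" where
  "day_rels M N n =
     {frag_of (g, i, x \<otimes>\<^bsub>Grp M i\<^esub> x', y) - frag_of (g, i, x, y) - frag_of (g, i, x', y) | g i x x' y.
        g \<in> carrier (GL n) \<and> i \<le> n \<and>
        x \<in> carrier (Grp M i) \<and> x' \<in> carrier (Grp M i) \<and> y \<in> carrier (Grp N (n - i))}
   \<union> {frag_of (g, i, x, y \<otimes>\<^bsub>Grp N (n - i)\<^esub> y') - frag_of (g, i, x, y) - frag_of (g, i, x, y') | g i x y y'.
        g \<in> carrier (GL n) \<and> i \<le> n \<and>
        x \<in> carrier (Grp M i) \<and> y \<in> carrier (Grp N (n - i)) \<and> y' \<in> carrier (Grp N (n - i))}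
   \<union> {frag_of (g * block_sum h k, i, x, y) - frag_of (g, i, Act M i h x, Act N (n - i) k y) | g h k i x y.
        g \<in> carrier (GL n) \<and> i \<le> n \<and> h \<in> carrier (GL i) \<and> k \<in> carrier (GL (n - i)) \<and>
        x \<in> carrier (Grp M i) \<and> y \<in> carrier (Grp N (n - i))}"

definition day_elt ::
    "('r :: comm_ring_1, 'm, 'y) gl_seq_scheme \<Rightarrow> ('r, 'n, 'z) gl_seq_scheme \<Rightarrow> nat
       \<Rightarrow> ('r, 'm, 'n) day_gen \<Rightarrow> (('r, 'm, 'n) day_gen \<Rightarrow>\<^sub>0 int) set" where
  "day_elt M N n = presented_gen (day_gens M N n) (day_rels M N n)"

definition day_tensor ::
    "('r :: comm_ring_1, 'm, 'y) gl_seq_scheme \<Rightarrow> ('r, 'n, 'z) gl_seq_scheme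
       \<Rightarrow> ('r, (('r, 'm, 'n) day_gen \<Rightarrow>\<^sub>0 int) set) gl_seq" where
  "day_tensor M N =
     \<lparr>Grp = \<lambda>n. presented (day_gens M N n) (day_rels M N n),
      Act = \<lambda>n h. presented_ext (presented (day_gens M N n) (day_rels M N n))
              (\<lambda>(g, i, x, y). day_elt M N n (h * g, i, x, y))\<rparr>"

record ('r, 'a) gl_monoid = "('r, 'a) gl_seq" +
  Unt :: 'a
  Mul :: "nat \<Rightarrow> nat \<Rightarrow> 'a \<Rightarrow> 'a \<Rightarrow> 'a"

text \<open>A morphism from the unit object \<open>\<int>\<close> (in degree \<open>0\<close>) to \<open>A\<close> is an element of \<open>A\<^sub>0\<close>.\<close>

definition is_monoid :: "('r :: comm_ring_1, 'a) gl_monoid \<Rightarrow> bool" where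
  "is_monoid A \<longleftrightarrow> gl_object A \<and> gl_pairing A A A (Mul A) \<and>
     Unt A \<in> carrier (Grp A 0) \<and>
     (\<forall>n. \<forall>a\<in>carrier (Grp A n). Mul A 0 n (Unt A) a = a \<and> Mul A n 0 a (Unt A) = a) \<and>
     (\<forall>i j k. \<forall>a\<in>carrier (Grp A i). \<forall>b\<in>carrier (Grp A j). \<forall>c\<in>carrier (Grp A k).
        Mul A (i + j) k (Mul A i j a b) c = Mul A i (j + k) a (Mul A j k b c))"

text \<open>Here \<open>a \<in> A(R\<^sup>n \<oplus> 0)\<close> and \<open>b \<in> A(0 \<oplus> R\<^sup>m)\<close>; the block swap transports their product in the
  other order from \<open>A(R\<^sup>m \<oplus> R\<^sup>n)\<close> to \<open>A(R\<^sup>n \<oplus> R\<^sup>m)\<close>.\<close>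

definition commutative :: "('r :: comm_ring_1, 'a) gl_monoid \<Rightarrow> bool" where
  "commutative A \<longleftrightarrow> (\<forall>n m. \<forall>a\<in>carrier (Grp A n). \<forall>b\<in>carrier (Grp A m).
     Mul A n m a b = Act A (n + m) (block_swap n m) (Mul A m n b a))"

definition skew_commutative :: "('r :: comm_ring_1, 'a) gl_monoid \<Rightarrow> bool" where
  "skew_commutative A \<longleftrightarrow> (\<forall>n m. \<forall>a\<in>carrier (Grp A n). \<forall>b\<in>carrier (Grp A m).
     Mul A n m a b =
       Act A (n + m) (block_swap n m) (Mul A m n b a) [^]\<^bsub>Grp A (n + m)\<^esub> ((-1) ^ (n * m) :: int))"

record ('r, 'a, 'm) gl_left_module = "('r, 'm) gl_seq" +
  LAct :: "nat \<Rightarrow> nat \<Rightarrow> 'a \<Rightarrow> 'm \<Rightarrow> 'm"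

record ('r, 'a, 'm) gl_right_module = "('r, 'm) gl_seq" +
  RAct :: "nat \<Rightarrow> nat \<Rightarrow> 'm \<Rightarrow> 'a \<Rightarrow> 'm"

definition left_hom ::
    "('r :: comm_ring_1, 'a) gl_monoid \<Rightarrow> ('r, 'a, 'm) gl_left_module \<Rightarrow> ('r, 'a, 'n) gl_left_module
       \<Rightarrow> (nat \<Rightarrow> 'm \<Rightarrow> 'n) \<Rightarrow> bool" where
  "left_hom A M N f \<longleftrightarrow> gl_hom M N f \<and>
     (\<forall>i j. \<forall>a\<in>carrier (Grp A i). \<forall>x\<in>carrier (Grp M j).
        f (i + j) (LAct M i j a x) = LAct N i j a (f j x))"

text \<open>
  \<open>M \<otimes>\<^sub>A N\<close> is the quotient of \<open>M \<otimes> N\<close> by the image of the difference of the two maps from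
  \<open>M \<otimes> A \<otimes> N\<close>; that image is generated by the values at \<open>g \<otimes> (x \<otimes> a \<otimes> y)\<close>.
\<close>

definition coeq_subgroup ::
    "('r :: comm_ring_1, 'a) gl_monoid \<Rightarrow> ('r, 'a, 'm) gl_right_module \<Rightarrow> ('r, 'a, 'n) gl_left_module
       \<Rightarrow> nat \<Rightarrow> (('r, 'm, 'n) day_gen \<Rightarrow>\<^sub>0 int) set set" where
  "coeq_subgroup A M N n = generate (Grp (day_tensor M N) n)
     {day_elt M N n (g, i + j, RAct M i j x a, y)
        \<otimes>\<^bsub>Grp (day_tensor M N) n\<^esub> inv\<^bsub>Grp (day_tensor M N) n\<^esub> day_elt M N n (g, i, x, LAct N j k a y)
      | g i j k x a y. n = i + j + k \<and> g \<in> carrier (GL n) \<and>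
          x \<in> carrier (Grp M i) \<and> a \<in> carrier (Grp A j) \<and> y \<in> carrier (Grp N k)}"

definition module_tensor ::
    "('r :: comm_ring_1, 'a) gl_monoid \<Rightarrow> ('r, 'a, 'm) gl_right_module \<Rightarrow> ('r, 'a, 'n) gl_left_module
       \<Rightarrow> nat \<Rightarrow> (('r, 'm, 'n) day_gen \<Rightarrow>\<^sub>0 int) set set monoid" where
  "module_tensor A M N n = Grp (day_tensor M N) n Mod coeq_subgroup A M N n"

definition module_tensor_map ::
    "('r :: comm_ring_1, 'a) gl_monoid \<Rightarrow> ('r, 'a, 'm) gl_right_module \<Rightarrow> ('r, 'a, 'n') gl_left_module
       \<Rightarrow> (nat \<Rightarrow> 'n \<Rightarrow> 'n') \<Rightarrow> nat
       \<Rightarrow> (('r, 'm, 'n) day_gen \<Rightarrow>\<^sub>0 int) set set \<Rightarrow> (('r, 'm, 'n') day_gen \<Rightarrow>\<^sub>0 int) set set" where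
  "module_tensor_map A M N' f n S =
     coeq_subgroup A M N' n #>\<^bsub>Grp (day_tensor M N') n\<^esub>
       presented_ext (Grp (day_tensor M N') n)
         (\<lambda>(g, i, x, y). day_elt M N' n (g, i, x, f (n - i) y)) (SOME t. t \<in> S)"

text \<open>The free object on a graded set \<open>B\<close>: in degree \<open>n\<close> it is the free \<open>\<int>[GL\<^sub>n]\<close>-module on \<open>B n\<close>.\<close>

definition free_object :: "(nat \<Rightarrow> 'b set) \<Rightarrow> ('r :: comm_ring_1, ('b \<times> 'r mat) \<Rightarrow>\<^sub>0 int) gl_seq" where
  "free_object B =
     \<lparr>Grp = \<lambda>n. free_Abelian_group (B n \<times> carrier (GL n)),
      Act = \<lambda>n g. frag_extend (\<lambda>(b, h). frag_of (b, g * h))\<rparr>"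

type_synonym ('r, 'a, 'b) free_elt = "(('r, 'a, ('b \<times> 'r mat) \<Rightarrow>\<^sub>0 int) day_gen \<Rightarrow>\<^sub>0 int) set"

definition free_left_module ::
    "('r :: comm_ring_1, 'a) gl_monoid \<Rightarrow> (nat \<Rightarrow> 'b set)
       \<Rightarrow> ('r, 'a, ('r, 'a, 'b) free_elt) gl_left_module" where
  "free_left_module A B =
     \<lparr>Grp = Grp (day_tensor A (free_object B)),
      Act = Act (day_tensor A (free_object B)),
      LAct = \<lambda>i j a. presented_ext (Grp (day_tensor A (free_object B)) (i + j))
        (\<lambda>(g, l, x, v). day_elt A (free_object B) (i + j) (block_sum (1\<^sub>m i) g, i + l, Mul A i l a x, v))\<rparr>"

definition free_resolution ::
    "('r :: comm_ring_1, 'a) gl_monoid \<Rightarrow> ('r, 'a, 'n) gl_left_module \<Rightarrow> (nat \<Rightarrow> nat \<Rightarrow> 'b set)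
       \<Rightarrow> (nat \<Rightarrow> nat \<Rightarrow> ('r, 'a, 'b) free_elt \<Rightarrow> ('r, 'a, 'b) free_elt)
       \<Rightarrow> (nat \<Rightarrow> ('r, 'a, 'b) free_elt \<Rightarrow> 'n) \<Rightarrow> bool" where
  "free_resolution A N B d \<eta> \<longleftrightarrow>
     (let F = (\<lambda>p. free_left_module A (B p)) in
      left_hom A (F 0) N \<eta> \<and> (\<forall>p. left_hom A (F (Suc p)) (F p) (d (Suc p))) \<and>
      (\<forall>n. \<eta> n ` carrier (Grp (F 0) n) = carrier (Grp N n) \<and>
           d 1 n ` carrier (Grp (F 1) n) = kernel (Grp (F 0) n) (Grp N n) (\<eta> n) \<and>
           (\<forall>p. d (Suc (Suc p)) n ` carrier (Grp (F (Suc (Suc p))) n)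
                = kernel (Grp (F (Suc p)) n) (Grp (F p) n) (d (Suc p) n))))"

text \<open>
  The degree \<open>n\<close> part of \<open>Tor\<^sup>A\<^sub>p(M, N)\<close>, by means of a chosen free resolution of the left module
  \<open>N\<close>. Every \<open>N\<close> has a free resolution with basis elements in \<^typ>\<open>('r \<times> 'a \<times> 'n) list\<close>: this type is
  infinite and at least as large as \<open>'r\<close>, \<open>'a\<close> and \<open>'n\<close>, so all elements of \<open>N\<^sub>n\<close>, and then of each
  successive kernel, can be indexed by it.
\<close>

definition Tor ::
    "('r :: comm_ring_1, 'a) gl_monoid \<Rightarrow> ('r, 'a, 'm) gl_right_module \<Rightarrow> ('r, 'a, 'n) gl_left_module
       \<Rightarrow> nat \<Rightarrow> nat
       \<Rightarrow> (('r, 'm, ('r, 'a, ('r \<times> 'a \<times> 'n) list) free_elt) day_gen \<Rightarrow>\<^sub>0 int) set set set monoid" where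
  "Tor A M N p n =
     (let (B, d) = (SOME (B, d). \<exists>\<eta>. free_resolution A N B d \<eta>);
          F = (\<lambda>p. free_left_module A (B p))
      in homology (\<lambda>p. module_tensor A M (F p) n) (\<lambda>p. module_tensor_map A M (F (p - 1)) (d p) n) p)"

definition unit_grp :: "nat \<Rightarrow> int monoid" where
  "unit_grp n = (if n = 0 then integer_group else singleton_group 0)"

definition unit_monoid :: "('r, int) gl_monoid" where
  "unit_monoid =
     \<lparr>Grp = unit_grp, Act = \<lambda>n g z. z, Unt = 1, Mul = \<lambda>i j z w. z * w\<rparr>"

definition monoid_hom ::
    "('r :: comm_ring_1, 'a) gl_monoid \<Rightarrow> ('r, 'b) gl_monoid \<Rightarrow> (nat \<Rightarrow> 'a \<Rightarrow> 'b) \<Rightarrow> bool" where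
  "monoid_hom A A' f \<longleftrightarrow> gl_hom A A' f \<and> f 0 (Unt A) = Unt A' \<and>
     (\<forall>i j. \<forall>a\<in>carrier (Grp A i). \<forall>b\<in>carrier (Grp A j).
        f (i + j) (Mul A i j a b) = Mul A' i j (f i a) (f j b))"

definition augmentation :: "('r :: comm_ring_1, 'a) gl_monoid \<Rightarrow> (nat \<Rightarrow> 'a \<Rightarrow> int) \<Rightarrow> bool" where
  "augmentation A \<epsilon> \<longleftrightarrow> monoid_hom A unit_monoid \<epsilon> \<and>
     (\<forall>n. \<epsilon> n ` carrier (Grp A n) = carrier (unit_grp n)) \<and>
     kernel (Grp A 0) (unit_grp 0) (\<epsilon> 0) = {\<one>\<^bsub>Grp A 0\<^esub>}"

definition unit_left :: "(nat \<Rightarrow> 'a \<Rightarrow> int) \<Rightarrow> ('r, 'a, int) gl_left_module" where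
  "unit_left \<epsilon> = \<lparr>Grp = unit_grp, Act = \<lambda>n g z. z, LAct = \<lambda>i j a z. \<epsilon> i a * z\<rparr>"

definition unit_right :: "(nat \<Rightarrow> 'a \<Rightarrow> int) \<Rightarrow> ('r, 'a, int) gl_right_module" where
  "unit_right \<epsilon> = \<lparr>Grp = unit_grp, Act = \<lambda>n g z. z, RAct = \<lambda>i j z a. z * \<epsilon> j a\<rparr>"

definition koszul :: "('r :: comm_ring_1, 'a) gl_monoid \<Rightarrow> bool" where
  "koszul A \<longleftrightarrow> (\<exists>\<epsilon>. augmentation A \<epsilon> \<and>
     (\<forall>i n. n \<noteq> i \<longrightarrow> trivial_group (Tor A (unit_right \<epsilon>) (unit_left \<epsilon>) i n)))"

definition gl_homology ::
    "('r :: comm_ring_1, 'a) gl_monoid \<Rightarrow> nat \<Rightarrow> nat \<Rightarrow> ('r mat list \<Rightarrow> 'a) set monoid" where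
  "gl_homology A n i = group_homology (GL n) (Grp A n) (Act A n) i"

definition product_map ::
    "('r :: comm_ring_1, 'a) gl_monoid \<Rightarrow> nat \<Rightarrow> nat \<Rightarrow> nat \<Rightarrow> nat
       \<Rightarrow> ((('r mat list \<Rightarrow> 'a) set \<times> ('r mat list \<Rightarrow> 'a) set) \<Rightarrow>\<^sub>0 int) set \<Rightarrow> ('r mat list \<Rightarrow> 'a) set" where
  "product_map A n m i j =
     group_homology_map (GL n \<times>\<times> GL m) (GL (n + m)) (Grp A (n + m)) (Act A (n + m))
       (\<lambda>(g, h). block_sum g h) (tensor_lift (Grp A (n + m)) (Mul A n m)) (i + j)
     \<circ> cross_product (GL n) (Grp A n) (Act A n) (GL m) (Grp A m) (Act A m) i j"

definition product_surjective :: "('r :: comm_ring_1, 'a) gl_monoid \<Rightarrow> nat \<Rightarrow> nat \<Rightarrow> nat \<Rightarrow> nat \<Rightarrow> bool" where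
  "product_surjective A n m i j \<longleftrightarrow>
     product_map A n m i j ` carrier (tensor_group (gl_homology A n i) (gl_homology A m j))
       = carrier (gl_homology A (n + m) (i + j))"

end

(*
 A class in H_i(GL_n(R); A_n) is a cycle in the homogeneous simplices on GL_n(R) with coefficients in A_n,
 modulo the relation (gamma h, a) = (gamma, h a). Choose a free resolution of Z by free A-modules. Its total
 complex has, in each degree n > 0, no homology, so that a cycle x of A_n bounds in it. By Shapiro's lemma the
 summand of the resolution generated by a basis element of degree k contributes the homology of GL_{n-k} with
 coefficients in A_{n-k}. Koszulness allows one to remove from a bounding chain all generators of resolution
 degree different from k, and the vanishing results for smaller n remove those with k >= 2, except for one
 critical term with k = 2, which is removed by means of hypothesis (b). What remains are the generators with
 k = 1: they say that x is a sum of products with A_1. If moreover x can be multiplied twice, then H_0(GL_2; A_2) = 0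
 makes the product a boundary. (Skew) commutativity only serves to exchange left and right multiplication by A_1;
 the exchange is a left translation by a block swap, which is homotopic to the identity.
*)

theory Submission
 imports Defs
begin

text \<open>The range comes from one inequality. A generator of degree K carries H_q(GL_{n-K};
  A_{n-K}) with q + K <= i + 1, and induction kills it if n - K >= 2q + 2. For n >= 2i + 2 this
  covers every K >= 2; for n = 2i + 1 only K = 2, q = i - 1 escapes. If i = 1, the claim for this n
  is hypothesis (b) itself. If i > 1, the surviving coefficients lie in H_{i-1}(GL_{2i-1};
  A_{2i-1}), hence by induction are sums of products with A_1. The product of an element of A_1 with
  a generator of degree 2 lives over GL_3, where (b) allows completing it to a cycle by terms of
  smaller degree; multiples of that cycle are subtracted. The resolution is arbitrary and may have
  generators off the diagonal p = k (p the resolution degree). Koszulness enters through an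
  endomorphism homotopic to the identity that lowers k on every generator with p < k; iterating it
  ends because 0 <= k <= n. No spectral sequence is formed: chains are formal sums of generators,
  computed modulo an explicit subgroup of relations, so filtrations are conditions on generators and
  a chain is split by restricting its support.\<close>

abbreviation (input) "fex == frag_extend"
abbreviation (input) "fo == frag_of"
abbreviation (input) "idm == one_mat"

subsection \<open>Free abelian groups modulo relations\<close>

text \<open>The additive subgroup generated by \<open>R\<close>, on type class groups so that
  equations between elements are left to the simplifier. Zero and differences suffice, so inductions
  need no separate cases for sums and inverses.\<close>

inductive_set gsp :: "'x::ab_group_add set => 'x set" for R where
 gsp_zero [simp, intro]: "0 : gsp R"
| gsp_base: "r : R ==> r : gsp R"
| gsp_diff: "x : gsp R ==> y : gsp R ==> x - y : gsp R"

lemma gsp_minus: "x : gsp R ==> - x : gsp R"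
 using gsp_diff[of 0 R x] by simp

lemma gsp_minus_iff [simp]: "- x : gsp R \<longleftrightarrow> x : gsp R"
 using gsp_minus[of x R] gsp_minus[of "- x" R] by auto

lemma gsp_add: "x : gsp R ==> y : gsp R ==> x + y : gsp R"
 using gsp_diff[of x R "- y"] gsp_minus[of y R] by simp

lemma gsp_sum: "(!!i. i : I ==> f i : gsp R) ==> sum f I : gsp R"
 by (induction I rule: infinite_finite_induct) (auto intro: gsp_add)

lemma gsp_cmul: "x : gsp R ==> frag_cmul k x : gsp R"
 by (rule frag_closure_minus_cmul) (auto intro: gsp_diff)

lemma gsp_diff_commute: "x - y : gsp R \<longleftrightarrow> y - x : gsp R"
 using gsp_minus_iff[of "x - y" R] by simp

lemma gsp_diff_trans: "x - y : gsp R ==> y - z : gsp R ==> x - z : gsp R"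
 using gsp_add[of "x - y" R "y - z"] by simp

lemma gsp_diff_mem: "x - y : gsp R ==> x : gsp R \<longleftrightarrow> y : gsp R"
 using gsp_add[of "x - y" R y] gsp_diff[of x R "x - y"] by auto

lemma gsp_diff_add: "x - y : gsp R ==> x' - y' : gsp R ==> x + x' - (y + y') : gsp R"
 using gsp_add[of "x - y" R "x' - y'"] by (simp add: algebra_simps)

lemma gsp_diff_diff: "x - y : gsp R ==> x' - y' : gsp R ==> x - x' - (y - y') : gsp R"
 using gsp_diff[of "x - y" R "x' - y'"] by (simp add: algebra_simps)

text \<open>Additivity is stated through differences, to match the closure rules of
  \<open>gsp\<close> and the induction rule of free abelian groups.\<close>

definition addv :: "('x::ab_group_add => 'y::ab_group_add) => bool" where
 "addv f \<longleftrightarrow> (\<forall>x y. f (x - y) = f x - f y)"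

lemma addvD: "addv f ==> f (x - y) = f x - f y"
 by (simp add: addv_def)

lemma addv_zero: "addv f ==> f 0 = 0"
 using addvD[of f 0 0] by simp

lemma addv_minus: "addv f ==> f (- x) = - f x"
 using addvD[of f 0 x] by (simp add: addv_zero)

lemma addv_add: "addv f ==> f (x + y) = f x + f y"
 using addvD[of f x "- y"] by (simp add: addv_minus)

lemma addv_sum: "addv f ==> f (sum g I) = (\<Sum>i\<in>I. f (g i))"
 by (induction I rule: infinite_finite_induct) (auto simp: addv_zero addv_add)

lemma addv_cmul: "addv f ==> f (frag_cmul k x) = frag_cmul k (f x)"
proof -
 assume f: "addv f"
 have nat: "f (frag_cmul (int n) x) = frag_cmul (int n) (f x)" for n
 by (induction n) (auto simp: addv_zero[OF f] addv_add[OF f] frag_cmul_distrib)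
 show ?thesis
 proof (cases k)
 case (nonneg n) then show ?thesis using nat by simp
 next
 case (neg n)
 then have "frag_cmul k x = - frag_cmul (int (Suc n)) x" by simp
 then show ?thesis using nat[of "Suc n"] neg addv_minus[OF f]
 by (metis minus_frag_cmul)
 qed
qed

lemma addv_frag_extend [simp, intro]: "addv (fex f)"
 by (simp add: addv_def frag_extend_diff)

lemma addv_id [simp, intro]: "addv (%x. x)"
 by (simp add: addv_def)

lemma addv_compose: "addv f ==> addv g ==> addv (%x. f (g x))"
 by (simp add: addv_def)

lemma addv_plus: "addv f ==> addv g ==> addv (%x. f x + g x)"
 by (simp add: addv_def)

lemma addv_diff: "addv f ==> addv g ==> addv (%x. f x - g x)"
 by (simp add: addv_def)

lemma addv_const_zero [simp, intro]: "addv (%x. 0)"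
 by (simp add: addv_def)

lemma addv_frag_cmul: "addv f ==> addv (%x. frag_cmul k (f x))"
 unfolding addv_def using frag_cmul_distrib2[of k]
 by (metis (no_types) add_diff_cancel_right' diff_add_cancel)

lemma addv_funpow: "addv (f :: 'x::ab_group_add => 'x) ==> addv (f ^^ n)"
 by (induction n) (auto simp: addv_def)

lemma addv_gsp:
 assumes "addv f" "!!r. r : R ==> f r : gsp R'" "x : gsp R"
 shows "f x : gsp R'"
 using assms(3) by induction (auto simp: addv_zero[OF assms(1)] addvD[OF assms(1)] assms(2) intro: gsp_diff)

lemma gsp_mono: "R <= R' ==> gsp R <= gsp R'"
proof
 fix x assume "R <= R'" "x : gsp R"
 from this(2,1) show "x : gsp R'" by induction (auto intro: gsp_base gsp_diff)
qed

definition fr :: "'s set => ('s \<Rightarrow>\<^sub>0 int) set" where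
 "fr S = {c. Poly_Mapping.keys c <= S}"

lemma fr_zero [simp, intro]: "0 : fr S" by (simp add: fr_def)
lemma fr_of [simp]: "fo s : fr S \<longleftrightarrow> s : S" by (simp add: fr_def)
lemma fr_diff: "x : fr S ==> y : fr S ==> x - y : fr S"
 using keys_diff[of x y] by (auto simp: fr_def)
lemma fr_add: "x : fr S ==> y : fr S ==> x + y : fr S"
 using Poly_Mapping.keys_add[of x y] by (auto simp: fr_def)
lemma fr_minus: "x : fr S ==> - x : fr S" by (simp add: fr_def)
lemma fr_cmul: "x : fr S ==> frag_cmul k x : fr S"
 using keys_cmul[of k x] by (auto simp: fr_def)
lemma fr_sum: "(!!i. i : I ==> f i : fr S) ==> sum f I : fr S"
 by (induction I rule: infinite_finite_induct) (auto intro: fr_add)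
lemma fr_mono: "x : fr S ==> S <= S' ==> x : fr S'" by (auto simp: fr_def)
lemma fr_empty: "x : fr {} \<longleftrightarrow> x = 0" by (simp add: fr_def)
lemma fr_keys: "x : fr (Poly_Mapping.keys x)" by (simp add: fr_def)
lemma carrier_free [simp]: "carrier (free_Abelian_group S) = fr S"
 by (auto simp: fr_def)

lemma fr_induct [consumes 1, case_names zero of diff]:
 assumes "c : fr S" "P 0" "!!s. s : S ==> P (fo s)"
 "!!a b. a : fr S ==> b : fr S ==> P a ==> P b ==> P (a - b)"
 shows "P c"
 using assms free_Abelian_group_induct[of c S P] unfolding fr_def by auto

lemma fr_extend:
 assumes "c : fr S" "!!s. s : S ==> f s : fr S'"
 shows "fex f c : fr S'"
 using assms(1) by (induction rule: fr_induct) (auto simp: frag_extend_diff assms(2) intro: fr_diff)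

lemma addv_fr:
 assumes "addv f" "c : fr S" "!!s. s : S ==> f (fo s) : fr S'"
 shows "f c : fr S'"
 using assms(2) by (induction rule: fr_induct) (auto simp: addv_zero[OF assms(1)] addvD[OF assms(1)] assms(3) intro: fr_diff)

lemma addv_fr_gsp:
 assumes "addv f" "c : fr S" "!!s. s : S ==> f (fo s) : gsp R"
 shows "f c : gsp R"
 using assms(2) by (induction rule: fr_induct) (auto simp: addv_zero[OF assms(1)] addvD[OF assms(1)] assms(3) intro: gsp_diff)

lemma addv_cong_gsp:
 assumes "addv f" "addv g" "c : fr S" "!!s. s : S ==> f (fo s) - g (fo s) : gsp R"
 shows "f c - g c : gsp R"
 using addv_fr_gsp[OF addv_diff[OF assms(1,2)] assms(3)] assms(4) by blast

lemma addv_eq_on: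
 assumes "addv f" "addv g" "c : fr S" "!!s. s : S ==> f (fo s) = g (fo s)"
 shows "f c = g c"
 using assms(3) by (induction rule: fr_induct) (auto simp: addv_zero[OF assms(1)] addv_zero[OF assms(2)] addvD[OF assms(1)] addvD[OF assms(2)] assms(4))

lemma addv_eq:
 assumes "addv f" "addv g" "!!s. f (fo s) = g (fo s)"
 shows "f c = g c"
 using addv_eq_on[OF assms(1,2), of c UNIV] assms(3) by (auto simp: fr_def)

lemma gsp_fr: "R <= fr S ==> gsp R <= fr S"
proof
 fix x assume "R <= fr S" "x : gsp R"
 from this(2,1) show "x : fr S" by induction (auto intro: fr_diff)
qed

text \<open>Every filtration below is a condition on generators; its pieces are cut out by this
  projection.\<close>

definition restr :: "('s => bool) => ('s \<Rightarrow>\<^sub>0 int) => ('s \<Rightarrow>\<^sub>0 int)" where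
 "restr P = fex (%x. if P x then fo x else 0)"

lemma addv_restr [simp, intro]: "addv (restr P)" by (simp add: restr_def)

lemma restr_of [simp]: "restr P (fo x) = (if P x then fo x else 0)"
 by (simp add: restr_def)

lemma restr_fr: "c : fr S ==> restr P c : fr {x : S. P x}"
 unfolding restr_def by (erule fr_extend) auto

lemma restr_fr': "c : fr S ==> (!!x. x : S ==> P x ==> x : S') ==> restr P c : fr S'"
 by (rule fr_mono[OF restr_fr]) auto

lemma restr_id: "c : fr S ==> (!!x. x : S ==> P x) ==> restr P c = c"
 by (rule addv_eq_on[of "restr P" "%x. x"]) auto

lemma restr_0: "c : fr S ==> (!!x. x : S ==> \<not> P x) ==> restr P c = 0"
 by (rule addv_eq_on[of "restr P" "%x. 0"]) auto

lemma restr_split: "restr P c + restr (%x. \<not> P x) c = c"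
 by (rule addv_eq[of "%c. restr P c + restr (%x. \<not> P x) c" "%x. x"]) (auto intro: addv_plus)

lemma restr_cong: "c : fr S ==> (!!x. x : S ==> P x = Q x) ==> restr P c = restr Q c"
 by (rule addv_eq_on[of "restr P" "restr Q"]) auto

lemma restr_restr: "restr P (restr Q c) = restr (%x. P x & Q x) c"
 by (rule addv_eq[of "%c. restr P (restr Q c)"]) (auto intro: addv_compose simp: addv_zero[OF addv_restr])

lemma frag_extend_addv: "addv h ==> h (fex f c) = fex (%x. h (f x)) c"
 by (rule addv_eq[of "%c. h (fex f c)"]) (auto intro: addv_compose)

lemma frag_extend_0fun [simp]: "fex (%x. 0) c = 0"
 by (simp add: frag_extend_def)

subsection \<open>Presented groups\<close>

text \<open>The bridge between the record-based \<open>generate\<close> of the definitions and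
  \<open>gsp\<close>. The inclusion \<open>R <= fr S\<close> guarantees that inverses in the record
  are negatives.\<close>

lemma generate_free_Abelian_group:
 assumes "R <= fr S" shows "generate (free_Abelian_group S) R = gsp R"
proof
 show "generate (free_Abelian_group S) R <= gsp R"
 proof
 fix x assume "x : generate (free_Abelian_group S) R"
 then show "x : gsp R"
 proof induction
 case (inv h)
 then have "Poly_Mapping.keys h <= S" using assms by (auto simp: fr_def)
 then show ?case using inv by (simp add: gsp_base)
 qed (auto intro: gsp_base gsp_add)
 qed
 show "gsp R <= generate (free_Abelian_group S) R"
 proof
 fix x assume "x : gsp R"
 then show "x : generate (free_Abelian_group S) R"
 proof induction
 case gsp_zero show ?case using generate.one[of "free_Abelian_group S" R] by simp
 next
 case (gsp_diff x y)
 have "y : fr S" using gsp_diff.hyps(2) gsp_fr[OF assms] by auto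
 then have ky: "Poly_Mapping.keys y <= S" by (simp add: fr_def)
 have "inv\<^bsub>free_Abelian_group S\<^esub> y : generate (free_Abelian_group S) R"
 using group.generate_m_inv_closed[OF group_free_Abelian_group, of R S y] assms gsp_diff by auto
 then have "- y : generate (free_Abelian_group S) R" using ky by simp
 then show ?case using generate.eng[OF gsp_diff.IH(1), of "- y"] by simp
 qed (auto intro: generate.incl)
 qed
qed

lemma (in group) r_coset_eq_iff:
 assumes "subgroup H G" "x : carrier G" "y : carrier G"
 shows "H #> x = H #> y \<longleftrightarrow> x \<otimes> inv y : H"
proof
 assume "H #> x = H #> y"
 then have "x : H #> y" using rcos_self[OF assms(2,1)] by simp
 then obtain h where "h : H" "x = h \<otimes> y" by (auto simp: r_coset_def)
 then show "x \<otimes> inv y : H" using assms subgroup.mem_carrier[OF assms(1)] by (simp add: m_assoc)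
next
 assume h: "x \<otimes> inv y : H"
 have "x = (x \<otimes> inv y) \<otimes> y" using assms by (simp add: m_assoc)
 then have "x : H #> y" using h by (auto simp: r_coset_def)
 then show "H #> x = H #> y" using repr_independence[OF _ assms(3,1)] by simp
qed

text \<open>The class of an arbitrary combination of generators; \<open>presented_gen\<close> is the
  case of a single generator.\<close>

definition cls :: "'s set => ('s \<Rightarrow>\<^sub>0 int) set => ('s \<Rightarrow>\<^sub>0 int) => ('s \<Rightarrow>\<^sub>0 int) set" where
 "cls S Rs c = generate (free_Abelian_group S) Rs #>\<^bsub>free_Abelian_group S\<^esub> c"

lemma presented_gen_cls: "presented_gen S Rs s = cls S Rs (fo s)"
 by (simp add: presented_gen_def cls_def)

locale presentation =
 fixes S :: "'s set" and Rs :: "('s \<Rightarrow>\<^sub>0 int) set"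
 assumes rels: "Rs <= fr S"
begin

lemma gen: "generate (free_Abelian_group S) Rs = gsp Rs"
 by (rule generate_free_Abelian_group[OF rels])

lemma sub: "subgroup (gsp Rs) (free_Abelian_group S)"
 using group.generate_is_subgroup[OF group_free_Abelian_group, of Rs S] rels by (simp add: gen)

lemma nor: "gsp Rs \<lhd> free_Abelian_group S"
 using comm_group.subgroup_imp_normal[OF abelian_free_Abelian_group sub] .

lemma cls_eq: "cls S Rs c = gsp Rs #>\<^bsub>free_Abelian_group S\<^esub> c"
 by (simp add: cls_def gen)

lemma cls_eq_iff: "c : fr S ==> c' : fr S ==> cls S Rs c = cls S Rs c' \<longleftrightarrow> c - c' : gsp Rs"
 using group.r_coset_eq_iff[OF group_free_Abelian_group sub, of c c'] inv_free_Abelian_group[of c' S]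
 by (simp add: cls_eq fr_def)

lemma mem_cls: "c' : cls S Rs c \<longleftrightarrow> c' - c : gsp Rs"
 by (auto simp: cls_eq r_coset_def)
 (metis add_diff_cancel_right' diff_add_cancel)

lemma carrier_presented: "carrier (presented S Rs) = cls S Rs ` fr S"
 by (auto simp: presented_def FactGroup_def RCOSETS_def cls_def)

lemma comm_group_presented: "comm_group (presented S Rs)"
 unfolding presented_def gen
 using comm_group.abelian_FactGroup[OF abelian_free_Abelian_group sub] .

lemma cls_mult: "c : fr S ==> c' : fr S ==> cls S Rs c \<otimes>\<^bsub>presented S Rs\<^esub> cls S Rs c' = cls S Rs (c + c')"
 unfolding presented_def gen cls_eq
 using normal.rcos_sum[OF nor, of c c'] by (simp add: FactGroup_def)

lemma one_presented: "\<one>\<^bsub>presented S Rs\<^esub> = cls S Rs 0"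
 unfolding presented_def gen cls_eq
 using group.coset_mult_one[OF group_free_Abelian_group, of "gsp Rs" S] gsp_fr[OF rels] by (simp add: FactGroup_def)

lemma cls_in [simp]: "c : fr S ==> cls S Rs c : carrier (presented S Rs)"
 by (simp add: carrier_presented)

lemma cls_hom: "cls S Rs : hom (free_Abelian_group S) (presented S Rs)"
 by (rule homI) (auto simp: cls_mult)

lemma cls_one_iff: "c : fr S ==> cls S Rs c = \<one>\<^bsub>presented S Rs\<^esub> \<longleftrightarrow> c : gsp Rs"
 using cls_eq_iff[of c 0] by (simp add: one_presented)

lemma cls_inv: "c : fr S ==> inv\<^bsub>presented S Rs\<^esub> (cls S Rs c) = cls S Rs (- c)"
 by (rule group.inv_equality[OF comm_group.axioms(2)[OF comm_group_presented]])
 (auto simp: cls_mult fr_minus one_presented)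

end

text \<open>The homomorphism out of the free group with prescribed values on generators;
  \<open>presented_ext\<close> is this map evaluated at a chosen representative.\<close>

definition fev :: "('k, 'z) monoid_scheme => ('s => 'k) => ('s \<Rightarrow>\<^sub>0 int) => 'k" where
 "fev K b c = finprod K (%s. b s [^]\<^bsub>K\<^esub> Poly_Mapping.lookup c s) (Poly_Mapping.keys c)"

context comm_group begin

lemma fev_alt:
 assumes "b : S \<rightarrow> carrier G" "c : fr S" "finite I" "Poly_Mapping.keys c <= I" "I <= S"
 shows "fev G b c = finprod G (%s. b s [^] Poly_Mapping.lookup c s) I"
 unfolding fev_def
proof (rule finprod_mono_neutral_cong_left)
 show "b i [^] Poly_Mapping.lookup c i = \<one>" if "i : I - Poly_Mapping.keys c" for i
 using that by (auto simp: in_keys_iff)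
 show "(%s. b s [^] Poly_Mapping.lookup c s) : I \<rightarrow> carrier G"
 using assms by auto
qed (use assms in auto)

lemma fev_closed: "b : S \<rightarrow> carrier G ==> c : fr S ==> fev G b c : carrier G"
 unfolding fev_def by (rule finprod_closed) (auto simp: fr_def)

lemma fev_add:
 assumes "b : S \<rightarrow> carrier G" "c : fr S" "c' : fr S"
 shows "fev G b (c + c') = fev G b c \<otimes> fev G b c'"
proof -
 let ?I = "Poly_Mapping.keys c \<union> Poly_Mapping.keys c'"
 have I: "finite ?I" "?I <= S" using assms by (auto simp: fr_def)
 have bI: "b s : carrier G" if "s : ?I" for s using that I assms by auto
 have "fev G b (c + c') = finprod G (%s. b s [^] Poly_Mapping.lookup (c + c') s) ?I"
 by (rule fev_alt[OF assms(1) fr_add[OF assms(2,3)]]) (use I Poly_Mapping.keys_add[of c c'] in auto)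
 also have "... = finprod G (%s. b s [^] Poly_Mapping.lookup c s \<otimes> b s [^] Poly_Mapping.lookup c' s) ?I"
 by (rule finprod_cong) (use bI in \<open>auto simp: Poly_Mapping.lookup_add int_pow_mult simp_implies_def\<close>)
 also have "... = finprod G (%s. b s [^] Poly_Mapping.lookup c s) ?I \<otimes> finprod G (%s. b s [^] Poly_Mapping.lookup c' s) ?I"
 by (rule finprod_multf) (use bI in \<open>auto simp del: Un_iff\<close>)
 also have "... = fev G b c \<otimes> fev G b c'"
 using fev_alt[OF assms(1,2) I(1) _ I(2)] fev_alt[OF assms(1,3) I(1) _ I(2)] by simp
 finally show ?thesis .
qed

lemma fev_hom: "b : S \<rightarrow> carrier G ==> fev G b : hom (free_Abelian_group S) G"
 by (rule homI) (auto simp: fev_closed fev_add)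

lemma fev_of: "b s : carrier G ==> fev G b (fo s) = b s"
 by (simp add: fev_def finprod_singleton)

lemma fev_zero: "fev G b 0 = \<one>"
 by (simp add: fev_def)

lemma fev_diff:
 assumes "b : S \<rightarrow> carrier G" "c : fr S" "c' : fr S"
 shows "fev G b (c - c') = fev G b c \<otimes> inv fev G b c'"
proof -
 have "fev G b c = fev G b (c - c') \<otimes> fev G b c'"
 using fev_add[OF assms(1) fr_diff[OF assms(2,3)] assms(3)] by simp
 then show ?thesis
 using fev_closed[OF assms(1,2)] fev_closed[OF assms(1,3)] fev_closed[OF assms(1) fr_diff[OF assms(2,3)]]
 by (simp add: m_assoc)
qed

lemma fev_gsp:
 assumes "b : S \<rightarrow> carrier G" "Rs <= fr S" "!!r. r : Rs ==> fev G b r = \<one>" "x : gsp Rs"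
 shows "fev G b x = \<one>"
 using assms(4)
proof induction
 case (gsp_diff x y)
 then have "x : fr S" "y : fr S" using gsp_fr[OF assms(2)] by auto
 then show ?case using fev_diff[OF assms(1)] gsp_diff by simp
qed (auto simp: fev_zero assms)

lemma hom_eq_fev:
 assumes h: "h : hom (free_Abelian_group S) G" and c: "c : fr S" and b: "!!s. s : S ==> h (fo s) = b s"
 shows "h c = fev G b c"
proof -
 interpret h: group_hom "free_Abelian_group S" G h
 using h by (simp add: group_hom_def group_hom_axioms_def)
 have bS: "b : S \<rightarrow> carrier G" using h.hom_closed b by (metis Pi_I frag_of_in_free_Abelian_group)
 show ?thesis using c
 proof (induction rule: fr_induct)
 case (diff x y)
 have d: "x - y : fr S" by (rule fr_diff[OF diff(1,2)])
 have "h (x - y) \<otimes> h y = h x" using h.hom_mult[of "x - y" y] diff(1,2) d by simp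
 moreover have "h x : carrier G" "h y : carrier G" "h (x - y) : carrier G"
 using diff(1,2) d h.hom_closed by simp_all
 ultimately have "h (x - y) = h x \<otimes> inv h y" by (metis inv_solve_right)
 then show ?case using fev_diff[OF bS diff(1,2)] diff(3,4) by simp
 qed (use h.hom_one b in \<open>auto simp: fev_zero fev_of bS[THEN funcset_mem]\<close>)
qed

text \<open>The chosen representative differs from \<open>c\<close> by an element of
  \<open>gsp Rs\<close>, and \<open>fev\<close> is trivial there because it is trivial on
  \<open>Rs\<close>.\<close>

lemma presented_ext_cls:
 assumes Rs: "Rs <= fr S" and b: "b : S \<rightarrow> carrier G" and r: "!!r. r : Rs ==> fev G b r = \<one>" and c: "c : fr S"
 shows "presented_ext G b (cls S Rs c) = fev G b c"
proof -
 interpret p: presentation S Rs by (unfold_locales) (rule Rs)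
 define c' where "c' = (SOME c'. c' : cls S Rs c)"
 have "c' : cls S Rs c" unfolding c'_def by (rule someI[of _ c]) (simp add: p.mem_cls)
 then have d: "c' - c : gsp Rs" by (simp add: p.mem_cls)
 then have "c' - c : fr S" using gsp_fr[OF Rs] by auto
 then have c'S: "c' : fr S" using fr_add[OF _ c, of "c' - c"] by simp
 have "fev G b (c' - c) = \<one>" using fev_gsp[OF b Rs r d] by simp
 then have "fev G b c' = fev G b c"
 using fev_add[OF b \<open>c' - c : fr S\<close> c] fev_closed[OF b c] by simp
 then show ?thesis by (simp add: presented_ext_def c'_def[symmetric] fev_def Let_def)
qed

end

lemma (in presentation) fev_presented:
 assumes "c : fr T" "!!t. t : T ==> \<beta> t : fr S" "!!t. t : T ==> b t = cls S Rs (\<beta> t)"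
 shows "fev (presented S Rs) b c = cls S Rs (fex \<beta> c)"
proof -
 interpret K: comm_group "presented S Rs" by (rule comm_group_presented)
 have "(%c. cls S Rs (fex \<beta> c)) : hom (free_Abelian_group T) (presented S Rs)"
 by (rule homI) (auto simp: cls_mult frag_extend_add fr_extend assms intro!: cls_in)
 from K.hom_eq_fev[OF this assms(1), of b] assms(3) show ?thesis by simp
qed

text \<open>This reduces every map between presented groups in the definitions to a map
  \<open>fex \<beta>\<close> of free groups that carries relations to relations.\<close>

lemma (in presentation) presented_ext_presented:
 assumes "Rs' <= fr T" "c : fr T" "!!t. t : T ==> \<beta> t : fr S" "!!t. t : T ==> b t = cls S Rs (\<beta> t)"
 "!!r. r : Rs' ==> fex \<beta> r : gsp Rs"
 shows "presented_ext (presented S Rs) b (cls T Rs' c) = cls S Rs (fex \<beta> c)"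
proof -
 interpret K: comm_group "presented S Rs" by (rule comm_group_presented)
 have b: "b : T \<rightarrow> carrier (presented S Rs)" using assms(3,4) by auto
 have "fev (presented S Rs) b r = \<one>\<^bsub>presented S Rs\<^esub>" if "r : Rs'" for r
 proof -
 have "r : fr T" using that assms(1) by auto
 moreover have "fex \<beta> r : fr S" by (rule fr_extend[OF \<open>r : fr T\<close> assms(3)])
 ultimately show ?thesis
 using fev_presented[OF _ assms(3,4), of r] cls_one_iff assms(5)[OF that] by simp
 qed
 then show ?thesis
 using K.presented_ext_cls[OF assms(1) b _ assms(2)] fev_presented[OF assms(2,3,4)] by simp
qed

subsection \<open>General linear groups and block sums\<close>

abbreviation GLc :: "nat => 'r::comm_ring_1 mat set" where "GLc n \<equiv> carrier (GL n)"

lemma GL_carrier: "GLc n = {g :: 'r::comm_ring_1 mat. g : carrier_mat n n & (\<exists>h\<in>carrier_mat n n. h * g = idm n & g * h = idm n)}"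
 by (auto simp: GL_def units_of_def Units_def ring_mat_simps)

lemma GL_mult [simp]: "g \<otimes>\<^bsub>GL n\<^esub> h = g * h"
 by (simp add: GL_def units_of_def ring_mat_simps)

lemma GL_one [simp]: "\<one>\<^bsub>GL n\<^esub> = idm n"
 by (simp add: GL_def units_of_def ring_mat_simps)

lemma group_GL [simp, intro]: "group (GL n)"
 unfolding GL_def by (rule monoid.units_group) (rule ring.is_monoid[OF ring_mat])

lemma GLc_mat [simp]: "g : GLc n ==> g : carrier_mat n n"
 by (simp add: GL_carrier)

lemma GLc_dim [simp]: "g : GLc n ==> dim_row g = n" "g : GLc n ==> dim_col g = n"
 using GLc_mat by blast+

lemma GLc_mult [simp, intro]: "g : GLc n ==> h : GLc n ==> g * h : GLc n"
 using group.is_monoid[OF group_GL] monoid.m_closed by fastforce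

lemma GLc_one [simp, intro]: "idm n : GLc n"
 using group.is_monoid[OF group_GL] monoid.one_closed by fastforce

lemma GLc_assoc: "g : GLc n ==> h : GLc n ==> k : GLc n ==> g * h * k = g * (h * k)"
 using assoc_mult_mat[of g n n h n k n] by simp

lemma GLc_l_one [simp]: "g : GLc n ==> idm n * g = g"
 by simp

lemma GLc_r_one [simp]: "g : GLc n ==> g * idm n = g"
 by simp

definition ginv :: "nat => 'r::comm_ring_1 mat => 'r mat" where "ginv n g = inv\<^bsub>GL n\<^esub> g"

lemma ginv [simp]: "g : GLc n ==> ginv n g : GLc n" "g : GLc n ==> ginv n g * g = idm n"
 "g : GLc n ==> g * ginv n g = idm n"
 using group.inv_closed[OF group_GL, of g n] group.l_inv[OF group_GL, of g n] group.r_inv[OF group_GL, of g n]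
 by (auto simp: ginv_def)

lemma block_sum_dim [simp]: "dim_row (block_sum g h) = dim_row g + dim_row h" "dim_col (block_sum g h) = dim_col g + dim_col h"
 by (simp_all add: block_sum_def)

lemma block_sum_carrier: "g : carrier_mat n n ==> h : carrier_mat m m ==> block_sum g h : carrier_mat (n + m) (n + m)"
 unfolding block_sum_def by auto

lemma block_sum_mult_mat:
 fixes g :: "'r::comm_ring_1 mat"
 assumes "g : carrier_mat n n" "g' : carrier_mat n n" "h : carrier_mat m m" "h' : carrier_mat m m"
 shows "block_sum g h * block_sum g' h' = block_sum (g * g') (h * h')"
proof -
 have "block_sum g h * block_sum g' h' = four_block_mat g (0\<^sub>m n m) (0\<^sub>m m n) h * four_block_mat g' (0\<^sub>m n m) (0\<^sub>m m n) h'"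
 using assms by (auto simp: block_sum_def)
 also have "... = four_block_mat (g * g' + 0\<^sub>m n m * 0\<^sub>m m n) (g * 0\<^sub>m n m + 0\<^sub>m n m * h')
 (0\<^sub>m m n * g' + h * 0\<^sub>m m n) (0\<^sub>m m n * 0\<^sub>m n m + h * h')"
 by (rule mult_four_block_mat) (use assms in auto)
 also have "... = block_sum (g * g') (h * h')"
 unfolding block_sum_def by (rule cong_four_block_mat) (use assms in auto)
 finally show ?thesis .
qed

lemma block_sum_one [simp]: "block_sum (idm n) (idm m) = idm (n + m)"
 by (simp add: block_sum_def)

lemma block_sum_GL [simp, intro]:
 assumes "g : GLc n" "h : GLc m" shows "block_sum g h : GLc (n + m)"
proof -
 obtain g' h' where g': "g' : carrier_mat n n" "g' * g = idm n" "g * g' = idm n"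
 and h': "h' : carrier_mat m m" "h' * h = idm m" "h * h' = idm m"
 using assms unfolding GL_carrier by blast
 have "block_sum g' h' * block_sum g h = idm (n + m)" "block_sum g h * block_sum g' h' = idm (n + m)"
 using block_sum_mult_mat[of g' n g h' m h] block_sum_mult_mat[of g n g' h m h'] g' h' assms by simp_all
 then show ?thesis unfolding GL_carrier using block_sum_carrier[of _ n _ m] g' h' assms GLc_mat by blast
qed

lemma block_sum_GL' [simp, intro]:
 assumes "g : GLc i" "h : GLc (n - i)" "i <= n" shows "block_sum g h : GLc n"
 using block_sum_GL[OF assms(1,2)] assms(3) by simp

lemma block_sum_mult:
 assumes "g : GLc n" "g' : GLc n" "h : GLc m" "h' : GLc m"
 shows "block_sum g h * block_sum g' h' = block_sum (g * g') (h * h')"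
 by (rule block_sum_mult_mat) (use assms GLc_mat in auto)

lemma block_sum_assoc: "block_sum (block_sum f g) h = block_sum f (block_sum g h)"
 using assoc_four_block_mat[of f g h] unfolding block_sum_def by simp

lemma block_sum_0_left [simp]: "block_sum (idm 0) h = h"
 by (rule eq_matI) (auto simp: block_sum_def)

lemma block_sum_0_right [simp]: "block_sum h (idm 0) = h"
 by (rule eq_matI) (auto simp: block_sum_def)

lemma GLc_0: "g : GLc 0 \<longleftrightarrow> g = idm 0"
proof
 assume "g : GLc 0"
 then have "g : carrier_mat 0 0" by (rule GLc_mat)
 then show "g = idm 0" by (intro eq_matI) auto
qed auto

text \<open>Moving the swap across a block sum turns a right translation of simplices, which the
  relations control, into a left translation, which is homotopic to the identity.\<close>

lemma block_swap_mult_block_sum: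
 fixes g :: "'r::comm_ring_1 mat"
 assumes "g : carrier_mat n n" "h : carrier_mat m m"
 shows "block_swap n m * block_sum h g = block_sum g h * block_swap n m"
proof -
 have "block_swap n m * block_sum h g
 = four_block_mat (0\<^sub>m n m) (idm n) (idm m) (0\<^sub>m m n) * four_block_mat h (0\<^sub>m m n) (0\<^sub>m n m) g"
 using assms by (auto simp: block_sum_def block_swap_def)
 also have "... = four_block_mat (0\<^sub>m n m * h + idm n * 0\<^sub>m n m) (0\<^sub>m n m * 0\<^sub>m m n + idm n * g)
 (idm m * h + 0\<^sub>m m n * 0\<^sub>m n m) (idm m * 0\<^sub>m m n + 0\<^sub>m m n * g)"
 by (rule mult_four_block_mat) (use assms in auto)
 also have "... = four_block_mat (g * 0\<^sub>m n m + 0\<^sub>m n m * idm m) (g * idm n + 0\<^sub>m n m * 0\<^sub>m m n)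
 (0\<^sub>m m n * 0\<^sub>m n m + h * idm m) (0\<^sub>m m n * idm n + h * 0\<^sub>m m n)"
 by (rule cong_four_block_mat) (use assms in auto)
 also have "... = four_block_mat g (0\<^sub>m n m) (0\<^sub>m m n) h * four_block_mat (0\<^sub>m n m) (idm n) (idm m) (0\<^sub>m m n)"
 by (rule mult_four_block_mat[symmetric]) (use assms in auto)
 also have "... = block_sum g h * block_swap n m"
 using assms by (auto simp: block_sum_def block_swap_def)
 finally show ?thesis .
qed

lemma block_swap_GL [simp, intro]: "block_swap n m : GLc (n + m)"
proof -
 have inverse: "block_swap n m * block_swap m n = (idm (n + m) :: 'a mat)" for n m
 proof -
 have "block_swap n m * block_swap m n
 = four_block_mat (0\<^sub>m n m * 0\<^sub>m m n + idm n * idm n) (0\<^sub>m n m * idm m + idm n * 0\<^sub>m n m)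
 (idm m * 0\<^sub>m m n + 0\<^sub>m m n * idm n) (idm m * idm m + 0\<^sub>m m n * (0\<^sub>m n m :: 'a mat))"
 unfolding block_swap_def by (rule mult_four_block_mat) auto
 also have "... = four_block_mat (idm n) (0\<^sub>m n m) (0\<^sub>m m n) (idm m)"
 by (rule cong_four_block_mat) auto
 finally show ?thesis by simp
 qed
 have "block_swap n m : carrier_mat (n + m) (n + m)" "block_swap m n : carrier_mat (n + m) (n + m)"
 by (rule carrier_matI; simp only: block_swap_def index_mat_four_block index_zero_mat index_one_mat add.commute)+
 then show ?thesis unfolding GL_carrier using inverse[of n m] inverse[of m n, unfolded add.commute[of m n]]
 unfolding mem_Collect_eq by blast
qed

subsection \<open>Homogeneous simplices\<close>

definition cone :: "'v => ('v list \<Rightarrow>\<^sub>0 int) => ('v list \<Rightarrow>\<^sub>0 int)" where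
 "cone x = fex (%g. fo (x # g))"

primrec bda :: "'v list => ('v list \<Rightarrow>\<^sub>0 int)" where
 "bda [] = 0"
| "bda (x # xs) = fo xs - cone x (bda xs)"

text \<open>\<^const>\<open>bda\<close> is the boundary of the augmented complex; in \<open>bdl\<close> the augmentation is dropped.\<close>

definition bdl :: "'v list => ('v list \<Rightarrow>\<^sub>0 int)" where
 "bdl xs = (if length xs <= 1 then 0 else bda xs)"

definition fmap :: "('v => 'w) => ('v \<Rightarrow>\<^sub>0 int) => ('w \<Rightarrow>\<^sub>0 int)" where
 "fmap f = fex (%x. fo (f x))"

lemma addv_cone [simp, intro]: "addv (cone x)" by (simp add: cone_def)
lemma addv_fmap [simp, intro]: "addv (fmap f)" by (simp add: fmap_def)
lemma cone_of [simp]: "cone x (fo g) = fo (x # g)" by (simp add: cone_def)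
lemma fmap_of [simp]: "fmap f (fo g) = fo (f g)" by (simp add: fmap_def)
lemmas cone_simps [simp] = addvD[OF addv_cone] addv_add[OF addv_cone] addv_zero[OF addv_cone] addv_minus[OF addv_cone]
 addv_cmul[OF addv_cone]
lemmas fmap_simps [simp] = addvD[OF addv_fmap] addv_add[OF addv_fmap] addv_zero[OF addv_fmap] addv_minus[OF addv_fmap]
 addv_cmul[OF addv_fmap]

lemma fmap_cone: "fmap (map f) (cone x c) = cone (f x) (fmap (map f) c)"
 by (rule addv_eq[of "%c. fmap (map f) (cone x c)"]) (auto simp: addv_def)

lemma bda_map: "bda (map f xs) = fmap (map f) (bda xs)"
 by (induction xs) (auto simp: fmap_cone)

lemma bdl_map: "bdl (map f xs) = fmap (map f) (bdl xs)"
 by (simp add: bdl_def bda_map)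

lemma cone_fr: "c : fr S ==> (!!g. g : S ==> x # g : S') ==> cone x c : fr S'"
 by (rule addv_fr[of "cone x"]) auto

lemma bda_fr: "bda xs : fr {ys. Suc (length ys) = length xs & set ys <= set xs}"
proof (induction xs)
 case (Cons x xs)
 have "cone x (bda xs) : fr {ys. Suc (length ys) = length (x # xs) & set ys <= set (x # xs)}"
 by (rule cone_fr[OF Cons.IH]) auto
 then show ?case by (auto intro!: fr_diff)
qed simp

lemma bdl_fr: "bdl xs : fr {ys. ys ~= [] & Suc (length ys) = length xs & set ys <= set xs}"
proof (cases "length xs <= 1")
 case False
 have "bda xs : fr {ys. ys ~= [] & Suc (length ys) = length xs & set ys <= set xs}"
 by (rule fr_mono[OF bda_fr]) (use False in auto)
 then show ?thesis using False by (simp add: bdl_def)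
qed (simp add: bdl_def)

text \<open>The cone from \<open>x\<close> is a contracting homotopy of the augmented complex. This
  is the reason for keeping the empty simplex and for defining the boundary by recursion.\<close>

lemma bda_cone: "fex bda (cone x c) = c - cone x (fex bda c)"
 by (rule addv_eq[of "%c. fex bda (cone x c)"]) (auto simp: addv_def frag_extend_diff)

lemma bda_bda: "fex bda (bda xs) = 0"
 by (induction xs) (auto simp: frag_extend_diff bda_cone)

lemma bdl_eq_bda: "c : fr {ys. length ys >= 2} ==> fex bdl c = fex bda c"
 by (rule addv_eq_on) (auto simp: bdl_def)

lemma bdl_bdl: "fex bdl (bdl xs) = 0"
proof (cases "length xs >= 3")
 case True
 have "fex bdl (bda xs) = fex bda (bda xs)"
 by (rule bdl_eq_bda, rule fr_mono[OF bda_fr]) (use True in auto)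
 then show ?thesis using True by (simp add: bdl_def bda_bda)
next
 case False
 show ?thesis
 by (rule addv_eq_on[OF _ _ bdl_fr, of _ "%x. 0"]) (use False in \<open>auto simp: bdl_def\<close>)
qed

text \<open>The usual alternating sum over the position at which \<open>\<phi>\<close> changes to
  \<open>\<psi>\<close>: either the change happens at the first vertex, or \<open>\<phi> x\<close>
  is put in front of a later change.\<close>

primrec prism :: "('v => 'w) => ('v => 'w) => 'v list => ('w list \<Rightarrow>\<^sub>0 int)" where
 "prism \<phi> \<psi> [] = 0"
| "prism \<phi> \<psi> (x # xs) = fo (\<phi> x # map \<psi> (x # xs)) - cone (\<phi> x) (prism \<phi> \<psi> xs)"

lemma prism_cone: "fex (prism \<phi> \<psi>) (cone x c)
 = cone (\<phi> x) (cone (\<psi> x) (fmap (map \<psi>) c)) - cone (\<phi> x) (fex (prism \<phi> \<psi>) c)"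
 by (rule addv_eq[of "%c. fex (prism \<phi> \<psi>) (cone x c)"]) (auto simp: addv_def frag_extend_diff)

lemma bda_prism: "fex bda (prism \<phi> \<psi> xs)
 = fo (map \<psi> xs) - fo (map \<phi> xs) - fex (prism \<phi> \<psi>) (bda xs)"
proof (induction xs)
 case (Cons x xs)
 then show ?case
 by (simp add: frag_extend_diff bda_cone prism_cone bda_map)
qed simp

lemma prism_fr: "prism \<phi> \<psi> xs : fr {ys. length ys = Suc (length xs) & set ys <= \<phi> ` set xs \<union> \<psi> ` set xs}"
proof (induction xs)
 case (Cons x xs)
 have "cone (\<phi> x) (prism \<phi> \<psi> xs) : fr {ys. length ys = Suc (length (x # xs)) & set ys <= \<phi> ` set (x # xs) \<union> \<psi> ` set (x # xs)}"
 by (rule cone_fr[OF Cons.IH]) auto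
 then show ?case by (auto intro!: fr_diff)
qed simp

text \<open>Dropping the augmentation is harmless: it only alters the boundary of a single vertex,
  which is the empty simplex, and the prism over the empty simplex is 0.\<close>

lemma bdl_prism:
 assumes "xs ~= []"
 shows "fex bdl (prism \<phi> \<psi> xs)
 = fo (map \<psi> xs) - fo (map \<phi> xs) - fex (prism \<phi> \<psi>) (bdl xs)"
proof -
 have "length xs >= 1" using assms by (cases xs) auto
 then have "fex bdl (prism \<phi> \<psi> xs) = fex bda (prism \<phi> \<psi> xs)"
 by (intro bdl_eq_bda fr_mono[OF prism_fr]) (use \<open>length xs >= 1\<close> in auto)
 moreover have "fex (prism \<phi> \<psi>) (bda xs) = fex (prism \<phi> \<psi>) (bdl xs)"
 using assms by (cases xs; cases "tl xs") (auto simp: bdl_def frag_extend_diff)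
 ultimately show ?thesis by (simp add: bda_prism)
qed

lemma prism_equivariant:
 assumes "!!x. x : set xs ==> \<phi> (f x) = g (\<phi> x)" "!!x. x : set xs ==> \<psi> (f x) = g (\<psi> x)"
 shows "prism \<phi> \<psi> (map f xs) = fmap (map g) (prism \<phi> \<psi> xs)"
 using assms
proof (induction xs)
 case (Cons x xs)
 then have "map \<psi> (map f xs) = map g (map \<psi> xs)" by simp
 with Cons show ?case by (simp add: fmap_cone del: map_map)
qed simp

text \<open>The Eilenberg-Zilber shuffle product in homogeneous form: a sum over lattice paths from
  the first pair of vertices to the last, a pair x, y entering as \<open>\<beta> x y\<close>. A step
  in the second factor passes the \<open>length xs\<close> remaining steps of the first, whence the
  sign; the summand \<open>fo []\<close> ends a path.\<close>

function (sequential) sh :: "('x => 'y => 'v) => 'x list => 'y list => ('v list \<Rightarrow>\<^sub>0 int)" where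
 "sh \<beta> [] ys = 0"
| "sh \<beta> (x # xs) [] = 0"
| "sh \<beta> (x # xs) (y # ys) = cone (\<beta> x y) (sh \<beta> xs (y # ys) + frag_cmul ((-1) ^ length xs) (sh \<beta> (x # xs) ys)
 + (if xs = [] & ys = [] then fo [] else 0))"
 by pat_completeness auto
termination by (relation "measure (%(\<beta>, xs, ys). length xs + length ys)") auto

definition shL :: "('x => 'y => 'v) => ('x list \<Rightarrow>\<^sub>0 int) => ('y list \<Rightarrow>\<^sub>0 int) => ('v list \<Rightarrow>\<^sub>0 int)" where
 "shL \<beta> u v = fex (%x. fex (sh \<beta> x) v) u"

lemma addv_frag_extend_fun: "(!!x. addv (f x)) ==> addv (%v. fex (%x. f x v) u)"
 unfolding addv_def frag_extend_def
proof (intro allI)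
 fix x y assume *: "!!z. \<forall>x y. f z (x - y) = f z x - f z y"
 have c: "frag_cmul k (a - b) = frag_cmul k a - frag_cmul k b" for k and a b :: "'d \<Rightarrow>\<^sub>0 int"
 using addvD[OF addv_frag_cmul[OF addv_id]] .
 show "(\<Sum>i\<in>Poly_Mapping.keys u. frag_cmul (Poly_Mapping.lookup u i) (f i (x - y))) =
 (\<Sum>i\<in>Poly_Mapping.keys u. frag_cmul (Poly_Mapping.lookup u i) (f i x)) -
 (\<Sum>i\<in>Poly_Mapping.keys u. frag_cmul (Poly_Mapping.lookup u i) (f i y))"
 by (simp add: *[rule_format] c sum_subtractf)
qed

lemma addv_shL1 [simp, intro]: "addv (%u. shL \<beta> u v)" by (simp add: shL_def)
lemma addv_shL2 [simp, intro]: "addv (shL \<beta> u)"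
 unfolding shL_def by (rule addv_frag_extend_fun) simp
lemma shL_of [simp]: "shL \<beta> (fo x) (fo y) = sh \<beta> x y" by (simp add: shL_def)
lemma shL_0 [simp]: "shL \<beta> 0 v = 0" "shL \<beta> u 0 = 0"
 using addv_zero[OF addv_shL1] addv_zero[OF addv_shL2] by auto
lemmas shL_simps [simp] = addvD[OF addv_shL1] addv_add[OF addv_shL1] addvD[OF addv_shL2] addv_add[OF addv_shL2]
 addv_minus[OF addv_shL1] addv_minus[OF addv_shL2] addv_cmul[OF addv_shL1] addv_cmul[OF addv_shL2]

lemma frag_extend_sh_Nil [simp]: "fex (sh \<beta> []) v = 0"
 by (rule frag_extend_eq_0) simp

lemma sh_Nil2 [simp]: "sh \<beta> xs [] = 0" by (cases xs) auto

lemma shL_cone1: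
 assumes "w : fr {zs. length zs = m}"
 shows "shL \<beta> (cone x w) (fo (y # ys)) = cone (\<beta> x y) (shL \<beta> w (fo (y # ys))
 + frag_cmul ((-1) ^ m) (shL \<beta> (cone x w) (fo ys)) + (if m = 0 & ys = [] then fmap (%_. []) w else 0))"
proof (rule addv_eq_on[OF _ _ assms])
 show "addv (%w. shL \<beta> (cone x w) (fo (y # ys)))"
 by (rule addv_compose[OF addv_shL1 addv_cone])
 show "addv (%w. cone (\<beta> x y) (shL \<beta> w (fo (y # ys)) + frag_cmul ((-1) ^ m) (shL \<beta> (cone x w) (fo ys)) + (if m = 0 & ys = [] then fmap (%_. []) w else 0)))"
 by (intro addv_compose[OF addv_cone] addv_plus addv_shL1 addv_frag_cmul addv_compose[OF addv_shL1 addv_cone])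
 (simp add: addv_def)
qed auto

lemma shL_cone2:
 assumes "w : fr {zs. length zs = m}"
 shows "shL \<beta> (fo (x # xs)) (cone y w) = cone (\<beta> x y) (shL \<beta> (fo xs) (cone y w)
 + frag_cmul ((-1) ^ length xs) (shL \<beta> (fo (x # xs)) w) + (if m = 0 & xs = [] then fmap (%_. []) w else 0))"
proof (rule addv_eq_on[OF _ _ assms])
 show "addv (%w. shL \<beta> (fo (x # xs)) (cone y w))"
 by (rule addv_compose[OF addv_shL2 addv_cone])
 show "addv (%w. cone (\<beta> x y) (shL \<beta> (fo xs) (cone y w) + frag_cmul ((-1) ^ length xs) (shL \<beta> (fo (x # xs)) w) + (if m = 0 & xs = [] then fmap (%_. []) w else 0)))"
 by (intro addv_compose[OF addv_cone] addv_plus addv_shL2 addv_frag_cmul addv_compose[OF addv_shL2 addv_cone])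
 (simp add: addv_def)
qed auto

lemma sh_fr:
 "sh \<beta> xs ys : fr {zs. zs ~= [] & Suc (length zs) = length xs + length ys & set zs <= (%(x, y). \<beta> x y) ` (set xs \<times> set ys)}"
proof (induction \<beta> xs ys rule: sh.induct)
 case (3 \<beta> x xs y ys)
 show ?case unfolding sh.simps
 by (rule cone_fr[where S = "{zs. Suc (Suc (length zs)) = length (x # xs) + length (y # ys) & set zs <= (%(x, y). \<beta> x y) ` (set (x # xs) \<times> set (y # ys))}"],
 intro fr_add fr_cmul fr_mono[OF 3(1)] fr_mono[OF 3(2)]) auto
qed auto

lemma sh_bda_aux1: "shL \<beta> (bda xs) v = shL \<beta> (bdl xs) v"
proof (cases "length xs <= 1")
 case True
 then show ?thesis
 proof (cases xs)
 case (Cons x xs')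
 then have "xs = [x]" using True by simp
 then show ?thesis by (simp add: bdl_def) (simp add: shL_def)
 qed (simp add: bdl_def)
qed (simp add: bdl_def)

lemma sh_bda_aux2: "shL \<beta> u (bda ys) = shL \<beta> u (bdl ys)"
proof (cases "length ys <= 1")
 case True
 then show ?thesis
 proof (cases ys)
 case (Cons x ys')
 then have "ys = [x]" using True by simp
 then show ?thesis by (simp add: bdl_def) (simp add: shL_def)
 qed (simp add: bdl_def)
qed (simp add: bdl_def)

text \<open>With augmented boundaries the Leibniz rule fails exactly for two single vertices: their
  product bounds the empty simplex, while products with the empty simplex are 0. The last summand
  records this, and it disappears in \<open>bdl_sh\<close>.\<close>

lemma bda_sh:
 "xs ~= [] ==> ys ~= [] ==> fex bda (sh \<beta> xs ys) = shL \<beta> (bda xs) (fo ys)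
 + frag_cmul ((-1) ^ (length xs - 1)) (shL \<beta> (fo xs) (bda ys)) + (if length xs = 1 & length ys = 1 then fo [] else 0)"
proof (induction \<beta> xs ys rule: sh.induct)
 case (3 \<beta> x xs y ys)
 let ?c = "\<beta> x y" let ?s = "(-1) ^ length xs :: int"
 let ?e = "if xs = [] & ys = [] then fo [] else 0"
 have e: "fex bda ?e = 0" by simp
 have ss: "frag_cmul ?s (frag_cmul ?s z) = z" for z :: "'c list \<Rightarrow>\<^sub>0 int"
 by (simp flip: power_mult_distrib)
 have A: "fex bda (sh \<beta> xs (y # ys)) = shL \<beta> (bda xs) (fo (y # ys))
 - frag_cmul ?s (shL \<beta> (fo xs) (bda (y # ys))) + (if length xs = 1 & ys = [] then fo [] else 0)"
 proof (cases xs)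
 case Nil then show ?thesis by (simp add: shL_def)
 next
 case (Cons x' xs')
 then show ?thesis using 3(1) by (simp del: bda.simps sh.simps)
 qed
 have B: "fex bda (sh \<beta> (x # xs) ys) = shL \<beta> (bda (x # xs)) (fo ys)
 + frag_cmul ?s (shL \<beta> (fo (x # xs)) (bda ys)) + (if xs = [] & length ys = 1 then fo [] else 0)"
 proof (cases ys)
 case Nil then show ?thesis by (simp add: shL_def)
 next
 case (Cons y' ys')
 then show ?thesis using 3(2) by (simp del: bda.simps sh.simps)
 qed
 have c1: "shL \<beta> (cone x (bda xs)) (fo (y # ys)) = cone ?c (shL \<beta> (bda xs) (fo (y # ys))
 - frag_cmul ?s (shL \<beta> (cone x (bda xs)) (fo ys)) + (if length xs = 1 & ys = [] then fo [] else 0))"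
 proof (cases xs)
 case (Cons x' xs')
 have f: "bda xs : fr {zs. length zs = length xs'}" by (rule fr_mono[OF bda_fr]) (use Cons in auto)
 have "xs' = [] ==> bda xs = fo []" using Cons by simp
 then show ?thesis using shL_cone1[OF f, of \<beta> x y ys] Cons by (auto simp del: bda.simps)
 qed simp
 have c2: "shL \<beta> (fo (x # xs)) (cone y (bda ys)) = cone ?c (shL \<beta> (fo xs) (cone y (bda ys))
 + frag_cmul ?s (shL \<beta> (fo (x # xs)) (bda ys)) + (if length ys = 1 & xs = [] then fo [] else 0))"
 proof (cases ys)
 case (Cons y' ys')
 have f: "bda ys : fr {zs. length zs = length ys'}" by (rule fr_mono[OF bda_fr]) (use Cons in auto)
 have "ys' = [] ==> bda ys = fo []" using Cons by simp
 then show ?thesis using shL_cone2[OF f, of \<beta> x xs y] Cons by (auto simp del: bda.simps)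
 qed simp
 have z: "fex bda (sh \<beta> xs (y # ys) + frag_cmul ?s (sh \<beta> (x # xs) ys) + ?e)
 = shL \<beta> (bda xs) (fo (y # ys)) - frag_cmul ?s (shL \<beta> (cone x (bda xs)) (fo ys))
 + (if length xs = 1 & ys = [] then fo [] else 0)
 + frag_cmul ?s (shL \<beta> (fo xs) (cone y (bda ys))) + shL \<beta> (fo (x # xs)) (bda ys)
 + frag_cmul ?s (if xs = [] & length ys = 1 then fo [] else 0)"
 unfolding frag_extend_add frag_extend_cmul A B e
 by (simp add: frag_cmul_distrib2 ss addvD[OF addv_frag_cmul[OF addv_id]] del: frag_cmul_cmul)
 have "fex bda (sh \<beta> (x # xs) (y # ys)) = sh \<beta> xs (y # ys) + frag_cmul ?s (sh \<beta> (x # xs) ys) + ?e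
 - cone ?c (fex bda (sh \<beta> xs (y # ys) + frag_cmul ?s (sh \<beta> (x # xs) ys) + ?e))"
 unfolding sh.simps bda_cone ..
 also have "... = sh \<beta> xs (y # ys) + frag_cmul ?s (sh \<beta> (x # xs) ys) + ?e
 - shL \<beta> (cone x (bda xs)) (fo (y # ys)) - frag_cmul ?s (shL \<beta> (fo (x # xs)) (cone y (bda ys)))"
 unfolding z c1 c2 by (simp add: frag_cmul_distrib2 ss addvD[OF addv_frag_cmul[OF addv_id]] algebra_simps del: frag_cmul_cmul)
 finally show ?case
 by (simp add: frag_cmul_distrib2 addvD[OF addv_frag_cmul[OF addv_id]] del: sh.simps)
qed auto

lemma bdl_sh:
 assumes "xs ~= []" "ys ~= []"
 shows "fex bdl (sh \<beta> xs ys) = shL \<beta> (bdl xs) (fo ys)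
 + frag_cmul ((-1) ^ (length xs - 1)) (shL \<beta> (fo xs) (bdl ys))"
proof (cases "length xs = 1 & length ys = 1")
 case True
 then obtain x y where "xs = [x]" "ys = [y]" by (metis One_nat_def length_0_conv length_Suc_conv)
 then show ?thesis by (simp add: bdl_def)
next
 case False
 have "length xs >= 1" "length ys >= 1" using assms by (cases xs; cases ys; auto)+
 then have "fex bdl (sh \<beta> xs ys) = fex bda (sh \<beta> xs ys)"
 by (intro bdl_eq_bda fr_mono[OF sh_fr]) (use False in auto)
 then show ?thesis using bda_sh[OF assms, of \<beta>] False by (simp add: sh_bda_aux1 sh_bda_aux2)
qed

lemma sh_map:
 assumes "!!x y. x : set xs ==> y : set ys ==> \<beta> (f x) (g y) = h (\<beta>' x y)"
 shows "sh \<beta> (map f xs) (map g ys) = fmap (map h) (sh \<beta>' xs ys)"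
 using assms
proof (induction \<beta>' xs ys rule: sh.induct)
 case (3 \<beta>' x xs y ys)
 then show ?case by (simp add: fmap_cone)
qed auto

lemma sh_single_right: "xs ~= [] ==> sh \<beta> xs [y] = fo (map (%x. \<beta> x y) xs)"
proof (induction xs)
 case (Cons x xs) then show ?case by (cases xs) auto
qed simp

lemma sh_single_left: "ys ~= [] ==> sh \<beta> [x] ys = fo (map (\<beta> x) ys)"
proof (induction ys)
 case (Cons y ys) then show ?case by (cases ys) auto
qed simp

subsection \<open>Chains with coefficients\<close>

lemma block_sum_GL_one [simp, intro]:
 "i <= n ==> g : GLc (n - i) ==> block_sum (idm i) g : GLc n"
 "i <= n ==> h : GLc i ==> block_sum h (idm (n - i)) : GLc n"
 "h : GLc i ==> block_sum h (idm j) : GLc (i + j)"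
 "h : GLc i ==> block_sum (idm j) h : GLc (j + i)"
 using block_sum_GL'[of "idm i" i g n] block_sum_GL'[of h i "idm (n - i)" n] by auto

definition tens :: "('v \<Rightarrow>\<^sub>0 int) => 'x => (('v \<times> 'x) \<Rightarrow>\<^sub>0 int)" where
 "tens c x = fex (%gs. fo (gs, x)) c"

lemma addv_tens [simp, intro]: "addv (%c. tens c x)" by (simp add: tens_def)
lemma tens_of [simp]: "tens (fo gs) x = fo (gs, x)" by (simp add: tens_def)
lemma tens_0 [simp]: "tens 0 x = 0" by (simp add: tens_def)
lemmas tens_simps [simp] = addvD[OF addv_tens] addv_add[OF addv_tens] addv_minus[OF addv_tens] addv_cmul[OF addv_tens]

lemma tens_fr: "c : fr S ==> (!!g. g : S ==> (g, x) : S') ==> tens c x : fr S'"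
 by (rule addv_fr[of "%c. tens c x"]) auto

lemma frag_extend_tens: "fex f (tens c x) = fex (%gs. f (gs, x)) c"
 by (rule addv_eq[of "%c. fex f (tens c x)"]) (auto simp: addv_def frag_extend_diff)

text \<open>The generator \<open>(gs, i, a, l)\<close> stands for the simplex \<open>gs\<close> on
  GL_n, tensored over GL_i with a in A_i, at a basis element \<open>l\<close> of degree n - i. With
  single vertices this gives the degree n part of the free A-module on the labels, because inducing
  A_i \<otimes> \<int>[GL_{n-i}] from GL_i \<times> GL_{n-i} to GL_n is the same as inducing A_i
  from GL_i.\<close>

type_synonym ('r, 'a, 'l) gen = "'r mat list \<times> nat \<times> 'a \<times> 'l"
type_synonym ('r, 'a, 'l) chain = "('r, 'a, 'l) gen \<Rightarrow>\<^sub>0 int"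

abbreviation rmul :: "'r::comm_ring_1 mat list => 'r mat => 'r mat list" where
 "rmul gs h \<equiv> map (%g. g * h) gs"

definition smp :: "nat => 'r::comm_ring_1 mat list set" where
 "smp n = {gs. gs ~= [] & set gs <= GLc n}"

lemma smp_rmul [simp, intro]: "gs : smp n ==> h : GLc n ==> rmul gs h : smp n"
 by (auto simp: smp_def)

lemma smp_single [simp]: "[g] : smp n \<longleftrightarrow> g : GLc n" by (auto simp: smp_def)

lemma smp_hd [simp]: "gs : smp n ==> hd gs : GLc n"
 by (cases gs) (auto simp: smp_def)

lemma rmul_rmul: "gs : smp n ==> h : GLc n ==> k : GLc n ==> rmul (rmul gs h) k = rmul gs (h * k)"
 by (auto simp: smp_def GLc_assoc intro!: map_cong)

lemma rmul_one [simp]: "gs : smp n ==> rmul gs (idm n) = gs"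
 unfolding smp_def by (auto intro!: map_idI)

definition bd :: "('v list \<times> 'x \<Rightarrow>\<^sub>0 int) => ('v list \<times> 'x \<Rightarrow>\<^sub>0 int)" where
 "bd = fex (%(gs, x). tens (bdl gs) x)"

lemma addv_bd [simp, intro]: "addv bd" by (simp add: bd_def)
lemma bd_of [simp]: "bd (fo (gs, x)) = tens (bdl gs) x" by (simp add: bd_def)
lemmas bd_simps [simp] = addvD[OF addv_bd] addv_add[OF addv_bd] addv_zero[OF addv_bd] addv_minus[OF addv_bd] addv_cmul[OF addv_bd]

lemma bd_tens: "bd (tens c x) = tens (fex bdl c) x"
 by (rule addv_eq[of "%c. bd (tens c x)"]) (auto simp: addv_def frag_extend_diff)

lemma bd_bd: "bd (bd c) = 0"
 by (rule addv_eq[of "%c. bd (bd c)"]) (auto simp: addv_def bd_tens bdl_bdl)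

text \<open>A common form for the operators that act separately on simplex, index, coefficient and
  label, so that compatibility with the relations is checked once, in \<open>op_N\<close>.\<close>

definition op :: "(nat => 'l => 'v list => ('w list \<Rightarrow>\<^sub>0 int)) => (nat => nat) => (nat => 'a => 'a) => ('l => 'k)
 => ('v list \<times> nat \<times> 'a \<times> 'l \<Rightarrow>\<^sub>0 int) => ('w list \<times> nat \<times> 'a \<times> 'k \<Rightarrow>\<^sub>0 int)" where
 "op F \<iota> \<mu> lam = fex (%(gs, i, a, l). tens (F i l gs) (\<iota> i, \<mu> i a, lam l))"

lemma addv_op [simp, intro]: "addv (op F \<iota> \<mu> lam)" by (simp add: op_def)
lemma op_of [simp]: "op F \<iota> \<mu> lam (fo (gs, i, a, l)) = tens (F i l gs) (\<iota> i, \<mu> i a, lam l)" by (simp add: op_def)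

lemma bd_op: "bd = op (%i l. bdl) (%i. i) (%i a. a) (%l. l)"
 by (rule ext, rule addv_eq) auto

locale gl_alg =
 fixes A :: "('r::comm_ring_1, 'a) gl_monoid"
 assumes mon: "is_monoid A"
begin

abbreviation Ag :: "nat => 'a set" where "Ag n \<equiv> carrier (Grp A n)"

lemma gmod: "g_module (GL n) (Grp A n) (Act A n)"
 using mon by (auto simp: is_monoid_def gl_object_def)

lemma cgA [simp, intro]: "comm_group (Grp A n)" using gmod[of n] by (simp add: g_module_def)
lemma grA [simp, intro]: "group (Grp A n)" using comm_group.axioms(2)[OF cgA] .

lemma A_closed [simp, intro]: "a : Ag n ==> b : Ag n ==> a \<otimes>\<^bsub>Grp A n\<^esub> b : Ag n" "\<one>\<^bsub>Grp A n\<^esub> : Ag n"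
 "a : Ag n ==> inv\<^bsub>Grp A n\<^esub> a : Ag n" "a : Ag n ==> a [^]\<^bsub>Grp A n\<^esub> (z::int) : Ag n"
 using grA[of n] by (simp_all add: group.is_monoid monoid.m_closed group.inv_closed group.int_pow_closed)

lemma act_hom: "h : GLc n ==> Act A n h : hom (Grp A n) (Grp A n)"
 using gmod[of n] by (simp add: g_module_def)

lemma act_closed [simp, intro]: "h : GLc n ==> a : Ag n ==> Act A n h a : Ag n"
 using act_hom by (rule hom_in_carrier)

lemma act_one [simp]: "a : Ag n ==> Act A n (idm n) a = a"
 using gmod[of n] by (simp add: g_module_def)

lemma mul_hom1: "a : Ag i ==> Mul A i j a : hom (Grp A j) (Grp A (i + j))"
 and mul_hom2: "b : Ag j ==> (%a. Mul A i j a b) : hom (Grp A i) (Grp A (i + j))"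
 and mul_act: "g : GLc i ==> h : GLc j ==> a : Ag i ==> b : Ag j
 ==> Mul A i j (Act A i g a) (Act A j h b) = Act A (i + j) (block_sum g h) (Mul A i j a b)"
 using mon by (auto simp: is_monoid_def gl_pairing_def)

lemma mul_closed [simp, intro]: "a : Ag i ==> b : Ag j ==> Mul A i j a b : Ag (i + j)"
 using hom_in_carrier[OF mul_hom1] .

lemma mul_closed' [simp, intro]: "a : Ag i ==> b : Ag (n - i) ==> i <= n ==> Mul A i (n - i) a b : Ag n"
 using mul_closed[of a i b "n - i"] by simp

lemma mul_add1: "a : Ag i ==> b : Ag j ==> b' : Ag j
 ==> Mul A i j a (b \<otimes>\<^bsub>Grp A j\<^esub> b') = Mul A i j a b \<otimes>\<^bsub>Grp A (i + j)\<^esub> Mul A i j a b'"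
 using hom_mult[OF mul_hom1] .

lemma mul_add2: "a : Ag i ==> a' : Ag i ==> b : Ag j
 ==> Mul A i j (a \<otimes>\<^bsub>Grp A i\<^esub> a') b = Mul A i j a b \<otimes>\<^bsub>Grp A (i + j)\<^esub> Mul A i j a' b"
 using hom_mult[OF mul_hom2] .

lemma mul_act1: "h : GLc j ==> a : Ag i ==> b : Ag j
 ==> Mul A i j a (Act A j h b) = Act A (i + j) (block_sum (idm i) h) (Mul A i j a b)"
 using mul_act[of "idm i" i h j a b] by simp

lemma mul_act2: "g : GLc i ==> a : Ag i ==> b : Ag j
 ==> Mul A i j (Act A i g a) b = Act A (i + j) (block_sum g (idm j)) (Mul A i j a b)"
 using mul_act[of g i "idm j" j a b] by simp

lemma mul_assoc: "a : Ag i ==> b : Ag j ==> c : Ag k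
 ==> Mul A (i + j) k (Mul A i j a b) c = Mul A i (j + k) a (Mul A j k b c)"
 using mon by (auto simp: is_monoid_def)

lemma unt [simp, intro]: "Unt A : Ag 0" using mon by (auto simp: is_monoid_def)

lemma mul_unt [simp]: "a : Ag n ==> Mul A 0 n (Unt A) a = a" "a : Ag n ==> Mul A n 0 a (Unt A) = a"
 using mon by (auto simp: is_monoid_def)

definition gens :: "(nat => 'l set) => nat => ('r, 'a, 'l) gen set" where
 "gens L n = {(gs, i, a, l). gs : smp n & i <= n & a : Ag i & l : L (n - i)}"

lemma gens_iff [simp]: "(gs, i, a, l) : gens L n \<longleftrightarrow> gs : smp n & i <= n & a : Ag i & l : L (n - i)"
 by (simp add: gens_def)

text \<open>Additivity in the coefficient, and balancing over GL_i, which acts on simplices from the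
  right through the block inclusion. Left translations stay free for homotopies.\<close>

definition rels :: "(nat => 'l set) => nat => ('r, 'a, 'l) chain set" where
 "rels L n = {fo (gs, i, a \<otimes>\<^bsub>Grp A i\<^esub> a', l) - fo (gs, i, a, l) - fo (gs, i, a', l) | gs i a a' l.
 gs : smp n & i <= n & a : Ag i & a' : Ag i & l : L (n - i)}
 \<union> {fo (rmul gs (block_sum h (idm (n - i))), i, a, l) - fo (gs, i, Act A i h a, l) | gs h i a l.
 gs : smp n & i <= n & h : GLc i & a : Ag i & l : L (n - i)}"

definition N :: "(nat => 'l set) => nat => ('r, 'a, 'l) chain set" where "N L n = gsp (rels L n)"

lemma rels_cases [consumes 1, case_names add act]:
 assumes "r : rels L n"
 obtains gs i a a' l where "gs : smp n" "i <= n" "a : Ag i" "a' : Ag i" "l : L (n - i)"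
 "r = fo (gs, i, a \<otimes>\<^bsub>Grp A i\<^esub> a', l) - fo (gs, i, a, l) - fo (gs, i, a', l)"
 | gs h i a l where "gs : smp n" "i <= n" "h : GLc i" "a : Ag i" "l : L (n - i)"
 "r = fo (rmul gs (block_sum h (idm (n - i))), i, a, l) - fo (gs, i, Act A i h a, l)"
 using assms unfolding rels_def by blast

lemma N_add: "gs : smp n ==> i <= n ==> a : Ag i ==> a' : Ag i ==> l : L (n - i)
 ==> fo (gs, i, a \<otimes>\<^bsub>Grp A i\<^esub> a', l) - fo (gs, i, a, l) - fo (gs, i, a', l) : N L n"
 unfolding N_def by (rule gsp_base) (auto simp: rels_def)

lemma N_act: "gs : smp n ==> i <= n ==> h : GLc i ==> a : Ag i ==> l : L (n - i)
 ==> fo (rmul gs (block_sum h (idm (n - i))), i, a, l) - fo (gs, i, Act A i h a, l) : N L n"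
 unfolding N_def by (rule gsp_base) (auto simp: rels_def)

lemma rels_fr: "rels L n <= fr (gens L n)"
proof
 fix r assume "r : rels L n"
 then show "r : fr (gens L n)"
 by (cases rule: rels_cases) (auto intro!: fr_diff)
qed

lemma N_fr: "c : N L n ==> c : fr (gens L n)"
 using gsp_fr[OF rels_fr] by (auto simp: N_def)

lemma N_intros [simp, intro]: "0 : N L n" by (simp add: N_def)

lemmas N_minus = gsp_minus[where R = "rels L n", folded N_def] for L n
lemmas N_minus_iff [simp] = gsp_minus_iff[where R = "rels L n", folded N_def] for L n
lemmas N_plus = gsp_add[where R = "rels L n", folded N_def] for L n
lemmas N_diff = gsp_diff[where R = "rels L n", folded N_def] for L n
lemmas N_sum = gsp_sum[where R = "rels L n", folded N_def] for L n
lemmas N_cmul = gsp_cmul[where R = "rels L n", folded N_def] for L n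
lemmas N_commute = gsp_diff_commute[where R = "rels L n", folded N_def] for L n
lemmas N_trans = gsp_diff_trans[where R = "rels L n", folded N_def] for L n
lemmas N_mem = gsp_diff_mem[where R = "rels L n", folded N_def] for L n
lemmas N_diff_add = gsp_diff_add[where R = "rels L n", folded N_def] for L n
lemmas N_diff_diff = gsp_diff_diff[where R = "rels L n", folded N_def] for L n
lemmas addv_cong_N = addv_cong_gsp[where R = "rels L n", folded N_def] for L n
lemmas addv_fr_N = addv_fr_gsp[where R = "rels L n", folded N_def] for L n

lemma addv_N:
 assumes "addv f" "!!r. r : rels L n ==> f r : N L' n'" "c : N L n"
 shows "f c : N L' n'"
 using addv_gsp[OF assms(1), of "rels L n" "rels L' n'" c] assms(2,3) by (simp add: N_def)

lemma N_tens_add: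
 assumes "c : fr (smp n)" "i <= n" "a : Ag i" "a' : Ag i" "l : L (n - i)"
 shows "tens c (i, a \<otimes>\<^bsub>Grp A i\<^esub> a', l) - tens c (i, a, l) - tens c (i, a', l) : N L n"
 by (rule addv_fr_N[OF _ assms(1)]) (use assms in \<open>auto intro!: addv_diff N_add\<close>)

lemma N_tens_act:
 assumes "c : fr (smp n)" "i <= n" "h : GLc i" "a : Ag i" "l : L (n - i)"
 shows "tens (fmap (%gs. rmul gs (block_sum h (idm (n - i)))) c) (i, a, l) - tens c (i, Act A i h a, l) : N L n"
 by (rule addv_fr_N[OF _ assms(1)]) (use assms in \<open>auto intro!: N_act simp: addv_def\<close>)

lemma N_one:
 assumes "gs : smp n" "i <= n" "l : L (n - i)"
 shows "fo (gs, i, \<one>\<^bsub>Grp A i\<^esub>, l) : N L n"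
proof -
 have "- fo (gs, i, \<one>\<^bsub>Grp A i\<^esub>, l) : N L n"
 using N_add[OF assms(1,2) A_closed(2)[of i] A_closed(2)[of i], of l L] assms(3)
 by (simp add: monoid.l_one[OF group.is_monoid[OF grA]])
 then show ?thesis by (simp only: N_minus_iff)
qed

lemma op_fr:
 assumes "c : fr (gens L n)"
 and "!!gs i l. gs : smp n ==> i <= n ==> l : L (n - i) ==> F i l gs : fr (smp n')"
 and "!!i l. i <= n ==> l : L (n - i) ==> \<iota> i <= n' & lam l : L' (n' - \<iota> i)"
 and "!!i a. i <= n ==> a : Ag i ==> \<mu> i a : Ag (\<iota> i)"
 shows "op F \<iota> \<mu> lam c : fr (gens L' n')"
 by (rule addv_fr[OF addv_op assms(1)])
 (use assms(3,4) in \<open>auto simp: gens_def split: prod.splits intro!: tens_fr[OF assms(2)]\<close>)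

text \<open>\<open>\<theta>\<close> tells which group element acts after the operator when
  \<open>h\<close> acts before it. Balancing survives because coefficient map and simplex map are
  both equivariant along \<open>\<theta>\<close>.\<close>

lemma op_N:
 assumes c: "c : N L n"
 and F: "!!gs i l. gs : smp n ==> i <= n ==> l : L (n - i) ==> F i l gs : fr (smp n')"
 and \<iota>: "!!i l. i <= n ==> l : L (n - i) ==> \<iota> i <= n' & lam l : L' (n' - \<iota> i)"
 and \<mu>: "!!i a. i <= n ==> a : Ag i ==> \<mu> i a : Ag (\<iota> i)"
 and add: "!!i a a'. i <= n ==> a : Ag i ==> a' : Ag i ==> \<mu> i (a \<otimes>\<^bsub>Grp A i\<^esub> a') = \<mu> i a \<otimes>\<^bsub>Grp A (\<iota> i)\<^esub> \<mu> i a'"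
 and \<theta>: "!!i h. i <= n ==> h : GLc i ==> \<theta> i h : GLc (\<iota> i)"
 and act: "!!i h a. i <= n ==> h : GLc i ==> a : Ag i ==> \<mu> i (Act A i h a) = Act A (\<iota> i) (\<theta> i h) (\<mu> i a)"
 and equi: "!!gs i l h. gs : smp n ==> i <= n ==> l : L (n - i) ==> h : GLc i ==>
 F i l (rmul gs (block_sum h (idm (n - i)))) = fmap (%gs. rmul gs (block_sum (\<theta> i h) (idm (n' - \<iota> i)))) (F i l gs)"
 shows "op F \<iota> \<mu> lam c : N L' n'"
proof (rule addv_N[OF addv_op _ c])
 fix r assume "r : rels L n"
 then show "op F \<iota> \<mu> lam r : N L' n'"
 proof (cases rule: rels_cases)
 case (add gs i a a' l)
 then show ?thesis
 using N_tens_add[OF F[of gs i l], of "\<iota> i" "\<mu> i a" "\<mu> i a'" "lam l" L'] \<iota>[of i l] \<mu> assms(5)[of i a a']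
 by (simp add: addvD[OF addv_op])
 next
 case (act gs h i a l)
 then show ?thesis
 using N_tens_act[OF F[of gs i l], of "\<iota> i" "\<theta> i h" "\<mu> i a" "lam l" L'] \<iota>[of i l] \<mu> \<theta>[of i h] assms(7)[of i h a]
 equi[of gs i l h]
 by (simp add: addvD[OF addv_op])
 qed
qed

lemma bd_fr: "c : fr (gens L n) ==> bd c : fr (gens L n)"
 unfolding bd_op by (rule op_fr) (auto simp: smp_def intro!: fr_mono[OF bdl_fr])

lemma bd_N: "c : N L n ==> bd c : N L n"
 unfolding bd_op
 by (rule op_N[where \<theta> = "%i h. h"]) (auto simp: smp_def bdl_map intro!: fr_mono[OF bdl_fr])

text \<open>Both kinds of relations are homogeneous in the number of vertices, the index and the
  label, so a projection that depends only on these maps relations to relations.\<close>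

lemma restr_N':
 assumes c: "c : N L n" and P: "!!gs i a l. P (gs, i, a, l) = Q (length gs) i l"
 and L': "!!q i l. l : L (n - i) ==> i <= n ==> Q q i l ==> l : L' (n - i)"
 shows "restr P c : N L' n"
proof (rule addv_N[OF addv_restr _ c])
 fix r assume "r : rels L n"
 then show "restr P r : N L' n"
 proof (cases rule: rels_cases)
 case (add gs i a a' l)
 then show ?thesis using N_add[of gs n i a a' l L'] add(1-5) L'[of l i "length gs"]
 by (cases "Q (length gs) i l") (simp_all add: addvD[OF addv_restr] P add(6))
 next
 case (act gs h i a l)
 then show ?thesis using N_act[of gs n i h a l L'] act(1-5) L'[of l i "length gs"]
 by (cases "Q (length gs) i l") (simp_all add: addvD[OF addv_restr] P act(6))
 qed
qed

lemma restr_N: "c : N L n ==> (!!gs i a l. P (gs, i, a, l) = Q (length gs) i l) ==> restr P c : N L n"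
 by (rule restr_N')

lemma N_mono: "c : N L n ==> (!!k. k <= n ==> L k <= L' k) ==> c : N L' n"
 using restr_N'[of c L n "%_. True" "%_ _ _. True" L'] restr_id[OF N_fr, of c L n "%_. True"]
 by (auto simp: subset_iff)

subsection \<open>Maps of free modules\<close>

text \<open>The product of \<open>gs\<close> and \<open>a\<close> with an element of a free module
  in degree n - i. Module elements are chains of single vertices, hence only the first vertex of the
  second factor is read.\<close>

definition bil :: "'r mat list => nat => 'a => ('r, 'a, 'l) chain => ('r, 'a, 'l) chain" where
 "bil gs i a = fex (%(\<delta>, j, b, l). fo (rmul gs (block_sum (idm i) (hd \<delta>)), i + j, Mul A i j a b, l))"

lemma addv_bil [simp, intro]: "addv (bil gs i a)" by (simp add: bil_def)
lemma bil_of [simp]: "bil gs i a (fo (\<delta>, j, b, l)) = fo (rmul gs (block_sum (idm i) (hd \<delta>)), i + j, Mul A i j a b, l)"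
 by (simp add: bil_def)

text \<open>The A-linear extension of a map given on basis elements, applied in every simplicial
  degree.\<close>

definition xt :: "('k => ('r, 'a, 'l) chain) => ('r, 'a, 'k) chain => ('r, 'a, 'l) chain" where
 "xt f = fex (%(gs, i, a, l). bil gs i a (f l))"

lemma addv_xt [simp, intro]: "addv (xt f)" by (simp add: xt_def)
lemma xt_of [simp]: "xt f (fo (gs, i, a, l)) = bil gs i a (f l)" by (simp add: xt_def)
lemmas xt_simps [simp] = addvD[OF addv_xt] addv_add[OF addv_xt] addv_zero[OF addv_xt] addv_minus[OF addv_xt] addv_cmul[OF addv_xt]

lemma xt_diff: "xt (%l. f l - g l) c = xt f c - xt g c"
 by (rule addv_eq[of "xt (%l. f l - g l)"]) (auto simp: addv_def addvD[OF addv_bil])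

definition gens1 :: "(nat => 'l set) => nat => ('r, 'a, 'l) gen set" where
 "gens1 L n = {(\<delta>, j, b, l). \<exists>g\<in>GLc n. \<delta> = [g] & j <= n & b : Ag j & l : L (n - j)}"

lemma gens1_iff: "x : gens1 L n \<longleftrightarrow> x : gens L n & length (fst x) = 1"
 by (cases x) (auto simp: gens1_def gens_def smp_def length_Suc_conv)

lemma gens1_gens: "c : fr (gens1 L n) ==> c : fr (gens L n)"
 by (erule fr_mono) (auto simp: gens1_iff)

definition mapping :: "(nat => 'k set) => (nat => 'l set) => ('k => ('r, 'a, 'l) chain) => bool" where
 "mapping K L f \<longleftrightarrow> (\<forall>n. \<forall>l\<in>K n. f l : fr (gens1 L n))"

lemma mappingD: "mapping K L f ==> l : K n ==> f l : fr (gens1 L n)"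
 by (auto simp: mapping_def)

lemma bil_fr:
 assumes "gs : smp n" "i <= n" "a : Ag i" "t : fr (gens1 L (n - i))"
 shows "bil gs i a t : fr {x : gens L n. length (fst x) = length gs}"
proof (rule addv_fr[OF addv_bil assms(4)])
 fix x assume "x : gens1 L (n - i)"
 then obtain g j b l where x: "x = ([g], j, b, l)" "g : GLc (n - i)" "j <= n - i" "b : Ag j" "l : L (n - i - j)"
 by (auto simp: gens1_def)
 then show "bil gs i a (fo x) : fr {x : gens L n. length (fst x) = length gs}"
 using assms(1-3) by (auto simp: x(1))
qed

lemma xt_fr:
 assumes "mapping K L f" "c : fr (gens K n)"
 shows "xt f c : fr (gens L n)"
 by (rule addv_fr[OF addv_xt assms(2)])
 (auto simp: gens_def intro!: fr_mono[OF bil_fr] mappingD[OF assms(1)])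

lemma xt_fr1:
 assumes "mapping K L f" "c : fr (gens1 K n)"
 shows "xt f c : fr (gens1 L n)"
proof (rule addv_fr[OF addv_xt assms(2)])
 fix x assume "x : gens1 K n"
 then obtain g j b l where x: "x = ([g], j, b, l)" "g : GLc n" "j <= n" "b : Ag j" "l : K (n - j)"
 by (auto simp: gens1_def)
 show "xt f (fo x) : fr (gens1 L n)"
 using bil_fr[of "[g]" n j b "f l" L] x mappingD[OF assms(1)] by (auto elim!: fr_mono simp: gens1_iff)
qed

lemma bil_add_N:
 assumes "gs : smp n" "i <= n" "a : Ag i" "a' : Ag i" "t : fr (gens1 L (n - i))"
 shows "bil gs i (a \<otimes>\<^bsub>Grp A i\<^esub> a') t - bil gs i a t - bil gs i a' t : N L n"
proof (rule addv_fr_N[OF _ assms(5)])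
 fix x assume "x : gens1 L (n - i)"
 then obtain g j b l where x: "x = ([g], j, b, l)" "g : GLc (n - i)" "j <= n - i" "b : Ag j" "l : L (n - i - j)"
 by (auto simp: gens1_def)
 then show "bil gs i (a \<otimes>\<^bsub>Grp A i\<^esub> a') (fo x) - bil gs i a (fo x) - bil gs i a' (fo x) : N L n"
 using assms(1-4) by (auto simp: x(1) mul_add2 intro!: N_add)
qed (auto intro!: addv_diff)

lemma bil_act_N:
 assumes "gs : smp n" "i <= n" "a : Ag i" "h : GLc i" "t : fr (gens1 L (n - i))"
 shows "bil (rmul gs (block_sum h (idm (n - i)))) i a t - bil gs i (Act A i h a) t : N L n"
proof (rule addv_fr_N[OF _ assms(5)])
 fix x assume "x : gens1 L (n - i)"
 then obtain g j b l where x: "x = ([g], j, b, l)" "g : GLc (n - i)" "j <= n - i" "b : Ag j" "l : L (n - i - j)"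
 by (auto simp: gens1_def)
 \<comment> \<open>The matrices h \<oplus> 1 and 1 \<oplus> g commute, and h \<oplus> 1 can be
   regrouped as a matrix acting on the index i + j.\<close>
 have e: "rmul (rmul gs (block_sum h (idm (n - i)))) (block_sum (idm i) g)
 = rmul (rmul gs (block_sum (idm i) g)) (block_sum (block_sum h (idm j)) (idm (n - (i + j))))"
 proof -
 have "block_sum h (idm (n - i)) * block_sum (idm i) g = block_sum (idm i) g * block_sum h (idm (n - i))"
 using block_sum_mult[of h i "idm i" "idm (n - i)" "n - i" g] block_sum_mult[of "idm i" i h g "n - i" "idm (n - i)"]
 assms x by simp
 moreover have "block_sum (block_sum h (idm j)) (idm (n - (i + j))) = block_sum h (idm (n - i))"
 using x(3) assms(2) by (simp add: block_sum_assoc)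
 ultimately show ?thesis
 using rmul_rmul[of gs n "block_sum h (idm (n - i))" "block_sum (idm i) g"]
 rmul_rmul[of gs n "block_sum (idm i) g" "block_sum h (idm (n - i))"] assms x by simp
 qed
 have "bil (rmul gs (block_sum h (idm (n - i)))) i a (fo x) - bil gs i (Act A i h a) (fo x)
 = fo (rmul (rmul gs (block_sum (idm i) g)) (block_sum (block_sum h (idm j)) (idm (n - (i + j)))), i + j, Mul A i j a b, l)
 - fo (rmul gs (block_sum (idm i) g), i + j, Act A (i + j) (block_sum h (idm j)) (Mul A i j a b), l)"
 unfolding x(1) bil_of list.sel e using assms x by (simp add: mul_act2)
 also have "... : N L n"
 by (rule N_act) (use assms x in auto)
 finally show "bil (rmul gs (block_sum h (idm (n - i)))) i a (fo x) - bil gs i (Act A i h a) (fo x) : N L n" .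
qed (auto intro!: addv_diff)

lemma xt_N:
 assumes "mapping K L f" "c : N K n"
 shows "xt f c : N L n"
proof (rule addv_N[OF addv_xt _ assms(2)])
 fix r assume "r : rels K n"
 then show "xt f r : N L n"
 proof (cases rule: rels_cases)
 case (add gs i a a' l)
 then show ?thesis using bil_add_N[OF add(1-4) mappingD[OF assms(1) add(5)]] by simp
 next
 case (act gs h i a l)
 then show ?thesis using bil_act_N[OF act(1,2,4,3) mappingD[OF assms(1) act(5)]] by simp
 qed
qed

text \<open>For fixed \<open>gs\<close> and \<open>a\<close> the product is one of the operators
  \<open>op\<close>, equivariant along h \<mapsto> 1 \<oplus> h.\<close>

lemma bil_N:
 assumes "gs : smp n" "i <= n" "a : Ag i" "t : N L (n - i)"
 shows "bil gs i a t : N L n"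
proof -
 have "bil gs i a t = op (%j l \<delta>. fo (rmul gs (block_sum (idm i) (hd \<delta>)))) (%j. i + j) (%j b. Mul A i j a b) (%l. l) t"
 by (rule addv_eq) auto
 also have "... : N L n"
 proof (rule op_N[OF assms(4), where \<theta> = "%j h. block_sum (idm i) h"])
 fix \<delta> :: "'r mat list" and j and l :: 'b and h :: "'r mat" assume *: "\<delta> : smp (n - i)" "j <= n - i" "h : GLc j"
 have hd: "hd \<delta> : GLc (n - i)" "hd (rmul \<delta> k) = hd \<delta> * k" for k
 using *(1) by (auto simp: smp_def hd_map)
 have "block_sum (idm i) (hd \<delta> * block_sum h (idm (n - i - j)))
 = block_sum (idm i) (hd \<delta>) * block_sum (block_sum (idm i) h) (idm (n - (i + j)))"
 using block_sum_mult[of "idm i" i "idm i" "hd \<delta>" "n - i" "block_sum h (idm (n - i - j))"] hd * by (simp add: block_sum_assoc)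
 then show "fo (rmul gs (block_sum (idm i) (hd (rmul \<delta> (block_sum h (idm (n - i - j)))))))
 = fmap (%gs. rmul gs (block_sum (block_sum (idm i) h) (idm (n - (i + j))))) (fo (rmul gs (block_sum (idm i) (hd \<delta>))))"
 using rmul_rmul[of gs n "block_sum (idm i) (hd \<delta>)" "block_sum (block_sum (idm i) h) (idm (n - (i + j)))"] assms * hd
 block_sum_GL'[OF block_sum_GL[OF GLc_one *(3)], of "idm (n - (i + j))" n i]
 by (simp add: hd(2) del: map_map)
 qed (use assms in \<open>auto simp: mul_add1 mul_act1\<close>)
 finally show ?thesis .
qed

text \<open>Associativity of \<open>Mul\<close> and of block sums is strict, so composition of
  A-linear maps holds as an equation of chains and not only modulo relations.\<close>

lemma xt_xt:
 assumes "mapping K L g" "mapping L M f" "c : fr (gens K n)"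
 shows "xt f (xt g c) = xt (%l. xt f (g l)) c"
proof (rule addv_eq_on[OF _ _ assms(3)])
 fix x assume "x : gens K n"
 then obtain gs i a l where x: "x = (gs, i, a, l)" "gs : smp n" "i <= n" "a : Ag i" "l : K (n - i)"
 by (auto simp: gens_def)
 have "xt f (bil gs i a t) = bil gs i a (xt f t)" if "t : fr (gens1 L (n - i))" for t
 proof (rule addv_eq_on[OF _ _ that])
 fix y assume "y : gens1 L (n - i)"
 then obtain g j b m where y: "y = ([g], j, b, m)" "g : GLc (n - i)" "j <= n - i" "b : Ag j" "m : L (n - i - j)"
 by (auto simp: gens1_def)
 have fm: "f m : fr (gens1 M (n - i - j))" using mappingD[OF assms(2) y(5)] .
 have "bil (rmul gs (block_sum (idm i) g)) (i + j) (Mul A i j a b) u = bil gs i a (bil [g] j b u)"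
 if "u : fr (gens1 M (n - i - j))" for u
 proof (rule addv_eq_on[OF _ _ that])
 fix z assume "z : gens1 M (n - i - j)"
 then obtain h k c m' where z: "z = ([h], k, c, m')" "h : GLc (n - i - j)" "k <= n - i - j" "c : Ag k"
 by (auto simp: gens1_def)
 have "block_sum (idm i) g * block_sum (idm (i + j)) h = block_sum (idm i) (g * block_sum (idm j) h)"
 using block_sum_mult[of "idm i" i "idm i" g "n - i" "block_sum (idm j) h"] y z
 by (simp flip: block_sum_one block_sum_assoc)
 moreover have "block_sum (idm (i + j)) h : GLc n" using block_sum_GL'[of "idm (i + j)" "i + j" h n] y z x by simp
 ultimately show "bil (rmul gs (block_sum (idm i) g)) (i + j) (Mul A i j a b) (fo z) = bil gs i a (bil [g] j b (fo z))"
 using rmul_rmul[of gs n "block_sum (idm i) g" "block_sum (idm (i + j)) h"] x y z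
 by (simp add: mul_assoc add.assoc del: map_map)
 qed (auto simp: addv_def addvD[OF addv_bil])
 then show "xt f (bil gs i a (fo y)) = bil gs i a (xt f (fo y))" using fm y by simp
 qed (auto simp: addv_def addvD[OF addv_bil])
 then show "xt f (xt g (fo x)) = xt (%l. xt f (g l)) (fo x)"
 using mappingD[OF assms(1) x(5)] x by simp
qed (auto simp: addv_def)

text \<open>The boundary deletes vertices, while \<open>bil\<close> multiplies all vertices from the
  right by one and the same matrix.\<close>

lemma bd_xt:
 fixes f :: "'k => ('r, 'a, 'l) chain"
 shows "bd (xt f c) = xt f (bd c)"
proof (rule addv_eq[of "%c. bd (xt f c)"])
 fix s :: "('r, 'a, 'k) gen"
 obtain gs i a l where s: "s = (gs, i, a, l)" by (cases s)
 have tb: "fex (%(gs, i, a, l). bil gs i a (f l)) (tens c (i, a, l)) = fex (%gs. bil gs i a (f l)) c" for c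
 by (simp add: frag_extend_tens)
 have "bd (bil gs i a t) = fex (%gs. bil gs i a t) (bdl gs)" for t :: "('r, 'a, 'l) chain"
 proof (rule addv_eq[of "%t. bd (bil gs i a t)"])
 show "addv (%t. fex (%gs. bil gs i a t) (bdl gs))" by (rule addv_frag_extend_fun) simp
 fix y :: "('r, 'a, 'l) gen"
 obtain \<delta> j b m where y: "y = (\<delta>, j, b, m)" by (cases y)
 show "bd (bil gs i a (fo y)) = fex (%gs. bil gs i a (fo y)) (bdl gs)"
 by (simp add: y bdl_map fmap_def tens_def frag_extend_addv)
 qed (auto simp: addv_def addvD[OF addv_bil])
 then show "bd (xt f (fo s)) = xt f (bd (fo s))"
 by (simp add: s xt_def tb)
qed (auto simp: addv_def)

end

subsection \<open>Products\<close>

text \<open>A single label in degree 0: the free module on it is A, the index is forced to be n, and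
  the chains with these labels compute the homology of GL_n with coefficients in A_n.\<close>

definition LC :: "nat => unit set" where "LC k = (if k = 0 then {()} else {})"

lemma LC_iff [simp]: "u : LC k \<longleftrightarrow> k = 0" by (simp add: LC_def)

abbreviation len :: "('v list \<times> 'x) => nat" where "len x \<equiv> length (fst x)"
definition idx :: "('v \<times> nat \<times> 'a \<times> 'l) => nat" where "idx x = fst (snd x)"
definition lab :: "('v \<times> nat \<times> 'a \<times> 'l) => 'l" where "lab x = snd (snd (snd x))"
lemma idx_simp [simp]: "idx (gs, i, a, l) = i" by (simp add: idx_def)
lemma lab_simp [simp]: "lab (gs, i, a, l) = l" by (simp add: lab_def)

lemma (in gl_alg) restr_N_graded: "c : N L n ==> restr (%x. Q (len x) (idx x) (lab x)) c : N L n"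
 by (rule restr_N[where Q = Q]) simp_all

lemma op_map_bd:
 fixes F :: "nat => 'l => 'v list => ('w list \<Rightarrow>\<^sub>0 int)" and \<mu> :: "nat => 'a => 'a"
 assumes "!!i l gs. F i l gs = (if Q i l then fo (map (\<phi> i l) gs) else 0)"
 shows "bd (op F \<iota> \<mu> lam c) = op F \<iota> \<mu> lam (bd c)"
proof (rule addv_eq[of "%c. bd (op F \<iota> \<mu> lam c)"])
 fix s :: "'v list \<times> nat \<times> 'a \<times> 'l"
 obtain gs i a l where s: "s = (gs, i, a, l)" by (cases s)
 have "op F \<iota> \<mu> lam (tens c (i, a, l)) = (if Q i l then tens (fmap (map (\<phi> i l)) c) (\<iota> i, \<mu> i a, lam l) else 0)" for c
 by (rule addv_eq[of "%c. op F \<iota> \<mu> lam (tens c (i, a, l))"]) (auto simp: addv_def addvD[OF addv_op] assms)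
 then show "bd (op F \<iota> \<mu> lam (fo s)) = op F \<iota> \<mu> lam (bd (fo s))"
 by (simp add: s assms bdl_map)
qed (auto simp: addv_def addvD[OF addv_op])

lemma op_prism_bd:
 fixes c :: "'v list \<times> nat \<times> 'a \<times> 'l \<Rightarrow>\<^sub>0 int"
 assumes "c : fr {(gs, x). gs ~= []}"
 shows "bd (op (%i l. prism (\<phi> i l) (\<psi> i l)) \<iota> \<mu> lam c) =
 op (%i l gs. fo (map (\<psi> i l) gs)) \<iota> \<mu> lam c - op (%i l gs. fo (map (\<phi> i l) gs)) \<iota> \<mu> lam c
 - op (%i l. prism (\<phi> i l) (\<psi> i l)) \<iota> \<mu> lam (bd c)"
proof (rule addv_eq_on[OF _ _ assms])
 fix s :: "'v list \<times> nat \<times> 'a \<times> 'l" assume "s : {(gs, x). gs ~= []}"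
 then obtain gs i a l where s: "s = (gs, i, a, l)" "gs ~= []" by (cases s) auto
 have "op (%i l. prism (\<phi> i l) (\<psi> i l)) \<iota> \<mu> lam (tens c (i, a, l)) = tens (fex (prism (\<phi> i l) (\<psi> i l)) c) (\<iota> i, \<mu> i a, lam l)" for c
 by (rule addv_eq[of "%c. op (%i l. prism (\<phi> i l) (\<psi> i l)) \<iota> \<mu> lam (tens c (i, a, l))"])
 (auto simp: addv_def addvD[OF addv_op] frag_extend_diff)
 then show "bd (op (%i l. prism (\<phi> i l) (\<psi> i l)) \<iota> \<mu> lam (fo s)) =
 op (%i l gs. fo (map (\<psi> i l) gs)) \<iota> \<mu> lam (fo s) - op (%i l gs. fo (map (\<phi> i l) gs)) \<iota> \<mu> lam (fo s)
 - op (%i l. prism (\<phi> i l) (\<psi> i l)) \<iota> \<mu> lam (bd (fo s))"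
 using s(2) by (simp add: s(1) bd_tens bdl_prism)
qed (auto simp: addv_def addvD[OF addv_op])

context gl_alg begin

text \<open>The cross product of chains followed by block sum and multiplication. The coefficients
  of the first factor multiply from the left, so that the labels of the second factor
  survive.\<close>

definition xp :: "('r, 'a, 'u) chain => ('r, 'a, 'l) chain => ('r, 'a, 'l) chain" where
 "xp c t = fex (%(\<eta>, m, a, u). op (%i l gs. sh block_sum \<eta> gs) (%i. m + i) (%i b. Mul A m i a b) (%l. l) t) c"

lemma addv_xp1 [simp, intro]: "addv (%c. xp c t)" by (simp add: xp_def)
lemma addv_xp2 [simp, intro]: "addv (xp c)" unfolding xp_def
 by (rule addv_frag_extend_fun) (auto split: prod.splits)
lemmas xp_simps [simp] = addvD[OF addv_xp1] addv_add[OF addv_xp1] addvD[OF addv_xp2] addv_add[OF addv_xp2]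
 addv_minus[OF addv_xp1] addv_minus[OF addv_xp2] addv_cmul[OF addv_xp1] addv_cmul[OF addv_xp2]
 addv_zero[OF addv_xp1] addv_zero[OF addv_xp2]
lemma xp_of [simp]: "xp (fo (\<eta>, m, a, u)) (fo (gs, i, b, l)) = tens (sh block_sum \<eta> gs) (m + i, Mul A m i a b, l)"
 by (simp add: xp_def)
lemma xp_of1: "xp (fo (\<eta>, m, a, u)) t = op (%i l gs. sh block_sum \<eta> gs) (%i. m + i) (%i b. Mul A m i a b) (%l. l) t"
 by (simp add: xp_def)
lemma xp_of2: "xp c (fo (gs, i, b, l)) = op (%m u \<eta>. sh block_sum \<eta> gs) (%m. m + i) (%m a. Mul A m i a b) (%u. l) c"
 by (rule addv_eq[of "%c. xp c (fo (gs, i, b, l))"]) auto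

lemma sh_smp: "\<eta> : smp m ==> gs : smp n ==> sh block_sum \<eta> gs : fr {\<zeta> : smp (m + n). Suc (length \<zeta>) = length \<eta> + length gs}"
proof (rule fr_mono[OF sh_fr])
 assume "\<eta> : smp m" "gs : smp n"
 then have "(%(x, y). block_sum x y) ` (set \<eta> \<times> set gs) <= GLc (m + n)" by (force simp: smp_def)
 then show "{zs. zs ~= [] & Suc (length zs) = length \<eta> + length gs & set zs <= (%(x, y). block_sum x y) ` (set \<eta> \<times> set gs)}
 <= {\<zeta> : smp (m + n). Suc (length \<zeta>) = length \<eta> + length gs}" unfolding smp_def by blast
qed

lemma xp_fr_graded:
 assumes "c : fr {x : gens LC m. len x = p}" "t : fr {x : gens L n. Q x}"
 shows "xp c t : fr {x : gens L (m + n). \<exists>y\<in>gens L n. Q y & Suc (len x) = p + len y & lab x = lab y & idx x = m + idx y}"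
 (is "_ : fr ?S")
proof (rule addv_fr[OF addv_xp1 assms(1)])
 fix x assume "x : {x : gens LC m. len x = p}"
 then obtain \<eta> a u where x: "x = (\<eta>, m, a, u)" "\<eta> : smp m" "a : Ag m" "length \<eta> = p"
 by (cases x) auto
 show "xp (fo x) t : fr ?S"
 proof (rule addv_fr[OF addv_xp2 assms(2)])
 fix y assume "y : {x : gens L n. Q x}"
 moreover obtain gs i b l where y: "y = (gs, i, b, l)" by (cases y)
 ultimately have y': "gs : smp n" "i <= n" "b : Ag i" "l : L (n - i)" "Q (gs, i, b, l)" by auto
 show "xp (fo x) (fo y) : fr ?S"
 unfolding x(1) y xp_of
 proof (rule tens_fr[OF sh_smp[OF x(2) y'(1)]])
 fix g :: "'r mat list" assume "g : {\<zeta> : smp (m + n). Suc (length \<zeta>) = length \<eta> + length gs}"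
 then show "(g, m + i, Mul A m i a b, l) : ?S"
 using x y' by (auto intro!: bexI[of _ "(gs, i, b, l)"])
 qed
 qed
qed

lemma xp_fr: "c : fr (gens LC m) ==> t : fr (gens L n) ==> xp c t : fr (gens L (m + n))"
proof -
 assume c: "c : fr (gens LC m)" and t: "t : fr (gens L n)"
 show ?thesis
 proof (rule addv_fr[OF addv_xp1 c])
 fix s assume "s : gens LC m"
 then have "fo s : fr {x : gens LC m. len x = len s}" by simp
 from xp_fr_graded[OF this, of t L n "%_. True"] t
 show "xp (fo s) t : fr (gens L (m + n))" by (auto elim: fr_mono)
 qed
qed

lemma xp_N2:
 assumes "c : fr (gens LC m)" "t : N L n"
 shows "xp c t : N L (m + n)"
proof (rule addv_fr_N[OF addv_xp1 assms(1)])
 fix x assume "x : gens LC m"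
 then obtain \<eta> a u where x: "x = (\<eta>, m, a, u)" "\<eta> : smp m" "a : Ag m" by (cases x) auto
 show "xp (fo x) t : N L (m + n)"
 unfolding x(1) xp_of1
 proof (rule op_N[OF assms(2), where \<theta> = "%i h. block_sum (idm m) h"])
 fix gs :: "'r mat list" and i and l :: 'b and h :: "'r mat" assume *: "gs : smp n" "i <= n" "h : GLc i"
 show "sh block_sum \<eta> (rmul gs (block_sum h (idm (n - i))))
 = fmap (%gs. rmul gs (block_sum (block_sum (idm m) h) (idm (m + n - (m + i))))) (sh block_sum \<eta> gs)"
 using sh_map[of \<eta> gs block_sum "%x. x" "%g. g * block_sum h (idm (n - i))"
 "%g. g * block_sum (block_sum (idm m) h) (idm (m + n - (m + i)))" block_sum] * x(2)
 by (force simp: smp_def block_sum_assoc block_sum_mult[of _ m _ _ n])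
 qed (use x in \<open>auto simp: mul_add1 mul_act1 intro!: fr_mono[OF sh_smp]\<close>)
qed

lemma xp_N1:
 assumes "c : N LC m" "t : fr (gens L n)"
 shows "xp c t : N L (m + n)"
proof (rule addv_fr_N[OF addv_xp2 assms(2)])
 fix x assume "x : gens L n"
 then obtain gs i b l where x: "x = (gs, i, b, l)" "gs : smp n" "i <= n" "b : Ag i" "l : L (n - i)" by (cases x) auto
 show "xp c (fo x) : N L (m + n)"
 unfolding x(1) xp_of2
 proof (rule op_N[OF assms(1), where \<theta> = "%j h. block_sum h (idm i)"])
 fix gs' :: "'r mat list" and j and u :: unit and h :: "'r mat" assume *: "gs' : smp m" "j <= m" "u : LC (m - j)" "h : GLc j"
 \<comment> \<open>The label of \<open>LC\<close> has degree 0, so the whole rank m belongs to the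
   index.\<close>
 then have j: "j = m" by simp
 show "sh block_sum (rmul gs' (block_sum h (idm (m - j)))) gs
 = fmap (%gs. rmul gs (block_sum (block_sum h (idm i)) (idm (m + n - (j + i))))) (sh block_sum gs' gs)"
 using sh_map[of gs' gs block_sum "%g. g * h" "%x. x"
 "%g. g * block_sum (block_sum h (idm i)) (idm (m + n - (m + i)))" block_sum] * x(2,3)
 by (force simp: smp_def j block_sum_assoc block_sum_mult[of _ m _ _ n])
 qed (use x in \<open>auto simp: mul_add2 mul_act2 intro!: fr_mono[OF sh_smp]\<close>)
qed

lemma xp_bd:
 assumes "c : fr {x. len x = Suc p}" "t : fr {x. len x ~= 0}"
 shows "bd (xp c t) = xp (bd c) t + frag_cmul ((-1) ^ p) (xp c (bd t))"
proof (rule addv_eq_on[OF _ _ assms(1)])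
 fix x :: "('r, 'a, 'b) gen" assume "x : {x. len x = Suc p}"
 then obtain \<eta> m a u where x: "x = (\<eta>, m, a, u)" "length \<eta> = Suc p" by (cases x) auto
 show "bd (xp (fo x) t) = xp (bd (fo x)) t + frag_cmul ((-1) ^ p) (xp (fo x) (bd t))"
 proof (rule addv_eq_on[OF _ _ assms(2)])
 fix y :: "('r, 'a, 'c) gen" assume "y : {x. len x ~= 0}"
 then obtain gs i b l where y: "y = (gs, i, b, l)" "gs ~= []" by (cases y) auto
 have 1: "xp (tens c (m, a, u)) (fo (gs, i, b, l)) = tens (shL block_sum c (fo gs)) (m + i, Mul A m i a b, l)" for c
 by (rule addv_eq[of "%c. xp (tens c (m, a, u)) (fo (gs, i, b, l))"]) (auto simp: addv_def)
 have 2: "xp (fo (\<eta>, m, a, u)) (tens c (i, b, l)) = tens (shL block_sum (fo \<eta>) c) (m + i, Mul A m i a b, l)" for c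
 by (rule addv_eq[of "%c. xp (fo (\<eta>, m, a, u)) (tens c (i, b, l))"]) (auto simp: addv_def)
 have "\<eta> ~= []" using x(2) by auto
 then show "bd (xp (fo x) (fo y)) = xp (bd (fo x)) (fo y) + frag_cmul ((-1) ^ p) (xp (fo x) (bd (fo y)))"
 using y(2) x(2) by (simp add: x(1) y(1) 1 2 bd_tens bdl_sh)
 qed (auto simp: addv_def addvD[OF addv_frag_cmul[OF addv_id]])
qed (auto simp: addv_def addvD[OF addv_frag_cmul[OF addv_id]])

text \<open>Left multiplication by a chain and A-linear extension multiply coefficients on opposite
  sides; strict associativity makes them commute.\<close>

lemma xt_xp:
 assumes "mapping K L f" "c : fr (gens LC m)" "t : fr (gens K n)"
 shows "xt f (xp c t) = xp c (xt f t)"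
proof (rule addv_eq_on[OF _ _ assms(2)])
 fix x assume "x : gens LC m"
 then obtain \<eta> a u where x: "x = (\<eta>, m, a, u)" "\<eta> : smp m" "a : Ag m" by (cases x) auto
 show "xt f (xp (fo x) t) = xp (fo x) (xt f t)"
 proof (rule addv_eq_on[OF _ _ assms(3)])
 fix y assume "y : gens K n"
 then obtain gs i b l where y: "y = (gs, i, b, l)" "gs : smp n" "i <= n" "b : Ag i" "l : K (n - i)"
 by (cases y) auto
 have 1: "xt f (tens c (m + i, Mul A m i a b, l)) = fex (%\<zeta>. bil \<zeta> (m + i) (Mul A m i a b) (f l)) c" for c
 by (rule addv_eq[of "%c. xt f (tens c (m + i, Mul A m i a b, l))"]) (auto simp: addv_def frag_extend_diff)
 have "fex (%\<zeta>. bil \<zeta> (m + i) (Mul A m i a b) s) (sh block_sum \<eta> gs) = xp (fo (\<eta>, m, a, u)) (bil gs i b s)"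
 if "s : fr (gens1 L (n - i))" for s
 proof (rule addv_eq_on[OF _ _ that])
 show "addv (%s. fex (%\<zeta>. bil \<zeta> (m + i) (Mul A m i a b) s) (sh block_sum \<eta> gs))"
 by (rule addv_frag_extend_fun) simp
 fix z assume "z : gens1 L (n - i)"
 then obtain h k c l' where z: "z = ([h], k, c, l')" "h : GLc (n - i)" "k <= n - i" "c : Ag k"
 by (auto simp: gens1_def)
 have "sh block_sum \<eta> (rmul gs (block_sum (idm i) h)) = fmap (%\<zeta>. rmul \<zeta> (block_sum (idm (m + i)) h)) (sh block_sum \<eta> gs)"
 using sh_map[of \<eta> gs block_sum "%x. x" "%g. g * block_sum (idm i) h"
 "%g. g * block_sum (idm (m + i)) h" block_sum] x y z
 by (force simp: smp_def block_sum_assoc block_sum_mult[of _ m _ _ n] simp flip: block_sum_one)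
 then show "fex (%\<zeta>. bil \<zeta> (m + i) (Mul A m i a b) (fo z)) (sh block_sum \<eta> gs) = xp (fo (\<eta>, m, a, u)) (bil gs i b (fo z))"
 using x y z by (simp add: mul_assoc add.assoc fmap_def tens_def frag_extend_addv)
 qed (auto simp: addv_def addvD[OF addv_bil])
 then show "xt f (xp (fo x) (fo y)) = xp (fo x) (xt f (fo y))"
 using mappingD[OF assms(1) y(5)] by (simp add: x(1) y(1) 1)
 qed (auto simp: addv_def)
qed (auto simp: addv_def)

text \<open>With single vertices as second and third factor each shuffle product has one term, and
  the claim reduces to associativity of \<open>Mul\<close> and of block sums.\<close>

lemma xp_assoc_single:
 assumes "c : fr (gens LC m)" "g : GLc i" "a : Ag i" "h : GLc n" "j <= n" "b : Ag j"
 shows "xp (xp c (fo ([g], i, a, u))) (fo ([h], j, b, l)) = xp c (xp (fo ([g], i, a, u)) (fo ([h], j, b, l)))"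
proof (rule addv_eq_on[OF _ _ assms(1)])
 fix x assume "x : gens LC m"
 then obtain \<eta> e w where x: "x = (\<eta>, m, e, w)" "\<eta> : smp m" "e : Ag m" by (cases x) auto
 then have "\<eta> ~= []" by (simp add: smp_def)
 then show "xp (xp (fo x) (fo ([g], i, a, u))) (fo ([h], j, b, l))
 = xp (fo x) (xp (fo ([g], i, a, u)) (fo ([h], j, b, l)))"
 using x assms by (simp add: x(1) sh_single_right mul_assoc add.assoc block_sum_assoc comp_def del: sh.simps)
qed (auto simp: addv_def)

subsection \<open>Shapiro's lemma\<close>

lemma block_sum_one_inj:
 fixes h h' :: "'r mat"
 assumes "block_sum h (idm j) = block_sum h' (idm j)" "h : GLc i" "h' : GLc i"
 shows "h = h'"
proof (rule eq_matI)
 fix x y assume *: "x < dim_row h'" "y < dim_col h'"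
 have "block_sum h (idm j) $$ (x, y) = h $$ (x, y)" "block_sum h' (idm j) $$ (x, y) = h' $$ (x, y)"
 using * assms(2,3) by (auto simp: block_sum_def)
 then show "h $$ (x, y) = h' $$ (x, y)" using assms(1) by simp
qed (use assms in auto)

text \<open>GL_i acts freely on GL_n by right translation. Once a representative of each orbit is
  chosen, \<open>r g\<close> is the matrix that leads from the representative to
  \<open>g\<close>.\<close>

lemma equivariant_retraction:
 assumes "i <= n"
 shows "\<exists>r. \<forall>g\<in>GLc n. r g : GLc i & (\<forall>h\<in>GLc i. r (g * block_sum h (idm (n - i))) = r g * (h :: 'r mat))"
proof -
 define orb where "orb g = {g * block_sum h (idm (n - i)) | h. h : GLc i}" for g :: "'r mat"
 \<comment> \<open>The choice is made from the orbit as a set, so all elements of an orbit get the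
   same representative.\<close>
 define rep where "rep g = (SOME x. x : orb g)" for g
 define r where "r g = (SOME h. h : GLc i & g = rep g * block_sum h (idm (n - i)))" for g
 have mult: "block_sum h (idm (n - i)) * block_sum k (idm (n - i)) = block_sum (h * k) (idm (n - i))"
 if "h : GLc i" "k : GLc i" for h k :: "'r mat" using block_sum_mult[of h i k "idm (n - i)" "n - i" "idm (n - i)"] that by simp
 have rep: "\<exists>h. h : GLc i & g = rep g * block_sum h (idm (n - i))" if "g : GLc n" for g
 proof -
 have "g : orb g" unfolding orb_def using that assms by (auto intro!: exI[of _ "idm i"])
 then have "rep g : orb g" unfolding rep_def by (rule someI)
 then obtain h where h: "h : GLc i" "rep g = g * block_sum h (idm (n - i))" by (auto simp: orb_def)
 have "rep g * block_sum (ginv i h) (idm (n - i)) = g"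
 using h that assms by (simp add: GLc_assoc[of _ n] mult)
 then show ?thesis using h by (metis ginv(1))
 qed
 have r: "r g : GLc i & g = rep g * block_sum (r g) (idm (n - i))" if "g : GLc n" for g
 unfolding r_def by (rule someI_ex) (rule rep[OF that])
 have orb: "orb (g * block_sum k (idm (n - i))) = orb g" if g: "g : GLc n" and k: "k : GLc i" for g k
 proof (intro equalityI subsetI)
 fix x assume "x : orb (g * block_sum k (idm (n - i)))"
 then obtain h where "h : GLc i" "x = g * block_sum k (idm (n - i)) * block_sum h (idm (n - i))" by (auto simp: orb_def)
 then show "x : orb g" unfolding orb_def using g k assms by (auto simp: GLc_assoc[of _ n] mult intro!: exI[of _ "k * h"])
 next
 fix x assume "x : orb g"
 then obtain h where h: "h : GLc i" "x = g * block_sum h (idm (n - i))" by (auto simp: orb_def)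
 have "k * (ginv i k * h) = h" using h k by (simp flip: GLc_assoc[of _ i])
 then show "x : orb (g * block_sum k (idm (n - i)))" unfolding orb_def
 using g k h assms by (auto simp: GLc_assoc[of _ n] mult intro!: exI[of _ "ginv i k * h"])
 qed
 have "r (g * block_sum h (idm (n - i))) = r g * h" if g: "g : GLc n" and h: "h : GLc i" for g h
 proof -
 let ?g = "g * block_sum h (idm (n - i))"
 have g': "?g : GLc n" using g h assms by simp
 have "rep ?g = rep g" using orb[OF g h] by (simp add: rep_def)
 have repG: "rep g : GLc n"
 proof -
 have "g : orb g" unfolding orb_def using g assms by (auto intro!: exI[of _ "idm i"])
 then have "rep g : orb g" unfolding rep_def by (rule someI)
 then show ?thesis using g assms by (auto simp: orb_def)
 qed
 have "rep g * block_sum (r ?g) (idm (n - i)) = ?g" using r[OF g'] \<open>rep ?g = rep g\<close> by simp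
 also have "?g = rep g * block_sum (r g) (idm (n - i)) * block_sum h (idm (n - i))" using r[OF g] by simp
 also have "... = rep g * block_sum (r g * h) (idm (n - i))"
 proof -
 have rg: "r g : GLc i" using r[OF g] by blast
 then show ?thesis using repG h assms by (simp add: GLc_assoc[of _ n] mult)
 qed
 finally have "ginv n (rep g) * (rep g * block_sum (r ?g) (idm (n - i))) = ginv n (rep g) * (rep g * block_sum (r g * h) (idm (n - i)))" by simp
 then have "block_sum (r ?g) (idm (n - i)) = block_sum (r g * h) (idm (n - i))"
 using repG r[OF g] r[OF g'] h assms by (simp flip: GLc_assoc[of _ n])
 then show ?thesis using block_sum_one_inj r[OF g] r[OF g'] h by (metis GLc_mult)
 qed
 then show ?thesis using r by blast
qed

text \<open>The basis element \<open>l\<close> itself, of degree \<open>k\<close>, with the unit of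
  A as coefficient.\<close>

definition inc :: "nat => 'l => ('r, 'a, 'l) chain" where
 "inc k l = fo ([idm k], 0, Unt A, l)"

text \<open>The map g \<mapsto> r g \<oplus> 1 is equivariant under right translation by GL_m and
  therefore homotopic to the identity by a prism. Its values lie in the block subgroup GL_m, where a
  chain is a cross product with basis elements; sorting by labels gives the cycles
  \<open>c l\<close>.\<close>

lemma shapiro:
 assumes Y: "Y : fr {x : gens L n. len x = Suc q & idx x = m & lab x : \<Lambda>}" and m: "m <= n" and cyc: "bd Y : N L n"
 shows "\<exists>Z c Ls. Z : fr {x : gens L n. len x = Suc (Suc q) & idx x = m & lab x : \<Lambda>} & finite Ls & Ls <= L (n - m) \<inter> \<Lambda> &
 (\<forall>l. c l : fr {x : gens LC m. len x = Suc q} & bd (c l) : N LC m) &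
 Y - bd Z - (\<Sum>l\<in>Ls. xp (c l) (inc (n - m) l)) : N L n"
proof -
 obtain r where r: "!!g. g : GLc n ==> r g : GLc m"
 "!!g h. g : GLc n ==> h : GLc m ==> r (g * block_sum h (idm (n - m))) = r g * (h :: 'r mat)"
 using equivariant_retraction[OF m] by blast
 \<comment> \<open>The retraction is equivariant for GL_m only. The labels are cut down so that
   every relation in sight has index m; projecting turns the relation \<open>bd Y\<close> over
   \<open>L\<close> into one over \<open>L'\<close>.\<close>
 define L' where "L' k = (if k = n - m then L k \<inter> \<Lambda> else {})" for k
 define Ls where "Ls = lab ` Poly_Mapping.keys Y"
 define \<phi> where "\<phi> g = block_sum (r g) (idm (n - m))" for g
 define P where "P = op (%i (l::'b). prism \<phi> (%g. g)) (%i. i) (%i (a::'a). a) (%l. l)"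
 define R where "R l' = op (%i (l::'b) gs. if l = l' then fo (map r gs) else 0) (%i. i) (%i (a::'a). a) (%_. ())" for l'
 have [simp, intro]: "\<phi> g : GLc n" if "g : GLc n" for g unfolding \<phi>_def using r(1)[OF that] m by simp
 have YL': "Y : fr (gens L' n)" by (rule fr_mono[OF Y]) (use m in \<open>auto simp: L'_def idx_def lab_def gens_def\<close>)
 have keysY: "x : {x : gens L n. len x = Suc q & idx x = m & lab x : \<Lambda>}" if "x : Poly_Mapping.keys Y" for x
 using Y that by (auto simp: fr_def)
 have Ls: "finite Ls" "Ls <= L (n - m) \<inter> \<Lambda>" unfolding Ls_def using keysY by (auto simp: gens_def lab_def idx_def)
 have bY: "bd Y : N L' n"
 proof -
 have bdY: "bd Y : fr {x. idx x = m & lab x : \<Lambda>}"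
 by (rule addv_fr[OF addv_bd Y]) (auto intro!: tens_fr[OF bdl_fr])
 have "restr (%x. idx x = m & lab x : \<Lambda>) (bd Y) : N L' n"
 by (rule restr_N'[OF cyc, where Q = "%_ i l. i = m & l : \<Lambda>"]) (auto simp: L'_def)
 then show ?thesis using restr_id[OF bdY, of "%x. idx x = m & lab x : \<Lambda>"] by simp
 qed
 have L'm: "i <= n ==> l : L' (n - i) ==> i = m" for i l using m by (auto simp: L'_def split: if_splits)
 have LL: "L' k <= L k" for k by (auto simp: L'_def)
 have PN: "P (bd Y) : N L n"
 unfolding P_def
 proof (rule N_mono[OF op_N[OF bY, where \<theta> = "%i h. h" and L' = L']])
 fix gs :: "'r mat list" and i and l :: 'b and h :: "'r mat" assume *: "gs : smp n" "i <= n" "l : L' (n - i)" "h : GLc i"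
 then have i: "i = m" using L'm by blast
 have "\<phi> (g * block_sum h (idm (n - m))) = \<phi> g * block_sum h (idm (n - m))" if "g : set gs" for g
 proof -
 have "g : GLc n" using that * by (auto simp: smp_def)
 then show ?thesis unfolding \<phi>_def using r *(4) i
 using block_sum_mult[of "r g" m h "idm (n - m)" "n - m" "idm (n - m)"] by simp
 qed
 then show "prism \<phi> (%g. g) (rmul gs (block_sum h (idm (n - i)))) = fmap (%gs. rmul gs (block_sum h (idm (n - i)))) (prism \<phi> (%g. g) gs)"
 unfolding i by (intro prism_equivariant) auto
 qed (auto simp: smp_def LL subsetD[OF LL] intro!: fr_mono[OF prism_fr])
 have RN: "R l (bd Y) : N LC m" for l
 unfolding R_def
 proof (rule op_N[OF bY, where \<theta> = "%i h. h"])
 fix gs :: "'r mat list" and i and l' :: 'b and h :: "'r mat" assume *: "gs : smp n" "i <= n" "l' : L' (n - i)" "h : GLc i"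
 then have i: "i = m" using L'm by blast
 have "map r (rmul gs (block_sum h (idm (n - m)))) = rmul (map r gs) h"
 using *(1,4) i r by (auto simp: smp_def)
 then show "(if l' = l then fo (map r (rmul gs (block_sum h (idm (n - i))))) else 0)
 = fmap (%gs. rmul gs (block_sum h (idm (m - i)))) (if l' = l then fo (map r gs) else 0)"
 unfolding i by (simp del: map_map)
 qed (use L'm r(1) in \<open>auto simp: smp_def\<close>)
 have Pr: "bd (P Y) = Y - op (%i l gs. fo (map \<phi> gs)) (%i. i) (%i a. a) (%l. l) Y - P (bd Y)"
 proof -
 have "Y : fr {(gs, x). gs ~= []}" by (rule fr_mono[OF Y]) auto
 moreover have "op (%i l gs. fo (map (%g. g) gs)) (%i. i) (%i a. a) (%l. l) Y = Y"
 by (rule addv_eq[of _ "%x. x"]) auto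
 ultimately show ?thesis unfolding P_def
 using op_prism_bd[of Y "%i l. \<phi>" "%i l g. g" "%i. i" "%i a. a" "%l. l"] by simp
 qed
 have dec: "op (%i l gs. fo (map \<phi> gs)) (%i. i) (%i a. a) (%l. l) Y = (\<Sum>l\<in>Ls. xp (R l Y) (inc (n - m) l))"
 proof (rule addv_eq_on[of _ _ Y "Poly_Mapping.keys Y"])
 show "addv (%Y. \<Sum>l\<in>Ls. xp (R l Y) (inc (n - m) l))"
 unfolding addv_def R_def by (simp add: addvD[OF addv_op] sum_subtractf)
 fix x assume x: "x : Poly_Mapping.keys Y"
 then obtain gs a l where x': "x = (gs, m, a, l)" "a : Ag m" "gs : smp n" using keysY[OF x] by (cases x) auto
 have l: "l : Ls" using x x' by (force simp: Ls_def)
 have "(\<Sum>l'\<in>Ls. xp (R l' (fo x)) (inc (n - m) l')) = (\<Sum>l'\<in>Ls. if l' = l then xp (R l (fo x)) (inc (n - m) l) else 0)"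
 by (rule sum.cong) (auto simp: R_def x')
 also have "... = xp (R l (fo x)) (inc (n - m) l)" using Ls l by simp
 also have "... = op (%i l gs. fo (map \<phi> gs)) (%i. i) (%i a. a) (%l. l) (fo x)"
 proof -
 have "(%x. block_sum (r x) (idm (n - m))) = \<phi>" by (simp add: \<phi>_def fun_eq_iff)
 then show ?thesis using x'(2,3) by (simp add: R_def x'(1) inc_def sh_single_right smp_def comp_def)
 qed
 finally show "op (%i l gs. fo (map \<phi> gs)) (%i. i) (%i a. a) (%l. l) (fo x) = (\<Sum>l\<in>Ls. xp (R l (fo x)) (inc (n - m) l))" by simp
 qed (auto simp: fr_keys)
 have PZ: "P Y : fr {x : gens L n. len x = Suc (Suc q) & idx x = m & lab x : \<Lambda>}"
 proof (rule addv_fr[OF _ Y])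
 fix s assume "s : {x : gens L n. len x = Suc q & idx x = m & lab x : \<Lambda>}"
 then obtain gs a l where s: "s = (gs, m, a, l)" "gs : smp n" "a : Ag m" "l : L (n - m)" "l : \<Lambda>" "length gs = Suc q"
 by (cases s) auto
 have "set gs <= GLc n" using s by (auto simp: smp_def)
 then show "P (fo s) : fr {x : gens L n. len x = Suc (Suc q) & idx x = m & lab x : \<Lambda>}"
 unfolding P_def s(1) op_of using m by (intro tens_fr[OF prism_fr]) (auto simp: smp_def s)
 qed (simp add: P_def)
 have RZ: "R l Y : fr {x : gens LC m. len x = Suc q}" for l
 proof (rule addv_fr[OF _ Y])
 fix s assume "s : {x : gens L n. len x = Suc q & idx x = m & lab x : \<Lambda>}"
 then obtain gs a l where s: "s = (gs, m, a, l)" "gs : smp n" "a : Ag m" "length gs = Suc q"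
 by (cases s) auto
 then show "R l (fo s) : fr {x : gens LC m. len x = Suc q}" for l
 unfolding R_def s(1) op_of using r(1) by (auto simp: smp_def)
 qed (simp add: R_def)
 have Rb: "bd (R l Y) : N LC m" for l
 using RN[of l] op_map_bd[of "%i l' gs. if l' = l then fo (map r gs) else 0" "%i l'. l' = l" "%i l. r"
 "%i. i" "%i a. a" "%_. ()" Y]
 unfolding R_def by simp
 have "Y - bd (P Y) - (\<Sum>l\<in>Ls. xp (R l Y) (inc (n - m) l)) : N L n"
 using PN by (simp add: Pr dec)
 then show ?thesis using PZ RZ Rb Ls by (intro exI[of _ "P Y"] exI[of _ "%l. R l Y"] exI[of _ Ls]) auto
qed

subsection \<open>Exactness in higher simplicial degree\<close>

lemma ginv_mult: "g : GLc n ==> h : GLc n ==> ginv n (g * h) = ginv n h * ginv n (g :: 'r mat)"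
 using group.inv_mult_group[OF group_GL, of g n h] by (simp add: ginv_def)

lemma op_xt:
 fixes f :: "'k => ('r, 'a, 'l) chain"
 assumes f: "mapping K L f" and c: "c : fr (gens K n)"
 and F: "!!gs k. gs : smp n ==> k : GLc n ==> F (rmul gs k) = fmap (%gs. rmul gs k) (F gs)"
 shows "op (%i l. F) (%i. i) (%i a. a) (%l. l) (xt f c) = xt f (op (%i l. F) (%i. i) (%i a. a) (%l. l) c)"
proof (rule addv_eq_on[OF _ _ c])
 fix s assume "s : gens K n"
 then obtain gs i a l where s: "s = (gs, i, a, l)" "gs : smp n" "i <= n" "a : Ag i" "l : K (n - i)" by (cases s) auto
 have "op (%i l. F) (%i. i) (%i a. a) (%l. l) (bil gs i a t) = fex (%\<zeta>. bil \<zeta> i a t) (F gs)"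
 if "t : fr (gens1 L (n - i))" for t
 proof (rule addv_eq_on[OF _ _ that])
 show "addv (%t. fex (%\<zeta>. bil \<zeta> i a t) (F gs))" by (rule addv_frag_extend_fun) simp
 fix y assume "y : gens1 L (n - i)"
 then obtain h j b m where y: "y = ([h], j, b, m)" "h : GLc (n - i)" by (auto simp: gens1_def)
 show "op (%i l. F) (%i. i) (%i a. a) (%l. l) (bil gs i a (fo y)) = fex (%\<zeta>. bil \<zeta> i a (fo y)) (F gs)"
 using s y by (simp add: F fmap_def tens_def frag_extend_addv)
 qed (auto simp: addv_def addvD[OF addv_bil] addvD[OF addv_op])
 moreover have "xt f (tens u (i, a, l)) = fex (%\<zeta>. bil \<zeta> i a (f l)) u" for u
 by (rule addv_eq[of "%u. xt f (tens u (i, a, l))"]) (auto simp: addv_def frag_extend_diff)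
 ultimately show "op (%i l. F) (%i. i) (%i a. a) (%l. l) (xt f (fo s)) = xt f (op (%i l. F) (%i. i) (%i a. a) (%l. l) (fo s))"
 using mappingD[OF f s(5)] by (simp add: s(1))
qed (auto simp: addv_def addvD[OF addv_op])

text \<open>A simplex amounts to its last vertex together with the simplex normalized to last vertex
  1, and right translation changes only the former. Chains with q + 1 vertices are thus a direct sum
  of copies of the chains of single vertices, and exactness holds in each copy.\<close>

lemma row_exact:
 fixes f :: "'y => ('r, 'a, 'z) chain" and g :: "'x => ('r, 'a, 'y) chain"
 assumes f: "mapping L M f" and g: "mapping K L g"
 and ex: "!!z. z : fr (gens1 L n) ==> xt f z : N M n ==> \<exists>w\<in>fr (gens1 K n). z - xt g w : N L n"
 and c: "c : fr {x : gens L n. len x = Suc q}" "xt f c : N M n"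
 shows "\<exists>w\<in>fr {x : gens K n. len x = Suc q}. c - xt g w : N L n"
proof -
 define nrm where "nrm gs = rmul gs (ginv n (last gs))" for gs :: "'r mat list"
 \<comment> \<open>\<open>KK v\<close> extracts the copy belonging to the normalized simplex
   \<open>v\<close>; \<open>J v\<close> and \<open>JK v\<close> put such a copy back.\<close>
 define FK where "FK v gs = (if nrm gs = v then fo [last gs] else 0)" for v gs
 define FJ where "FJ v gs = fo (map (%x. x * hd gs) v)" for v and gs :: "'r mat list"
 define KK where "KK v = op (%i l. FK v) (%i. i) (%i (a::'a). a) (%l::'y. l)" for v
 define J where "J v = op (%i l. FJ v) (%i. i) (%i (a::'a). a) (%l::'y. l)" for v
 define JK where "JK v = op (%i l. FJ v) (%i. i) (%i (a::'a). a) (%l::'x. l)" for v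
 define V where "V = (%x. nrm (fst x)) ` Poly_Mapping.keys c"
 have last: "last gs : GLc n" if "gs : smp n" for gs using that by (cases gs rule: rev_cases) (auto simp: smp_def)
 have lastr: "last (rmul gs k) = last gs * k" "hd (rmul gs k) = hd gs * k" if "gs : smp n" for gs k
 using that by (auto simp: smp_def last_map hd_map)
 have nrmr: "nrm (rmul gs k) = nrm gs" if "gs : smp n" "k : GLc n" for gs k
 proof -
 have "nrm (rmul gs k) = rmul gs (k * (ginv n k * ginv n (last gs)))"
 unfolding nrm_def lastr[OF that(1)] ginv_mult[OF last[OF that(1)] that(2)]
 using rmul_rmul[OF that, of "ginv n k * ginv n (last gs)"] last[OF that(1)] that(2) by simp
 also have "k * (ginv n k * ginv n (last gs)) = ginv n (last gs)"
 using last[OF that(1)] that(2) by (simp flip: GLc_assoc[of _ n])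
 finally show ?thesis by (simp add: nrm_def)
 qed
 have FK: "FK v (rmul gs k) = fmap (%gs. rmul gs k) (FK v gs)" if "gs : smp n" "k : GLc n" for v gs k
 using that by (simp add: FK_def nrmr lastr)
 have FJ: "FJ v (rmul gs k) = fmap (%gs. rmul gs k) (FJ v gs)" if "gs : smp n" "k : GLc n" "v : smp n" for v gs k
 using rmul_rmul[OF that(3), of "hd gs" k] that(1,2) by (simp add: FJ_def lastr del: map_map)
 have keysc: "x : gens L n & len x = Suc q" if "x : Poly_Mapping.keys c" for x
 using c(1) that by (auto simp: fr_def)
 have nrm: "nrm gs : smp n" "length (nrm gs) = length gs" if "gs : smp n" for gs
 using that last[OF that] by (auto simp: nrm_def)
 have V: "finite V" "v : V ==> v : smp n & length v = Suc q" for v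
 unfolding V_def using keysc nrm by (auto simp: gens_def)
 have cL: "c : fr (gens L n)" by (rule fr_mono[OF c(1)]) auto
 have KKc: "KK v c : fr (gens1 L n)" for v
 by (rule addv_fr[OF _ cL]) (auto simp: KK_def FK_def gens_def gens1_def last)
 have fKK: "xt f (KK v c) : N M n" for v
 proof -
 have "op (%i l. FK v) (%i. i) (%i a. a) (%l. l) (xt f c) : N M n"
 by (rule op_N[OF c(2), where \<theta> = "%i h. h"], simp_all add: FK) (simp add: FK_def last)
 then show ?thesis unfolding KK_def using op_xt[OF f cL, of "FK v"] FK by simp
 qed
 have "\<forall>v. \<exists>w. w : fr (gens1 K n) & KK v c - xt g w : N L n" using ex[OF KKc fKK] by blast
 then obtain w where w: "!!v. w v : fr (gens1 K n)" "!!v. KK v c - xt g (w v) : N L n" by metis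
 have cJ: "c = (\<Sum>v\<in>V. J v (KK v c))"
 proof (rule addv_eq_on[of "%x. x" "%c. \<Sum>v\<in>V. J v (KK v c)" c "Poly_Mapping.keys c"])
 show "addv (%c. \<Sum>v\<in>V. J v (KK v c))"
 unfolding addv_def J_def KK_def by (simp add: addvD[OF addv_op] sum_subtractf)
 fix x assume x: "x : Poly_Mapping.keys c"
 then obtain gs i a l where x': "x = (gs, i, a, l)" "gs : smp n" using keysc[OF x] by (cases x) auto
 have vV: "nrm gs : V" using x x' by (force simp: V_def)
 have "(\<Sum>v\<in>V. J v (KK v (fo x))) = (\<Sum>v\<in>V. if v = nrm gs then J v (KK v (fo x)) else 0)"
 by (rule sum.cong) (auto simp: x' KK_def J_def FK_def addv_zero[OF addv_op])
 also have "... = J (nrm gs) (KK (nrm gs) (fo x))" using V(1) vV by simp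
 also have "... = fo (rmul (nrm gs) (last gs), i, a, l)" by (simp add: x' KK_def J_def FK_def FJ_def)
 also have "rmul (nrm gs) (last gs) = gs"
 unfolding nrm_def using rmul_rmul[OF x'(2), of "ginv n (last gs)" "last gs"] last[OF x'(2)] x'(2) by simp
 finally show "fo x = (\<Sum>v\<in>V. J v (KK v (fo x)))" by (simp add: x'(1))
 qed (auto simp: fr_keys)
 let ?w = "\<Sum>v\<in>V. JK v (w v)"
 have "J v (KK v c) - xt g (JK v (w v)) : N L n" if "v : V" for v
 proof -
 have v: "v : smp n" using V(2)[OF that] by simp
 have "J v (KK v c - xt g (w v)) : N L n"
 unfolding J_def by (rule op_N[OF w(2), where \<theta> = "%i h. h"]) (use v in \<open>auto simp: FJ\<close>, auto simp: FJ_def)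
 moreover have "J v (xt g (w v)) = xt g (JK v (w v))"
 unfolding J_def JK_def by (rule op_xt[OF g gens1_gens[OF w(1)]]) (use v FJ in auto)
 ultimately show ?thesis by (simp add: J_def addvD[OF addv_op])
 qed
 then have "(\<Sum>v\<in>V. J v (KK v c) - xt g (JK v (w v))) : N L n" by (rule N_sum)
 then have "c - xt g ?w : N L n" by (simp add: sum_subtractf addv_sum[OF addv_xt] flip: cJ)
 moreover have "?w : fr {x : gens K n. len x = Suc q}"
 proof (rule fr_sum)
 fix v assume "v : V"
 then have "v : smp n & length v = Suc q" by (rule V(2))
 then show "JK v (w v) : fr {x : gens K n. len x = Suc q}"
 unfolding JK_def by (intro addv_fr[OF addv_op w(1)]) (auto simp: gens1_def FJ_def)
 qed
 ultimately show ?thesis by blast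
qed

end

subsection \<open>A free resolution and its total complex\<close>

text \<open>A label records the resolution degree p, the degree k and the basis element, so that one
  chain can combine all modules of the resolution.\<close>

type_synonym 'b lbl = "nat \<times> nat \<times> 'b"

definition LT :: "(nat => nat => 'b set) => nat => nat => 'b lbl set" where
 "LT B p k = {(p, k, b) | b. b : B p k}"

definition LA :: "(nat => nat => 'b set) => nat => 'b lbl set" where
 "LA B k = {(p, k, b) | p b. b : B p k}"

lemma LT_iff [simp]: "(p', k', b) : LT B p k \<longleftrightarrow> p' = p & k' = k & b : B p k" by (auto simp: LT_def)
lemma LA_iff [simp]: "(p, k', b) : LA B k \<longleftrightarrow> k' = k & b : B p k" by (auto simp: LA_def)
lemma LT_LA: "LT B p k <= LA B k" by (auto simp: LT_def)

definition pl :: "('v \<times> nat \<times> 'a \<times> 'b lbl) => nat" where "pl x = fst (lab x)"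
definition kl :: "('v \<times> nat \<times> 'a \<times> 'b lbl) => nat" where "kl x = fst (snd (lab x))"
lemma pl_simp [simp]: "pl (gs, i, a, p, k, b) = p" by (simp add: pl_def)
lemma kl_simp [simp]: "kl (gs, i, a, p, k, b) = k" by (simp add: kl_def)

abbreviation (in gl_alg) "restr0 \<equiv> restr (%x. idx x = 0)"

text \<open>The A-linear map F_0 \<rightarrow> A that multiplies basis elements of degree 0 by a
  weight and kills the others. With the values of the augmentation F_0 \<rightarrow> \<int> as
  weights, it lifts that augmentation to A.\<close>

definition aug :: "('b => int) => ('v list \<times> nat \<times> 'a \<times> 'b lbl \<Rightarrow>\<^sub>0 int) => ('v list \<times> nat \<times> 'a \<times> unit \<Rightarrow>\<^sub>0 int)" where
 "aug \<eta> = op (%i (p, k, b) gs. if p = 0 & k = 0 then frag_cmul (\<eta> b) (fo gs) else 0) (%i. i) (%i a. a) (%_. ())"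

lemma addv_aug [simp, intro]: "addv (aug \<eta>)" by (simp add: aug_def)

lemma (in gl_alg) xt_inc: "t : fr (gens1 L k) ==> f l = t ==> xt f (inc k l) = t"
proof -
 assume t: "t : fr (gens1 L k)" and f: "f l = t"
 have "bil [idm k] 0 (Unt A) t = t"
 by (rule addv_eq_on[OF addv_bil addv_id t]) (auto simp: gens1_def)
 then show ?thesis by (simp add: inc_def f)
qed

lemma (in gl_alg) inc_fr: "l : L k ==> inc k l : fr (gens1 L k)"
 by (auto simp: inc_def gens1_def)

text \<open>A free resolution of \<int>, expressed by chains of single vertices modulo
  \<open>N\<close>; \<open>f0\<close> lifts 1. Exactness at F_0 is stated separately in positive
  degree, where \<int> vanishes, and in degree 0. \<open>restr0\<close> keeps the terms with
  coefficient in A_0, which represent \<int> \<otimes>_A F, so \<open>koszul_exact\<close> is the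
  vanishing of Tor_p in degree k for p < k.\<close>

locale resolution = gl_alg A for A :: "('r::comm_ring_1, 'a) gl_monoid" +
 fixes B :: "nat => nat => 'b set" and \<delta> :: "'b lbl => ('r, 'a, 'b lbl) chain" and \<eta> :: "'b => int"
 and f0 :: "('r, 'a, 'b lbl) chain"
 assumes \<delta>0: "\<delta> (0, k, b) = 0"
 and \<delta>: "b : B (Suc p) k ==> \<delta> (Suc p, k, b) : fr (gens1 (LT B p) k)"
 and dd: "b : B (Suc (Suc p)) k ==> xt \<delta> (\<delta> (Suc (Suc p), k, b)) : N (LT B p) k"
 and exact_Suc: "z : fr (gens1 (LT B (Suc p)) n) ==> xt \<delta> z : N (LT B p) n
 ==> \<exists>w\<in>fr (gens1 (LT B (Suc (Suc p))) n). z - xt \<delta> w : N (LT B (Suc p)) n"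
 and exact_0: "n >= 1 ==> z : fr (gens1 (LT B 0) n) ==> \<exists>w\<in>fr (gens1 (LT B (Suc 0)) n). z - xt \<delta> w : N (LT B 0) n"
 and f0: "f0 : fr (gens1 (LT B 0) 0)" "aug \<eta> f0 - inc 0 () : N LC 0"
 and aug_\<delta>: "b : B (Suc 0) 0 ==> aug \<eta> (\<delta> (Suc 0, 0, b)) : N LC 0"
 and aug_exact: "z : fr (gens1 (LT B 0) 0) ==> aug \<eta> z : N LC 0 ==> \<exists>w\<in>fr (gens1 (LT B (Suc 0)) 0). z - xt \<delta> w : N (LT B 0) 0"
 and koszul_exact: "p < k ==> z : fr (gens1 (LT B p) k) ==> restr0 (xt \<delta> z) : N (LA B) k
 ==> \<exists>w\<in>fr (gens1 (LT B (Suc p)) k). restr0 (z - xt \<delta> w) : N (LT B p) k"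
begin

lemma N_LT_LA: "c : N (LT B p) n ==> c : N (LA B) n"
 by (erule N_mono) (rule LT_LA)

lemma N_LA_LT:
 assumes "c : N (LA B) n" "c : fr {x. pl x = p}" shows "c : N (LT B p) n"
proof -
 have "restr (%x. pl x = p) c : N (LT B p) n"
 by (rule restr_N'[OF assms(1), where Q = "%_ _ l. fst l = p"]) (auto simp: LA_def LT_def)
 then show ?thesis using restr_id[OF assms(2), of "%x. pl x = p"] by simp
qed

lemma gens_LT: "x : gens (LT B p) n \<longleftrightarrow> x : gens (LA B) n & pl x = p"
 by (cases x) auto

lemma gens_LT_LA: "c : fr (gens (LT B p) n) ==> c : fr (gens (LA B) n)"
 by (erule fr_mono) (use gens_LT in blast)

lemma gens1_LT: "x : gens1 (LT B p) n \<longleftrightarrow> x : gens1 (LA B) n & pl x = p"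
 by (auto simp: gens1_iff gens_LT)

lemma gens1_LT_LA: "c : fr (gens1 (LT B p) n) ==> c : fr (gens1 (LA B) n)"
 by (erule fr_mono) (auto simp: gens1_LT)

lemma kl_idx: "x : gens (LA B) n ==> kl x = n - idx x & idx x <= n & kl x <= n"
 by (cases x) auto

lemma mapping_LT: "mapping (LT B p) L f \<longleftrightarrow> (\<forall>k b. b : B p k --> f (p, k, b) : fr (gens1 L k))"
proof
 assume m: "mapping (LT B p) L f"
 show "\<forall>k b. b : B p k --> f (p, k, b) : fr (gens1 L k)"
 using mappingD[OF m] by simp
next
 assume "\<forall>k b. b : B p k --> f (p, k, b) : fr (gens1 L k)"
 then show "mapping (LT B p) L f" unfolding mapping_def by (auto simp: LT_def)
qed

lemma map_\<delta>: "mapping (LT B (Suc p)) (LT B p) \<delta>"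
 using \<delta> by (auto simp: mapping_LT)

lemma map_\<delta>A: "mapping (LA B) (LA B) \<delta>"
 unfolding mapping_def
proof (intro allI ballI)
 fix n l assume "l : LA B n"
 then obtain p b where l: "l = (p, n, b)" "b : B p n" by (auto simp: LA_def)
 show "\<delta> l : fr (gens1 (LA B) n)"
 by (cases p) (use l \<delta>0 gens1_LT_LA[OF \<delta>] in auto)
qed

abbreviation dl :: "('r, 'a, 'b lbl) chain => ('r, 'a, 'b lbl) chain" where "dl \<equiv> xt \<delta>"

lemma bil_0 [simp]: "bil gs i a 0 = 0" by (rule addv_zero) simp

lemma dl_LT0: "c : fr (gens (LT B 0) n) ==> dl c = 0"
 by (rule addv_eq_on[of _ "%x. 0"]) (auto simp: gens_def LT_def \<delta>0)

lemma xt_cong_N: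
 assumes "mapping K L f" "mapping K L g" "!!n l. l : K n ==> f l - g l : N L n" "c : fr (gens K n)"
 shows "xt f c - xt g c : N L n"
proof (rule addv_cong_N[OF _ _ assms(4)])
 fix s assume "s : gens K n"
 then obtain gs i a l where s: "s = (gs, i, a, l)" "gs : smp n" "i <= n" "a : Ag i" "l : K (n - i)" by (cases s) auto
 then show "xt f (fo s) - xt g (fo s) : N L n"
 using bil_N[OF s(2-4) assms(3)[OF s(5)]] by (simp add: addvD[OF addv_bil])
qed auto

lemma xt_all_N:
 assumes "!!n l. l : K n ==> f l : N L n" "c : fr (gens K n)"
 shows "xt f c : N L n"
proof (rule addv_fr_N[OF addv_xt assms(2)])
 fix s assume "s : gens K n"
 then obtain gs i a l where s: "s = (gs, i, a, l)" "gs : smp n" "i <= n" "a : Ag i" "l : K (n - i)" by (cases s) auto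
 then show "xt f (fo s) : N L n" using bil_N[OF s(2-4) assms(1)[OF s(5)]] by simp
qed

lemma dl_dl_N: "c : fr (gens (LA B) n) ==> dl (dl c) : N (LA B) n"
proof -
 assume c: "c : fr (gens (LA B) n)"
 have "xt (%l. dl (\<delta> l)) c : N (LA B) n"
 proof (rule xt_all_N[OF _ c])
 fix n l assume "l : LA B n"
 then obtain p b where l: "l = (p, n, b)" "b : B p n" by (auto simp: LA_def)
 show "dl (\<delta> l) : N (LA B) n"
 proof (cases p)
 case 0 then show ?thesis by (simp add: l \<delta>0)
 next
 case (Suc p')
 then show ?thesis
 proof (cases p')
 case 0
 have "dl (\<delta> l) = 0" by (rule dl_LT0[of _ n], rule gens1_gens) (use \<delta>[of b 0 n] l Suc 0 in simp)
 then show ?thesis by simp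
 qed (use N_LT_LA[OF dd] l Suc in auto)
 qed
 qed
 then show ?thesis using xt_xt[OF map_\<delta>A map_\<delta>A c] by simp
qed

definition idl :: "'b lbl => ('r, 'a, 'b lbl) chain" where "idl l = inc (fst (snd l)) l"

lemma idl_fr: "(p, k, b) : LT B p k ==> idl (p, k, b) : fr (gens1 (LT B p) k)"
 unfolding idl_def by (simp add: inc_fr)

lemma xt_idl: "c : fr (gens (LA B) n) ==> xt idl c = c"
proof (rule addv_eq_on[OF addv_xt addv_id])
 fix s assume "s : gens (LA B) n"
 then obtain gs i a p b where s: "s = (gs, i, a, p, n - i, b)" "gs : smp n" "i <= n" "a : Ag i"
 by (cases s) (auto simp: LA_def)
 have "block_sum (idm i) (idm (n - i)) = (idm n :: 'r mat)" using s by simp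
 then show "xt idl (fo s) = fo s" using s by (simp add: idl_def inc_def del: block_sum_one)
qed

subsection \<open>The contraction below the diagonal\<close>

definition pick :: "'b lbl => ('r, 'a, 'b lbl) chain => ('r, 'a, 'b lbl) chain" where
 "pick l u = (case l of (p, k, b) => if p < k then (SOME w. w : fr (gens1 (LT B (Suc p)) k) & restr0 (u - dl w) : N (LT B p) k) else 0)"

text \<open>A contraction of \<int> \<otimes>_A F below the diagonal: the basis element minus the
  part contracted before is a cycle there, and \<open>pick\<close> fills it. The parameter repeats
  the resolution degree of the label in order to make the recursion primitive.\<close>

primrec sg :: "nat => 'b lbl => ('r, 'a, 'b lbl) chain" where
 "sg 0 l = pick l (idl l)"
| "sg (Suc p) l = pick l (idl l - xt (sg p) (\<delta> l))"

definition \<sigma> :: "'b lbl => ('r, 'a, 'b lbl) chain" where "\<sigma> l = sg (fst l) l"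

lemma \<sigma>_ge: "k <= p ==> \<sigma> (p, k, b) = 0"
 by (cases p) (simp_all add: \<sigma>_def pick_def)

text \<open>The endomorphism 1 - (d\<sigma> + \<sigma>d) of the resolution, homotopic to the
  identity.\<close>

definition e0 :: "'b lbl => ('r, 'a, 'b lbl) chain" where "e0 l = idl l - dl (\<sigma> l) - xt \<sigma> (\<delta> l)"

lemma xt_\<sigma>_sg: "c : fr (gens (LT B p) n) ==> xt \<sigma> c = xt (sg p) c"
 by (rule addv_eq_on) (auto simp: gens_def LT_def \<sigma>_def)

text \<open>Indices add under multiplication, so a coefficient of positive index contributes nothing
  to the part of index 0.\<close>

lemma restr0_xt_N:
 assumes "!!l. l : K n ==> restr0 (f l) : N L n" "mapping K L f" "c : fr (gens1 K n)"
 shows "restr0 (xt f c) : N L n"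
proof (rule addv_fr_N[of "%c. restr0 (xt f c)", OF _ assms(3)])
 fix s assume "s : gens1 K n"
 then obtain g i a l where s: "s = ([g], i, a, l)" "g : GLc n" "i <= n" "a : Ag i" "l : K (n - i)"
 by (auto simp: gens1_def)
 have bil0: "restr0 (bil [g] i a t) = (if i = 0 then bil [g] i a (restr0 t) else 0)" for t :: "('r, 'a, 'd) chain"
 by (rule addv_eq) (auto simp: addv_def addvD[OF addv_bil] addvD[OF addv_restr] split: if_splits)
 show "restr0 (xt f (fo s)) : N L n"
 proof (cases "i = 0")
 case True
 then show ?thesis using s bil_N[of "[g]" n i a "restr0 (f l)" L] assms(1)[of l] bil0[of "f l"] by simp
 qed (simp add: s(1) bil0)
qed (auto simp: addv_def addvD[OF addv_restr])

lemma e0_fr: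
 assumes "!!q k b. q <= p ==> b : B q k ==> \<sigma> (q, k, b) : fr (gens1 (LT B (Suc q)) k)" "b : B p k"
 shows "e0 (p, k, b) : fr (gens1 (LT B p) k)"
proof -
 have m: "mapping (LT B q) (LT B (Suc q)) \<sigma>" if "q <= p" for q using assms(1) that by (auto simp: mapping_LT)
 have 1: "dl (\<sigma> (p, k, b)) : fr (gens1 (LT B p) k)" using xt_fr1[OF map_\<delta>] assms by blast
 have 2: "xt \<sigma> (\<delta> (p, k, b)) : fr (gens1 (LT B p) k)"
 proof (cases p)
 case 0 then show ?thesis by (simp add: \<delta>0)
 next
 case (Suc q)
 have "\<delta> (p, k, b) : fr (gens1 (LT B q) k)" using \<delta> assms(2) Suc by simp
 then show ?thesis using xt_fr1[OF m[of q]] Suc by simp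
 qed
 show ?thesis unfolding e0_def by (intro fr_diff 1 2 idl_fr) (use assms(2) in simp)
qed

lemma xt_e0:
 assumes "!!q k b. q <= p ==> b : B q k ==> \<sigma> (q, k, b) : fr (gens1 (LT B (Suc q)) k)" "c : fr (gens (LT B p) n)"
 shows "xt e0 c = c - dl (xt \<sigma> c) - xt \<sigma> (dl c)"
proof -
 have m: "mapping (LT B q) (LT B (Suc q)) \<sigma>" if "q <= p" for q using assms(1) that by (auto simp: mapping_LT)
 have c: "c : fr (gens (LA B) n)" by (rule gens_LT_LA[OF assms(2)])
 have "xt e0 c = xt idl c - xt (%l. dl (\<sigma> l)) c - xt (%l. xt \<sigma> (\<delta> l)) c"
 unfolding e0_def[abs_def] xt_diff ..
 moreover have "xt (%l. dl (\<sigma> l)) c = dl (xt \<sigma> c)" using xt_xt[OF m[of p] map_\<delta> assms(2)] by simp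
 moreover have "xt (%l. xt \<sigma> (\<delta> l)) c = xt \<sigma> (dl c)"
 proof (cases p)
 case 0
 have "xt (%l. xt \<sigma> (\<delta> l)) c = 0"
 by (rule addv_eq_on[OF addv_xt addv_const_zero assms(2)]) (auto simp: gens_def LT_def 0 \<delta>0)
 then show ?thesis using dl_LT0 assms(2) 0 by simp
 next
 case (Suc q)
 then show ?thesis using xt_xt[OF map_\<delta> m[of q], of c n] assms(2) by simp
 qed
 ultimately show ?thesis using xt_idl[OF c] by simp
qed

text \<open>To fill u = l - \<sigma>(dl), its differential has to vanish in \<int> \<otimes>_A F.
  Modulo relations du is \<open>e0\<close> applied to dl, and by induction the part of index 0 of
  that is a relation.\<close>

lemma \<sigma>_spec:
 "b : B p k ==> \<sigma> (p, k, b) : fr (gens1 (LT B (Suc p)) k) & (p < k --> restr0 (e0 (p, k, b)) : N (LT B p) k)"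
proof (induction p arbitrary: k b rule: less_induct)
 case (less r k b)
 show ?case
 proof (cases r)
 case 0
 show ?thesis
 proof (cases "0 < k")
 case True
 have i: "idl (0, k, b) : fr (gens1 (LT B 0) k)" using less.prems 0 by (simp add: idl_fr)
 have "dl (idl (0, k, b)) = 0" by (rule dl_LT0[OF gens1_gens[OF i]])
 then have "\<exists>w. w : fr (gens1 (LT B (Suc 0)) k) & restr0 (idl (0, k, b) - dl w) : N (LT B 0) k"
 using koszul_exact[OF True i] by (auto simp: addv_zero[OF addv_restr])
 then have "\<sigma> (0, k, b) : fr (gens1 (LT B (Suc 0)) k) & restr0 (idl (0, k, b) - dl (\<sigma> (0, k, b))) : N (LT B 0) k"
 unfolding \<sigma>_def using True by (simp add: pick_def) (rule someI_ex)
 then show ?thesis using 0 by (simp add: e0_def \<delta>0)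
 qed (simp add: \<sigma>_ge 0)
 next
 case (Suc p)
 have prem: "b : B (Suc p) k" using less.prems Suc by simp
 have IH1: "\<sigma> (q, k, b) : fr (gens1 (LT B (Suc q)) k)" if "q <= p" "b : B q k" for q k b
 using less.IH[of q b k] that Suc by simp
 show ?thesis
 proof (cases "Suc p < k")
 case True
 let ?l = "(Suc p, k, b)"
 have d: "\<delta> ?l : fr (gens1 (LT B p) k)" using \<delta>[OF prem] .
 have m\<sigma>: "mapping (LT B q) (LT B (Suc q)) \<sigma>" if "q <= p" for q using IH1 that by (auto simp: mapping_LT)
 have i: "idl ?l : fr (gens1 (LT B (Suc p)) k)" using prem by (simp add: idl_fr)
 let ?u = "idl ?l - xt (sg p) (\<delta> ?l)"
 have \<sigma>d: "xt \<sigma> (\<delta> ?l) = xt (sg p) (\<delta> ?l)" by (rule xt_\<sigma>_sg[OF gens1_gens[OF d]])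
 have sd: "xt \<sigma> (\<delta> ?l) : fr (gens1 (LT B (Suc p)) k)" by (rule xt_fr1[OF m\<sigma> d]) simp
 have u: "?u : fr (gens1 (LT B (Suc p)) k)" using i sd \<sigma>d by (auto intro: fr_diff)
 have dlu: "dl ?u = \<delta> ?l - dl (xt \<sigma> (\<delta> ?l))" using xt_inc[OF d, of \<delta>] by (simp add: \<sigma>d idl_def)
 have me0: "mapping (LT B p) (LT B p) e0" using e0_fr[OF IH1] by (auto simp: mapping_LT)
 have A: "restr0 (xt e0 (\<delta> ?l)) : N (LT B p) k"
 proof (rule restr0_xt_N[OF _ me0 d])
 fix l assume "l : LT B p k"
 then obtain b' where "b' : B p k" "l = (p, k, b')" unfolding LT_def by blast
 then show "restr0 (e0 l) : N (LT B p) k" using less.IH[of p b' k] Suc True by simp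
 qed
 have Bn: "xt \<sigma> (dl (\<delta> ?l)) : N (LT B p) k"
 proof (cases p)
 case 0
 then have "dl (\<delta> ?l) = 0" using dl_LT0[of "\<delta> ?l" k] gens1_gens[OF d] by simp
 then show ?thesis by simp
 next
 case (Suc q)
 then show ?thesis using xt_N[OF m\<sigma>[of q] dd[of b q k]] prem by simp
 qed
 have "dl ?u = xt e0 (\<delta> ?l) + xt \<sigma> (dl (\<delta> ?l))"
 using xt_e0[OF IH1 gens1_gens[OF d]] dlu by simp
 then have "restr0 (dl ?u) : N (LT B p) k"
 using N_plus[OF A restr_N_graded[OF Bn, of "%_ i _. i = 0"]] by (simp add: addv_add[OF addv_restr])
 then have "\<exists>w. w : fr (gens1 (LT B (Suc (Suc p))) k) & restr0 (?u - dl w) : N (LT B (Suc p)) k"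
 using koszul_exact[OF True u] N_LT_LA by blast
 then have "\<sigma> ?l : fr (gens1 (LT B (Suc (Suc p))) k) & restr0 (?u - dl (\<sigma> ?l)) : N (LT B (Suc p)) k"
 unfolding \<sigma>_def using True by (simp add: pick_def) (rule someI_ex)
 moreover have "e0 ?l = ?u - dl (\<sigma> ?l)" unfolding e0_def by (simp add: \<sigma>d)
 ultimately show ?thesis using Suc by simp
 qed (use Suc in \<open>simp add: \<sigma>_ge\<close>)
 qed
qed

lemma map_\<sigma>: "mapping (LT B p) (LT B (Suc p)) \<sigma>" using \<sigma>_spec by (auto simp: mapping_LT)

lemma e0_LT: "b : B p k ==> e0 (p, k, b) : fr (gens1 (LT B p) k)"
 by (rule e0_fr) (use \<sigma>_spec in auto)

text \<open>For p < k the part of \<open>e0\<close> of index 0 is a relation; here it is removed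
  literally. All remaining terms then have a label of smaller degree, a fact that conditions on the
  support can express.\<close>

definition e1 :: "'b lbl => ('r, 'a, 'b lbl) chain" where
 "e1 l = (case l of (p, k, b) => if p < k then restr (%x. idx x ~= 0) (e0 l) else e0 l)"

lemma e1_fr: "b : B p k ==> e1 (p, k, b) : fr {x : gens1 (LA B) k. pl x = p & (p < k --> kl x < k)}"
proof -
 assume b: "b : B p k"
 have *: "x : gens1 (LA B) k & pl x = p" if "x : gens1 (LT B p) k" for x using that by (simp add: gens1_LT)
 show ?thesis
 proof (cases "p < k")
 case True
 then show ?thesis unfolding e1_def
 using restr_fr'[OF e0_LT[OF b], of "%x. idx x ~= 0" "{x : gens1 (LA B) k. pl x = p & (p < k --> kl x < k)}"] * kl_idx
 by (auto simp: gens1_iff)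
 next
 case False
 moreover have "e0 (p, k, b) : fr {x : gens1 (LA B) k. pl x = p}"
 by (rule fr_mono[OF e0_LT[OF b]]) (use * in blast)
 ultimately show ?thesis by (simp add: e1_def)
 qed
qed

lemma map_e0: "mapping (LA B) (LA B) e0"
 unfolding mapping_def using gens1_LT_LA[OF e0_LT] by (auto simp: LA_def)

lemma map_e1: "mapping (LA B) (LA B) e1"
 unfolding mapping_def using fr_mono[OF e1_fr] by (auto simp: LA_def)

lemma e1_e0: "l : LA B k ==> e1 l - e0 l : N (LA B) k"
proof -
 assume "l : LA B k"
 then obtain p b where l: "l = (p, k, b)" "b : B p k" by (auto simp: LA_def)
 show ?thesis
 proof (cases "p < k")
 case True
 have "restr0 (e0 l) + restr (%x. idx x ~= 0) (e0 l) = e0 l" by (rule restr_split)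
 then have "e1 l - e0 l = - restr0 (e0 l)" using True by (simp add: e1_def l algebra_simps)
 moreover have "restr0 (e0 l) : N (LA B) k"
 using \<sigma>_spec[OF l(2)] True l(1) by (intro N_LT_LA[of _ p]) simp
 ultimately show ?thesis by simp
 qed (simp add: e1_def l)
qed

lemma e1_id: "b : B 0 0 ==> e1 (0, 0, b) = idl (0, 0, b)"
 by (simp add: e1_def e0_def \<sigma>_ge \<delta>0)

lemma gens_split_LT:
 assumes "addv P'" "!!p c. c : fr (gens (LT B p) n) ==> P' c : N (LA B) n" "c : fr (gens (LA B) n)"
 shows "P' c : N (LA B) n"
 by (rule addv_fr_N[OF assms(1,3)]) (auto simp: gens_def LA_def intro: assms(2))

text \<open>Both composites of \<open>e0\<close> with d equal d - d\<sigma>d up to terms containing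
  d twice in succession, which are relations; and \<open>e1\<close> differs from \<open>e0\<close>
  by relations.\<close>

lemma e1_dl: "c : fr (gens (LA B) n) ==> xt e1 (dl c) - dl (xt e1 c) : N (LA B) n"
proof -
 assume c: "c : fr (gens (LA B) n)"
 have 1: "xt e1 (dl c) - xt e0 (dl c) : N (LA B) n"
 by (rule xt_cong_N[OF map_e1 map_e0 e1_e0 xt_fr[OF map_\<delta>A c]])
 have 2: "dl (xt e1 c) - dl (xt e0 c) : N (LA B) n"
 using xt_N[OF map_\<delta>A xt_cong_N[OF map_e1 map_e0 e1_e0 c]] by simp
 have 3: "xt e0 (dl c) - dl (xt e0 c) : N (LA B) n"
 proof (rule gens_split_LT[OF _ _ c, where P' = "%c. xt e0 (dl c) - dl (xt e0 c)"])
 fix p c assume c: "c : fr (gens (LT B p) n)"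
 have cA: "c : fr (gens (LA B) n)" by (rule gens_LT_LA[OF c])
 have s: "q <= p' ==> b : B q k ==> \<sigma> (q, k, b) : fr (gens1 (LT B (Suc q)) k)" for q k b p' using \<sigma>_spec by blast
 note e = xt_e0[OF s c]
 have sc: "xt \<sigma> c : fr (gens (LT B (Suc p)) n)" by (rule xt_fr[OF map_\<sigma> c])
 have dds: "dl (dl (xt \<sigma> c)) : N (LA B) n"
 by (rule dl_dl_N) (rule gens_LT_LA[OF sc])
 show "xt e0 (dl c) - dl (xt e0 c) : N (LA B) n"
 proof (cases p)
 case 0
 then have "dl c = 0" using dl_LT0 c by simp
 then show ?thesis using dds by (simp add: e)
 next
 case (Suc q)
 have dc: "dl c : fr (gens (LT B q) n)" using xt_fr[OF map_\<delta>] c Suc by simp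
 have "xt \<sigma> (dl (dl c)) : N (LA B) n"
 proof (cases q)
 case 0
 then have "dl (dl c) = 0" using dl_LT0 dc by simp
 then show ?thesis by simp
 next
 case (Suc q')
 have "dl (dl c) : fr (gens (LT B q') n)" using xt_fr[OF map_\<delta>] dc Suc by simp
 then have "dl (dl c) : N (LT B q') n"
 by (intro N_LA_LT[OF dl_dl_N[OF cA]]) (auto elim!: fr_mono simp: gens_LT)
 then show ?thesis using xt_N[OF map_\<sigma>] N_LT_LA by blast
 qed
 then show ?thesis using dds xt_e0[OF s dc] N_diff by (simp add: e)
 qed
 qed (auto simp: addv_def)
 show ?thesis using N_plus[OF N_diff[OF 1 2] 3] by (simp add: algebra_simps)
qed

subsection \<open>The total differential\<close>

definition sgn :: "('v list \<times> nat \<times> 'a \<times> 'l \<Rightarrow>\<^sub>0 int) => ('v list \<times> nat \<times> 'a \<times> 'l \<Rightarrow>\<^sub>0 int)" where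
 "sgn = op (%i l gs. frag_cmul ((-1) ^ (length gs - 1)) (fo gs)) (%i. i) (%i a. a) (%l. l)"

lemma addv_sgn [simp, intro]: "addv sgn" by (simp add: sgn_def)
lemma sgn_of [simp]: "sgn (fo x) = frag_cmul ((-1) ^ (len x - 1)) (fo x)" by (cases x) (simp add: sgn_def)
lemmas sgn_simps [simp] = addvD[OF addv_sgn] addv_add[OF addv_sgn] addv_zero[OF addv_sgn] addv_minus[OF addv_sgn] addv_cmul[OF addv_sgn]

lemma sgn_hom: "c : fr {x. len x = Suc q} ==> sgn c = frag_cmul ((-1) ^ q) c"
 by (rule addv_eq_on[of sgn "frag_cmul ((-1) ^ q)"]) (auto simp: addv_frag_cmul)

lemma sgn_N: "c : N L n ==> sgn c : N L n"
 unfolding sgn_def by (rule op_N[where \<theta> = "%i h. h"]) (auto intro: fr_cmul)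

lemma sgn_fr: "c : fr S ==> sgn c : fr S"
 by (rule addv_fr[OF addv_sgn]) (auto intro: fr_cmul)

lemma sgn_sgn: "sgn (sgn c) = c"
proof (rule addv_eq[of "%c. sgn (sgn c)"])
 fix s show "sgn (sgn (fo s)) = fo s"
 by (simp flip: power_mult_distrib)
qed (auto simp: addv_def)

lemma bil_len: "bil gs i a t : fr {x. len x = length gs}"
 by (rule addv_fr[OF addv_bil fr_keys]) (auto simp: bil_def split: prod.splits)

lemma sgn_xt:
 fixes c :: "('r, 'a, 'd) chain"
 shows "sgn (xt f c) = xt f (sgn c)"
proof (rule addv_eq[of "%c. sgn (xt f c)"])
 fix s :: "'r mat list \<times> nat \<times> 'a \<times> 'd"
 obtain gs i a l where s: "s = (gs, i, a, l)" by (cases s)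
 have "bil gs i a (f l) : fr {x. len x = Suc (length gs - 1)} \<or> gs = []" using bil_len[of gs i a "f l"] by (cases gs) auto
 moreover have "sgn c = c" if "c : fr {x. len x = 0}" for c :: "('r, 'a, 'e) chain"
 by (rule addv_eq_on[OF addv_sgn addv_id that]) auto
 ultimately show "sgn (xt f (fo s)) = xt f (sgn (fo s))"
 using sgn_hom[of "bil gs i a (f l)" "length gs - 1"] bil_len[of gs i a "f l"] by (auto simp: s)
qed (auto simp: addv_def)

lemma sgn_bd:
 fixes c :: "'v list \<times> nat \<times> 'a \<times> 'e \<Rightarrow>\<^sub>0 int"
 shows "sgn (bd c) = - bd (sgn c)"
proof (rule addv_eq[of "%c. sgn (bd c)"])
 fix s :: "'v list \<times> nat \<times> 'a \<times> 'e"
 obtain gs x where s: "s = (gs, x)" by (cases s)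
 show "sgn (bd (fo s)) = - bd (sgn (fo s))"
 proof (cases "length gs <= 1")
 case False
 then obtain q where q: "length gs = Suc (Suc q)" by (metis Suc_pred' diff_is_0_eq neq0_conv length_0_conv le_zero_eq One_nat_def not_less_eq_eq zero_less_diff)
 have "tens (bdl gs) x : fr {x. len x = Suc q}" by (rule tens_fr[OF bdl_fr]) (simp add: q)
 then show ?thesis using sgn_hom[of "tens (bdl gs) x" q] by (simp add: s q)
 qed (simp add: s bdl_def)
qed (auto simp: addv_def)

text \<open>Simplicial boundary and resolution differential commute; the sign by simplicial degree
  makes them anticommute, so D D reduces to \<open>dl\<close> applied twice.\<close>

definition D :: "('r, 'a, 'b lbl) chain => ('r, 'a, 'b lbl) chain" where "D c = bd c + dl (sgn c)"

lemma addv_D [simp, intro]: "addv D" by (simp add: D_def addv_def)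
lemmas D_simps [simp] = addvD[OF addv_D] addv_add[OF addv_D] addv_zero[OF addv_D] addv_minus[OF addv_D] addv_cmul[OF addv_D]

lemma D_N: "c : N (LA B) n ==> D c : N (LA B) n"
 unfolding D_def by (intro N_plus bd_N xt_N[OF map_\<delta>A] sgn_N)

lemma D_fr: "c : fr (gens (LA B) n) ==> D c : fr (gens (LA B) n)"
 unfolding D_def by (intro fr_add bd_fr xt_fr[OF map_\<delta>A] sgn_fr)

lemma D_hom: "c : fr {x. len x = Suc q} ==> D c = bd c + frag_cmul ((-1) ^ q) (dl c)"
 by (simp add: D_def sgn_hom)

lemma D_D: "c : fr (gens (LA B) n) ==> D (D c) : N (LA B) n"
proof -
 assume c: "c : fr (gens (LA B) n)"
 have "D (D c) = dl (dl c)"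
 unfolding D_def by (simp add: bd_bd bd_xt sgn_bd sgn_xt sgn_sgn)
 then show ?thesis using dl_dl_N[OF c] by simp
qed

lemma D_e1: "c : fr (gens (LA B) n) ==> xt e1 (D c) - D (xt e1 c) : N (LA B) n"
 using e1_dl[OF sgn_fr[of c "gens (LA B) n"]] by (simp add: D_def bd_xt sgn_xt)

text \<open>Consequently left multiplication by a cycle is a chain map of the total complex up to
  sign and relations.\<close>

lemma D_xp:
 assumes "c : fr {x : gens LC m. len x = Suc p}" "t : fr (gens (LA B) n)"
 shows "D (xp c t) = xp (bd c) t + frag_cmul ((-1) ^ p) (xp c (D t))"
proof -
 have c: "c : fr {x. len x = Suc p}" "c : fr (gens LC m)" by (rule fr_mono[OF assms(1)], auto)+
 have t: "t : fr {x. len x ~= 0}" by (rule fr_mono[OF assms(2)]) (auto simp: gens_def smp_def)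
 have "sgn (xp c t) = frag_cmul ((-1) ^ p) (xp c (sgn t))"
 proof (rule addv_eq_on[of "%t. sgn (xp c t)", OF _ _ assms(2)])
 fix s assume s: "s : gens (LA B) n"
 then have l: "len s = Suc (len s - 1)" by (cases s; cases "fst s") (auto simp: smp_def)
 have "xp c (fo s) : fr {x. len x = Suc (p + (len s - 1))}"
 by (rule fr_mono[OF xp_fr_graded[OF assms(1), of "fo s" "LA B" n "%x. x = s"]]) (use s l in auto)
 then show "sgn (xp c (fo s)) = frag_cmul ((-1) ^ p) (xp c (sgn (fo s)))"
 using sgn_hom[of "xp c (fo s)"] by (simp add: power_add)
 qed (auto simp: addv_def addvD[OF addv_frag_cmul[OF addv_id]])
 then show ?thesis
 unfolding D_def using xp_bd[OF c(1) t] xt_xp[OF map_\<delta>A c(2) sgn_fr[OF assms(2)]]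
 by (simp add: frag_cmul_distrib2)
qed

definition EE :: "nat => ('r, 'a, 'b lbl) chain => ('r, 'a, 'b lbl) chain" where "EE M = xt e1 ^^ M"

lemma addv_EE [simp, intro]: "addv (EE M)" unfolding EE_def by (rule addv_funpow) simp
lemmas EE_simps [simp] = addvD[OF addv_EE] addv_add[OF addv_EE] addv_zero[OF addv_EE] addv_minus[OF addv_EE] addv_cmul[OF addv_EE]

lemma EE_Suc: "EE (Suc M) c = xt e1 (EE M c)" by (simp add: EE_def)
lemma EE_0 [simp]: "EE 0 c = c" by (simp add: EE_def)

lemma EE_N: "c : N (LA B) n ==> EE M c : N (LA B) n"
 by (induction M) (auto simp: EE_Suc xt_N[OF map_e1])

lemma EE_fr: "c : fr (gens (LA B) n) ==> EE M c : fr (gens (LA B) n)"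
 by (induction M) (auto simp: EE_Suc xt_fr[OF map_e1])

lemma D_EE: "c : fr (gens (LA B) n) ==> EE M (D c) - D (EE M c) : N (LA B) n"
proof (induction M)
 case (Suc M)
 have "xt e1 (EE M (D c)) - xt e1 (D (EE M c)) : N (LA B) n"
 using xt_N[OF map_e1 Suc.IH[OF Suc.prems]] by simp
 from N_plus[OF this D_e1[OF EE_fr[OF Suc.prems], of M]] show ?case by (simp add: EE_Suc)
qed simp

lemma EE_xp: "c : fr (gens LC m) ==> t : fr (gens (LA B) n) ==> EE M (xp c t) = xp c (EE M t)"
 by (induction M) (auto simp: EE_Suc xt_xp[OF map_e1 _ EE_fr])

text \<open>In these predicates q counts vertices, one more than the simplicial degree; total degree
  m therefore reads \<open>q + p = Suc m\<close>.\<close>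

definition SS :: "nat => (nat => nat => nat => bool) => ('r, 'a, 'b lbl) gen set" where
 "SS n P = {x : gens (LA B) n. P (len x) (pl x) (kl x)}"

lemma SS_gens: "c : fr (SS n P) ==> c : fr (gens (LA B) n)" by (erule fr_mono) (auto simp: SS_def)

lemma SS_mono:
 assumes "c : fr (SS n P)" "!!q p k. P (Suc q) p k ==> k <= n ==> Q (Suc q) p k"
 shows "c : fr (SS n Q)"
proof (rule fr_mono[OF assms(1)])
 show "SS n P <= SS n Q"
 proof
 fix x assume x: "x : SS n P"
 then have "len x = Suc (len x - 1)" "kl x <= n" by (auto simp: SS_def gens_def smp_def kl_idx)
 then show "x : SS n Q" using x assms(2)[of "len x - 1"] by (auto simp: SS_def)
 qed
qed

lemma SS_empty: "c : fr (SS n (%_ _ _. False)) ==> c = 0" by (simp add: SS_def fr_empty)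

lemma SS_restr:
 "c : fr (SS n P) ==> restr (%x. Q (len x) (pl x) (kl x)) c : fr (SS n (%q p k. P q p k & Q q p k))"
 by (erule restr_fr') (auto simp: SS_def)

lemma SS_restr_id:
 assumes "c : fr (SS n P)" "!!q p k. P q p k ==> Q q p k"
 shows "restr (%x. Q (len x) (pl x) (kl x)) c = c"
 by (rule restr_id[OF assms(1)]) (use assms(2) in \<open>auto simp: SS_def\<close>)

lemma SS_restr_0:
 assumes "c : fr (SS n P)" "!!q p k. P q p k ==> \<not> Q q p k"
 shows "restr (%x. Q (len x) (pl x) (kl x)) c = 0"
 by (rule restr_0[OF assms(1)]) (use assms(2) in \<open>auto simp: SS_def\<close>)

lemma restr_SN: "c : N (LA B) n ==> restr (%x. Q (len x) (pl x) (kl x)) c : N (LA B) n"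
 by (rule restr_N[where Q = "%q i l. Q q (fst l) (fst (snd l))"]) (auto simp: pl_def kl_def)

lemma bd_SS: "c : fr (SS n P) ==> bd c : fr (SS n (%q p k. P (Suc q) p k))"
proof (rule addv_fr[OF addv_bd])
 fix s assume "s : SS n P"
 then obtain gs i a l where s: "s = (gs, i, a, l)" "(gs, i, a, l) : SS n P" by (cases s) auto
 then show "bd (fo s) : fr (SS n (%q p k. P (Suc q) p k))"
 unfolding s(1) bd_of
 by (intro tens_fr[OF bdl_fr]) (auto simp: SS_def smp_def pl_def kl_def)
qed

lemma xt_SS:
 assumes "c : fr (SS n P)" "!!p k b. b : B p k ==> f (p, k, b) : fr {x : gens1 (LA B) k. R p k (pl x) (kl x)}"
 shows "xt f c : fr (SS n (%q p' k'. \<exists>p k. P q p k & R p k p' k' & k' <= k))"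
proof (rule addv_fr[OF addv_xt assms(1)])
 fix s assume "s : SS n P"
 then obtain gs i a p b where s: "s = (gs, i, a, p, n - i, b)" "gs : smp n" "i <= n" "a : Ag i" "b : B p (n - i)" "P (length gs) p (n - i)"
 by (cases s) (auto simp: SS_def)
 show "xt f (fo s) : fr (SS n (%q p' k'. \<exists>p k. P q p k & R p k p' k' & k' <= k))"
 unfolding s(1) xt_of
 proof (rule addv_fr[OF addv_bil assms(2)[OF s(5)]])
 fix x assume "x : {x : gens1 (LA B) (n - i). R p (n - i) (pl x) (kl x)}"
 then obtain g j c p' b' where x: "x = ([g], j, c, p', n - i - j, b')" "g : GLc (n - i)" "j <= n - i" "c : Ag j"
 "b' : B p' (n - i - j)" "R p (n - i) p' (n - i - j)"
 by (cases x) (auto simp: gens1_def)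
 show "bil gs i a (fo x) : fr (SS n (%q p' k'. \<exists>p k. P q p k & R p k p' k' & k' <= k))"
 proof -
 have "\<exists>p0 k0. P (length gs) p0 k0 & R p0 k0 p' (n - i - j) & n - i - j <= k0"
 using s x by (intro exI[of _ p] exI[of _ "n - i"]) simp
 then show ?thesis unfolding x(1) bil_of using s x by (simp add: SS_def)
 qed
 qed
qed

lemma dl_SS: "c : fr (SS n P) ==> dl c : fr (SS n (%q p' k'. \<exists>k\<ge>k'. P q (Suc p') k))"
proof -
 assume c: "c : fr (SS n P)"
 have "dl c : fr (SS n (%q p' k'. \<exists>p k. P q p k & p = Suc p' & k' <= k))"
 proof (rule xt_SS[OF c])
 fix p k b assume b: "b : B p k"
 show "\<delta> (p, k, b) : fr {x : gens1 (LA B) k. p = Suc (pl x)}"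
 proof (cases p)
 case (Suc p')
 have "\<delta> (p, k, b) : fr (gens1 (LT B p') k)" using \<delta> b Suc by simp
 then show ?thesis by (rule fr_mono) (auto simp: gens1_LT Suc)
 qed (simp add: \<delta>0)
 qed
 then show ?thesis by (rule SS_mono) auto
qed

lemma D_SS: "c : fr (SS n P) ==> D c : fr (SS n (%q p k. P (Suc q) p k \<or> (\<exists>k'\<ge>k. P q (Suc p) k')))"
proof -
 assume c: "c : fr (SS n P)"
 show ?thesis unfolding D_def
 by (intro fr_add SS_mono[OF bd_SS[OF c]] SS_mono[OF dl_SS[OF sgn_fr[OF c]]]) auto
qed

lemma e1_SS: "c : fr (SS n P) ==> xt e1 c : fr (SS n (%q p k. \<exists>k'\<ge>k. P q p k' & (p < k' --> k < k')))"
 by (rule SS_mono[OF xt_SS[OF _ e1_fr]]) auto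

text \<open>A round of \<open>e1\<close> keeps p and never raises k. A term that ends with p < k had
  p < k all along, so each of the M rounds lowered k.\<close>

lemma EE_SS: "c : fr (SS n P) ==> EE M c : fr (SS n (%q p k. \<exists>k'\<ge>k. P q p k' & (p < k --> k + M <= k')))"
proof (induction M)
 case 0 then show ?case by (auto elim: SS_mono)
next
 case (Suc M)
 show ?case unfolding EE_Suc
 proof (rule SS_mono[OF e1_SS[OF Suc.IH[OF Suc.prems]]])
 fix q p k
 assume "\<exists>k'\<ge>k. (\<exists>k''\<ge>k'. P (Suc q) p k'' & (p < k' --> k' + M <= k'')) & (p < k' --> k < k')"
 then obtain k' k'' where *: "k <= k'" "k' <= k''" "P (Suc q) p k''" "p < k' --> k' + M <= k''" "p < k' --> k < k'" by blast
 then show "\<exists>k'\<ge>k. P (Suc q) p k' & (p < k --> k + Suc M <= k')" by (intro exI[of _ k'']) auto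
 qed
qed

text \<open>Label degrees lie between 0 and n, so more than n strict descents are impossible and
  only terms with k \<le> p survive.\<close>

lemma EE_diag:
 assumes "n <= M" "c : fr (SS n P)"
 shows "EE (Suc M) c : fr (SS n (%q p k. k <= p & (\<exists>k'\<ge>k. k' <= n & P q p k')))"
proof -
 have "c : fr (SS n (%q p k. P q p k & k <= n))" using assms(2) by (rule SS_mono) auto
 from EE_SS[OF this, of "Suc M"] show ?thesis
 by (rule SS_mono) (use assms(1) in force)
qed

text \<open>On labels with p = k = 0 both \<open>\<sigma>\<close> and \<open>\<delta>\<close> vanish
  and \<open>e1\<close> is the identity. The lifts of cycles of A live there and thus are not
  disturbed.\<close>

lemma EE_fix: "c : fr (SS n (%q p k. p = 0 & k = 0)) ==> EE M c = c"
proof (induction M)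
 case (Suc M)
 have "xt e1 c = xt idl c"
 by (rule addv_eq_on[OF addv_xt addv_xt Suc.prems]) (auto simp: SS_def gens_def LA_def e1_id)
 then show ?case using Suc xt_idl[OF SS_gens[OF Suc.prems]] by (simp add: EE_Suc)
qed simp

subsection \<open>Acyclicity of the total complex\<close>

lemma row_exact_LT:
 assumes n: "n >= 1" and c: "c : fr (SS n (%q p k. q = Suc s & p = j))" and d: "dl c : N (LA B) n"
 shows "\<exists>w \<in> fr (SS n (%q p k. q = Suc s & p = Suc j)). c - dl w : N (LA B) n"
proof -
 have SS: "SS n (%q p k. q = Suc s & p = j) = {x : gens (LT B j) n. len x = Suc s}" for j
 by (auto simp: SS_def gens_LT)
 show ?thesis
 proof (cases j)
 case 0
 \<comment> \<open>In resolution degree 0 the row ends in 0, since \<int> vanishes in degree n \<ge>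
   1; the zero map plays the part of the next differential.\<close>
 have m0: "mapping (LT B 0) (LT B 0) (%_. 0 :: ('r, 'a, 'b lbl) chain)" by (auto simp: mapping_def)
 have "xt (%_. 0) c = (0 :: ('r, 'a, 'b lbl) chain)" for c :: "('r, 'a, 'b lbl) chain"
 by (rule addv_eq) (auto simp: xt_def split: prod.splits)
 then have "\<exists>w \<in> fr {x : gens (LT B (Suc 0)) n. len x = Suc s}. c - dl w : N (LT B 0) n"
 using row_exact[OF m0 map_\<delta>[of 0], of n c s] exact_0[OF n] c by (auto simp: SS 0)
 then show ?thesis using N_LT_LA by (auto simp: SS 0)
 next
 case (Suc j')
 have c': "c : fr {x : gens (LT B (Suc j')) n. len x = Suc s}" using c by (simp add: SS Suc)
 have "dl c : fr (gens (LT B j') n)"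
 by (rule xt_fr[OF map_\<delta>]) (rule fr_mono[OF c'], auto)
 then have "dl c : N (LT B j') n" by (intro N_LA_LT[OF d]) (auto elim!: fr_mono simp: gens_LT)
 then have "\<exists>w \<in> fr {x : gens (LT B (Suc (Suc j'))) n. len x = Suc s}. c - dl w : N (LT B (Suc j')) n"
 using row_exact[OF map_\<delta> map_\<delta> exact_Suc c'] by blast
 then show ?thesis using N_LT_LA by (auto simp: SS Suc)
 qed
qed

text \<open>The part of a cycle in the lowest resolution degree j is a cycle for the resolution
  differential; exact rows allow exchanging it, modulo a boundary, for terms in resolution degree j
  + 1. Beyond j = m nothing remains, since a simplex has a vertex.\<close>

lemma total_exact:
 assumes n: "n >= 1"
 shows "y : fr (SS n (%q p k. q + p = Suc m & j <= p)) ==> D y : N (LA B) n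
 ==> \<exists>w \<in> fr (SS n (%q p k. q + p = Suc (Suc m))). y - D w : N (LA B) n"
proof (induction "Suc m - j" arbitrary: j y)
 case 0
 have "y : fr (SS n (%_ _ _. False))" by (rule SS_mono[OF 0(2)]) (use 0(1) in auto)
 then have "y = 0" by (rule SS_empty)
 then show ?case by (auto intro!: bexI[of _ 0])
next
 case (Suc t)
 define s where "s = m - j"
 have s: "Suc m = Suc s + j" using Suc(2) by (simp add: s_def)
 define y0 where "y0 = restr (%x. (%q p k. p = j) (len x) (pl x) (kl x)) y"
 define y1 where "y1 = restr (%x. (%q p k. p ~= j) (len x) (pl x) (kl x)) y"
 have yy: "y = y0 + y1" unfolding y0_def y1_def using restr_split[of "%x. pl x = j" y] by simp
 have y0: "y0 : fr (SS n (%q p k. q = Suc s & p = j))"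
 unfolding y0_def by (rule SS_mono[OF SS_restr[OF Suc(3)]]) (use s in auto)
 have y1: "y1 : fr (SS n (%q p k. q + p = Suc m & Suc j <= p))"
 unfolding y1_def by (rule SS_mono[OF SS_restr[OF Suc(3)]]) auto
 have Dy0: "D y0 = bd y0 + frag_cmul ((-1) ^ s) (dl y0)"
 by (rule D_hom) (rule fr_mono[OF y0], auto simp: SS_def)
 have "dl y0 : N (LA B) n"
 proof (cases j)
 case 0
 have "dl y0 : fr (SS n (%_ _ _. False))" by (rule SS_mono[OF dl_SS[OF y0]]) (auto simp: 0)
 then show ?thesis using SS_empty by fastforce
 next
 case (Suc j')
 \<comment> \<open>Only \<open>y0\<close> contributes to D y in resolution degree j - 1, and only
   through \<open>dl\<close>.\<close>
 let ?Q = "%q p k. p = j' & q = Suc s"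
 have "restr (%x. ?Q (len x) (pl x) (kl x)) (D y) : N (LA B) n" by (rule restr_SN[OF Suc.prems(2)])
 moreover have "restr (%x. ?Q (len x) (pl x) (kl x)) (D y1) = 0"
 by (rule SS_restr_0[OF D_SS[OF y1]]) (use Suc s in auto)
 moreover have "restr (%x. ?Q (len x) (pl x) (kl x)) (bd y0) = 0"
 by (rule SS_restr_0[OF bd_SS[OF y0]]) (use Suc in auto)
 moreover have "restr (%x. ?Q (len x) (pl x) (kl x)) (dl y0) = dl y0"
 by (rule SS_restr_id[OF dl_SS[OF y0]]) (use Suc in auto)
 ultimately have "frag_cmul ((-1) ^ s) (dl y0) : N (LA B) n"
 by (simp add: yy Dy0 addv_add[OF addv_restr] addv_cmul[OF addv_restr])
 from N_cmul[OF this, of "(-1) ^ s"] show ?thesis by (simp flip: power_mult_distrib)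
 qed
 then obtain w where w: "w : fr (SS n (%q p k. q = Suc s & p = Suc j))" "y0 - dl w : N (LA B) n"
 using row_exact_LT[OF n y0] by blast
 \<comment> \<open>The factor cancels the sign that D attaches to \<open>dl\<close> in simplicial
   degree s.\<close>
 let ?w = "frag_cmul ((-1) ^ s) w"
 have Dw: "D ?w = frag_cmul ((-1) ^ s) (bd w) + dl w"
 proof -
 have "D w = bd w + frag_cmul ((-1) ^ s) (dl w)" by (rule D_hom) (rule fr_mono[OF w(1)], auto simp: SS_def)
 then show ?thesis by (simp add: frag_cmul_distrib2 flip: power_mult_distrib)
 qed
 define y' where "y' = y1 - frag_cmul ((-1) ^ s) (bd w)"
 have "y - D ?w - y' = y0 - dl w" unfolding yy y'_def Dw by simp
 then have yy': "y - D ?w - y' : N (LA B) n" using w(2) by simp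
 have "y' : fr (SS n (%q p k. q + p = Suc m & Suc j <= p))"
 unfolding y'_def by (intro fr_diff y1 fr_cmul SS_mono[OF bd_SS[OF w(1)]]) (use s in auto)
 moreover have "D y' : N (LA B) n"
 proof -
 have "D (y - D ?w - y') : N (LA B) n" by (rule D_N[OF yy'])
 moreover have "D (D ?w) : N (LA B) n" by (rule D_D[OF fr_cmul[OF SS_gens[OF w(1)]]])
 ultimately have "D y - D (D ?w) - D y' : N (LA B) n" by simp
 from N_diff[OF N_diff[OF Suc.prems(2) \<open>D (D ?w) : N (LA B) n\<close>] this] show ?thesis by simp
 qed
 ultimately obtain w' where w': "w' : fr (SS n (%q p k. q + p = Suc (Suc m)))" "y' - D w' : N (LA B) n"
 proof -
 have t: "t = Suc m - Suc j" using Suc(2) by arith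
 assume "y' : fr (SS n (%q p k. q + p = Suc m & Suc j <= p))" "D y' : N (LA B) n"
 from Suc(1)[OF t this] show thesis using that by blast
 qed
 have "y - D (?w + w') : N (LA B) n" using N_plus[OF yy' w'(2)] by (simp add: algebra_simps)
 moreover have "?w + w' : fr (SS n (%q p k. q + p = Suc (Suc m)))"
 by (intro fr_add fr_cmul w'(1) SS_mono[OF w(1)]) (use s in auto)
 ultimately show ?case by blast
qed

end

section \<open>Cycles, boundaries and products with A_1 in the homology of GL_n\<close>

context gl_alg begin

definition chn :: "nat => nat => ('r, 'a, unit) chain set" where
 "chn n q = fr {x : gens LC n. len x = Suc q}"

definition cyc :: "nat => nat => ('r, 'a, unit) chain set" where
 "cyc n q = {z : chn n q. bd z : N LC n}"

definition BD :: "nat => nat => ('r, 'a, unit) chain set" where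
 "BD n q = gsp (rels LC n \<union> bd ` chn n (Suc q))"

text \<open>The vanishing of H_q(GL_n; A_n), in terms of homogeneous chains.\<close>

definition Hz :: "nat => nat => bool" where
 "Hz n q \<longleftrightarrow> cyc n q <= BD n q"

definition vt :: "'a => ('r, 'a, unit) chain" where "vt a = fo ([idm (Suc 0)], Suc 0, a, ())"

definition PR :: "nat => nat => ('r, 'a, unit) chain set" where
 "PR n q = gsp {xp c (vt a) | c a. c : cyc n q & a : Ag (Suc 0)}"

text \<open>H_q of GL_{n+1} is generated by products with A_1; the parameter is the rank of the
  smaller group. A_1 multiplies from the right, because that is where the differential of a basis
  element of degree 1 puts it.\<close>

definition RG :: "nat => nat => bool" where
 "RG n q \<longleftrightarrow> (\<forall>z\<in>cyc (Suc n) q. \<exists>s\<in>PR n q. z - s : BD (Suc n) q)"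

lemma chn_gens: "c : chn n q ==> c : fr (gens LC n)" unfolding chn_def by (erule fr_mono) auto
lemma cyc_chn: "c : cyc n q ==> c : chn n q" by (simp add: cyc_def)
lemma chn_closed: "0 : chn n q" "x : chn n q ==> y : chn n q ==> x - y : chn n q" "x : chn n q ==> y : chn n q ==> x + y : chn n q"
 "x : chn n q ==> frag_cmul k x : chn n q" "x : chn n q ==> - x : chn n q"
 by (auto simp: chn_def intro: fr_diff fr_add fr_cmul fr_minus)

lemma cyc_closed: "x : cyc n q ==> y : cyc n q ==> x - y : cyc n q"
 by (auto simp: cyc_def chn_closed N_diff)

lemma bd_chn: "c : chn n (Suc q) ==> bd c : chn n q"
 unfolding chn_def
proof (rule addv_fr[OF addv_bd])
 fix s assume "s : {x : gens LC n. len x = Suc (Suc q)}"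
 then show "bd (fo s) : fr {x : gens LC n. len x = Suc q}"
 by (cases s) (auto simp: smp_def intro!: tens_fr[OF bdl_fr])
qed auto

lemma xp_chn: "c : chn m p ==> t : chn n q ==> xp c t : chn (m + n) (p + q)"
proof -
 assume "c : chn m p" "t : chn n q"
 then have "xp c t : fr {x : gens LC (m + n). \<exists>y\<in>gens LC n. len y = Suc q & Suc (len x) = Suc p + len y & lab x = lab y & idx x = m + idx y}"
 unfolding chn_def by (rule xp_fr_graded)
 then show ?thesis unfolding chn_def by (rule fr_mono) auto
qed

lemma vt_chn: "a : Ag (Suc 0) ==> vt a : chn (Suc 0) 0" by (simp add: vt_def chn_def)
lemma bd_vt [simp]: "bd (vt a) = 0" by (simp add: vt_def bdl_def)
lemma bd_inc [simp]: "bd (inc k l) = 0" by (simp add: inc_def bdl_def)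

lemma bd_len1: "c : fr {x. len x = 1} ==> bd c = 0"
 by (rule addv_eq_on[OF addv_bd addv_const_zero]) (auto simp: bdl_def)

lemma bd_gens1: "c : fr (gens1 L n) ==> bd c = 0"
 by (rule bd_len1) (erule fr_mono, auto simp: gens1_iff)

lemma bd_xp_chn:
 assumes "c : chn m p" "t : fr (gens L n)"
 shows "bd (xp c t) = xp (bd c) t + frag_cmul ((-1) ^ p) (xp c (bd t))"
proof (rule xp_bd)
 show "c : fr {x. len x = Suc p}" using assms(1) unfolding chn_def by (rule fr_mono) auto
 show "t : fr {x. len x ~= 0}" using assms(2) by (rule fr_mono) (auto simp: smp_def gens_def)
qed

lemma xp_cyc: "c : cyc m p ==> t : cyc n q ==> xp c t : cyc (m + n) (p + q)"
proof -
 assume c: "c : cyc m p" and t: "t : cyc n q"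
 have "xp (bd c) t : N LC (m + n)" "xp c (bd t) : N LC (m + n)"
 using xp_N1[of "bd c" m t LC n] xp_N2[of c m "bd t" LC n] c t chn_gens by (auto simp: cyc_def)
 then show ?thesis using c t bd_xp_chn[of c m p t LC n]
 by (auto simp: cyc_def xp_chn chn_gens intro!: N_plus N_cmul)
qed

lemma vt_cyc: "a : Ag (Suc 0) ==> vt a : cyc (Suc 0) 0" by (simp add: cyc_def vt_chn)

lemma gsp_image_iff:
 assumes f: "addv f" and U: "0 : U" "!!x y. x : U ==> y : U ==> x - y : U"
 shows "x : gsp (R \<union> f ` U) \<longleftrightarrow> (\<exists>w\<in>U. x - f w : gsp R)"
proof
 assume "x : gsp (R \<union> f ` U)"
 then show "\<exists>w\<in>U. x - f w : gsp R"
 proof induction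
 case gsp_zero show ?case using U(1) addv_zero[OF f] by (intro bexI[of _ 0]) auto
 next
 case (gsp_base r)
 then show ?case
 proof
 assume "r : R" then show ?thesis using U(1) addv_zero[OF f] by (intro bexI[of _ 0]) (auto intro: gsp.gsp_base)
 qed force
 next
 case (gsp_diff x y)
 then obtain w v where "w : U" "v : U" "x - f w : gsp R" "y - f v : gsp R" by blast
 then show ?case using U(2) gsp_diff_diff[of x "f w" R y "f v"] by (intro bexI[of _ "w - v"]) (auto simp: addvD[OF f])
 qed
next
 assume "\<exists>w\<in>U. x - f w : gsp R"
 then obtain w where w: "w : U" "x - f w : gsp R" by blast
 have "x - f w : gsp (R \<union> f ` U)" using w(2) gsp_mono[of R "R \<union> f ` U"] by auto
 moreover have "f w : gsp (R \<union> f ` U)" using w(1) by (auto intro: gsp_base)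
 ultimately show "x : gsp (R \<union> f ` U)" using gsp_add by force
qed

lemma BD_iff: "x : BD n q \<longleftrightarrow> (\<exists>w\<in>chn n (Suc q). x - bd w : N LC n)"
 unfolding BD_def N_def by (rule gsp_image_iff) (auto simp: chn_closed)

lemma BD_bd: "w : chn n (Suc q) ==> bd w : BD n q" unfolding BD_def by (auto intro: gsp_base)
lemma BD_N: "x : N LC n ==> x : BD n q"
 unfolding BD_def N_def using gsp_mono[of "rels LC n" "rels LC n \<union> bd ` chn n (Suc q)"] by auto
lemma BD_diff: "x : BD n q ==> y : BD n q ==> x - y : BD n q" unfolding BD_def by (rule gsp_diff)
lemma BD_add: "x : BD n q ==> y : BD n q ==> x + y : BD n q" unfolding BD_def by (rule gsp_add)
lemma BD_minus: "x : BD n q ==> - x : BD n q" unfolding BD_def by (rule gsp_minus)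
lemma BD_cmul: "x : BD n q ==> frag_cmul k x : BD n q" unfolding BD_def by (rule gsp_cmul)
lemma BD_zero [simp]: "0 : BD n q" unfolding BD_def by simp

lemma BD_xp:
 assumes "c : BD m p" "t : cyc n q" shows "xp c t : BD (m + n) (p + q)"
proof -
 obtain w where w: "w : chn m (Suc p)" "c - bd w : N LC m" using assms(1) BD_iff by blast
 have t: "t : fr (gens LC n)" using chn_gens cyc_chn assms(2) by blast
 have "xp (c - bd w) t : BD (m + n) (p + q)" by (rule BD_N[OF xp_N1[OF w(2) t]])
 moreover have "xp (bd w) t = bd (xp w t) - frag_cmul ((-1) ^ Suc p) (xp w (bd t))"
 using bd_xp_chn[OF w(1) t] by simp
 moreover have "bd (xp w t) : BD (m + n) (p + q)"
 using BD_bd[of "xp w t" "m + n" "p + q"] xp_chn[OF w(1) cyc_chn[OF assms(2)]] by simp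
 moreover have "frag_cmul ((-1) ^ Suc p) (xp w (bd t)) : BD (m + n) (p + q)"
 using assms(2) by (intro BD_cmul BD_N xp_N2[OF chn_gens[OF w(1)]]) (simp add: cyc_def)
 ultimately have "xp (c - bd w) t + (bd (xp w t) - frag_cmul ((-1) ^ Suc p) (xp w (bd t))) : BD (m + n) (p + q)"
 by (intro BD_add BD_diff)
 then show ?thesis using bd_xp_chn[OF w(1) t] by simp
qed

lemma BD_xp2:
 assumes "c : cyc m p" "t : BD n q" shows "xp c t : BD (m + n) (p + q)"
proof -
 obtain w where w: "w : chn n (Suc q)" "t - bd w : N LC n" using assms(2) BD_iff by blast
 have c: "c : fr (gens LC m)" "c : chn m p" using chn_gens cyc_chn assms(1) by blast+
 have 1: "xp c (t - bd w) : BD (m + n) (p + q)" by (rule BD_N[OF xp_N2[OF c(1) w(2)]])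
 have "frag_cmul ((-1) ^ p) (xp c (bd w)) = bd (xp c w) - xp (bd c) w"
 using bd_xp_chn[OF c(2) chn_gens[OF w(1)]] by simp
 moreover have "bd (xp c w) - xp (bd c) w : BD (m + n) (p + q)"
 using BD_bd[of "xp c w" "m + n" "p + q"] xp_chn[OF c(2) w(1)] assms(1)
 by (intro BD_diff BD_N[OF xp_N1] chn_gens[OF w(1)]) (auto simp: cyc_def)
 ultimately have "frag_cmul ((-1) ^ p) (frag_cmul ((-1) ^ p) (xp c (bd w))) : BD (m + n) (p + q)"
 using BD_cmul[of "frag_cmul ((-1) ^ p) (xp c (bd w))"] by metis
 then have "xp c (bd w) : BD (m + n) (p + q)" by (simp flip: power_mult_distrib)
 from BD_add[OF 1 this] show ?thesis by simp
qed

text \<open>Balancing moves the matrix of a single vertex into its coefficient, which turns a chain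
  of single vertices into a sum of terms \<open>vt a\<close>.\<close>

lemma single_vt: "t : fr (gens1 LC (Suc 0)) ==> c : cyc n q ==> \<exists>s\<in>PR n q. xp c t - s : N LC (Suc n)"
proof (induction t rule: fr_induct)
 case zero then show ?case by (auto simp: PR_def intro!: bexI[of _ 0])
next
 case (of x)
 then obtain g a where x: "x = ([g], Suc 0, a, ())" "g : GLc (Suc 0)" "a : Ag (Suc 0)"
 by (auto simp: gens1_def le_Suc_eq)
 have "fo x - vt (Act A (Suc 0) g a) : N LC (Suc 0)"
 using N_act[of "[idm (Suc 0)]" "Suc 0" "Suc 0" g a "()" LC] x by (simp add: vt_def)
 then have "xp c (fo x - vt (Act A (Suc 0) g a)) : N LC (n + Suc 0)"
 by (rule xp_N2[OF chn_gens[OF cyc_chn[OF of(2)]]])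
 moreover have "xp c (vt (Act A (Suc 0) g a)) : PR n q"
 unfolding PR_def using x of(2) by (intro gsp_base) auto
 ultimately show ?case by (intro bexI[of _ "xp c (vt (Act A (Suc 0) g a))"]) simp_all
next
 case (diff t t')
 then obtain s s' where "s : PR n q" "xp c t - s : N LC (Suc n)" "s' : PR n q" "xp c t' - s' : N LC (Suc n)" by blast
 then show ?case using N_diff_diff by (intro bexI[of _ "s - s'"]) (auto simp: PR_def intro: gsp_diff)
qed

lemma xp_vt_assoc: "c : fr (gens LC m) ==> a : Ag (Suc 0) ==> t : fr (gens1 L n)
 ==> xp (xp c (vt a)) t = xp c (xp (vt a) t)"
proof -
 assume c: "c : fr (gens LC m)" and a: "a : Ag (Suc 0)" and t: "t : fr (gens1 L n)"
 show ?thesis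
 proof (rule addv_eq_on[OF _ _ t])
 fix x assume "x : gens1 L n"
 then obtain h j b l where x: "x = ([h], j, b, l)" "h : GLc n" "j <= n" "b : Ag j" by (auto simp: gens1_def)
 then show "xp (xp c (vt a)) (fo x) = xp c (xp (vt a) (fo x))"
 using xp_assoc_single[OF c GLc_one a x(2-4), of "()" l] by (simp add: vt_def)
 qed (auto simp: addv_def)
qed

text \<open>Two factors from A_1 split off, and their product lies in H_0(GL_2; A_2) = 0.\<close>

lemma Hz_of_RG:
 assumes h2: "Hz (Suc (Suc 0)) 0" and r: "RG n q" "RG (Suc n) q" shows "Hz (Suc (Suc n)) q"
 unfolding Hz_def
proof
 fix z assume z: "z : cyc (Suc (Suc n)) q"
 have A: "xp s (vt a) : BD (Suc (Suc n)) q" if s: "s : PR n q" and a: "a : Ag (Suc 0)" for s a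
 using s unfolding PR_def
 proof (induction rule: gsp.induct)
 case (gsp_base r)
 then obtain c b where r: "r = xp c (vt b)" "c : cyc n q" "b : Ag (Suc 0)" by blast
 have "vt a : fr (gens1 LC (Suc 0))" using a by (simp add: vt_def gens1_def)
 then have "xp r (vt a) = xp c (xp (vt b) (vt a))"
 using xp_vt_assoc r chn_gens cyc_chn by blast
 moreover have "xp (vt b) (vt a) : BD (Suc (Suc 0)) 0"
 using h2 xp_cyc[OF vt_cyc[OF r(3)] vt_cyc[OF a]] by (auto simp: Hz_def)
 ultimately show ?case using BD_xp2[OF r(2)] by fastforce
 qed (auto simp: BD_diff)
 have B: "s : BD (Suc (Suc n)) q" if "s : PR (Suc n) q" for s
 using that unfolding PR_def[of "Suc n"]
 proof (induction rule: gsp.induct)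
 case (gsp_base t)
 then obtain c a where t: "t = xp c (vt a)" "c : cyc (Suc n) q" "a : Ag (Suc 0)" by blast
 obtain s where s: "s : PR n q" "c - s : BD (Suc n) q" using r(1) t(2) by (auto simp: RG_def)
 have "xp (c - s) (vt a) : BD (Suc (Suc n)) q" using BD_xp[OF s(2) vt_cyc[OF t(3)]] by simp
 then show ?case using BD_add[OF _ A[OF s(1) t(3)]] t(1) by fastforce
 qed (auto simp: BD_diff)
 obtain s where "s : PR (Suc n) q" "z - s : BD (Suc (Suc n)) q" using r(2) z by (auto simp: RG_def)
 then show "z : BD (Suc (Suc n)) q" using BD_add[OF _ B] by fastforce
qed

end

section \<open>Removing components of a chain by vanishing in lower rank\<close>

context resolution begin

lemma xp_SS:
 assumes "c : chn m p0" "t : fr (SS n P)"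
 shows "xp c t : fr (SS (m + n) (%q p k. \<exists>q'. P q' p k & Suc q = Suc p0 + q'))"
proof -
 have t: "t : fr {x : gens (LA B) n. P (len x) (pl x) (kl x)}" using assms(2) by (simp add: SS_def)
 have "xp c t : fr {x : gens (LA B) (m + n). \<exists>y\<in>gens (LA B) n. P (len y) (pl y) (kl y) & Suc (len x) = Suc p0 + len y & lab x = lab y & idx x = m + idx y}"
 using assms(1) t unfolding chn_def by (rule xp_fr_graded)
 then show ?thesis by (rule fr_mono) (auto simp: SS_def pl_def kl_def)
qed

lemma inc_SS: "b : B p k ==> inc k (p, k, b) : fr (SS k (%q p' k'. q = Suc 0 & p' = p & k' = k))"
 by (simp add: inc_def SS_def)

lemma decomp:
 assumes Y: "Y : fr (SS n (%q' p' k'. q' = Suc q & p' = p & k' = k))" "bd Y : N (LA B) n" and k: "k <= n"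
 shows "\<exists>Z c Bs. Z : fr (SS n (%q' p' k'. q' = Suc (Suc q) & p' = p & k' = k)) & finite Bs & Bs <= B p k &
 (\<forall>b. c b : cyc (n - k) q) & Y - bd Z - (\<Sum>b\<in>Bs. xp (c b) (inc k (p, k, b))) : N (LA B) n"
proof -
 have SS: "SS n (%q' p' k'. q' = q & p' = p & k' = k) = {x : gens (LA B) n. len x = q & idx x = n - k & lab x : {l. fst l = p}}" for q
 proof -
 have "x : gens (LA B) n ==> kl x = k \<longleftrightarrow> idx x = n - k" for x using kl_idx[of x n] k by auto
 then show ?thesis unfolding SS_def pl_def by blast
 qed
 have Y': "Y : fr {x : gens (LA B) n. len x = Suc q & idx x = n - k & lab x : {l. fst l = p}}" using Y(1) SS by simp
 obtain Z c Ls where *: "Z : fr (SS n (%q' p' k'. q' = Suc (Suc q) & p' = p & k' = k))" "finite Ls"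
 "Ls <= LA B k \<inter> {l. fst l = p}" "!!l. c l : cyc (n - k) q" "Y - bd Z - (\<Sum>l\<in>Ls. xp (c l) (inc k l)) : N (LA B) n"
 using shapiro[OF Y' _ Y(2)] k unfolding SS cyc_def chn_def by auto
 let ?Bs = "(%l. snd (snd l)) ` Ls"
 have Ls: "Ls = (%b. (p, k, b)) ` ?Bs"
 proof
 show "Ls <= (%b. (p, k, b)) ` ?Bs" using *(3) by (force simp: LA_def)
 show "(%b. (p, k, b)) ` ?Bs <= Ls" using *(3) by (force simp: LA_def)
 qed
 have "(\<Sum>l\<in>Ls. xp (c l) (inc k l)) = (\<Sum>b\<in>?Bs. xp (c (p, k, b)) (inc k (p, k, b)))"
 by (subst Ls, subst sum.reindex) (auto simp: inj_on_def)
 moreover have "?Bs <= B p k" using *(3) by (fastforce simp: LA_def)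
 ultimately show ?thesis using * by (intro exI[of _ Z] exI[of _ "%b. c (p, k, b)"] exI[of _ ?Bs]) auto
qed

lemma xp_inc_bd: "w : chn m (Suc q) ==> b : B p k ==> xp (bd w) (inc k (p, k, b)) = bd (xp w (inc k (p, k, b)))"
 using bd_xp_chn[of w m "Suc q" "inc k (p, k, b)" "LA B" k] by (simp add: gens1_gens inc_fr)

text \<open>By Shapiro's lemma the component is a sum of cycles over GL_{n-k} times basis elements;
  each cycle is filled separately.\<close>

lemma vanish:
 assumes Y: "Y : fr (SS n (%q' p' k'. q' = Suc q & p' = p & k' = k))" "bd Y : N (LA B) n" and k: "k <= n" and h: "Hz (n - k) q"
 shows "\<exists>Z \<in> fr (SS n (%q' p' k'. q' = Suc (Suc q) & p' = p & k' = k)). Y - bd Z : N (LA B) n"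
proof -
 obtain Z c Bs where *: "Z : fr (SS n (%q' p' k'. q' = Suc (Suc q) & p' = p & k' = k))" "finite Bs" "Bs <= B p k"
 "!!b. c b : cyc (n - k) q" "Y - bd Z - (\<Sum>b\<in>Bs. xp (c b) (inc k (p, k, b))) : N (LA B) n"
 using decomp[OF Y k] by blast
 have "\<forall>b. \<exists>w\<in>chn (n - k) (Suc q). c b - bd w : N LC (n - k)" using h *(4) BD_iff unfolding Hz_def by blast
 then obtain w where w: "!!b. w b : chn (n - k) (Suc q)" "!!b. c b - bd (w b) : N LC (n - k)" by metis
 let ?W = "\<Sum>b\<in>Bs. xp (w b) (inc k (p, k, b))"
 have W: "?W : fr (SS n (%q' p' k'. q' = Suc (Suc q) & p' = p & k' = k))"
 proof (rule fr_sum)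
 fix b assume "b : Bs"
 then have "b : B p k" using *(3) by auto
 then show "xp (w b) (inc k (p, k, b)) : fr (SS n (%q' p' k'. q' = Suc (Suc q) & p' = p & k' = k))"
 using xp_SS[OF w(1) inc_SS, of b p k b] k by (auto elim!: SS_mono)
 qed
 have "(\<Sum>b\<in>Bs. xp (c b) (inc k (p, k, b)) - bd (xp (w b) (inc k (p, k, b)))) : N (LA B) n"
 proof (rule N_sum)
 fix b assume "b : Bs"
 then have b: "b : B p k" using *(3) by auto
 have "xp (c b - bd (w b)) (inc k (p, k, b)) : N (LA B) (n - k + k)"
 by (rule xp_N1[OF w(2)]) (use b in \<open>simp add: gens1_gens inc_fr\<close>)
 then show "xp (c b) (inc k (p, k, b)) - bd (xp (w b) (inc k (p, k, b))) : N (LA B) n"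
 using k by (simp add: xp_inc_bd[OF w(1) b])
 qed
 then have "(\<Sum>b\<in>Bs. xp (c b) (inc k (p, k, b))) - bd ?W : N (LA B) n" by (simp add: sum_subtractf addv_sum[OF addv_bd])
 from N_plus[OF *(5) this] have "Y - bd (Z + ?W) : N (LA B) n" by (simp add: algebra_simps)
 then show ?thesis using fr_add[OF *(1) W] by blast
qed

text \<open>The resolution differential lowers p by one and does not raise k. With K the largest
  label degree and P the largest resolution degree occurring with it, nothing but the simplicial
  boundary reaches this component of D y.\<close>

lemma component_cycle:
 assumes y: "y : fr (SS n (%q p k. q + p = Suc m & k <= K & (k = K --> p <= P)))"
 and c: "restr (%x. kl x = K) (D y) : N (LA B) n"
 shows "bd (restr (%x. pl x = P & kl x = K) y) : N (LA B) n"
proof -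
 let ?Q = "%q p k. p = P & k = K"
 define Y where "Y = restr (%x. ?Q (len x) (pl x) (kl x)) y"
 define Y' where "Y' = restr (%x. (%q p k. \<not> (p = P & k = K)) (len x) (pl x) (kl x)) y"
 have y': "y = Y + Y'" unfolding Y_def Y'_def using restr_split[of "%x. pl x = P & kl x = K" y] by simp
 have Y: "Y : fr (SS n (%q p k. p = P & k = K))" unfolding Y_def by (rule SS_mono[OF SS_restr[OF y]]) auto
 have Y': "Y' : fr (SS n (%q p k. \<not> (p = P & k = K) & k <= K & (k = K --> p <= P)))"
 unfolding Y'_def by (rule SS_mono[OF SS_restr[OF y]]) auto
 have "restr (%x. (%q p k. p = P) (len x) (pl x) (kl x)) (restr (%x. kl x = K) (D y)) : N (LA B) n"
 by (rule restr_SN[OF c])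
 then have "restr (%x. ?Q (len x) (pl x) (kl x)) (D y) : N (LA B) n" by (simp add: restr_restr)
 moreover have "restr (%x. ?Q (len x) (pl x) (kl x)) (D Y') = 0"
 by (rule SS_restr_0[OF D_SS[OF Y']]) auto
 moreover have "restr (%x. ?Q (len x) (pl x) (kl x)) (bd Y) = bd Y"
 by (rule SS_restr_id[OF bd_SS[OF Y]]) auto
 moreover have "restr (%x. ?Q (len x) (pl x) (kl x)) (dl (sgn Y)) = 0"
 by (rule SS_restr_0[OF dl_SS[OF sgn_fr[OF Y]]]) auto
 moreover have "D y = bd Y + dl (sgn Y) + D Y'" by (simp add: y' D_def[of Y])
 ultimately have "bd Y : N (LA B) n" by (simp add: addv_add[OF addv_restr])
 then show ?thesis by (simp add: Y_def)
qed

lemma D_single: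
 assumes "Z : fr (SS n (%q p k. q = Suc r & P p k))"
 shows "D Z = bd Z + frag_cmul ((-1) ^ r) (dl Z)"
 by (rule D_hom) (rule fr_mono[OF assms], auto simp: SS_def)

text \<open>The components with label degree \<open>K\<close> are removed one resolution degree at a time, from the top.\<close>

lemma prune_step:
 assumes y: "y : fr (SS n (%q p k. q + p = Suc m & k <= K & k <= p & (k = K --> p <= P)))"
 and c: "restr (%x. kl x = K) (D y) : N (LA B) n" and K: "K <= n"
 and h: "P <= m ==> Hz (n - K) (m - P)"
 shows "\<exists>Z y1 y2. Z : fr (SS n (%q p k. q + p = Suc (Suc m) & k <= K)) &
 y1 : fr (SS n (%q p k. q + p = Suc m & k <= K & k <= p & (k = K --> p < P))) &
 y2 : fr (SS n (%q p k. q + p = Suc m & k <= K & Suc p = P)) & y - D Z - (y1 + y2) : N (LA B) n"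
proof -
 define Y where "Y = restr (%x. (%q p k. p = P & k = K) (len x) (pl x) (kl x)) y"
 define y1 where "y1 = restr (%x. (%q p k. \<not> (p = P & k = K)) (len x) (pl x) (kl x)) y"
 have yY: "y = Y + y1" unfolding Y_def y1_def using restr_split[of "%x. pl x = P & kl x = K" y] by simp
 have y1: "y1 : fr (SS n (%q p k. q + p = Suc m & k <= K & k <= p & (k = K --> p < P)))"
 unfolding y1_def by (rule SS_mono[OF SS_restr[OF y]]) auto
 show ?thesis
 proof (cases "P <= m")
 \<comment> \<open>A generator with p = P > m would have no vertices.\<close>
 case False
 have "Y : fr (SS n (%_ _ _. False))" unfolding Y_def by (rule SS_mono[OF SS_restr[OF y]]) (use False in auto)
 then have "Y = 0" by (rule SS_empty)
 then show ?thesis using y1 yY by (intro exI[of _ 0] exI[of _ y1]) auto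
 next
 case True
 define r where "r = m - P"
 have Y: "Y : fr (SS n (%q p k. q = Suc r & p = P & k = K))"
 unfolding Y_def by (rule SS_mono[OF SS_restr[OF y]]) (use True in \<open>auto simp: r_def\<close>)
 have "bd Y : N (LA B) n"
 using component_cycle[OF SS_mono[OF y], of m K P] c by (simp add: Y_def)
 then obtain Z where Z: "Z : fr (SS n (%q p k. q = Suc (Suc r) & p = P & k = K))" "Y - bd Z : N (LA B) n"
 using vanish[OF Y _ K] h True by (auto simp: r_def)
 \<comment> \<open>The side effect of subtracting D Z: it lies one resolution degree lower, with
   label degrees still at most K.\<close>
 define y2 where "y2 = - frag_cmul ((-1) ^ Suc r) (dl Z)"
 have "y2 : fr (SS n (%q p k. q + p = Suc m & k <= K & Suc p = P))"
 unfolding y2_def by (intro fr_minus fr_cmul SS_mono[OF dl_SS[OF Z(1)]]) (use True in \<open>auto simp: r_def\<close>)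
 moreover have "y - D Z - (y1 + y2) : N (LA B) n"
 proof -
 have "y - D Z - (y1 + y2) = Y - bd Z" unfolding yY y2_def D_single[OF Z(1)] by simp
 then show ?thesis using Z(2) by simp
 qed
 moreover have "Z : fr (SS n (%q p k. q + p = Suc (Suc m) & k <= K))"
 by (rule SS_mono[OF Z(1)]) (use True in \<open>auto simp: r_def\<close>)
 ultimately show ?thesis using y1 by blast
 qed
qed

lemma restr_D_stable:
 assumes "y - D Z - y' : N (LA B) n" "Z : fr (gens (LA B) n)" "restr (%x. kl x = K) (D y) : N (LA B) n"
 shows "restr (%x. kl x = K) (D y') : N (LA B) n"
proof -
 have 1: "D (y - D Z - y') : N (LA B) n" by (rule D_N[OF assms(1)])
 have 2: "D (D Z) : N (LA B) n" by (rule D_D[OF assms(2)])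
 have "restr (%x. (%q p k. k = K) (len x) (pl x) (kl x)) (D (y - D Z - y') + D (D Z)) : N (LA B) n"
 by (rule restr_SN[OF N_plus[OF 1 2]])
 then have "restr (%x. kl x = K) (D y) - restr (%x. kl x = K) (D y') : N (LA B) n"
 by (simp add: addvD[OF addv_restr] addv_add[OF addv_restr])
 from N_diff[OF assms(3) this] show ?thesis by simp
qed

text \<open>The descent stops at p = K. A further step would leave terms with p = K - 1 whose label
  degree may still be K, in violation of k \<le> p.\<close>

lemma prune_above:
 assumes K: "K <= n" and h: "!!q. q + K < m ==> Hz (n - K) q"
 shows "y : fr (SS n (%q p k. q + p = Suc m & k <= K & k <= p & (k = K --> p <= K + d))) ==>
 restr (%x. kl x = K) (D y) : N (LA B) n ==>
 \<exists>Z y'. Z : fr (SS n (%q p k. q + p = Suc (Suc m) & k <= K)) &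
 y' : fr (SS n (%q p k. q + p = Suc m & k <= K & k <= p & (k = K --> p = K))) & y - D Z - y' : N (LA B) n"
proof (induction d arbitrary: y)
 case 0
 have "y : fr (SS n (%q p k. q + p = Suc m & k <= K & k <= p & (k = K --> p = K)))"
 by (rule SS_mono[OF 0(1)]) auto
 then show ?case by (intro exI[of _ 0] exI[of _ y]) auto
next
 case (Suc d)
 obtain Z y1 y2 where *: "Z : fr (SS n (%q p k. q + p = Suc (Suc m) & k <= K))"
 "y1 : fr (SS n (%q p k. q + p = Suc m & k <= K & k <= p & (k = K --> p < K + Suc d)))"
 "y2 : fr (SS n (%q p k. q + p = Suc m & k <= K & Suc p = K + Suc d))" "y - D Z - (y1 + y2) : N (LA B) n"
 using prune_step[OF Suc.prems K] h[of "m - (K + Suc d)"] by fastforce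
 have y': "y1 + y2 : fr (SS n (%q p k. q + p = Suc m & k <= K & k <= p & (k = K --> p <= K + d)))"
 by (intro fr_add SS_mono[OF *(2)] SS_mono[OF *(3)]) auto
 obtain Z' y' where **: "Z' : fr (SS n (%q p k. q + p = Suc (Suc m) & k <= K))"
 "y' : fr (SS n (%q p k. q + p = Suc m & k <= K & k <= p & (k = K --> p = K)))" "y1 + y2 - D Z' - y' : N (LA B) n"
 using Suc.IH[OF y' restr_D_stable[OF *(4) SS_gens[OF *(1)] Suc.prems(2)]] by blast
 have "y - D (Z + Z') - y' : N (LA B) n" using N_plus[OF *(4) **(3)] by (simp add: algebra_simps)
 then show ?case using fr_add[OF *(1) **(1)] **(2) by blast
qed

end

context resolution begin

text \<open>Here p = K is removed too. The side effect has p = K - 1, and iterating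
  \<open>e1\<close> pushes it to k \<le> p < K, so label degree K is gone altogether.\<close>

lemma EE_prune:
 assumes M: "n <= M" and K: "K <= n" and h: "!!q. q + K <= m ==> Hz (n - K) q"
 and y: "y : fr (SS n (%q p k. q + p = Suc m & k <= K & k <= p))"
 and c: "restr (%x. kl x = K) (D y) : N (LA B) n"
 shows "\<exists>Z y'. Z : fr (SS n (%q p k. q + p = Suc (Suc m) & k <= K)) &
 y' : fr (SS n (%q p k. q + p = Suc m & k < K & k <= p)) & EE (Suc M) y - D Z - y' : N (LA B) n"
proof -
 have h': "Hz (n - K) q" if "q + K < m" for q using h that by simp
 have yy: "y : fr (SS n (%q p k. q + p = Suc m & k <= K & k <= p & (k = K --> p <= K + Suc m)))"
 by (rule SS_mono[OF y]) auto
 obtain Z0 y0 where 0: "Z0 : fr (SS n (%q p k. q + p = Suc (Suc m) & k <= K))"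
 "y0 : fr (SS n (%q p k. q + p = Suc m & k <= K & k <= p & (k = K --> p = K)))" "y - D Z0 - y0 : N (LA B) n"
 using prune_above[OF K h' yy c] by blast
 have hh: "Hz (n - K) (m - K)" if "K <= m" using h[of "m - K"] that by simp
 have yy0: "y0 : fr (SS n (%q p k. q + p = Suc m & k <= K & k <= p & (k = K --> p <= K)))"
 by (rule SS_mono[OF 0(2)]) auto
 obtain Z1 y1 y2 where 1: "Z1 : fr (SS n (%q p k. q + p = Suc (Suc m) & k <= K))"
 "y1 : fr (SS n (%q p k. q + p = Suc m & k <= K & k <= p & (k = K --> p < K)))"
 "y2 : fr (SS n (%q p k. q + p = Suc m & k <= K & Suc p = K))" "y0 - D Z1 - (y1 + y2) : N (LA B) n"
 using prune_step[OF yy0 restr_D_stable[OF 0(3) SS_gens[OF 0(1)] c] K hh] by blast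
 let ?Z = "Z0 + Z1" let ?y = "y1 + y2"
 have Z: "?Z : fr (SS n (%q p k. q + p = Suc (Suc m) & k <= K))" by (rule fr_add[OF 0(1) 1(1)])
 have "y - D ?Z - ?y : N (LA B) n" using N_plus[OF 0(3) 1(4)] by (simp add: algebra_simps)
 then have "EE (Suc M) (y - D ?Z - ?y) : N (LA B) n" by (rule EE_N)
 from N_plus[OF this D_EE[OF SS_gens[OF Z], of "Suc M"]]
 have "EE (Suc M) y - D (EE (Suc M) ?Z) - EE (Suc M) ?y : N (LA B) n" by (simp add: algebra_simps)
 moreover have "EE (Suc M) ?Z : fr (SS n (%q p k. q + p = Suc (Suc m) & k <= K))"
 by (rule SS_mono[OF EE_SS[OF Z]]) auto
 moreover have "EE (Suc M) ?y : fr (SS n (%q p k. q + p = Suc m & k < K & k <= p))"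
 proof -
 have y1: "y1 : fr (SS n (%q p k. q + p = Suc m & k < K & k <= p))" by (rule SS_mono[OF 1(2)]) auto
 have "EE (Suc M) y1 : fr (SS n (%q p k. q + p = Suc m & k < K & k <= p))"
 by (rule SS_mono[OF EE_diag[OF M y1]]) auto
 moreover have "EE (Suc M) y2 : fr (SS n (%q p k. q + p = Suc m & k < K & k <= p))"
 by (rule SS_mono[OF EE_diag[OF M 1(3)]]) auto
 ultimately show ?thesis by (simp add: fr_add)
 qed
 ultimately show ?thesis by blast
qed

text \<open>The equation D y = w survives every round, because \<open>w\<close> is fixed by
  \<open>e1\<close> and has no component of positive label degree.\<close>

lemma EE_prune_to:
 assumes M: "n <= M" and K0: "K0 >= 1" and h: "!!q K. K0 < K ==> K <= n ==> q + K <= m ==> Hz (n - K) q"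
 and w: "w : fr (SS n (%q p k. p = 0 & k = 0))"
 shows "K0 + d <= n ==> y : fr (SS n (%q p k. q + p = Suc m & k <= K0 + d & k <= p)) ==> D y - w : N (LA B) n
 ==> \<exists>y'. y' : fr (SS n (%q p k. q + p = Suc m & k <= K0 & k <= p)) & D y' - w : N (LA B) n"
proof (induction d arbitrary: y)
 case 0 then show ?case by auto
next
 case (Suc d)
 let ?K = "K0 + Suc d"
 have w0: "restr (%x. (%q p k. k = ?K) (len x) (pl x) (kl x)) w = 0" by (rule SS_restr_0[OF w]) (use K0 in auto)
 have "restr (%x. (%q p k. k = ?K) (len x) (pl x) (kl x)) (D y - w) : N (LA B) n" by (rule restr_SN[OF Suc.prems(3)])
 then have c: "restr (%x. kl x = ?K) (D y) : N (LA B) n" using w0 by (simp add: addvD[OF addv_restr])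
 obtain Z y' where *: "Z : fr (SS n (%q p k. q + p = Suc (Suc m) & k <= ?K))"
 "y' : fr (SS n (%q p k. q + p = Suc m & k < ?K & k <= p))" "EE (Suc M) y - D Z - y' : N (LA B) n"
 using EE_prune[OF M Suc.prems(1) h Suc.prems(2) c] Suc.prems(1) by auto
 have y': "y' : fr (SS n (%q p k. q + p = Suc m & k <= K0 + d & k <= p))" by (rule SS_mono[OF *(2)]) auto
 have 1: "D (EE (Suc M) y - D Z - y') : N (LA B) n" by (rule D_N[OF *(3)])
 have 2: "D (D Z) : N (LA B) n" by (rule D_D[OF SS_gens[OF *(1)]])
 have 3: "EE (Suc M) (D y) - D (EE (Suc M) y) : N (LA B) n" by (rule D_EE[OF SS_gens[OF Suc.prems(2)]])
 have 4: "EE (Suc M) (D y - w) : N (LA B) n" by (rule EE_N[OF Suc.prems(3)])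
 have "EE (Suc M) w = w" by (rule EE_fix[OF w])
 then have "D y' - w : N (LA B) n"
 using N_diff[OF N_diff[OF 4 3] N_plus[OF 1 2]] by (simp add: algebra_simps)
 then show ?case using Suc.IH[OF _ y'] Suc.prems(1) by auto
qed

subsection \<open>The augmentation\<close>

lemma aug_of: "aug \<eta> (fo (gs, i, a, p, k, b)) = (if p = 0 & k = 0 then frag_cmul (\<eta> b) (fo (gs, i, a, ())) else 0)"
 by (simp add: aug_def)

lemmas aug_simps [simp] = addvD[OF addv_aug] addv_add[OF addv_aug] addv_zero[OF addv_aug] addv_minus[OF addv_aug] addv_cmul[OF addv_aug]

lemma aug_restr: "aug \<eta> c = aug \<eta> (restr (%x. pl x = 0 & kl x = 0) c)"
proof (rule addv_eq[of "aug \<eta>"])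
 fix s :: "'v list \<times> nat \<times> 'd \<times> 'b lbl"
 obtain gs i a p k b where "s = (gs, i, a, p, k, b)" by (cases s)
 then show "aug \<eta> (fo s) = aug \<eta> (restr (%x. pl x = 0 & kl x = 0) (fo s))" by (simp add: aug_of)
qed (auto simp: addv_def addvD[OF addv_restr])

lemma aug_0: "c : fr (SS n (%q p k. \<not> (p = 0 & k = 0))) ==> aug \<eta> c = 0"
 using aug_restr[of c] SS_restr_0[of c n "%q p k. \<not> (p = 0 & k = 0)" "%q p k. p = 0 & k = 0"] by simp

lemma aug_fr:
 assumes "c : fr (SS n (%q p k. q = Suc q0))" shows "aug \<eta> c : chn n q0"
 unfolding chn_def
proof (rule addv_fr[OF addv_aug assms])
 fix s assume s: "s : SS n (%q p k. q = Suc q0)"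
 obtain gs i a p k b where "s = (gs, i, a, p, k, b)" by (cases s)
 then show "aug \<eta> (fo s) : fr {x : gens LC n. len x = Suc q0}"
 using s by (auto simp: aug_of SS_def intro!: fr_cmul)
qed

lemma aug_fr1: "c : fr (gens1 (LA B) n) ==> aug \<eta> c : fr (gens1 LC n)"
proof (erule addv_fr[OF addv_aug])
 fix s assume s: "s : gens1 (LA B) n"
 obtain gs i a p k b where "s = (gs, i, a, p, k, b)" by (cases s)
 then show "aug \<eta> (fo s) : fr (gens1 LC n)"
 using s by (auto simp: aug_of gens1_def intro!: fr_cmul)
qed

lemma aug_N: "c : N (LA B) n ==> aug \<eta> c : N LC n"
proof -
 assume c: "c : N (LA B) n"
 let ?L = "%k. if k = 0 then LT B 0 0 else {}"
 have "restr (%x. pl x = 0 & kl x = 0) c : N ?L n"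
 by (rule restr_N'[OF c, where Q = "%_ i l. fst l = 0 & fst (snd l) = 0"]) (auto simp: LA_def pl_def kl_def)
 then have "aug \<eta> (restr (%x. pl x = 0 & kl x = 0) c) : N LC n"
 unfolding aug_def
 by (rule op_N[where \<theta> = "%i h. h"]) (auto split: if_splits intro!: fr_cmul)
 then show ?thesis using aug_restr[of c] by simp
qed

lemma aug_bd: "aug \<eta> (bd c) = bd (aug \<eta> c)"
proof (rule addv_eq[of "%c. aug \<eta> (bd c)"])
 fix s :: "'v list \<times> nat \<times> 'd \<times> 'b lbl"
 obtain gs i a p k b where s: "s = (gs, i, a, p, k, b)" by (cases s)
 have "aug \<eta> (tens c (i, a, p, k, b)) = (if p = 0 & k = 0 then frag_cmul (\<eta> b) (tens c (i, a, ())) else 0)" for c :: "'v list \<Rightarrow>\<^sub>0 int"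
 by (rule addv_eq[of "%c. aug \<eta> (tens c (i, a, p, k, b))"]) (auto simp: addv_def aug_of addvD[OF addv_frag_cmul[OF addv_id]])
 then show "aug \<eta> (bd (fo s)) = bd (aug \<eta> (fo s))" by (simp add: s aug_of)
qed (auto simp: addv_def)

lemma aug_xp: "aug \<eta> (xp c t) = xp c (aug \<eta> t)"
proof (rule addv_eq[of "%c. aug \<eta> (xp c t)"])
 fix x :: "('r, 'a, 'u) gen"
 obtain \<zeta> m e u where x: "x = (\<zeta>, m, e, u)" by (cases x)
 show "aug \<eta> (xp (fo x) t) = xp (fo x) (aug \<eta> t)"
 proof (rule addv_eq[of "%t. aug \<eta> (xp (fo x) t)"])
 fix y :: "('r, 'a, 'b lbl) gen"
 obtain gs i a p k b where y: "y = (gs, i, a, p, k, b)" by (cases y)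
 have "aug \<eta> (tens c (i, a, p, k, b)) = (if p = 0 & k = 0 then frag_cmul (\<eta> b) (tens c (i, a, ())) else 0)" for c :: "'r mat list \<Rightarrow>\<^sub>0 int" and i and a :: 'a
 by (rule addv_eq[of "%c. aug \<eta> (tens c (i, a, p, k, b))"]) (auto simp: addv_def aug_of addvD[OF addv_frag_cmul[OF addv_id]])
 then show "aug \<eta> (xp (fo x) (fo y)) = xp (fo x) (aug \<eta> (fo y))" by (simp add: x y aug_of)
 qed (auto simp: addv_def)
qed (auto simp: addv_def)

lemma aug_bil: "aug \<eta> (bil gs i a t) = bil gs i a (aug \<eta> t)"
proof (rule addv_eq[of "%t. aug \<eta> (bil gs i a t)"])
 fix y :: "('r, 'a, 'b lbl) gen"
 obtain \<delta>' j b p k b' where y: "y = (\<delta>', j, b, p, k, b')" by (cases y)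
 show "aug \<eta> (bil gs i a (fo y)) = bil gs i a (aug \<eta> (fo y))"
 by (simp add: y aug_of addv_cmul[OF addv_bil])
qed (auto simp: addv_def addvD[OF addv_bil])

text \<open>In label degree 0 the augmentation kills differentials of F_1 by
  \<open>aug_\<delta>\<close>; the general case follows by A-linearity.\<close>

lemma aug_dl_N:
 assumes "c : fr (SS n (%q p k. p = 1 & k = 0))" shows "aug \<eta> (dl c) : N LC n"
proof (rule addv_fr_N[of "%c. aug \<eta> (dl c)", OF _ assms])
 fix s assume s: "s : SS n (%q p k. p = 1 & k = 0)"
 obtain gs i a p k b where "s = (gs, i, a, p, k, b)" by (cases s)
 with s have s: "s = (gs, n, a, Suc 0, 0, b)" "gs : smp n" "a : Ag n" "b : B (Suc 0) 0"
 by (auto simp: SS_def)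
 show "aug \<eta> (dl (fo s)) : N LC n"
 using bil_N[OF s(2) le_refl s(3), of "aug \<eta> (\<delta> (Suc 0, 0, b))" LC] aug_\<delta>[OF s(4)] by (simp add: s(1) aug_bil)
qed (auto simp: addv_def)

lemma f0_SS: "f0 : fr (SS 0 (%q p k. q = Suc 0 & p = 0 & k = 0))"
 by (rule fr_mono[OF f0(1)]) (auto simp: SS_def gens1_iff gens_LT)

lemma f0_gens1: "f0 : fr (gens1 (LA B) 0)" by (rule gens1_LT_LA[OF f0(1)])

lemma D_f0: "D f0 = 0"
proof -
 have "dl f0 = 0" by (rule dl_LT0[OF gens1_gens[OF f0(1)]])
 moreover have "bd f0 = 0" by (rule bd_gens1[OF f0(1)])
 ultimately show ?thesis using D_single[of f0 0 0 "%p k. p = 0 & k = 0"] f0_SS by simp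
qed

lemma D_xp_chn:
 assumes "c : chn m p" "t : fr (gens (LA B) n)"
 shows "D (xp c t) = xp (bd c) t + frag_cmul ((-1) ^ p) (xp c (D t))"
 using D_xp[of c m p t n] assms by (simp add: chn_def)

lemma D_gens1: "t : fr (gens1 (LA B) n) ==> D t = dl t"
proof -
 assume t: "t : fr (gens1 (LA B) n)"
 have "D t = bd t + frag_cmul ((-1) ^ 0) (dl t)" by (rule D_hom) (rule fr_mono[OF t], auto simp: gens1_iff)
 then show ?thesis using bd_gens1[OF t] by simp
qed

lemma xp_f0_SS: "x : chn n i ==> xp x f0 : fr (SS n (%q p k. q = Suc i & p = 0 & k = 0))"
 using xp_SS[OF _ f0_SS, of x n i] by (auto elim: SS_mono)

lemma D_xp_f0: "x : chn n i ==> D (xp x f0) = xp (bd x) f0"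
 using D_xp_chn[of x n i f0 0] gens1_gens[OF f0_gens1] D_f0 by simp

lemma aug_xp_f0: "x : chn n i ==> aug \<eta> (xp x f0) - x : N LC n"
proof -
 assume x: "x : chn n i"
 have "xp x (aug \<eta> f0 - inc 0 ()) : N LC (n + 0)" by (rule xp_N2[OF chn_gens[OF x] f0(2)])
 moreover have "xp x (inc 0 ()) = x"
 proof (rule addv_eq_on[OF addv_xp1 addv_id chn_gens[OF x]])
 fix s assume "s : gens LC n"
 then obtain gs a where s: "s = (gs, n, a, ())" "gs : smp n" "a : Ag n" by (cases s) auto
 then have "gs ~= []" by (simp add: smp_def)
 then show "xp (fo s) (inc 0 ()) = fo s"
 using s by (simp add: inc_def sh_single_right)
 qed
 ultimately show ?thesis by (simp add: aug_xp)
qed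

text \<open>Multiplication with \<open>f0\<close> places \<open>x\<close> into resolution degree 0
  of the total complex, which is acyclic in positive rank. Iterating \<open>e1\<close> on the
  bounding chain does not change its boundary modulo relations.\<close>

lemma lift_cycle:
 assumes n: "n >= 1" and x: "x : cyc n i" and M: "n <= M"
 shows "\<exists>y. y : fr (SS n (%q p k. q + p = Suc (Suc i) & k <= n & k <= p)) & D y - xp x f0 : N (LA B) n"
proof -
 have xf: "xp x f0 : fr (SS n (%q p k. q = Suc i & p = 0 & k = 0))" using xp_f0_SS x cyc_chn by blast
 have "xp (bd x) f0 : N (LA B) (n + 0)" by (rule xp_N1) (use x gens1_gens[OF f0_gens1] in \<open>auto simp: cyc_def\<close>)
 then have "D (xp x f0) : N (LA B) n" using D_xp_f0[OF cyc_chn[OF x]] by simp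
 moreover have "xp x f0 : fr (SS n (%q p k. q + p = Suc i & 0 <= p))" by (rule SS_mono[OF xf]) auto
 ultimately obtain y where y: "y : fr (SS n (%q p k. q + p = Suc (Suc i)))" "xp x f0 - D y : N (LA B) n"
 using total_exact[OF n] by blast
 have 1: "EE (Suc M) (D y) - D (EE (Suc M) y) : N (LA B) n" by (rule D_EE[OF SS_gens[OF y(1)]])
 have 2: "EE (Suc M) (xp x f0 - D y) : N (LA B) n" by (rule EE_N[OF y(2)])
 have "EE (Suc M) (xp x f0) = xp x f0" by (rule EE_fix[OF SS_mono[OF xf]]) auto
 then have "xp x f0 - D (EE (Suc M) y) : N (LA B) n" using N_plus[OF 2 1] by simp
 then have "D (EE (Suc M) y) - xp x f0 : N (LA B) n" using N_commute by blast
 moreover have "EE (Suc M) y : fr (SS n (%q p k. q + p = Suc (Suc i) & k <= n & k <= p))"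
 by (rule SS_mono[OF EE_diag[OF M y(1)]]) auto
 ultimately show ?thesis by blast
qed

text \<open>Applied to D y = xp x f0, the augmentation returns x on the right. On the left,
  resolution degree 0 gives a boundary, label degree 0 in resolution degree 1 gives a relation, and
  the component p = k = 1 gives cycles over GL_{n-1} times elements of A_1.\<close>

lemma finish:
 assumes n: "n >= 1" and x: "x : cyc n i" and h: "!!q. q < i ==> Hz (n - 1) q"
 and y: "y : fr (SS n (%q p k. q + p = Suc (Suc i) & k <= 1 & k <= p))" "D y - xp x f0 : N (LA B) n"
 shows "\<exists>s\<in>PR (n - 1) i. x - s : BD n i"
proof -
 have xf: "xp x f0 : fr (SS n (%q p k. q = Suc i & p = 0 & k = 0))" using xp_f0_SS x cyc_chn by blast
 have w0: "restr (%x. (%q p k. k = Suc 0) (len x) (pl x) (kl x)) (xp x f0) = 0" by (rule SS_restr_0[OF xf]) auto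
 have "restr (%x. (%q p k. k = Suc 0) (len x) (pl x) (kl x)) (D y - xp x f0) : N (LA B) n" by (rule restr_SN[OF y(2)])
 then have c: "restr (%x. kl x = 1) (D y) : N (LA B) n" using w0 by (simp add: addvD[OF addv_restr])
 have h': "Hz (n - 1) q" if "q + 1 < Suc i" for q using h that by simp
 have yy: "y : fr (SS n (%q p k. q + p = Suc (Suc i) & k <= 1 & k <= p & (k = 1 --> p <= 1 + Suc (Suc i))))"
 by (rule SS_mono[OF y(1)]) auto
 obtain Z0 y0 where 0: "Z0 : fr (SS n (%q p k. q + p = Suc (Suc (Suc i)) & k <= 1))"
 "y0 : fr (SS n (%q p k. q + p = Suc (Suc i) & k <= 1 & k <= p & (k = 1 --> p = 1)))" "y - D Z0 - y0 : N (LA B) n"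
 using prune_above[OF n h' yy c] by blast
 have 1: "D (y - D Z0 - y0) : N (LA B) n" by (rule D_N[OF 0(3)])
 have 2: "D (D Z0) : N (LA B) n" by (rule D_D[OF SS_gens[OF 0(1)]])
 have Dy0: "D y0 - xp x f0 : N (LA B) n" using N_diff[OF y(2) N_plus[OF 1 2]] by (simp add: algebra_simps)
 have c0: "restr (%x. kl x = 1) (D y0) : N (LA B) n" by (rule restr_D_stable[OF 0(3) SS_gens[OF 0(1)] c])
 define Y where "Y = restr (%x. (%q p k. p = 1 & k = 1) (len x) (pl x) (kl x)) y0"
 define U where "U = restr (%x. (%q p k. p = 1 & k = 0) (len x) (pl x) (kl x)) y0"
 \<comment> \<open>The differential of these components has no part in resolution degree 0, the only
   place the augmentation sees.\<close>
 define V where "V = restr (%x. (%q p k. p ~= 1) (len x) (pl x) (kl x)) y0"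
 have yUV: "y0 = Y + U + V"
 proof -
 have "y0 = restr (%x. pl x = 1) y0 + V" using restr_split[of "%x. pl x = 1" y0] by (simp add: V_def)
 moreover have "restr (%x. pl x = 1) y0 = Y + restr (%x. \<not> kl x = 1 & pl x = 1) y0"
 using restr_split[of "%x. kl x = 1" "restr (%x. pl x = 1) y0"] by (simp add: Y_def restr_restr conj_commute)
 moreover have "restr (%x. \<not> kl x = 1 & pl x = 1) y0 = U"
 unfolding U_def by (rule restr_cong[OF 0(2)]) (auto simp: SS_def)
 ultimately show ?thesis by simp
 qed
 have Y: "Y : fr (SS n (%q p k. q = Suc i & p = 1 & k = 1))"
 unfolding Y_def by (rule SS_mono[OF SS_restr[OF 0(2)]]) auto
 have U: "U : fr (SS n (%q p k. q = Suc i & p = 1 & k = 0))"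
 unfolding U_def by (rule SS_mono[OF SS_restr[OF 0(2)]]) auto
 have V: "V : fr (SS n (%q p k. q + p = Suc (Suc i) & p ~= 1))"
 unfolding V_def by (rule SS_mono[OF SS_restr[OF 0(2)]]) auto
 have "y0 : fr (SS n (%q p k. q + p = Suc (Suc i) & k <= 1 & (k = 1 --> p <= 1)))"
 by (rule SS_mono[OF 0(2)]) auto
 from component_cycle[OF this c0] have "bd Y : N (LA B) n" by (simp add: Y_def)
 then obtain Z cc Bs where dec: "Z : fr (SS n (%q' p' k'. q' = Suc (Suc i) & p' = 1 & k' = 1))" "finite Bs" "Bs <= B 1 1"
 "!!b. cc b : cyc (n - 1) i" "Y - bd Z - (\<Sum>b\<in>Bs. xp (cc b) (inc 1 (1, 1, b))) : N (LA B) n"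
 using decomp[OF Y _ n] by blast
 have augD: "aug \<eta> (D y0) = bd (aug \<eta> y0) + frag_cmul ((-1) ^ i) (aug \<eta> (dl Y)) + frag_cmul ((-1) ^ i) (aug \<eta> (dl U))"
 proof -
 have "aug \<eta> (dl (sgn V)) = 0"
 by (rule aug_0[OF SS_mono[OF dl_SS[OF sgn_fr[OF V]]]]) auto
 moreover have "sgn Y = frag_cmul ((-1) ^ i) Y" by (rule sgn_hom) (rule fr_mono[OF Y], auto simp: SS_def)
 moreover have "sgn U = frag_cmul ((-1) ^ i) U" by (rule sgn_hom) (rule fr_mono[OF U], auto simp: SS_def)
 moreover have "D y0 = bd y0 + dl (sgn Y) + dl (sgn U) + dl (sgn V)" by (simp add: D_def yUV)
 ultimately show ?thesis by (simp add: aug_bd)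
 qed
 have aU: "aug \<eta> (dl U) : BD n i" by (rule BD_N[OF aug_dl_N[OF SS_mono[OF U]]]) auto
 have augy0: "bd (aug \<eta> y0) : BD n i"
 proof -
 have "aug \<eta> y0 = aug \<eta> (restr (%x. (%q p k. p = 0) (len x) (pl x) (kl x)) y0)"
 using aug_restr[of y0] aug_restr[of "restr (%x. pl x = 0) y0"] by (simp add: restr_restr conj_commute conj_left_commute)
 moreover have "aug \<eta> (restr (%x. (%q p k. p = 0) (len x) (pl x) (kl x)) y0) : chn n (Suc i)"
 by (rule aug_fr[OF SS_mono[OF SS_restr[OF 0(2)]]]) auto
 ultimately show ?thesis using BD_bd by metis
 qed
 have aZ: "aug \<eta> (dl (bd Z)) : BD n i"
 proof -
 have "aug \<eta> (dl (bd Z)) = bd (aug \<eta> (dl Z))" by (simp add: aug_bd flip: bd_xt)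
 moreover have "aug \<eta> (dl Z) : chn n (Suc i)" by (rule aug_fr[OF SS_mono[OF dl_SS[OF dec(1)]]]) auto
 ultimately show ?thesis using BD_bd by metis
 qed
 have "\<exists>s\<in>PR (n - 1) i. aug \<eta> (dl (xp (cc b) (inc 1 (1, 1, b)))) - s : N LC n" if "b : Bs" for b
 proof -
 have b: "b : B (Suc 0) (Suc 0)" using that dec(3) by auto
 have i1: "inc 1 (1, 1, b) : fr (gens (LA B) 1)" by (rule gens1_gens[OF inc_fr]) (use b in simp)
 have "dl (xp (cc b) (inc 1 (1, 1, b))) = xp (cc b) (\<delta> (Suc 0, Suc 0, b))"
 using xt_xp[OF map_\<delta>A chn_gens[OF cyc_chn[OF dec(4)]] i1] xt_inc[OF \<delta>[OF b], of \<delta> "(Suc 0, Suc 0, b)"] by simp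
 moreover have "aug \<eta> (\<delta> (Suc 0, Suc 0, b)) : fr (gens1 LC (Suc 0))" by (rule aug_fr1[OF gens1_LT_LA[OF \<delta>[OF b]]])
 ultimately show ?thesis using single_vt[OF _ dec(4)] n by (simp add: aug_xp)
 qed
 then obtain s where s: "!!b. b : Bs ==> s b : PR (n - 1) i & aug \<eta> (dl (xp (cc b) (inc 1 (1, 1, b)))) - s b : N LC n" by metis
 define S where "S = sum s Bs"
 have S: "S : PR (n - 1) i" unfolding S_def PR_def by (rule gsp_sum) (use s in \<open>simp add: PR_def\<close>)
 have "(\<Sum>b\<in>Bs. aug \<eta> (dl (xp (cc b) (inc 1 (1, 1, b)))) - s b) : N LC n" by (rule N_sum) (use s in auto)
 then have aS: "aug \<eta> (dl (\<Sum>b\<in>Bs. xp (cc b) (inc 1 (1, 1, b)))) - S : N LC n"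
 by (simp add: S_def sum_subtractf addv_sum[OF addv_xt] addv_sum[OF addv_aug])
 have "aug \<eta> (dl (Y - bd Z - (\<Sum>b\<in>Bs. xp (cc b) (inc 1 (1, 1, b))))) : N LC n"
 by (rule aug_N[OF xt_N[OF map_\<delta>A dec(5)]])
 from BD_N[OF N_plus[OF this aS]] have "aug \<eta> (dl Y) - aug \<eta> (dl (bd Z)) - S : BD n i" by simp
 from BD_add[OF this aZ] have aY: "aug \<eta> (dl Y) - S : BD n i" by simp
 have "aug \<eta> (D y0 - xp x f0) : N LC n" by (rule aug_N[OF Dy0])
 from BD_N[OF N_plus[OF this aug_xp_f0[OF cyc_chn[OF x]]]] have "aug \<eta> (D y0) - x : BD n i" by simp
 from BD_minus[OF BD_diff[OF this BD_add[OF augy0 BD_add[OF BD_cmul[OF aY, of "(-1) ^ i"] BD_cmul[OF aU, of "(-1) ^ i"]]]]]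
 have "x - frag_cmul ((-1) ^ i) S : BD n i"
 by (simp add: augD addvD[OF addv_frag_cmul[OF addv_id]] algebra_simps)
 moreover have "frag_cmul ((-1) ^ i) S : PR (n - 1) i" using S unfolding PR_def by (rule gsp_cmul)
 ultimately show ?thesis by blast
qed

text \<open>The first hypothesis removes the label degrees K \<ge> 2 from the bounding chain, the
  second removes label degree 1 in resolution degrees above 1.\<close>

lemma RG_I:
 assumes h: "!!q K. 2 <= K ==> K <= Suc n ==> q + K <= Suc i ==> Hz (Suc n - K) q" "!!q. q < i ==> Hz n q"
 shows "RG n i"
 unfolding RG_def
proof
 fix x assume x: "x : cyc (Suc n) i"
 have xf: "xp x f0 : fr (SS (Suc n) (%q p k. p = 0 & k = 0))" using SS_mono[OF xp_f0_SS[OF cyc_chn[OF x]]] by auto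
 obtain y where y: "y : fr (SS (Suc n) (%q p k. q + p = Suc (Suc i) & k <= Suc n & k <= p))" "D y - xp x f0 : N (LA B) (Suc n)"
 using lift_cycle[OF _ x le_refl] by auto
 have y1: "y : fr (SS (Suc n) (%q p k. q + p = Suc (Suc i) & k <= 1 + n & k <= p))" by (rule SS_mono[OF y(1)]) auto
 have h': "Hz (Suc n - K) q" if "1 < K" "K <= Suc n" "q + K <= Suc i" for q K using h(1) that by simp
 obtain y' where y': "y' : fr (SS (Suc n) (%q p k. q + p = Suc (Suc i) & k <= 1 & k <= p))" "D y' - xp x f0 : N (LA B) (Suc n)"
 using EE_prune_to[OF le_refl le_refl h' xf _ y1 y(2)] by auto
 show "\<exists>s\<in>PR n i. x - s : BD (Suc n) i" using finish[OF _ x _ y'] h(2) by simp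
qed

end

section \<open>The critical component of label degree 2\<close>

context resolution begin

text \<open>Boundaries of chains with label degrees at most K. Keeping track of the bound ensures
  that the correction terms of \<open>tau\<close> stay in label degree at most 1.\<close>

definition BT :: "nat => nat => nat => ('r, 'a, 'b lbl) chain set" where
 "BT n m K = gsp (rels (LA B) n \<union> D ` fr (SS n (%q p k. q + p = Suc (Suc m) & k <= K)))"

lemma BT_iff: "x : BT n m K \<longleftrightarrow> (\<exists>w\<in>fr (SS n (%q p k. q + p = Suc (Suc m) & k <= K)). x - D w : N (LA B) n)"
 unfolding BT_def N_def by (rule gsp_image_iff) (auto intro: fr_diff)

lemma BT_D: "w : fr (SS n (%q p k. q + p = Suc (Suc m) & k <= K)) ==> D w : BT n m K"
 unfolding BT_def by (auto intro: gsp_base)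
lemma BT_N: "x : N (LA B) n ==> x : BT n m K"
 unfolding BT_def N_def using gsp_mono[OF Un_upper1] by blast
lemma BT_diff: "x : BT n m K ==> y : BT n m K ==> x - y : BT n m K" unfolding BT_def by (rule gsp_diff)
lemma BT_add: "x : BT n m K ==> y : BT n m K ==> x + y : BT n m K" unfolding BT_def by (rule gsp_add)
lemma BT_cmul: "x : BT n m K ==> frag_cmul k x : BT n m K" unfolding BT_def by (rule gsp_cmul)
lemma BT_sum: "(!!i. i : I ==> f i : BT n m K) ==> sum f I : BT n m K" unfolding BT_def by (rule gsp_sum)

lemma dl_SS0: "c : fr (SS n P) ==> (!!q p k. P q p k ==> p = 0) ==> dl c = 0"
proof -
 assume c: "c : fr (SS n P)" and P: "!!q p k. P q p k ==> p = 0"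
 have "dl c : fr (SS n (%_ _ _. False))" by (rule SS_mono[OF dl_SS[OF c]]) (use P in blast)
 then show ?thesis by (rule SS_empty)
qed

text \<open>The Leibniz rule shows that \<open>xp c W\<close> is a filling up to sign, and it has
  the labels of \<open>W\<close>, of degree at most k.\<close>

lemma BT_xp_dl:
 assumes c: "c : cyc m q" and W: "W : fr (gens1 (LT B (Suc p)) k)" and k: "k <= K"
 shows "xp c (dl W) : BT (m + k) (q + p) K"
proof -
 have W': "W : fr (gens1 (LA B) k)" by (rule gens1_LT_LA[OF W])
 have "W : fr (SS k (%q' p' k'. q' = Suc 0 & p' = Suc p))"
 by (rule fr_mono[OF W]) (auto simp: SS_def gens1_LT gens1_iff)
 then have WS: "W : fr (SS k (%q' p' k'. q' = Suc 0 & p' = Suc p & k' <= K))"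
 by (rule SS_mono) (use k in auto)
 have "D (xp c W) = xp (bd c) W + frag_cmul ((-1) ^ q) (xp c (dl W))"
 using D_xp_chn[OF cyc_chn[OF c] gens1_gens[OF W']] D_gens1[OF W'] by simp
 moreover have "D (xp c W) : BT (m + k) (q + p) K"
 by (rule BT_D[OF SS_mono[OF xp_SS[OF cyc_chn[OF c] WS]]]) auto
 moreover have "xp (bd c) W : BT (m + k) (q + p) K"
 by (rule BT_N[OF xp_N1]) (use c gens1_gens[OF W'] in \<open>auto simp: cyc_def\<close>)
 ultimately have "frag_cmul ((-1) ^ q) (xp c (dl W)) : BT (m + k) (q + p) K"
 using BT_diff by (metis add_diff_cancel_left')
 from BT_cmul[OF this, of "(-1) ^ q"] show ?thesis by (simp flip: power_mult_distrib)
qed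

lemma EE_add: "EE (m + n) c = EE m (EE n c)" by (simp add: EE_def funpow_add)

text \<open>By \<open>rg\<close>, a class over GL_3 is a sum of products c' a with a in A_1. The
  element a f0 of F_0 has degree 1, where the resolution is exact, hence is the differential of some
  w with labels of degree at most 1; c' w then fills the class.\<close>

lemma filtration_zero_cycle:
 assumes rg: "RG (Suc (Suc 0)) 1" and \<zeta>: "\<zeta> : fr (SS 3 (%q p k. q = 2 & p = 0 & k = 0))" and c: "bd \<zeta> : N (LA B) 3"
 shows "\<zeta> : BT 3 1 1"
proof -
 have "\<zeta> : fr (SS 3 (%q p k. q = Suc 1 & p = 0 & k = 0))" by (rule SS_mono[OF \<zeta>]) auto
 then obtain Z cc Bs where dec: "Z : fr (SS 3 (%q' p' k'. q' = Suc (Suc 1) & p' = 0 & k' = 0))" "finite Bs" "Bs <= B 0 0"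
 "!!b. cc b : cyc 3 1" "\<zeta> - bd Z - (\<Sum>b\<in>Bs. xp (cc b) (inc 0 (0, 0, b))) : N (LA B) 3"
 using decomp[OF _ c, of 1 0 0] by auto
 have bdZ: "bd Z : BT 3 1 1"
 proof -
 have "dl Z = 0" by (rule dl_SS0[OF dec(1)]) simp
 then have "D Z = bd Z" using D_single[OF dec(1)] by simp
 moreover have "D Z : BT 3 1 1" by (rule BT_D[OF SS_mono[OF dec(1)]]) auto
 ultimately show ?thesis by simp
 qed
 have xpf: "xp c f0 : BT 3 1 1" if c: "c : cyc 3 1" for c
 proof -
 obtain s where s: "s : PR (Suc (Suc 0)) 1" "c - s : BD 3 1"
 using rg c unfolding RG_def by (auto simp: numeral_3_eq_3)
 obtain u where u: "u : chn 3 (Suc 1)" "c - s - bd u : N LC 3" using s(2) BD_iff by blast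
 have 1: "xp (c - s - bd u) f0 : BT 3 1 1"
 using BT_N[OF xp_N1[OF u(2) gens1_gens[OF f0_gens1]]] by simp
 have 2: "xp (bd u) f0 : BT 3 1 1"
 using BT_D[OF SS_mono[OF xp_f0_SS[OF u(1)]], of "1" 1] D_xp_f0[OF u(1)] by simp
 have 3: "xp s f0 : BT 3 1 1"
 using s(1) unfolding PR_def
 proof (induction rule: gsp.induct)
 case (gsp_base r)
 then obtain c' a where r: "r = xp c' (vt a)" "c' : cyc (Suc (Suc 0)) 1" "a : Ag (Suc 0)" by blast
 have e: "xp r f0 = xp c' (xp (vt a) f0)"
 using xp_vt_assoc[OF chn_gens[OF cyc_chn[OF r(2)]] r(3) f0_gens1] r(1) by simp
 have va: "xp (vt a) f0 : fr (SS (Suc 0) (%q p k. q = Suc 0 & p = 0 & k = 0))"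
 using xp_f0_SS[OF vt_chn[OF r(3)]] .
 then have "xp (vt a) f0 : fr (gens1 (LT B 0) (Suc 0))"
 by (rule fr_mono) (auto simp: SS_def gens1_LT gens1_iff)
 then obtain w where w: "w : fr (gens1 (LT B (Suc 0)) (Suc 0))" "xp (vt a) f0 - dl w : N (LT B 0) (Suc 0)"
 using exact_0[of "Suc 0"] by auto
 have "xp c' (xp (vt a) f0 - dl w) : BT 3 1 1"
 using BT_N[OF xp_N2[OF chn_gens[OF cyc_chn[OF r(2)]] N_LT_LA[OF w(2)]]] by (simp add: numeral_3_eq_3)
 moreover have "xp c' (dl w) : BT 3 1 1"
 using BT_xp_dl[OF r(2) w(1), of 1] by (simp add: numeral_3_eq_3)
 ultimately show ?case using BT_add e by fastforce
 qed (auto simp: BT_diff BT_N)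
 have "xp c f0 = xp (c - s - bd u) f0 + (xp (bd u) f0 + xp s f0)" by simp
 then show ?thesis using BT_add[OF 1 BT_add[OF 2 3]] by simp
 qed
 have "xp (cc b) (inc 0 (0, 0, b)) : BT 3 1 1" if "b : Bs" for b
 proof -
 have b: "b : B 0 0" using that dec(3) by auto
 \<comment> \<open>A basis element of degree 0 is \<open>\<eta> b\<close> times \<open>f0\<close> up
   to an element killed by the augmentation, that is, up to a differential.\<close>
 let ?g = "inc 0 (0, 0, b) - frag_cmul (\<eta> b) f0"
 have g: "?g : fr (gens1 (LT B 0) 0)" using b f0(1) by (intro fr_diff fr_cmul inc_fr) auto
 have "aug \<eta> ?g = - frag_cmul (\<eta> b) (aug \<eta> f0 - inc 0 ())"
 by (simp add: aug_of inc_def addvD[OF addv_frag_cmul[OF addv_id]])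
 then have "aug \<eta> ?g : N LC 0" using N_cmul[OF f0(2), of "\<eta> b"] by (simp del: minus_frag_cmul aug_simps)
 then obtain w where w: "w : fr (gens1 (LT B (Suc 0)) 0)" "?g - dl w : N (LT B 0) 0"
 using aug_exact[OF g] by blast
 have 1: "xp (cc b) (?g - dl w) : BT 3 1 1"
 using BT_N[OF xp_N2[OF chn_gens[OF cyc_chn[OF dec(4)]] N_LT_LA[OF w(2)]]] by simp
 have 2: "xp (cc b) (dl w) : BT 3 1 1" using BT_xp_dl[OF dec(4) w(1), of 1] by simp
 have "xp (cc b) (inc 0 (0, 0, b)) = xp (cc b) (?g - dl w) + (xp (cc b) (dl w) + frag_cmul (\<eta> b) (xp (cc b) f0))" by simp
 then show ?thesis using BT_add[OF 1 BT_add[OF 2 BT_cmul[OF xpf[OF dec(4)[of b]], of "\<eta> b"]]] by simp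
 qed
 then have "(\<Sum>b\<in>Bs. xp (cc b) (inc 0 (0, 0, b))) : BT 3 1 1" by (rule BT_sum)
 from BT_add[OF BT_add[OF BT_N[OF dec(5)] this] bdZ] show ?thesis by simp
qed

text \<open>The cycle by which multiples of a cycle cancel the second filtration step.\<close>

lemma tau:
 assumes h2: "Hz 2 0" and h3: "Hz 3 0" and rg: "RG (Suc (Suc 0)) 1" and a: "a : Ag (Suc 0)" and b: "b : B 2 2" and M: "3 <= M"
 shows "\<exists>\<theta>\<in>fr (SS 3 (%q p k. q + p = Suc 2 & k <= 1)). D (EE (Suc M + Suc M) (xp (vt a) (inc 2 (2, 2, b))) + \<theta>) : N (LA B) 3"
proof -
 let ?u = "xp (vt a) (inc 2 ((2, 2, b) :: 'b lbl))"
 have u: "?u : fr (SS 3 (%q p k. q = Suc 0 & p = 2 & k = 2))"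
 using SS_mono[OF xp_SS[OF vt_chn[OF a] inc_SS[OF b]], of "%q p k. q = Suc 0 & p = 2 & k = 2"] by (simp add: numeral_3_eq_3)
 have Du: "D ?u : fr (SS 3 (%q p k. q + p = Suc 1 & q = Suc 0 & k <= 2))"
 proof -
 have "bd ?u = 0" by (rule bd_len1) (rule fr_mono[OF u], auto simp: SS_def)
 then have "D ?u = dl ?u" using D_single[of ?u 3 0 "%p k. p = 2 & k = 2"] u by simp
 then show ?thesis using dl_SS[OF u] by (auto elim!: SS_mono)
 qed
 \<comment> \<open>The chain \<open>D ?u\<close> lives in resolution degree 1, so after this
   iteration its label degrees are at most 1.\<close>
 define w0 where "w0 = EE (Suc M) (D ?u)"
 have w0: "w0 : fr (SS 3 (%q p k. q + p = Suc 1 & k <= 1 & k <= p))"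
 unfolding w0_def by (rule SS_mono[OF EE_diag[OF M Du]]) auto
 have Dw0: "D w0 : N (LA B) 3"
 proof -
 have 1: "EE (Suc M) (D (D ?u)) : N (LA B) 3" by (rule EE_N[OF D_D[OF SS_gens[OF u]]])
 have 2: "EE (Suc M) (D (D ?u)) - D w0 : N (LA B) 3" unfolding w0_def by (rule D_EE[OF SS_gens[OF Du]])
 show ?thesis using N_diff[OF 1 2] by simp
 qed
 have restrN: "restr (%x. kl x = K) c : N (LA B) 3" if "c : N (LA B) 3" for c K
 using restr_SN[OF that, of "%q p k. k = K"] .
 \<comment> \<open>Over GL_3 the part of label degree 1 carries H_0(GL_2; A_2); the part of label
   degree 0 treated afterwards carries H_0(GL_3; A_3). Both vanish.\<close>
 have h2': "Hz (3 - 1) q" if "q + 1 <= 1" for q using h2 that by simp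
 obtain Z1 \<zeta> where 1: "Z1 : fr (SS 3 (%q p k. q + p = Suc (Suc 1) & k <= 1))"
 "\<zeta> : fr (SS 3 (%q p k. q + p = Suc 1 & k < 1 & k <= p))" "EE (Suc M) w0 - D Z1 - \<zeta> : N (LA B) 3"
 using EE_prune[OF M _ h2' w0 restrN[OF Dw0]] by auto
 have DZ: "D (D Z) : N (LA B) 3" if "Z : fr (SS 3 P)" for Z P by (rule D_D[OF SS_gens[OF that]])
 have D\<zeta>: "D \<zeta> : N (LA B) 3"
 proof -
 have a1: "D (EE (Suc M) w0 - D Z1 - \<zeta>) : N (LA B) 3" by (rule D_N[OF 1(3)])
 have a2: "EE (Suc M) (D w0) - D (EE (Suc M) w0) : N (LA B) 3" by (rule D_EE[OF SS_gens[OF w0]])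
 have "EE (Suc M) (D w0) : N (LA B) 3" by (rule EE_N[OF Dw0])
 from N_diff[OF N_diff[OF this a2] N_plus[OF a1 DZ[OF 1(1)]]] show ?thesis by simp
 qed
 have "\<zeta> : fr (SS 3 (%q p k. q + p = Suc 1 & k <= 0 & k <= p & (k = 0 --> p <= 0 + 2)))" by (rule SS_mono[OF 1(2)]) auto
 moreover have h3': "Hz (3 - 0) q" if "q + 0 < 1" for q using h3 that by simp
 ultimately obtain Z2 \<zeta>' where 2: "Z2 : fr (SS 3 (%q p k. q + p = Suc (Suc 1) & k <= 0))"
 "\<zeta>' : fr (SS 3 (%q p k. q + p = Suc 1 & k <= 0 & k <= p & (k = 0 --> p = 0)))" "\<zeta> - D Z2 - \<zeta>' : N (LA B) 3"
 using prune_above[OF _ h3' _ restrN[OF D\<zeta>]] by blast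
 have \<zeta>': "\<zeta>' : fr (SS 3 (%q p k. q = 2 & p = 0 & k = 0))" by (rule SS_mono[OF 2(2)]) auto
 have "bd \<zeta>' : N (LA B) 3"
 proof -
 have "D (\<zeta> - D Z2 - \<zeta>') : N (LA B) 3" by (rule D_N[OF 2(3)])
 from N_diff[OF D\<zeta> N_plus[OF this DZ[OF 2(1)]]] have "D \<zeta>' : N (LA B) 3" by simp
 moreover have "dl \<zeta>' = 0" by (rule dl_SS0[OF \<zeta>']) simp
 then have "D \<zeta>' = bd \<zeta>'" using D_single[of \<zeta>' 3 1 "%p k. p = 0 & k = 0"] \<zeta>' by (simp add: numeral_2_eq_2)
 ultimately show ?thesis by simp
 qed
 \<comment> \<open>What is left has p = k = 0 and simplicial degree 1: classes of H_1(GL_3; A_3), to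
   which the surjectivity \<open>rg\<close> applies.\<close>
 from filtration_zero_cycle[OF rg \<zeta>' this] have z: "\<zeta>' : BT 3 1 1" .
 have z1: "D Z1 : BT 3 1 1" by (rule BT_D[OF 1(1)])
 have z2: "D Z2 : BT 3 1 1" by (rule BT_D[OF SS_mono[OF 2(1)]]) auto
 have "EE (Suc M) w0 - D Z1 - \<zeta> + (\<zeta> - D Z2 - \<zeta>') + (D Z1 + (D Z2 + \<zeta>')) : BT 3 1 1"
 using BT_add[OF BT_add[OF BT_N[OF 1(3)] BT_N[OF 2(3)]] BT_add[OF z1 BT_add[OF z2 z]]] .
 then have "EE (Suc M) w0 : BT 3 1 1" by simp
 then obtain \<theta> where \<theta>: "\<theta> : fr (SS 3 (%q p k. q + p = Suc (Suc 1) & k <= 1))" "EE (Suc M) w0 - D \<theta> : N (LA B) 3"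
 using BT_iff by blast
 have "EE (Suc M + Suc M) (D ?u) - D (EE (Suc M + Suc M) ?u) : N (LA B) 3" by (rule D_EE[OF SS_gens[OF u]])
 then have "EE (Suc M) w0 - D (EE (Suc M + Suc M) ?u) : N (LA B) 3" unfolding w0_def EE_add .
 from N_diff[OF \<theta>(2) this] have "D (EE (Suc M + Suc M) ?u + - \<theta>) : N (LA B) 3" by simp
 moreover have "- \<theta> : fr (SS 3 (%q p k. q + p = Suc 2 & k <= 1))" by (rule fr_minus[OF SS_mono[OF \<theta>(1)]]) auto
 ultimately show ?thesis by blast
qed

text \<open>In a product c a the left factor is a cycle, so multiplying the cycle of
  \<open>tau\<close> for a by c from the left gives a cycle again.\<close>

lemma tau_PR:
 assumes h: "Hz 2 0" "Hz 3 0" "RG (Suc (Suc 0)) 1" and b: "b : B 2 2" and M: "3 <= M" and s: "s : PR h j"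
 shows "\<exists>\<theta>\<in>fr (SS (h + 3) (%q p k. q + p = Suc (Suc (Suc j)) & k <= 1)).
 D (EE (Suc M + Suc M) (xp s (inc 2 (2, 2, b))) + \<theta>) : N (LA B) (h + 3)"
 using s unfolding PR_def
proof (induction rule: gsp.induct)
 case gsp_zero then show ?case by (auto intro!: bexI[of _ 0])
next
 case (gsp_base r)
 then obtain c a where r: "r = xp c (vt a)" "c : cyc h j" "a : Ag (Suc 0)" by blast
 obtain \<theta> where \<theta>: "\<theta> : fr (SS 3 (%q p k. q + p = Suc 2 & k <= 1))"
 "D (EE (Suc M + Suc M) (xp (vt a) (inc 2 (2, 2, b))) + \<theta>) : N (LA B) 3"
 using tau[OF h r(3) b M] by blast
 let ?u = "xp (vt a) (inc 2 ((2, 2, b) :: 'b lbl))"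
 have i: "inc 2 (2, 2, b) : fr (gens1 (LA B) 2)" using b by (intro inc_fr) simp
 have c: "c : fr (gens LC h)" "c : chn h j" using chn_gens cyc_chn r(2) by blast+
 have u: "?u : fr (gens (LA B) 3)"
 using xp_fr[OF chn_gens[OF vt_chn[OF r(3)]] gens1_gens[OF i]] by (simp add: numeral_3_eq_3)
 have e: "EE (Suc M + Suc M) (xp r (inc 2 (2, 2, b))) = xp c (EE (Suc M + Suc M) ?u)"
 using xp_vt_assoc[OF c(1) r(3) i] EE_xp[OF c(1) u] r(1) by metis
 have t: "EE (Suc M + Suc M) ?u + \<theta> : fr (gens (LA B) 3)" by (intro fr_add EE_fr u SS_gens[OF \<theta>(1)])
 have "D (xp c (EE (Suc M + Suc M) ?u + \<theta>)) = xp (bd c) (EE (Suc M + Suc M) ?u + \<theta>) + frag_cmul ((-1) ^ j) (xp c (D (EE (Suc M + Suc M) ?u + \<theta>)))"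
 by (rule D_xp_chn[OF c(2) t])
 moreover have "xp (bd c) (EE (Suc M + Suc M) ?u + \<theta>) : N (LA B) (h + 3)"
 by (rule xp_N1[OF _ t]) (use r(2) in \<open>simp add: cyc_def\<close>)
 moreover have "xp c (D (EE (Suc M + Suc M) ?u + \<theta>)) : N (LA B) (h + 3)" by (rule xp_N2[OF c(1) \<theta>(2)])
 ultimately have "D (xp c (EE (Suc M + Suc M) ?u + \<theta>)) : N (LA B) (h + 3)" by (metis N_plus N_cmul)
 then have "D (EE (Suc M + Suc M) (xp r (inc 2 (2, 2, b))) + xp c \<theta>) : N (LA B) (h + 3)"
 using e by simp
 moreover have "xp c \<theta> : fr (SS (h + 3) (%q p k. q + p = Suc (Suc (Suc j)) & k <= 1))"
 by (rule SS_mono[OF xp_SS[OF c(2) \<theta>(1)]]) auto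
 ultimately show ?case by blast
next
 case (gsp_diff x y)
 then obtain \<theta> \<theta>' where "\<theta> : fr (SS (h + 3) (%q p k. q + p = Suc (Suc (Suc j)) & k <= 1))"
 "D (EE (Suc M + Suc M) (xp x (inc 2 (2, 2, b))) + \<theta>) : N (LA B) (h + 3)"
 "\<theta>' : fr (SS (h + 3) (%q p k. q + p = Suc (Suc (Suc j)) & k <= 1))"
 "D (EE (Suc M + Suc M) (xp y (inc 2 (2, 2, b))) + \<theta>') : N (LA B) (h + 3)" by blast
 then show ?case using N_diff by (intro bexI[of _ "\<theta> - \<theta>'"]) (auto simp: algebra_simps intro: fr_diff)
qed

text \<open>The coefficients at p = k = 2 are cycles over GL_{h+1} that need not bound. By
  \<open>rg\<close> they are sums of products from GL_h up to boundaries, and then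
  \<open>tau_PR\<close> supplies a cycle with the same part in label degree 2, which is
  subtracted.\<close>

lemma second_step:
 assumes h: "Hz 2 0" "Hz 3 0" "RG (Suc (Suc 0)) 1" and rg: "RG h j" and hz: "!!q. q < j ==> Hz (Suc h) q"
 and M: "h + 3 <= M" and w: "w : fr (SS (h + 3) (%q p k. p = 0 & k = 0))"
 and y: "y : fr (SS (h + 3) (%q p k. q + p = Suc (Suc (Suc j)) & k <= 2 & k <= p))" "D y - w : N (LA B) (h + 3)"
 shows "\<exists>y'. y' : fr (SS (h + 3) (%q p k. q + p = Suc (Suc (Suc j)) & k <= 1 & k <= p)) & D y' - w : N (LA B) (h + 3)"
proof -
 \<comment> \<open>The iterate matches the one in \<open>tau\<close>, where two rounds of length M +
   1 are used.\<close>
 let ?n = "h + 3" let ?E = "EE (Suc M + Suc M)"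
 have w0: "restr (%x. (%q p k. k = 2) (len x) (pl x) (kl x)) w = 0" by (rule SS_restr_0[OF w]) auto
 have "restr (%x. (%q p k. k = 2) (len x) (pl x) (kl x)) (D y - w) : N (LA B) ?n" by (rule restr_SN[OF y(2)])
 then have c: "restr (%x. kl x = 2) (D y) : N (LA B) ?n" using w0 by (simp add: addvD[OF addv_restr])
 have n2: "?n - 2 = Suc h" by simp
 have h': "Hz (?n - 2) q" if "q + 2 < Suc (Suc j)" for q using hz that n2 by simp
 have yy: "y : fr (SS ?n (%q p k. q + p = Suc (Suc (Suc j)) & k <= 2 & k <= p & (k = 2 --> p <= 2 + Suc j)))"
 by (rule SS_mono[OF y(1)]) auto
 obtain Z0 y0 where 0: "Z0 : fr (SS ?n (%q p k. q + p = Suc (Suc (Suc (Suc j))) & k <= 2))"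
 "y0 : fr (SS ?n (%q p k. q + p = Suc (Suc (Suc j)) & k <= 2 & k <= p & (k = 2 --> p = 2)))" "y - D Z0 - y0 : N (LA B) ?n"
 using prune_above[OF _ h' yy c] by auto
 have 1: "D (y - D Z0 - y0) : N (LA B) ?n" by (rule D_N[OF 0(3)])
 have 2: "D (D Z0) : N (LA B) ?n" by (rule D_D[OF SS_gens[OF 0(1)]])
 have Dy0: "D y0 - w : N (LA B) ?n" using N_diff[OF y(2) N_plus[OF 1 2]] by (simp add: algebra_simps)
 have c0: "restr (%x. kl x = 2) (D y0) : N (LA B) ?n" by (rule restr_D_stable[OF 0(3) SS_gens[OF 0(1)] c])
 define Y where "Y = restr (%x. (%q p k. p = 2 & k = 2) (len x) (pl x) (kl x)) y0"
 define y1 where "y1 = restr (%x. (%q p k. \<not> (p = 2 & k = 2)) (len x) (pl x) (kl x)) y0"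
 have yY: "y0 = Y + y1" unfolding Y_def y1_def using restr_split[of "%x. pl x = 2 & kl x = 2" y0] by simp
 have y1: "y1 : fr (SS ?n (%q p k. q + p = Suc (Suc (Suc j)) & k <= 1))"
 unfolding y1_def by (rule SS_mono[OF SS_restr[OF 0(2)]]) auto
 have Y: "Y : fr (SS ?n (%q p k. q = Suc j & p = 2 & k = 2))"
 unfolding Y_def by (rule SS_mono[OF SS_restr[OF 0(2)]]) auto
 have "y0 : fr (SS ?n (%q p k. q + p = Suc (Suc (Suc j)) & k <= 2 & (k = 2 --> p <= 2)))"
 by (rule SS_mono[OF 0(2)]) auto
 from component_cycle[OF this c0] have bY: "bd Y : N (LA B) ?n" by (simp add: Y_def)
 have le: "2 <= ?n" by simp
 obtain Z cc Bs where dec: "Z : fr (SS ?n (%q' p' k'. q' = Suc (Suc j) & p' = 2 & k' = 2))" "finite Bs" "Bs <= B 2 2"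
 "!!b. cc b : cyc (Suc h) j" "Y - bd Z - (\<Sum>b\<in>Bs. xp (cc b) (inc 2 (2, 2, b))) : N (LA B) ?n"
 using decomp[OF Y bY le] unfolding n2 by blast
 have "\<forall>b. \<exists>s u. s : PR h j & u : chn (Suc h) (Suc j) & cc b - s - bd u : N LC (Suc h)"
 using rg dec(4) unfolding RG_def BD_iff by blast
 then obtain s u where su: "!!b. s b : PR h j" "!!b. u b : chn (Suc h) (Suc j)" "!!b. cc b - s b - bd (u b) : N LC (Suc h)"
 by metis
 have "\<forall>b. \<exists>\<theta>. b : B 2 2 --> \<theta> : fr (SS ?n (%q p k. q + p = Suc (Suc (Suc j)) & k <= 1)) &
 D (?E (xp (s b) (inc 2 (2, 2, b))) + \<theta>) : N (LA B) ?n"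
 using tau_PR[OF h _ _ su(1)] M by (meson le_add2 le_trans)
 then obtain \<theta>b where \<theta>b: "!!b. b : B 2 2 ==> \<theta>b b : fr (SS ?n (%q p k. q + p = Suc (Suc (Suc j)) & k <= 1)) &
 D (?E (xp (s b) (inc 2 (2, 2, b))) + \<theta>b b) : N (LA B) ?n" by metis
 define S where "S = (\<Sum>b\<in>Bs. xp (s b) (inc 2 ((2, 2, b) :: 'b lbl)))"
 define W where "W = Z + (\<Sum>b\<in>Bs. xp (u b) (inc 2 (2, 2, b)))"
 define \<theta> where "\<theta> = sum \<theta>b Bs"
 have Bs: "b : B 2 2" if "b : Bs" for b using that dec(3) by auto
 have \<theta>: "\<theta> : fr (SS ?n (%q p k. q + p = Suc (Suc (Suc j)) & k <= 1))"
 unfolding \<theta>_def by (rule fr_sum) (use \<theta>b Bs in blast)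
 have ES: "D (?E S + \<theta>) : N (LA B) ?n"
 proof -
 have "(\<Sum>b\<in>Bs. D (?E (xp (s b) (inc 2 (2, 2, b))) + \<theta>b b)) : N (LA B) ?n" by (rule N_sum) (use \<theta>b Bs in blast)
 then show ?thesis by (simp add: S_def \<theta>_def sum.distrib addv_sum[OF addv_EE] addv_sum[OF addv_D])
 qed
 have W: "W : fr (SS ?n (%q p k. q = Suc (Suc j) & p = 2 & k = 2))"
 unfolding W_def
 proof (intro fr_add dec(1) fr_sum)
 fix b assume "b : Bs"
 have "xp (u b) (inc 2 (2, 2, b)) : fr (SS (Suc h + 2) (%q p k. q = Suc (Suc j) & p = 2 & k = 2))"
 by (rule SS_mono[OF xp_SS[OF su(2) inc_SS[OF Bs[OF \<open>b : Bs\<close>]]]]) auto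
 then show "xp (u b) (inc 2 (2, 2, b)) : fr (SS ?n (%q p k. q = Suc (Suc j) & p = 2 & k = 2))"
 by (simp add: numeral_3_eq_3)
 qed
 have YW: "Y - bd W - S : N (LA B) ?n"
 proof -
 have "(\<Sum>b\<in>Bs. xp (cc b - s b - bd (u b)) (inc 2 (2, 2, b))) : N (LA B) ?n"
 proof (rule N_sum)
 fix b assume "b : Bs"
 have "xp (cc b - s b - bd (u b)) (inc 2 (2, 2, b)) : N (LA B) (Suc h + 2)"
 by (rule xp_N1[OF su(3)]) (use Bs[OF \<open>b : Bs\<close>] in \<open>simp add: gens1_gens inc_fr\<close>)
 then show "xp (cc b - s b - bd (u b)) (inc 2 (2, 2, b)) : N (LA B) ?n" by (simp add: numeral_3_eq_3)
 qed
 moreover have "(\<Sum>b\<in>Bs. xp (bd (u b)) (inc 2 ((2, 2, b) :: 'b lbl))) = bd (\<Sum>b\<in>Bs. xp (u b) (inc 2 (2, 2, b)))"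
 unfolding addv_sum[OF addv_bd] by (rule sum.cong) (use xp_inc_bd[OF su(2) Bs] in auto)
 ultimately have "(\<Sum>b\<in>Bs. xp (cc b) (inc 2 (2, 2, b))) - S - bd (\<Sum>b\<in>Bs. xp (u b) (inc 2 (2, 2, b))) : N (LA B) ?n"
 by (simp add: S_def sum_subtractf)
 from N_plus[OF dec(5) this] show ?thesis by (simp add: W_def algebra_simps)
 qed
 define y2 where "y2 = - frag_cmul ((-1) ^ Suc j) (dl W)"
 have y2: "y2 : fr (SS ?n (%q p k. q + p = Suc (Suc (Suc j)) & p = 1))"
 unfolding y2_def by (intro fr_minus fr_cmul SS_mono[OF dl_SS[OF W]]) auto
 have R: "y0 - D W - (y1 + y2) - S : N (LA B) ?n"
 proof -
 have "y0 - D W - (y1 + y2) - S = Y - bd W - S" unfolding yY y2_def D_single[OF W] by simp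
 then show ?thesis using YW by simp
 qed
 \<comment> \<open>Since \<open>?E S + \<theta>\<close> is a cycle, the critical part
   \<open>?E S\<close> may be replaced by \<open>- \<theta>\<close>, which has label degrees at most
   1.\<close>
 define y3 where "y3 = ?E (y1 + y2) - \<theta>"
 have E1: "EE (Suc M) y2 : fr (SS ?n (%q p k. q + p = Suc (Suc (Suc j)) & k <= 1))"
 by (rule SS_mono[OF EE_diag[OF M y2]]) auto
 have E2: "EE (Suc M) y1 : fr (SS ?n (%q p k. q + p = Suc (Suc (Suc j)) & k <= 1))"
 by (rule SS_mono[OF EE_diag[OF M y1]]) auto
 have E3: "EE (Suc M) (y1 + y2) : fr (SS ?n (%q p k. q + p = Suc (Suc (Suc j)) & k <= 1))"
 using fr_add[OF E2 E1] by simp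
 have "?E (y1 + y2) : fr (SS ?n (%q p k. q + p = Suc (Suc (Suc j)) & k <= 1))"
 unfolding EE_add by (rule SS_mono[OF EE_diag[OF M E3]]) auto
 then have y3: "y3 : fr (SS ?n (%q p k. q + p = Suc (Suc (Suc j)) & k <= 1))"
 unfolding y3_def by (intro fr_diff \<theta>)
 have gens: "y0 : fr (gens (LA B) ?n)" "y1 + y2 : fr (gens (LA B) ?n)" "D W : fr (gens (LA B) ?n)"
 using SS_gens[OF 0(2)] SS_gens[OF y1] SS_gens[OF y2] D_fr[OF SS_gens[OF W]] fr_add by blast+
 have Dy3: "D y3 - w : N (LA B) ?n"
 proof -
 have a1: "D (?E (y0 - D W - (y1 + y2) - S)) : N (LA B) ?n" by (rule D_N[OF EE_N[OF R]])
 have a2: "?E (D y0) - D (?E y0) : N (LA B) ?n" by (rule D_EE[OF gens(1)])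
 have a3: "?E (D (D W)) - D (?E (D W)) : N (LA B) ?n" by (rule D_EE[OF gens(3)])
 have a4: "?E (D (D W)) : N (LA B) ?n" by (rule EE_N[OF D_D[OF SS_gens[OF W]]])
 have a5: "?E (D y0 - w) : N (LA B) ?n" by (rule EE_N[OF Dy0])
 have "?E w = w" by (rule EE_fix[OF w])
 then have "D y3 - w = (?E (D y0 - w) - (?E (D y0) - D (?E y0))) - (D (?E (y0 - D W - (y1 + y2) - S)) + (?E (D (D W)) - (?E (D (D W)) - D (?E (D W))))) - D (?E S + \<theta>)"
 unfolding y3_def by (simp add: algebra_simps)
 then show ?thesis
 using N_diff[OF N_diff[OF N_diff[OF a5 a2] N_plus[OF a1 N_diff[OF a4 a3]]] ES] by simp
 qed
 \<comment> \<open>Subtracting \<open>\<theta>\<close> may have destroyed k \<le> p; one more round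
   restores it.\<close>
 have b1: "EE (Suc M) (D y3) - D (EE (Suc M) y3) : N (LA B) ?n" by (rule D_EE[OF SS_gens[OF y3]])
 have b2: "EE (Suc M) (D y3 - w) : N (LA B) ?n" by (rule EE_N[OF Dy3])
 have "EE (Suc M) w = w" by (rule EE_fix[OF w])
 then have "D (EE (Suc M) y3) - w : N (LA B) ?n" using N_diff[OF b2 b1] by (simp add: algebra_simps)
 moreover have "EE (Suc M) y3 : fr (SS ?n (%q p k. q + p = Suc (Suc (Suc j)) & k <= 1 & k <= p))"
 by (rule SS_mono[OF EE_diag[OF M y3]]) auto
 ultimately show ?thesis by blast
qed

text \<open>Applied with h = 2j: then h + 3 = 2(j + 1) + 1 is the first rank of the range in
  homological degree j + 1, and H_j of GL_{h+1} lies just outside the vanishing range.\<close>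

lemma RG_critical:
 assumes h: "Hz 2 0" "Hz 3 0" "RG (Suc (Suc 0)) 1" and rg: "RG h j"
 and hz: "!!q K. 2 < K ==> K <= h + 3 ==> q + K <= Suc (Suc j) ==> Hz (h + 3 - K) q"
 "!!q. q < j ==> Hz (Suc h) q" "!!q. q < Suc j ==> Hz (h + 2) q"
 shows "RG (h + 2) (Suc j)"
 unfolding RG_def
proof
 have n: "Suc (h + 2) = h + 3" by simp
 fix x assume x: "x : cyc (Suc (h + 2)) (Suc j)"
 then have x: "x : cyc (h + 3) (Suc j)" by (simp only: n)
 have xf: "xp x f0 : fr (SS (h + 3) (%q p k. p = 0 & k = 0))" using SS_mono[OF xp_f0_SS[OF cyc_chn[OF x]]] by auto
 obtain y where y: "y : fr (SS (h + 3) (%q p k. q + p = Suc (Suc (Suc j)) & k <= h + 3 & k <= p))" "D y - xp x f0 : N (LA B) (h + 3)"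
 using lift_cycle[OF _ x le_refl] by auto
 have y1: "y : fr (SS (h + 3) (%q p k. q + p = Suc (Suc (Suc j)) & k <= 2 + Suc h & k <= p))" by (rule SS_mono[OF y(1)]) auto
 obtain y' where y': "y' : fr (SS (h + 3) (%q p k. q + p = Suc (Suc (Suc j)) & k <= 2 & k <= p))" "D y' - xp x f0 : N (LA B) (h + 3)"
 using EE_prune_to[OF le_refl _ hz(1) xf _ y1 y(2)] by auto
 obtain y'' where y'': "y'' : fr (SS (h + 3) (%q p k. q + p = Suc (Suc (Suc j)) & k <= 1 & k <= p))" "D y'' - xp x f0 : N (LA B) (h + 3)"
 using second_step[OF h rg hz(2) le_refl xf y'] by blast
 have "\<exists>s\<in>PR (h + 3 - 1) (Suc j). x - s : BD (h + 3) (Suc j)" by (rule finish[OF _ x _ y'']) (use hz(3) in simp_all)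
 moreover have "h + 3 - 1 = h + 2" by simp
 ultimately show "\<exists>s\<in>PR (h + 2) (Suc j). x - s : BD (Suc (h + 2)) (Suc j)" unfolding n by metis
qed

text \<open>\<open>RG n i\<close> concerns GL_{n+1}, so n \<ge> 2i is the range n + 1 \<ge> 2i + 1.
  For n > 2i the induction hypothesis covers all removals. The case n = 2i is void of removals for i
  = 0, is the hypothesis \<open>r\<close> for i = 1, and is the critical step beyond. Vanishing then
  follows by splitting off two factors from A_1.\<close>

theorem stability:
 assumes h2: "Hz 2 0" and r: "RG (Suc (Suc 0)) 1"
 shows "(\<forall>n\<ge>2 * i. RG n i) & (\<forall>n\<ge>2 * i + 2. Hz n i)"
proof (induction i rule: less_induct)
 case (less i)
 have hz: "Hz n q" if "q < i" "n >= 2 * q + 2" for n q using less.IH that by blast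
 have big: "RG n i" if "n >= 2 * i + 1" for n
 by (rule RG_I) (use hz that in auto)
 have crit: "RG (2 * i) i"
 proof (cases "i = 0")
 case True
 then show ?thesis by (intro RG_I) auto
 next
 case False
 show ?thesis
 proof (cases "i = 1")
 case True
 then show ?thesis using r by (simp add: numeral_2_eq_2)
 next
 case i: False
 define j where "j = i - 1"
 define h where "h = 2 * j"
 have ij: "i = Suc j" using False by (simp add: j_def)
 have "RG (h + 2) (Suc j)"
 proof (rule RG_critical[OF h2 _ r])
 show "Hz 3 0" using hz[of 0 3] False by simp
 show "RG h j" using less.IH[of j] ij by (simp add: h_def)
 qed (use hz ij h_def in auto)
 then show ?thesis by (simp add: ij h_def)
 qed
 qed
 have all: "RG n i" if "n >= 2 * i" for n using big crit that by (cases "n = 2 * i") auto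
 have "Hz n i" if n: "n >= 2 * i + 2" for n
 proof -
 define n' where "n' = n - 2"
 have n': "n = Suc (Suc n')" using n by (simp add: n'_def)
 show ?thesis unfolding n' by (rule Hz_of_RG) (use h2 all n n' in \<open>auto simp: numeral_2_eq_2\<close>)
 qed
 then show ?case using all by blast
qed

end

subsection \<open>Homology of complexes of abelian groups\<close>

lemma (in comm_group) hom_finprod:
 assumes "comm_group H" "h : hom G H" "f : I \<rightarrow> carrier G"
 shows "h (finprod G f I) = finprod H (%i. h (f i)) I"
proof -
 interpret H: comm_group H by (rule assms)
 interpret h: group_hom G H h using assms(2) by (simp add: group_hom_def group_hom_axioms_def)
 show ?thesis
 using assms(3)
 proof (induction I rule: infinite_finite_induct)
 case (insert i I)
 then have "f i : carrier G" "f : I \<rightarrow> carrier G" by auto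
 moreover have "(%i. h (f i)) : I \<rightarrow> carrier H" using insert.prems by (auto intro: h.hom_closed)
 ultimately show ?case using insert by (simp add: h.hom_closed)
 qed auto
qed

lemma (in comm_group) mult_inv_cancel:
 "x : carrier G ==> y : carrier G ==> x \<otimes> y \<otimes> inv x \<otimes> inv y = \<one>"
 by (metis inv_closed m_closed m_comm r_inv inv_solve_right')

locale abelian_complex =
 fixes C :: "nat => 'c monoid" and d :: "nat => 'c => 'c"
 assumes cg: "!!p. comm_group (C p)" and dh: "!!p. d (Suc p) : hom (C (Suc p)) (C p)"
 and dd: "!!p x. x : carrier (C (Suc (Suc p))) ==> d (Suc p) (d (Suc (Suc p)) x) = \<one>\<^bsub>C p\<^esub>"
begin

lemma grp: "group (C p)" using comm_group.axioms(2)[OF cg] .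

lemma gh: "group_hom (C (Suc p)) (C p) (d (Suc p))"
 using grp dh by (simp add: group_hom_def group_hom_axioms_def)

lemma sub_cyc: "subgroup (cycles C d p) (C p)"
proof (cases p)
 case 0 then show ?thesis using group.subgroup_self[OF grp] by (simp add: cycles_def)
next
 case (Suc q) then show ?thesis using group_hom.subgroup_kernel[OF gh[of q]] by (simp add: cycles_def)
qed

lemma sub_bnd: "subgroup (boundaries C d p) (C p)"
 unfolding boundaries_def using group_hom.img_is_subgroup[OF gh] .

lemma bnd_cyc: "boundaries C d p <= cycles C d p"
proof (cases p)
 case 0 then show ?thesis using dh[of 0] by (auto simp: boundaries_def cycles_def hom_def)
next
 case (Suc q) then show ?thesis using dh[of "Suc q"] dd by (auto simp: boundaries_def cycles_def hom_def kernel_def)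
qed

lemma cyc_carrier: "z : cycles C d p ==> z : carrier (C p)"
 using subgroup.mem_carrier[OF sub_cyc] .

abbreviation "Zg p \<equiv> subgroup_generated (C p) (cycles C d p)"

lemma carrier_Zg: "carrier (Zg p) = cycles C d p"
 using subgroup.carrier_subgroup_generated_subgroup[OF sub_cyc] .

lemma cg_Zg: "comm_group (Zg p)"
 using group.abelian_subgroup_generated[OF grp cg] .

lemma sub_bnd': "subgroup (boundaries C d p) (Zg p)"
 using group.subgroup_subgroup_generated_iff[OF grp] sub_bnd bnd_cyc carrier_Zg by metis

lemma comm_group_homology: "comm_group (homology C d p)"
 unfolding homology_def using comm_group.abelian_FactGroup[OF cg_Zg sub_bnd'] .

lemma carrier_homology: "carrier (homology C d p) = homology_class C d p ` cycles C d p"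
 unfolding homology_def homology_class_def FactGroup_def RCOSETS_def by (auto simp: carrier_Zg)

lemma class_in: "z : cycles C d p ==> homology_class C d p z : carrier (homology C d p)"
 by (simp add: carrier_homology)

lemma class_mult:
 assumes "z : cycles C d p" "z' : cycles C d p"
 shows "homology_class C d p z \<otimes>\<^bsub>homology C d p\<^esub> homology_class C d p z' = homology_class C d p (z \<otimes>\<^bsub>C p\<^esub> z')"
 using normal.rcos_sum[OF comm_group.subgroup_imp_normal[OF cg_Zg sub_bnd'], of z p z'] assms
 by (simp add: homology_def homology_class_def FactGroup_def carrier_Zg)

lemma class_eq_iff:
 assumes "z : cycles C d p" "z' : cycles C d p"
 shows "homology_class C d p z = homology_class C d p z' \<longleftrightarrow> z \<otimes>\<^bsub>C p\<^esub> inv\<^bsub>C p\<^esub> z' : boundaries C d p"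
proof -
 have "inv\<^bsub>Zg p\<^esub> z' = inv\<^bsub>C p\<^esub> z'"
 using group.inv_subgroup_generated[OF grp, of z' p "cycles C d p"] assms(2) by (simp add: carrier_Zg)
 then show ?thesis
 using group.r_coset_eq_iff[OF comm_group.axioms(2)[OF cg_Zg] sub_bnd', of z p z'] assms
 by (simp add: homology_class_def carrier_Zg)
qed

lemma class_rep:
 assumes "z : cycles C d p" "z' : homology_class C d p z"
 shows "z' : cycles C d p" "homology_class C d p z' = homology_class C d p z"
proof -
 have z: "z' : boundaries C d p #>\<^bsub>Zg p\<^esub> z" using assms(2) by (simp add: homology_class_def)
 obtain b where b: "b : boundaries C d p" "z' = b \<otimes>\<^bsub>C p\<^esub> z" using z by (auto simp: r_coset_def)
 then show "z' : cycles C d p" using subgroup.m_closed[OF sub_cyc] bnd_cyc assms(1) by blast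
 show "homology_class C d p z' = homology_class C d p z"
 using group.repr_independence[OF comm_group.axioms(2)[OF cg_Zg] z _ sub_bnd'] assms(1)
 by (simp add: homology_class_def carrier_Zg)
qed

lemma class_self: "z : cycles C d p ==> z : homology_class C d p z"
 using group.rcos_self[OF comm_group.axioms(2)[OF cg_Zg] _ sub_bnd', of z p]
 by (simp add: homology_class_def carrier_Zg)

lemma trivial_iff: "trivial_group (homology C d p) \<longleftrightarrow> cycles C d p <= boundaries C d p"
proof -
 interpret H: comm_group "homology C d p" by (rule comm_group_homology)
 interpret Cp: group "C p" by (rule grp)
 have one: "\<one>\<^bsub>C p\<^esub> : cycles C d p" using subgroup.one_closed[OF sub_cyc] .
 have c1: "homology_class C d p \<one>\<^bsub>C p\<^esub> = \<one>\<^bsub>homology C d p\<^esub>"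
 using class_mult[OF one one] group.is_monoid[OF grp] class_in[OF one]
 by (metis H.l_cancel_one' monoid.l_one monoid.one_closed)
 have iff: "homology_class C d p z = \<one>\<^bsub>homology C d p\<^esub> \<longleftrightarrow> z : boundaries C d p" if "z : cycles C d p" for z
 using class_eq_iff[OF that one] c1 Cp.inv_one cyc_carrier[OF that] by (simp del: Cp.inv_one)
 show ?thesis
 proof
 assume t: "trivial_group (homology C d p)"
 show "cycles C d p <= boundaries C d p"
 proof
 fix z assume z: "z : cycles C d p"
 then have "homology_class C d p z = \<one>\<^bsub>homology C d p\<^esub>"
 using t class_in by (auto simp: trivial_group_def)
 then show "z : boundaries C d p" using iff[OF z] by simp
 qed
 next
 assume s: "cycles C d p <= boundaries C d p"
 have "carrier (homology C d p) <= {\<one>\<^bsub>homology C d p\<^esub>}"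
 unfolding carrier_homology using iff s by blast
 then show "trivial_group (homology C d p)" using H.trivial_group_subset by blast
 qed
qed

end

subsection \<open>Bar complexes\<close>

text \<open>The closed form, needed for comparison with the faces of the bar complex.\<close>

lemma bda_eq: "bda xs = (\<Sum>i<length xs. frag_cmul ((-1) ^ i) (fo (take i xs @ drop (Suc i) xs)))"
proof (induction xs)
 case (Cons x xs)
 have "bda (x # xs) = fo xs - (\<Sum>i<length xs. frag_cmul ((-1) ^ i) (fo (x # take i xs @ drop (Suc i) xs)))"
 by (simp add: Cons.IH addv_sum[OF addv_cone])
 then show ?case by (simp add: sum.lessThan_Suc_shift del: sum.lessThan_Suc flip: sum_negf)
qed simp

locale gmod =
 fixes G :: "('g, 'y) monoid_scheme" and M :: "'m monoid" and \<rho> :: "'g => 'm => 'm"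
 assumes gm: "g_module G M \<rho>"
begin

sublocale G: group G using gm by (simp add: g_module_def)
sublocale M: comm_group M using gm by (simp add: g_module_def)

lemma rho_closed [simp, intro]: "g : carrier G ==> m : carrier M ==> \<rho> g m : carrier M"
 using gm by (auto simp: g_module_def hom_def)
lemma rho_mult: "g : carrier G ==> m : carrier M ==> m' : carrier M ==> \<rho> g (m \<otimes>\<^bsub>M\<^esub> m') = \<rho> g m \<otimes>\<^bsub>M\<^esub> \<rho> g m'"
 using gm by (auto simp: g_module_def hom_def)
lemma rho_one [simp]: "m : carrier M ==> \<rho> \<one>\<^bsub>G\<^esub> m = m"
 using gm by (auto simp: g_module_def)
lemma rho_comp: "g : carrier G ==> h : carrier G ==> m : carrier M ==> \<rho> (g \<otimes>\<^bsub>G\<^esub> h) m = \<rho> g (\<rho> h m)"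
 using gm by (auto simp: g_module_def)
abbreviation "BC \<equiv> bar_chains G M"
abbreviation "Bd \<equiv> bar_diff G M \<rho>"
abbreviation "Wd \<equiv> bar_words G"

lemma carrier_BC: "carrier (BC p) = {x : \<Pi>\<^sub>E w\<in>Wd p. carrier M. finite {w : Wd p. x w ~= \<one>\<^bsub>M\<^esub>}}"
 unfolding bar_chains_def by (rule carrier_sum_group) (rule M.is_group)

lemma BC_mult: "x \<otimes>\<^bsub>BC p\<^esub> y = (\<lambda>w\<in>Wd p. x w \<otimes>\<^bsub>M\<^esub> y w)" by (simp add: bar_chains_def)
lemma BC_one: "\<one>\<^bsub>BC p\<^esub> = (\<lambda>w\<in>Wd p. \<one>\<^bsub>M\<^esub>)" by (simp add: bar_chains_def)

lemma cgBC: "comm_group (BC p)"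
proof (rule group.group_comm_groupI)
 show "group (BC p)" unfolding bar_chains_def by (rule sum_group) (rule M.is_group)
 fix x y assume "x : carrier (BC p)" "y : carrier (BC p)"
 then show "x \<otimes>\<^bsub>BC p\<^esub> y = y \<otimes>\<^bsub>BC p\<^esub> x"
 by (auto simp: carrier_BC BC_mult PiE_iff M.m_comm intro!: restrict_ext)
qed

lemma sym_closed: "w : Wd p ==> m : carrier M ==> bar_symbol G M w m : carrier (BC p)"
proof -
 assume w: "w : Wd p" and m: "m : carrier M"
 have p: "length w = p" using w by (simp add: bar_words_def)
 have "{v : Wd p. bar_symbol G M w m v ~= \<one>\<^bsub>M\<^esub>} <= {w}" by (auto simp: bar_symbol_def p)
 then show ?thesis using w m finite_subset by (auto simp: carrier_BC bar_symbol_def p)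
qed

lemma sym_mult: "w : Wd p ==> m : carrier M ==> m' : carrier M ==>
 bar_symbol G M w (m \<otimes>\<^bsub>M\<^esub> m') = bar_symbol G M w m \<otimes>\<^bsub>BC p\<^esub> bar_symbol G M w m'"
 by (auto simp: bar_symbol_def BC_mult bar_words_def intro!: restrict_ext)

lemma sym_hom: "w : Wd p ==> bar_symbol G M w : hom M (BC p)"
 by (rule homI) (auto simp: sym_closed sym_mult)

text \<open>Evaluation at a word is a homomorphism, so the equation can be checked one coordinate at
  a time.\<close>

lemma finprod_sym:
 assumes x: "x : carrier (BC p)"
 shows "x = finprod (BC p) (%w. bar_symbol G M w (x w)) {w : Wd p. x w ~= \<one>\<^bsub>M\<^esub>}" (is "x = finprod _ _ ?I")
proof -
 interpret K: comm_group "BC p" by (rule cgBC)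
 have I: "finite ?I" and xc: "x w : carrier M" if "w : Wd p" for w using x that by (auto simp: carrier_BC)
 have fI: "finite ?I" using x by (auto simp: carrier_BC)
 have s: "(%w. bar_symbol G M w (x w)) : ?I \<rightarrow> carrier (BC p)" using sym_closed xc by auto
 let ?y = "finprod (BC p) (%w. bar_symbol G M w (x w)) ?I"
 have y: "?y : carrier (BC p)" using s by (rule K.finprod_closed)
 have ev: "(%x. x v) : hom (BC p) M" if "v : Wd p" for v
 by (rule homI) (use that in \<open>auto simp: carrier_BC BC_mult\<close>)
 have "?y v = x v" if v: "v : Wd p" for v
 proof -
 have "?y v = finprod M (%w. bar_symbol G M w (x w) v) ?I"
 by (rule K.hom_finprod[OF M.comm_group_axioms ev[OF v] s])
 also have "... = finprod M (%w. if w = v then x w else \<one>\<^bsub>M\<^esub>) ?I"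
 by (rule M.finprod_cong') (use v xc in \<open>auto simp: bar_symbol_def bar_words_def\<close>)
 also have "... = x v"
 proof (cases "v : ?I")
 case True
 then show ?thesis using M.finprod_singleton_swap[OF True fI, of x] xc by auto
 next
 case False
 then have "finprod M (%w. if w = v then x w else \<one>\<^bsub>M\<^esub>) ?I = finprod M (%w. \<one>\<^bsub>M\<^esub>) ?I"
 by (intro M.finprod_cong') auto
 then show ?thesis using False v by simp
 qed
 finally show ?thesis .
 qed
 moreover have "x : (\<Pi>\<^sub>E w\<in>Wd p. carrier M)" "?y : (\<Pi>\<^sub>E w\<in>Wd p. carrier M)" using x y by (auto simp: carrier_BC)
 ultimately show ?thesis by (intro PiE_ext[of x "Wd p" "%_. carrier M" ?y]) simp_all
qed

lemma ext_hom:
 assumes K: "comm_group K" and f: "!!w. w : Wd p ==> f w : hom M K"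
 shows "bar_ext G p K f : hom (BC p) K"
proof -
 interpret K: comm_group K by (rule K)
 show ?thesis unfolding bar_ext_def bar_chains_def by (rule K.hom_group_sum[OF f M.is_group])
qed

lemma ext_sym:
 assumes K: "comm_group K" and f: "!!w. w : Wd p ==> f w : hom M K" and w: "w : Wd p" and m: "m : carrier M"
 shows "bar_ext G p K f (bar_symbol G M w m) = f w m"
proof -
 interpret K: comm_group K by (rule K)
 have p: "length w = p" using w by (simp add: bar_words_def)
 have f1: "f v \<one>\<^bsub>M\<^esub> = \<one>\<^bsub>K\<^esub>" if "v : Wd p" for v using hom_one[OF f[OF that] M.is_group K.is_group] .
 have fm: "f w m : carrier K" using f[OF w] m by (auto simp: hom_def)
 have sub: "{v : Wd p. f v (bar_symbol G M w m v) ~= \<one>\<^bsub>K\<^esub>} <= {w}" using f1 by (auto simp: bar_symbol_def p)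
 show ?thesis
 proof (cases "f w m = \<one>\<^bsub>K\<^esub>")
 case True
 then have e: "{v : Wd p. f v (bar_symbol G M w m v) ~= \<one>\<^bsub>K\<^esub>} = {}" using sub w by (auto simp: bar_symbol_def p)
 show ?thesis unfolding bar_ext_def gfinprod_def e using True by simp
 next
 case False
 then have e: "{v : Wd p. f v (bar_symbol G M w m v) ~= \<one>\<^bsub>K\<^esub>} = {w}" using sub w by (auto simp: bar_symbol_def p)
 show ?thesis unfolding bar_ext_def gfinprod_def e using fm w by (simp add: bar_symbol_def p)
 qed
qed

text \<open>\<open>\<gamma>\<close> with coefficient \<open>a\<close> corresponds to \<open>[\<gamma>\<^sub>0\<gamma>\<^sub>1\<inverse>|...|\<gamma>\<^sub>q\<^sub>-\<^sub>1\<gamma>\<^sub>q\<inverse>] \<gamma>\<^sub>q a\<close>.\<close>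

definition wrd :: "'g list => 'g list" where
 "wrd gs = map (%j. gs ! j \<otimes>\<^bsub>G\<^esub> inv\<^bsub>G\<^esub> (gs ! Suc j)) [0..<length gs - 1]"

definition bsy :: "'g list \<times> 'm => 'g list => 'm" where
 "bsy = (%(gs, a). bar_symbol G M (wrd gs) (\<rho> (last gs) a))"

definition hg :: "nat => ('g list \<times> 'm) set" where
 "hg q = {(gs, a). length gs = Suc q & set gs <= carrier G & a : carrier M}"

text \<open>From homogeneous chains to bar chains. By \<open>bt_surj\<close>,
  \<open>bt_kernel\<close> and \<open>Bd_bt\<close> it identifies the bar complex with homogeneous
  chains modulo additivity and balancing.\<close>

definition bt :: "nat => ('g list \<times> 'm \<Rightarrow>\<^sub>0 int) => 'g list => 'm" where
 "bt q = fev (BC q) bsy"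

lemma nth_carrier: "set gs <= carrier G ==> j < length gs ==> gs ! j : carrier G" by auto

lemma last_carrier: "(gs, a) : hg q ==> last gs : carrier G"
 by (cases gs rule: rev_cases) (auto simp: hg_def)

lemma wrd_Wd: "(gs, a) : hg q ==> wrd gs : Wd q"
 by (auto simp: hg_def wrd_def bar_words_def intro!: G.m_closed G.inv_closed nth_carrier)

lemma bsy_closed: "x : hg q ==> bsy x : carrier (BC q)"
 by (cases x) (auto simp: bsy_def hg_def intro!: sym_closed wrd_Wd rho_closed last_carrier)

lemma bsy_Pi: "bsy : hg q \<rightarrow> carrier (BC q)" using bsy_closed by auto

lemma bt_hom: "bt q : hom (free_Abelian_group (hg q)) (BC q)"
 unfolding bt_def using comm_group.fev_hom[OF cgBC bsy_Pi] .

lemma bt_closed: "c : fr (hg q) ==> bt q c : carrier (BC q)"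
 unfolding bt_def using comm_group.fev_closed[OF cgBC bsy_Pi] .

lemma bt_add: "c : fr (hg q) ==> c' : fr (hg q) ==> bt q (c + c') = bt q c \<otimes>\<^bsub>BC q\<^esub> bt q c'"
 unfolding bt_def using comm_group.fev_add[OF cgBC bsy_Pi] .

lemma bt_diff: "c : fr (hg q) ==> c' : fr (hg q) ==> bt q (c - c') = bt q c \<otimes>\<^bsub>BC q\<^esub> inv\<^bsub>BC q\<^esub> bt q c'"
 unfolding bt_def using comm_group.fev_diff[OF cgBC bsy_Pi] .

lemma bt_of: "x : hg q ==> bt q (fo x) = bsy x"
 unfolding bt_def by (rule comm_group.fev_of[where b = bsy and s = x, OF cgBC[of q] bsy_closed])

text \<open>The simplex with last vertex \<open>1\<close> belonging to a word.\<close>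

primrec hom_of :: "'g list => 'g list" where
 "hom_of [] = [\<one>\<^bsub>G\<^esub>]"
| "hom_of (g # w) = (g \<otimes>\<^bsub>G\<^esub> hd (hom_of w)) # hom_of w"

lemma hom_of: "set w <= carrier G ==> length (hom_of w) = Suc (length w) & set (hom_of w) <= carrier G & last (hom_of w) = \<one>\<^bsub>G\<^esub>"
proof (induction w)
 case (Cons g w)
 then have "hd (hom_of w) : carrier G" by (cases "hom_of w") auto
 then show ?case using Cons by (cases "hom_of w") auto
qed auto

lemma hom_of_hg: "w : Wd q ==> a : carrier M ==> (hom_of w, a) : hg q"
 using hom_of[of w] by (simp add: bar_words_def hg_def)

lemma wrd_Cons: "gs ~= [] ==> wrd (x # gs) = (x \<otimes>\<^bsub>G\<^esub> inv\<^bsub>G\<^esub> hd gs) # wrd gs"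
proof -
 assume "gs ~= []"
 then obtain y ys where gs: "gs = y # ys" by (cases gs) auto
 have "[0..<Suc (length ys)] = 0 # map Suc [0..<length ys]" by (simp add: upt_conv_Cons map_Suc_upt del: upt_Suc)
 then show ?thesis by (simp add: wrd_def gs comp_def del: upt_Suc)
qed

lemma wrd_single [simp]: "wrd [x] = []" by (simp add: wrd_def)

lemma wrd_hom_of: "set w <= carrier G ==> wrd (hom_of w) = w"
proof (induction w)
 case (Cons g w)
 then have w: "length (hom_of w) = Suc (length w)" "set (hom_of w) <= carrier G" using hom_of[of w] by auto
 then have "hom_of w ~= []" "hd (hom_of w) : carrier G" by (cases "hom_of w"; auto)+
 then show ?case using Cons by (simp add: wrd_Cons G.m_assoc)
qed simp

text \<open>The quotients telescope: a word remembers its simplex up to right translation, here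
  normalized to last vertex 1.\<close>

lemma hom_of_wrd: "gs ~= [] ==> set gs <= carrier G ==> hom_of (wrd gs) = map (%g. g \<otimes>\<^bsub>G\<^esub> inv\<^bsub>G\<^esub> last gs) gs"
proof (induction gs)
 case (Cons x gs)
 show ?case
 proof (cases "gs = []")
 case False
 then obtain y ys where gs: "gs = y # ys" by (cases gs) auto
 have l: "last gs : carrier G" using Cons.prems False by (metis last_in_set list.set_intros(2) subsetD)
 have "hd (hom_of (wrd gs)) = y \<otimes>\<^bsub>G\<^esub> inv\<^bsub>G\<^esub> last gs" using Cons False gs by simp
 moreover have "x \<otimes>\<^bsub>G\<^esub> inv\<^bsub>G\<^esub> y \<otimes>\<^bsub>G\<^esub> (y \<otimes>\<^bsub>G\<^esub> inv\<^bsub>G\<^esub> last gs) = x \<otimes>\<^bsub>G\<^esub> inv\<^bsub>G\<^esub> last gs"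
 proof -
 have c: "x : carrier G" "y : carrier G" using Cons.prems gs by auto
 have "inv\<^bsub>G\<^esub> y \<otimes>\<^bsub>G\<^esub> (y \<otimes>\<^bsub>G\<^esub> inv\<^bsub>G\<^esub> last gs) = inv\<^bsub>G\<^esub> last gs"
 using c l G.m_assoc[of "inv\<^bsub>G\<^esub> y" y "inv\<^bsub>G\<^esub> last gs"] by simp
 then show ?thesis using c l by (simp add: G.m_assoc)
 qed
 ultimately show ?thesis using Cons False gs by (simp add: wrd_Cons)
 qed (use Cons in simp)
qed simp

lemma bt_surj: "x : carrier (BC q) ==> \<exists>c\<in>fr (hg q). bt q c = x"
proof -
 assume x: "x : carrier (BC q)"
 let ?I = "{w : Wd q. x w ~= \<one>\<^bsub>M\<^esub>}"
 interpret K: comm_group "BC q" by (rule cgBC)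
 have fI: "finite ?I" and xc: "!!w. w : Wd q ==> x w : carrier M" using x by (auto simp: carrier_BC)
 have b: "bsy (hom_of w, x w) = bar_symbol G M w (x w)" if "w : Wd q" for w
 using that xc hom_of[of w] by (simp add: bsy_def wrd_hom_of bar_words_def)
 have "finite J ==> J <= Wd q ==> (\<Sum>w\<in>J. fo (hom_of w, x w)) : fr (hg q) &
 bt q (\<Sum>w\<in>J. fo (hom_of w, x w)) = finprod (BC q) (%w. bar_symbol G M w (x w)) J" for J
 proof (induction J rule: finite_induct)
 case empty then show ?case by (simp add: bt_def K.fev_zero)
 next
 case (insert w J)
 have "fo (hom_of w, x w) : fr (hg q)" using insert.prems hom_of_hg xc by simp
 moreover have "(%w. bar_symbol G M w (x w)) : J \<rightarrow> carrier (BC q)" "bar_symbol G M w (x w) : carrier (BC q)"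
 using insert.prems sym_closed xc by auto
 ultimately show ?case using insert by (simp add: fr_add bt_add bt_of b)
 qed
 from this[OF fI] finprod_sym[OF x] show ?thesis by auto
qed

definition hrel :: "nat => ('g list \<times> 'm \<Rightarrow>\<^sub>0 int) set" where
 "hrel q = {fo (gs, a \<otimes>\<^bsub>M\<^esub> a') - fo (gs, a) - fo (gs, a') | gs a a'. (gs, a) : hg q & a' : carrier M}
 \<union> {fo (map (%g. g \<otimes>\<^bsub>G\<^esub> h) gs, a) - fo (gs, \<rho> h a) | gs a h. (gs, a) : hg q & h : carrier G}"

lemma hrel_fr: "hrel q <= fr (hg q)"
 by (auto simp: hrel_def hg_def subset_iff intro!: fr_diff)

lemma hrel_add: "(gs, a) : hg q ==> a' : carrier M ==>
 fo (gs, a \<otimes>\<^bsub>M\<^esub> a') - fo (gs, a) - fo (gs, a') : gsp (hrel q)"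
 by (rule gsp_base) (auto simp: hrel_def)

lemma hrel_one: "(gs, \<one>\<^bsub>M\<^esub>) : hg q ==> fo (gs, \<one>\<^bsub>M\<^esub>) : gsp (hrel q)"
 using hrel_add[of gs "\<one>\<^bsub>M\<^esub>" q "\<one>\<^bsub>M\<^esub>"] gsp_minus_iff[of "fo (gs, \<one>\<^bsub>M\<^esub>)" "hrel q"] by simp

lemma bt_hrel: "c : gsp (hrel q) ==> bt q c = \<one>\<^bsub>BC q\<^esub>"
 unfolding bt_def
proof (rule comm_group.fev_gsp[OF cgBC bsy_Pi hrel_fr])
 interpret K: comm_group "BC q" by (rule cgBC)
 fix r assume "r : hrel q"
 then consider gs a a' where "(gs, a) : hg q" "a' : carrier M" "r = fo (gs, a \<otimes>\<^bsub>M\<^esub> a') - fo (gs, a) - fo (gs, a')"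
 | gs a h where "(gs, a) : hg q" "h : carrier G" "r = fo (map (%g. g \<otimes>\<^bsub>G\<^esub> h) gs, a) - fo (gs, \<rho> h a)"
 unfolding hrel_def by blast
 then have "bt q r = \<one>\<^bsub>BC q\<^esub>"
 proof cases
 case 1
 have a: "a : carrier M" "(gs, a') : hg q" "(gs, a \<otimes>\<^bsub>M\<^esub> a') : hg q" using 1 by (auto simp: hg_def)
 have w: "wrd gs : Wd q" "last gs : carrier G" using wrd_Wd[OF 1(1)] last_carrier[OF 1(1)] by auto
 have e: "bsy (gs, a \<otimes>\<^bsub>M\<^esub> a') = bsy (gs, a) \<otimes>\<^bsub>BC q\<^esub> bsy (gs, a')"
 using sym_mult[OF w(1), of "\<rho> (last gs) a" "\<rho> (last gs) a'"] w a 1 by (simp add: bsy_def rho_mult)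
 have "bsy (gs, a) : carrier (BC q)" "bsy (gs, a') : carrier (BC q)" using bsy_closed 1 a by auto
 then have "bsy (gs, a) \<otimes>\<^bsub>BC q\<^esub> bsy (gs, a') \<otimes>\<^bsub>BC q\<^esub> inv\<^bsub>BC q\<^esub> bsy (gs, a) \<otimes>\<^bsub>BC q\<^esub> inv\<^bsub>BC q\<^esub> bsy (gs, a') = \<one>\<^bsub>BC q\<^esub>"
 by (rule K.mult_inv_cancel)
 then show ?thesis using 1 a e by (simp add: bt_diff fr_diff bt_of)
 next
 case 2
 have a: "a : carrier M" "set gs <= carrier G" "gs ~= []" using 2 by (auto simp: hg_def)
 have h: "(map (%g. g \<otimes>\<^bsub>G\<^esub> h) gs, a) : hg q" "(gs, \<rho> h a) : hg q" using 2 by (auto simp: hg_def)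
 have "wrd (map (%g. g \<otimes>\<^bsub>G\<^esub> h) gs) = wrd gs"
 unfolding wrd_def
 proof (rule map_cong)
 fix j assume "j : set [0..<length gs - 1]"
 then have "gs ! j : carrier G" "gs ! Suc j : carrier G" using a(2) by (auto intro!: nth_carrier)
 then have "gs ! j \<otimes>\<^bsub>G\<^esub> h \<otimes>\<^bsub>G\<^esub> inv\<^bsub>G\<^esub> (gs ! Suc j \<otimes>\<^bsub>G\<^esub> h) = gs ! j \<otimes>\<^bsub>G\<^esub> inv\<^bsub>G\<^esub> (gs ! Suc j)"
 proof -
 assume c: "gs ! j : carrier G" "gs ! Suc j : carrier G"
 have "h \<otimes>\<^bsub>G\<^esub> (inv\<^bsub>G\<^esub> h \<otimes>\<^bsub>G\<^esub> inv\<^bsub>G\<^esub> (gs ! Suc j)) = inv\<^bsub>G\<^esub> (gs ! Suc j)"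
 using c 2(2) G.m_assoc[of h "inv\<^bsub>G\<^esub> h" "inv\<^bsub>G\<^esub> (gs ! Suc j)"] by simp
 then show ?thesis using c 2(2) by (simp add: G.inv_mult_group G.m_assoc)
 qed
 then show "map (%g. g \<otimes>\<^bsub>G\<^esub> h) gs ! j \<otimes>\<^bsub>G\<^esub> inv\<^bsub>G\<^esub> (map (%g. g \<otimes>\<^bsub>G\<^esub> h) gs ! Suc j) = gs ! j \<otimes>\<^bsub>G\<^esub> inv\<^bsub>G\<^esub> (gs ! Suc j)"
 using \<open>j : set [0..<length gs - 1]\<close> by simp
 qed simp
 then have "bsy (map (%g. g \<otimes>\<^bsub>G\<^esub> h) gs, a) = bsy (gs, \<rho> h a)"
 using a 2 last_carrier[OF 2(1)] by (simp add: bsy_def last_map rho_comp)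
 then show ?thesis using h 2 bsy_closed[OF h(2)] by (simp add: bt_diff bt_of)
 qed
 then show "fev (BC q) bsy r = \<one>\<^bsub>BC q\<^esub>" by (simp add: bt_def)
qed

text \<open>The function \<open>al\<close> lifts bar chains back to simplices with last vertex 1. It
  is additive modulo relations and inverts \<open>bt\<close> modulo relations, so a chain with
  trivial image is a relation.\<close>

lemma bt_kernel: "c : fr (hg q) ==> bt q c = \<one>\<^bsub>BC q\<^esub> \<longleftrightarrow> c : gsp (hrel q)"
proof
 interpret K: comm_group "BC q" by (rule cgBC)
 define al where "al x = (\<Sum>w\<in>{w : Wd q. x w ~= \<one>\<^bsub>M\<^esub>}. fo (hom_of w, x w))" for x
 \<comment> \<open>Enlarging the support adds only generators with trivial coefficient, which are
   relations; this lets several bar chains share one finite index set.\<close>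
 have al_sup: "(\<Sum>w\<in>J. fo (hom_of w, x w)) - al x : gsp (hrel q)"
 if x: "x : carrier (BC q)" and J: "finite J" "{w : Wd q. x w ~= \<one>\<^bsub>M\<^esub>} <= J" "J <= Wd q" for x J
 proof -
 have "(\<Sum>w\<in>J. fo (hom_of w, x w)) = al x + (\<Sum>w\<in>J - {w : Wd q. x w ~= \<one>\<^bsub>M\<^esub>}. fo (hom_of w, x w))"
 unfolding al_def by (rule sum.subset_diff[OF J(2,1), THEN trans]) simp
 moreover have "(\<Sum>w\<in>J - {w : Wd q. x w ~= \<one>\<^bsub>M\<^esub>}. fo (hom_of w, x w)) : gsp (hrel q)"
 proof (rule gsp_sum)
 fix w assume "w : J - {w : Wd q. x w ~= \<one>\<^bsub>M\<^esub>}"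
 then have "w : Wd q" "x w = \<one>\<^bsub>M\<^esub>" using J by auto
 then show "fo (hom_of w, x w) : gsp (hrel q)" using hrel_one[OF hom_of_hg] by simp
 qed
 ultimately show ?thesis by simp
 qed
 have al_add: "al (x \<otimes>\<^bsub>BC q\<^esub> y) - al x - al y : gsp (hrel q)" if x: "x : carrier (BC q)" and y: "y : carrier (BC q)" for x y
 proof -
 let ?J = "{w : Wd q. x w ~= \<one>\<^bsub>M\<^esub>} \<union> {w : Wd q. y w ~= \<one>\<^bsub>M\<^esub>}"
 have J: "finite ?J" "?J <= Wd q" using x y by (auto simp: carrier_BC)
 have c: "x w : carrier M" "y w : carrier M" if "w : Wd q" for w using x y that by (auto simp: carrier_BC)
 have "{w : Wd q. (x \<otimes>\<^bsub>BC q\<^esub> y) w ~= \<one>\<^bsub>M\<^esub>} <= ?J" by (auto simp: BC_mult)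
 note 1 = al_sup[OF K.m_closed[OF x y] J(1) this J(2)] and 2 = al_sup[OF x J(1) _ J(2)] and 3 = al_sup[OF y J(1) _ J(2)]
 have "(\<Sum>w\<in>?J. fo (hom_of w, (x \<otimes>\<^bsub>BC q\<^esub> y) w) - fo (hom_of w, x w) - fo (hom_of w, y w)) : gsp (hrel q)"
 proof (rule gsp_sum)
 fix w assume "w : ?J"
 then have w: "w : Wd q" by auto
 then show "fo (hom_of w, (x \<otimes>\<^bsub>BC q\<^esub> y) w) - fo (hom_of w, x w) - fo (hom_of w, y w) : gsp (hrel q)"
 using hrel_add[OF hom_of_hg[OF w]] c by (simp add: BC_mult)
 qed
 from gsp_add[OF gsp_diff[OF this 1] gsp_add[OF 2 3]] show ?thesis by (simp add: sum_subtractf sum.distrib algebra_simps)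
 qed
 have al_bt: "c - al (bt q c) : gsp (hrel q)" if "c : fr (hg q)" for c
 using that
 proof (induction rule: fr_induct)
 case zero then show ?case by (simp add: bt_def K.fev_zero al_def BC_one)
 next
 case (of s)
 obtain gs a where s: "s = (gs, a)" by (cases s)
 have gs: "gs ~= []" "set gs <= carrier G" "a : carrier M" "length gs = Suc q" using of s by (auto simp: hg_def)
 have l: "last gs : carrier G" "wrd gs : Wd q" using last_carrier wrd_Wd of s by auto
 let ?x = "bar_symbol G M (wrd gs) (\<rho> (last gs) a)"
 have x: "?x : carrier (BC q)" using sym_closed l gs by simp
 have len: "length (wrd gs) = q" using l(2) by (simp add: bar_words_def)
 have "{w : Wd q. ?x w ~= \<one>\<^bsub>M\<^esub>} <= {wrd gs}" by (auto simp: bar_symbol_def len)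
 from al_sup[OF x _ this] l(2) have "fo (hom_of (wrd gs), ?x (wrd gs)) - al ?x : gsp (hrel q)" by simp
 moreover have "?x (wrd gs) = \<rho> (last gs) a" using l(2) len by (simp add: bar_symbol_def)
 ultimately have 1: "fo (hom_of (wrd gs), \<rho> (last gs) a) - al ?x : gsp (hrel q)" by simp
 have g: "(gs, a) : hg q" using of s by simp
 \<comment> \<open>Balancing by the inverse of the last vertex relates the simplex to its normalized
   form, with the coefficient transported.\<close>
 let ?g = "map (%g. g \<otimes>\<^bsub>G\<^esub> inv\<^bsub>G\<^esub> last gs) gs"
 have "fo (?g, \<rho> (last gs) a) - fo (gs, \<rho> (inv\<^bsub>G\<^esub> last gs) (\<rho> (last gs) a)) : gsp (hrel q)"
 unfolding hrel_def
 proof (rule gsp_base, rule UnI2, rule CollectI, rule exI[of _ gs], rule exI[of _ "\<rho> (last gs) a"],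
 rule exI[of _ "inv\<^bsub>G\<^esub> last gs"], intro conjI)
 show "(gs, \<rho> (last gs) a) : hg q" using gs l by (simp add: hg_def)
 qed (use l in auto)
 moreover have "\<rho> (inv\<^bsub>G\<^esub> last gs) (\<rho> (last gs) a) = a" using rho_comp[of "inv\<^bsub>G\<^esub> last gs" "last gs" a] l gs by simp
 ultimately have "fo (hom_of (wrd gs), \<rho> (last gs) a) - fo (gs, a) : gsp (hrel q)" using hom_of_wrd gs by simp
 from gsp_diff[OF 1 this] have "fo (gs, a) - al ?x : gsp (hrel q)" by simp
 then show ?case using bt_of[OF of] by (simp add: s bsy_def)
 next
 case (diff c c')
 have k: "bt q c' : carrier (BC q)" "bt q (c - c') : carrier (BC q)" "bt q c : carrier (BC q)"
 using bt_closed diff fr_diff by blast+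
 have "bt q (c - c') \<otimes>\<^bsub>BC q\<^esub> bt q c' = bt q c" using bt_add[OF fr_diff[OF diff(1,2)] diff(2)] by simp
 with al_add[OF k(2,1)] have "al (bt q c) - al (bt q (c - c')) - al (bt q c') : gsp (hrel q)" by simp
 from gsp_add[OF gsp_diff[OF diff(3,4)] this] show ?case by simp
 qed
 assume c: "c : fr (hg q)"
 show "c : gsp (hrel q)" if "bt q c = \<one>\<^bsub>BC q\<^esub>"
 proof -
 have "{w : Wd q. (\<lambda>w\<in>Wd q. \<one>\<^bsub>M\<^esub>) w ~= \<one>\<^bsub>M\<^esub>} = {}" by auto
 then have "al \<one>\<^bsub>BC q\<^esub> = 0" unfolding al_def BC_one by (simp only: sum.empty)
 then show ?thesis using al_bt[OF c] that by simp
 qed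
 show "bt q c = \<one>\<^bsub>BC q\<^esub>" if "c : gsp (hrel q)" using bt_hrel[OF that] .
qed

end

lemma (in comm_group) hom_free_eq:
 assumes "h : hom (free_Abelian_group S) G" "h' : hom (free_Abelian_group S) G" "!!s. s : S ==> h (fo s) = h' (fo s)" "c : fr S"
 shows "h c = h' c"
 using hom_eq_fev[OF assms(1,4), of "%s. h (fo s)"] hom_eq_fev[OF assms(2,4), of "%s. h (fo s)"] assms(3) by simp

lemma bd_len1': "c : fr {x. len x = 1} ==> bd c = 0"
 by (rule addv_eq_on[OF addv_bd addv_const_zero]) (auto simp: bdl_def)

context gmod begin

lemma bar_face_closed:
 assumes "w : Wd (Suc p)" "i <= Suc p" "m : carrier M"
 shows "bar_face G M \<rho> i w m : carrier (BC p)"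
proof -
 have w: "length w = Suc p" "set w <= carrier G" using assms(1) by (auto simp: bar_words_def)
 have "last w : carrier G" using w by (cases w rule: rev_cases) auto
 moreover have "tl w : Wd p" "butlast w : Wd p"
 using w by (auto simp: bar_words_def dest: in_set_butlastD list.set_sel(2)[rotated] split: list.splits)
 moreover have "take (i - 1) w @ [w ! (i - 1) \<otimes>\<^bsub>G\<^esub> w ! i] @ drop (Suc i) w : Wd p" if "i ~= 0" "i ~= length w"
 proof -
 have "w ! (i - 1) : carrier G" "w ! i : carrier G" using that assms(2) w by (auto intro!: nth_carrier)
 then show ?thesis using w that assms(2) set_take_subset[of "i - 1" w] set_drop_subset[of "Suc i" w]
 by (auto simp: bar_words_def)
 qed
 ultimately show ?thesis using assms(3) by (auto simp: bar_face_def intro!: sym_closed)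
qed

lemma bar_face_mult:
 assumes "w : Wd (Suc p)" "i <= Suc p" "m : carrier M" "m' : carrier M"
 shows "bar_face G M \<rho> i w (m \<otimes>\<^bsub>M\<^esub> m') = bar_face G M \<rho> i w m \<otimes>\<^bsub>BC p\<^esub> bar_face G M \<rho> i w m'"
proof -
 have w: "length w = Suc p" "set w <= carrier G" using assms(1) by (auto simp: bar_words_def)
 have l: "last w : carrier G" using w by (cases w rule: rev_cases) auto
 have *: "bar_symbol G M v (m \<otimes>\<^bsub>M\<^esub> m') = bar_symbol G M v m \<otimes>\<^bsub>BC p\<^esub> bar_symbol G M v m'" if "length v = p" for v and m m'
 using that by (auto simp: bar_symbol_def BC_mult intro!: restrict_ext)
 have "length (take (i - 1) w @ [w ! (i - 1) \<otimes>\<^bsub>G\<^esub> w ! i] @ drop (Suc i) w) = p" if "i ~= 0" "i ~= length w"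
 using that assms(2) w by auto
 then show ?thesis using * w l assms(3,4) by (auto simp: bar_face_def rho_mult)
qed

definition bdw :: "nat => 'g list => 'm => 'g list => 'm" where
 "bdw p w m = finprod (BC p) (%i. bar_face G M \<rho> i w m [^]\<^bsub>BC p\<^esub> ((-1) ^ i :: int)) {..Suc p}"

lemma bdw_hom: "w : Wd (Suc p) ==> bdw p w : hom M (BC p)"
proof (rule homI)
 interpret K: comm_group "BC p" by (rule cgBC)
 assume w: "w : Wd (Suc p)"
 fix m assume m: "m : carrier M"
 show "bdw p w m : carrier (BC p)"
 unfolding bdw_def by (rule K.finprod_closed) (use bar_face_closed[OF w] m in auto)
 fix m' assume m': "m' : carrier M"
 have "bdw p w (m \<otimes>\<^bsub>M\<^esub> m') = finprod (BC p) (%i. bar_face G M \<rho> i w m [^]\<^bsub>BC p\<^esub> ((-1) ^ i :: int) \<otimes>\<^bsub>BC p\<^esub> bar_face G M \<rho> i w m' [^]\<^bsub>BC p\<^esub> ((-1) ^ i :: int)) {..Suc p}"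
 unfolding bdw_def
 by (rule K.finprod_cong') (use bar_face_closed[OF w] bar_face_mult[OF w] m m' in \<open>auto simp: K.int_pow_distrib\<close>)
 also have "... = bdw p w m \<otimes>\<^bsub>BC p\<^esub> bdw p w m'"
 unfolding bdw_def by (rule K.finprod_multf) (use bar_face_closed[OF w] m m' in auto)
 finally show "bdw p w (m \<otimes>\<^bsub>M\<^esub> m') = bdw p w m \<otimes>\<^bsub>BC p\<^esub> bdw p w m'" .
qed

lemma Bd_ext: "Bd (Suc p) = bar_ext G (Suc p) (BC p) (bdw p)"
 by (simp add: bar_diff_def bdw_def[abs_def] Let_def)

lemma Bd_hom: "Bd (Suc p) : hom (BC (Suc p)) (BC p)"
 unfolding Bd_ext by (rule ext_hom[OF cgBC bdw_hom])

lemma last_drop_nth: "length gs = Suc q ==> last gs = gs ! q" by (cases gs rule: rev_cases) auto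

text \<open>Deleting an inner vertex multiplies the two adjacent quotients; deleting the first or
  last vertex drops a quotient. In the last case the new last vertex acts on the coefficient, which
  accounts for the extra factor in the bar face.\<close>

lemma bsy_face:
 assumes gs: "(gs, a) : hg (Suc q)" and i: "i <= Suc q"
 shows "bsy (take i gs @ drop (Suc i) gs, a) = bar_face G M \<rho> i (wrd gs) (\<rho> (last gs) a)"
proof -
 have l: "length gs = Suc (Suc q)" and c: "!!j. j < Suc (Suc q) ==> gs ! j : carrier G" and a: "a : carrier M"
 using gs by (auto simp: hg_def)
 let ?d = "take i gs @ drop (Suc i) gs"
 have w: "length (wrd gs) = Suc q" "!!j. j < Suc q ==> wrd gs ! j = gs ! j \<otimes>\<^bsub>G\<^esub> inv\<^bsub>G\<^esub> (gs ! Suc j)" by (auto simp: wrd_def l simp del: upt_Suc)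
 have dl: "length ?d = Suc q" using l i by auto
 have dn: "?d ! j = (if j < i then gs ! j else gs ! Suc j)" if "j < Suc q" for j
 using that l i by (auto simp: nth_append min_def)
 have wd: "length (wrd ?d) = q" "!!j. j < q ==> wrd ?d ! j = ?d ! j \<otimes>\<^bsub>G\<^esub> inv\<^bsub>G\<^esub> (?d ! Suc j)"
 by (simp_all add: wrd_def dl del: upt_Suc length_append length_take length_drop)
 have ld: "last ?d = (if i = Suc q then gs ! q else gs ! Suc q)" using last_drop_nth[OF dl] dn[of q] i by auto
 have lg: "last gs = gs ! Suc q" using last_drop_nth[OF l] .
 consider "i = 0" | "i = Suc q" | "0 < i" "i <= q" using i by linarith
 then show ?thesis
 proof cases
 case 1
 have "wrd ?d = tl (wrd gs)" by (rule nth_equalityI) (use w wd dn 1 in \<open>auto simp: nth_tl\<close>)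
 then show ?thesis using 1 ld lg by (simp add: bsy_def bar_face_def)
 next
 case 2
 have "wrd ?d = butlast (wrd gs)" by (rule nth_equalityI) (use w wd dn 2 in \<open>auto simp: nth_butlast\<close>)
 moreover have "last (wrd gs) = gs ! q \<otimes>\<^bsub>G\<^esub> inv\<^bsub>G\<^esub> (gs ! Suc q)" using last_drop_nth[OF w(1)] w(2) by simp
 moreover have "\<rho> (gs ! q \<otimes>\<^bsub>G\<^esub> inv\<^bsub>G\<^esub> (gs ! Suc q)) (\<rho> (gs ! Suc q) a) = \<rho> (gs ! q) a"
 using rho_comp[of "gs ! q \<otimes>\<^bsub>G\<^esub> inv\<^bsub>G\<^esub> (gs ! Suc q)" "gs ! Suc q" a] c a by (simp add: G.m_assoc)
 ultimately show ?thesis using 2 ld lg w(1) by (simp add: bsy_def bar_face_def)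
 next
 case 3
 let ?v = "take (i - 1) (wrd gs) @ [wrd gs ! (i - 1) \<otimes>\<^bsub>G\<^esub> wrd gs ! i] @ drop (Suc i) (wrd gs)"
 have "wrd ?d = ?v"
 proof (rule nth_equalityI)
 show "length (wrd ?d) = length ?v" using w wd 3 by auto
 fix j assume "j < length (wrd ?d)"
 then have j: "j < q" by (simp add: wd)
 have e: "wrd ?d ! j = (if j < i then gs ! j else gs ! Suc j) \<otimes>\<^bsub>G\<^esub> inv\<^bsub>G\<^esub> (if Suc j < i then gs ! Suc j else gs ! Suc (Suc j))"
 unfolding wd(2)[OF j] using dn[of j] dn[of "Suc j"] j by simp
 have vl: "?v ! j = (if j < i - 1 then wrd gs ! j else if j = i - 1 then wrd gs ! (i - 1) \<otimes>\<^bsub>G\<^esub> wrd gs ! i else wrd gs ! Suc j)"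
 using j w(1) 3 by (auto simp: nth_append min_def nth_Cons split: nat.splits) (rule arg_cong[of _ _ "(!) (wrd gs)"], linarith)
 consider "j < i - 1" | "j = i - 1" | "j >= i" by linarith
 then show "wrd ?d ! j = ?v ! j"
 proof cases
 case a1: 1
 then have "Suc j < i" "j < i" "j < Suc q" using j by auto
 then show ?thesis unfolding e vl using a1 w(2) by simp
 next
 case a2: 2
 have "wrd gs ! (i - 1) \<otimes>\<^bsub>G\<^esub> wrd gs ! i = gs ! (i - 1) \<otimes>\<^bsub>G\<^esub> inv\<^bsub>G\<^esub> (gs ! Suc i)"
 proof -
 have cc: "gs ! (i - 1) : carrier G" "gs ! i : carrier G" "gs ! Suc i : carrier G" using c 3 by auto
 have "inv\<^bsub>G\<^esub> (gs ! i) \<otimes>\<^bsub>G\<^esub> (gs ! i \<otimes>\<^bsub>G\<^esub> inv\<^bsub>G\<^esub> (gs ! Suc i)) = inv\<^bsub>G\<^esub> (gs ! Suc i)"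
 using cc G.m_assoc[of "inv\<^bsub>G\<^esub> (gs ! i)" "gs ! i" "inv\<^bsub>G\<^esub> (gs ! Suc i)"] by simp
 then show ?thesis using w(2)[of "i - 1"] w(2)[of i] 3 cc by (simp add: G.m_assoc)
 qed
 moreover have "j < i" "\<not> Suc j < i" "Suc (Suc j) = Suc i" using a2 3 by auto
 ultimately show ?thesis unfolding e vl using a2 by simp
 next
 case a3: 3
 then have "\<not> j < i" "\<not> Suc j < i" "\<not> j < i - 1" "j ~= i - 1" "Suc j < Suc q" using j 3 by auto
 then show ?thesis unfolding e vl using w(2) by simp
 qed
 qed
 then show ?thesis using 3 ld lg w(1) by (simp add: bsy_def bar_face_def)
 qed
qed

lemma del_hg: "(gs, a) : hg (Suc q) ==> i < Suc (Suc q) ==> (take i gs @ drop (Suc i) gs, a) : hg q"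
 using set_take_subset[of i gs] set_drop_subset[of "Suc i" gs] by (auto simp: hg_def)

lemma bt_sum:
 assumes "finite I" "!!i. i : I ==> x i : hg q"
 shows "(\<Sum>i\<in>I. frag_cmul (k i) (fo (x i))) : fr (hg q) &
 bt q (\<Sum>i\<in>I. frag_cmul (k i) (fo (x i))) = finprod (BC q) (%i. bsy (x i) [^]\<^bsub>BC q\<^esub> k i) I"
 using assms
proof (induction I rule: finite_induct)
 interpret K: comm_group "BC q" by (rule cgBC)
 case empty then show ?case by (simp add: bt_def K.fev_zero)
next
 interpret K: comm_group "BC q" by (rule cgBC)
 case (insert i I)
 have x: "x i : hg q" using insert.prems by simp
 have xf: "frag_cmul (k i) (fo (x i)) : fr (hg q)" using x by (simp add: fr_cmul)
 have "bt q (frag_cmul (k i) (fo (x i))) = bsy (x i) [^]\<^bsub>BC q\<^esub> k i"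
 proof (cases "k i = 0")
 case True then show ?thesis by (simp add: bt_def K.fev_zero)
 next
 case False
 then have "Poly_Mapping.keys (frag_cmul (k i) (fo (x i))) = {x i}" by auto
 then show ?thesis using bsy_closed[OF x] by (simp add: bt_def fev_def)
 qed
 moreover have "(%i. bsy (x i) [^]\<^bsub>BC q\<^esub> k i) : I \<rightarrow> carrier (BC q)" "bsy (x i) [^]\<^bsub>BC q\<^esub> k i : carrier (BC q)"
 using insert.prems bsy_closed by auto
 ultimately show ?case using insert xf by (simp add: fr_add bt_add)
qed

lemma bd_hg: "c : fr (hg (Suc q)) ==> bd c : fr (hg q)"
proof (rule addv_fr[OF addv_bd])
 fix x assume x: "x : hg (Suc q)"
 obtain gs a where s: "x = (gs, a)" by (cases x)
 have "set u <= carrier G" if "set u <= set gs" for u using that x s by (auto simp: hg_def)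
 then show "bd (fo x) : fr (hg q)" using x unfolding s by (auto simp: hg_def intro!: tens_fr[OF bdl_fr])
qed

lemma Bd_bt: "c : fr (hg (Suc q)) ==> Bd (Suc q) (bt (Suc q) c) = bt q (bd c)"
proof (rule comm_group.hom_free_eq[OF cgBC, of "%c. Bd (Suc q) (bt (Suc q) c)" "hg (Suc q)" q "%c. bt q (bd c)"])
 show "(%c. Bd (Suc q) (bt (Suc q) c)) : hom (free_Abelian_group (hg (Suc q))) (BC q)"
 using hom_compose[OF bt_hom Bd_hom] by (simp add: comp_def)
 show "(%c. bt q (bd c)) : hom (free_Abelian_group (hg (Suc q))) (BC q)"
 by (rule homI) (auto simp: bd_hg bt_closed bt_add)
 fix s assume s: "s : hg (Suc q)"
 obtain gs a where s': "s = (gs, a)" by (cases s)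
 have g: "(gs, a) : hg (Suc q)" using s s' by simp
 have l: "length gs = Suc (Suc q)" "a : carrier M" using g by (auto simp: hg_def)
 have w: "wrd gs : Wd (Suc q)" by (rule wrd_Wd[OF g])
 have m: "\<rho> (last gs) a : carrier M" using last_carrier[OF g] l by auto
 have "Bd (Suc q) (bt (Suc q) (fo s)) = bdw q (wrd gs) (\<rho> (last gs) a)"
 using ext_sym[where f="bdw q", OF cgBC bdw_hom w m] bt_of[OF s] by (simp add: Bd_ext s' bsy_def)
 also have "... = finprod (BC q) (%i. bsy (take i gs @ drop (Suc i) gs, a) [^]\<^bsub>BC q\<^esub> ((-1) ^ i :: int)) {..<Suc (Suc q)}"
 unfolding bdw_def
 proof (rule comm_monoid.finprod_cong'[OF comm_group.axioms(1)[OF cgBC]])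
 show "{..Suc q} = {..<Suc (Suc q)}" by auto
 show "(%i. bsy (take i gs @ drop (Suc i) gs, a) [^]\<^bsub>BC q\<^esub> ((-1) ^ i :: int)) : {..<Suc (Suc q)} \<rightarrow> carrier (BC q)"
 using bsy_closed[OF del_hg[OF g]] group.int_pow_closed[OF comm_group.axioms(2)[OF cgBC]] by auto
 qed (use bsy_face[OF g] in auto)
 also have "... = bt q (\<Sum>i<Suc (Suc q). frag_cmul ((-1) ^ i) (fo (take i gs @ drop (Suc i) gs, a)))"
 using bt_sum[of "{..<Suc (Suc q)}" "%i. (take i gs @ drop (Suc i) gs, a)" q "%i. (-1) ^ i"] del_hg[OF g] by auto
 also have "(\<Sum>i<Suc (Suc q). frag_cmul ((-1) ^ i) (fo (take i gs @ drop (Suc i) gs, a))) = bd (fo s)"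
 by (simp add: s' bdl_def l bda_eq addv_sum[OF addv_tens] del: sum.lessThan_Suc)
 finally show "Bd (Suc q) (bt (Suc q) (fo s)) = bt q (bd (fo s))" .
qed

sublocale bar: abelian_complex BC Bd
proof (rule abelian_complex.intro)
 fix p x assume "x : carrier (BC (Suc (Suc p)))"
 then obtain c where c: "c : fr (hg (Suc (Suc p)))" "x = bt (Suc (Suc p)) c" using bt_surj by blast
 then have "Bd (Suc p) (Bd (Suc (Suc p)) x) = bt p (bd (bd c))"
 using Bd_bt bd_hg by simp
 then show "Bd (Suc p) (Bd (Suc (Suc p)) x) = \<one>\<^bsub>BC p\<^esub>"
 by (simp add: bd_bd bt_def comm_group.fev_zero[OF cgBC])
qed (rule cgBC Bd_hom)+

lemma bd_hg0: "c : fr (hg 0) ==> bd c = 0"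
 by (rule bd_len1') (erule fr_mono, auto simp: hg_def)

lemma bt_cycles: "c : fr (hg q) ==> bt q c : cycles BC Bd q \<longleftrightarrow> bd c : gsp (hrel (q - 1))"
proof (cases q)
 case 0
 assume "c : fr (hg q)"
 then show ?thesis using 0 bt_closed bd_hg0 by (simp add: cycles_def)
next
 case (Suc p)
 assume c: "c : fr (hg q)"
 then have "bt q c : cycles BC Bd q \<longleftrightarrow> bt p (bd c) = \<one>\<^bsub>BC p\<^esub>"
 using Bd_bt[of c p] bt_closed[of c q] Suc by (simp add: cycles_def kernel_def)
 then show ?thesis using bt_kernel[OF bd_hg, of c p] c Suc by simp
qed

lemma bt_boundaries:
 assumes c: "c : fr (hg q)"
 shows "bt q c : boundaries BC Bd q \<longleftrightarrow> (\<exists>w\<in>fr (hg (Suc q)). c - bd w : gsp (hrel q))"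
proof -
 interpret K: comm_group "BC q" by (rule cgBC)
 have *: "bt q c = bt q (bd w) \<longleftrightarrow> c - bd w : gsp (hrel q)" if w: "w : fr (hg (Suc q))" for w
 proof -
 have b: "bt q c : carrier (BC q)" "bt q (bd w) : carrier (BC q)" using bt_closed c bd_hg[OF w] by auto
 have "bt q (c - bd w) = bt q c \<otimes>\<^bsub>BC q\<^esub> inv\<^bsub>BC q\<^esub> bt q (bd w)" by (rule bt_diff[OF c bd_hg[OF w]])
 then have "bt q c = bt q (bd w) \<longleftrightarrow> bt q (c - bd w) = \<one>\<^bsub>BC q\<^esub>" using b
 by (metis K.inv_closed K.inv_solve_right K.l_one K.one_closed K.r_inv)
 then show ?thesis using bt_kernel[OF fr_diff[OF c bd_hg[OF w]]] by simp
 qed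
 have "bt q c : boundaries BC Bd q \<longleftrightarrow> (\<exists>w\<in>fr (hg (Suc q)). bt q c = bt q (bd w))"
 proof
 assume "bt q c : boundaries BC Bd q"
 then obtain x where "x : carrier (BC (Suc q))" "bt q c = Bd (Suc q) x" by (auto simp: boundaries_def)
 then show "\<exists>w\<in>fr (hg (Suc q)). bt q c = bt q (bd w)" using bt_surj[of x "Suc q"] Bd_bt by metis
 next
 assume "\<exists>w\<in>fr (hg (Suc q)). bt q c = bt q (bd w)"
 then obtain w where w: "w : fr (hg (Suc q))" "bt q c = bt q (bd w)" by blast
 then have "bt q c = Bd (Suc q) (bt (Suc q) w)" using Bd_bt by simp
 then show "bt q c : boundaries BC Bd q" using bt_closed[OF w(1)] by (auto simp: boundaries_def)
 qed
 then show ?thesis using * by blast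
qed

lemma cycle_bt: "z : cycles BC Bd q ==> \<exists>c\<in>fr (hg q). z = bt q c & bd c : gsp (hrel (q - 1))"
 using bt_surj[OF bar.cyc_carrier] bt_cycles by blast

end

locale gmod_map = s: gmod G M \<rho> + t: gmod G' M' \<rho>'
 for G :: "('g, 'y) monoid_scheme" and M :: "'m monoid" and \<rho>
 and G' :: "('h, 'z) monoid_scheme" and M' :: "'n monoid" and \<rho>' +
 fixes \<phi> :: "'g => 'h" and f :: "'m => 'n"
 assumes \<phi>: "\<phi> : hom G G'" and f: "f : hom M M'"
 and equi: "!!g m. g : carrier G ==> m : carrier M ==> f (\<rho> g m) = \<rho>' (\<phi> g) (f m)"
begin

definition bmap :: "nat => ('g list => 'm) => 'h list => 'n" where
 "bmap p = bar_ext G p (bar_chains G' M' p) (%w m. bar_symbol G' M' (map \<phi> w) (f m))"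

lemma map_Wd: "w : s.Wd p ==> map \<phi> w : t.Wd p"
 using \<phi> by (auto simp: bar_words_def hom_def)

lemma sym_map_hom: "w : s.Wd p ==> (%m. bar_symbol G' M' (map \<phi> w) (f m)) : hom M (t.BC p)"
 using hom_compose[OF f t.sym_hom[OF map_Wd]] by (simp add: comp_def)

lemma bmap_hom: "bmap p : hom (s.BC p) (t.BC p)"
 unfolding bmap_def by (rule s.ext_hom[OF t.cgBC sym_map_hom])

lemma bmap_sym: "w : s.Wd p ==> m : carrier M ==> bmap p (bar_symbol G M w m) = bar_symbol G' M' (map \<phi> w) (f m)"
 unfolding bmap_def by (rule s.ext_sym[OF t.cgBC sym_map_hom])

definition hmap :: "('g list \<times> 'm \<Rightarrow>\<^sub>0 int) => ('h list \<times> 'n \<Rightarrow>\<^sub>0 int)" where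
 "hmap = fmap (%(gs, a). (map \<phi> gs, f a))"

lemma hmap_hg: "c : fr (s.hg q) ==> hmap c : fr (t.hg q)"
 unfolding hmap_def by (rule addv_fr[OF addv_fmap])
 (use hom_in_carrier[OF \<phi>] hom_in_carrier[OF f] in \<open>auto simp: s.hg_def t.hg_def subset_iff\<close>)

lemma bd_hmap: "bd (hmap c) = hmap (bd c)"
proof (rule addv_eq[of "%c. bd (hmap c)"])
 fix s :: "'g list \<times> 'm"
 obtain gs a where s: "s = (gs, a)" by (cases s)
 have "hmap (tens u a) = tens (fmap (map \<phi>) u) (f a)" for u
 unfolding hmap_def by (rule addv_eq[of "%u. fmap (%(gs, a). (map \<phi> gs, f a)) (tens u a)"]) (auto simp: addv_def)
 then show "bd (hmap (fo s)) = hmap (bd (fo s))" by (simp add: s bdl_map) (simp add: hmap_def bdl_map)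
qed (auto simp: addv_def hmap_def)

lemma bmap_bt: "c : fr (s.hg q) ==> bmap q (s.bt q c) = t.bt q (hmap c)"
proof (rule comm_group.hom_free_eq[OF t.cgBC, of "%c. bmap q (s.bt q c)" "s.hg q" q "%c. t.bt q (hmap c)"])
 show "(%c. bmap q (s.bt q c)) : hom (free_Abelian_group (s.hg q)) (t.BC q)"
 using hom_compose[OF s.bt_hom bmap_hom] by (simp add: comp_def)
 show "(%c. t.bt q (hmap c)) : hom (free_Abelian_group (s.hg q)) (t.BC q)"
 using hmap_hg by (intro homI) (auto simp: t.bt_closed t.bt_add hmap_def)
 fix s assume s: "s : s.hg q"
 obtain gs a where s': "s = (gs, a)" by (cases s)
 have g: "(gs, a) : s.hg q" using s s' by simp
 then have gs: "gs ~= []" "set gs <= carrier G" "a : carrier M" by (auto simp: s.hg_def)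
 have w: "s.wrd gs : s.Wd q" by (rule s.wrd_Wd[OF g])
 interpret \<phi>: group_hom G G' \<phi> using \<phi> by (simp add: group_hom_def group_hom_axioms_def s.G.is_group t.G.is_group)
 have "map \<phi> (s.wrd gs) = t.wrd (map \<phi> gs)"
 unfolding s.wrd_def t.wrd_def
 by (rule nth_equalityI) (use gs(2) in \<open>auto simp: subset_iff\<close>)
 moreover have "f (\<rho> (last gs) a) = \<rho>' (last (map \<phi> gs)) (f a)"
 using equi s.last_carrier[OF g] gs by (simp add: last_map)
 ultimately show "bmap q (s.bt q (fo s)) = t.bt q (hmap (fo s))"
 using bmap_sym[OF w, of "\<rho> (last gs) a"] s.bt_of[OF s] s.last_carrier[OF g] gs
 t.bt_of[of "(map \<phi> gs, f a)" q] hmap_hg[of "fo s" q] s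
 by (simp add: s' hmap_def s.bsy_def t.bsy_def)
qed

lemma bmap_Bd: "x : carrier (s.BC (Suc q)) ==> t.Bd (Suc q) (bmap (Suc q) x) = bmap q (s.Bd (Suc q) x)"
proof -
 assume "x : carrier (s.BC (Suc q))"
 then obtain c where "c : fr (s.hg (Suc q))" "x = s.bt (Suc q) c" using s.bt_surj by blast
 then show ?thesis by (simp add: bmap_bt s.Bd_bt t.Bd_bt hmap_hg s.bd_hg bd_hmap)
qed

lemma bmap_cycles: "z : cycles s.BC s.Bd q ==> bmap q z : cycles t.BC t.Bd q"
proof (cases q)
 case 0
 assume "z : cycles s.BC s.Bd q"
 then show ?thesis using 0 hom_in_carrier[OF bmap_hom] by (auto simp: cycles_def)
next
 case (Suc p)
 assume z: "z : cycles s.BC s.Bd q"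
 then have "z : carrier (s.BC (Suc p))" "s.Bd (Suc p) z = \<one>\<^bsub>s.BC p\<^esub>" using Suc by (auto simp: cycles_def kernel_def)
 moreover have "bmap p \<one>\<^bsub>s.BC p\<^esub> = \<one>\<^bsub>t.BC p\<^esub>"
 by (rule hom_one[OF bmap_hom]) (use comm_group.axioms(2) s.cgBC t.cgBC in blast)+
 ultimately show ?thesis using Suc bmap_Bd hom_in_carrier[OF bmap_hom] by (simp add: cycles_def kernel_def)
qed

lemma bmap_boundaries: "z : boundaries s.BC s.Bd q ==> bmap q z : boundaries t.BC t.Bd q"
 using bmap_Bd hom_in_carrier[OF bmap_hom, of _ "Suc q"] by (force simp: boundaries_def)

text \<open>The definition evaluates a representative picked by SOME; it differs from
  \<open>z\<close> by a boundary, and boundaries map to boundaries.\<close>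

lemma homology_map_class:
 assumes z: "z : cycles s.BC s.Bd q"
 shows "group_homology_map G G' M' \<rho>' \<phi> f q (group_homology_class G M \<rho> q z) = group_homology_class G' M' \<rho>' q (bmap q z)"
proof -
 define z' where "z' = (SOME z'. z' : group_homology_class G M \<rho> q z)"
 have z'c: "z' : homology_class s.BC s.Bd q z"
 unfolding z'_def group_homology_class_def by (rule someI[of _ z]) (rule s.bar.class_self[OF z])
 note r = s.bar.class_rep[OF z z'c]
 have b: "z' \<otimes>\<^bsub>s.BC q\<^esub> inv\<^bsub>s.BC q\<^esub> z : boundaries s.BC s.Bd q"
 using s.bar.class_eq_iff[OF r(1) z] r(2) by simp
 interpret h: group_hom "s.BC q" "t.BC q" "bmap q"
 using bmap_hom comm_group.axioms(2)[OF s.cgBC] comm_group.axioms(2)[OF t.cgBC] by (simp add: group_hom_def group_hom_axioms_def)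
 have "bmap q (z' \<otimes>\<^bsub>s.BC q\<^esub> inv\<^bsub>s.BC q\<^esub> z) = bmap q z' \<otimes>\<^bsub>t.BC q\<^esub> inv\<^bsub>t.BC q\<^esub> bmap q z"
 using s.bar.cyc_carrier[OF z] s.bar.cyc_carrier[OF r(1)] by simp
 then have "bmap q z' \<otimes>\<^bsub>t.BC q\<^esub> inv\<^bsub>t.BC q\<^esub> bmap q z : boundaries t.BC t.Bd q" using bmap_boundaries[OF b] by simp
 then have "homology_class t.BC t.Bd q (bmap q z') = homology_class t.BC t.Bd q (bmap q z)"
 using t.bar.class_eq_iff[OF bmap_cycles[OF r(1)] bmap_cycles[OF z]] by simp
 then show ?thesis unfolding group_homology_map_def bmap_def[symmetric] z'_def[symmetric] by (simp add: group_homology_class_def)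
qed

lemma homology_map_hom: "group_homology_map G G' M' \<rho>' \<phi> f q : hom (group_homology G M \<rho> q) (group_homology G' M' \<rho>' q)"
proof (rule homI)
 have cl: "\<exists>z\<in>cycles s.BC s.Bd q. x = group_homology_class G M \<rho> q z" if "x : carrier (group_homology G M \<rho> q)" for x
 using that by (auto simp: group_homology_def group_homology_class_def s.bar.carrier_homology)
 fix x assume "x : carrier (group_homology G M \<rho> q)"
 then obtain z where z: "z : cycles s.BC s.Bd q" "x = group_homology_class G M \<rho> q z" using cl by blast
 show "group_homology_map G G' M' \<rho>' \<phi> f q x : carrier (group_homology G' M' \<rho>' q)"
 using t.bar.class_in[OF bmap_cycles[OF z(1)]] homology_map_class[OF z(1)]
 unfolding z(2) by (simp add: group_homology_def group_homology_class_def)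
 fix y assume "y : carrier (group_homology G M \<rho> q)"
 then obtain z' where z': "z' : cycles s.BC s.Bd q" "y = group_homology_class G M \<rho> q z'" using cl by blast
 have zz: "z \<otimes>\<^bsub>s.BC q\<^esub> z' : cycles s.BC s.Bd q" using subgroup.m_closed[OF s.bar.sub_cyc z(1) z'(1)] .
 have "x \<otimes>\<^bsub>group_homology G M \<rho> q\<^esub> y = group_homology_class G M \<rho> q (z \<otimes>\<^bsub>s.BC q\<^esub> z')"
 using s.bar.class_mult[OF z(1) z'(1)] by (simp add: z z' group_homology_def group_homology_class_def)
 then show "group_homology_map G G' M' \<rho>' \<phi> f q (x \<otimes>\<^bsub>group_homology G M \<rho> q\<^esub> y)
 = group_homology_map G G' M' \<rho>' \<phi> f q x \<otimes>\<^bsub>group_homology G' M' \<rho>' q\<^esub> group_homology_map G G' M' \<rho>' \<phi> f q y"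
 using homology_map_class[OF zz] homology_map_class[OF z(1)] homology_map_class[OF z'(1)]
 t.bar.class_mult[OF bmap_cycles[OF z(1)] bmap_cycles[OF z'(1)]]
 hom_mult[OF bmap_hom s.bar.cyc_carrier[OF z(1)] s.bar.cyc_carrier[OF z'(1)]]
 by (simp add: z z' group_homology_def group_homology_class_def)
qed

end

subsection \<open>Tensor products of modules over groups\<close>

definition biadditive :: "('a, 'x) monoid_scheme => ('b, 'y) monoid_scheme => ('k, 'z) monoid_scheme => ('a => 'b => 'k) => bool" where
 "biadditive G H K b \<longleftrightarrow> (\<forall>x\<in>carrier G. b x : hom H K) & (\<forall>y\<in>carrier H. (%x. b x y) : hom G K)"

lemma biadditiveD:
 assumes "biadditive G H K b" "x : carrier G" "y : carrier H"
 shows "b x y : carrier K" "x' : carrier G ==> b (x \<otimes>\<^bsub>G\<^esub> x') y = b x y \<otimes>\<^bsub>K\<^esub> b x' y"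
 "y' : carrier H ==> b x (y \<otimes>\<^bsub>H\<^esub> y') = b x y \<otimes>\<^bsub>K\<^esub> b x y'"
proof -
 have 1: "b x : hom H K" "(%x. b x y) : hom G K" using assms by (auto simp: biadditive_def)
 show "b x y : carrier K" using hom_in_carrier[OF 1(1) assms(3)] .
 show "x' : carrier G ==> b (x \<otimes>\<^bsub>G\<^esub> x') y = b x y \<otimes>\<^bsub>K\<^esub> b x' y" using hom_mult[OF 1(2) assms(2)] .
 show "y' : carrier H ==> b x (y \<otimes>\<^bsub>H\<^esub> y') = b x y \<otimes>\<^bsub>K\<^esub> b x y'" using hom_mult[OF 1(1) assms(3)] .
qed

lemma biadditiveI:
 assumes "!!x y. x : carrier G ==> y : carrier H ==> b x y : carrier K"
 "!!x x' y. x : carrier G ==> x' : carrier G ==> y : carrier H ==> b (x \<otimes>\<^bsub>G\<^esub> x') y = b x y \<otimes>\<^bsub>K\<^esub> b x' y"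
 "!!x y y'. x : carrier G ==> y : carrier H ==> y' : carrier H ==> b x (y \<otimes>\<^bsub>H\<^esub> y') = b x y \<otimes>\<^bsub>K\<^esub> b x y'"
 shows "biadditive G H K b"
 unfolding biadditive_def by (intro conjI ballI homI) (simp_all add: assms)

locale tensor_pair =
 fixes G :: "('a, 'x) monoid_scheme" and H :: "('b, 'y) monoid_scheme"
 assumes grG: "group G" and grH: "group H"
begin

abbreviation "T \<equiv> tensor_group G H"
abbreviation "te \<equiv> tensor_elt G H"
abbreviation "GH \<equiv> carrier G \<times> carrier H"

sublocale tp: presentation "carrier G \<times> carrier H" "tensor_rels G H"
 by unfold_locales
 (auto simp: tensor_rels_def monoid.m_closed[OF group.is_monoid[OF grG]] monoid.m_closed[OF group.is_monoid[OF grH]] intro!: fr_diff)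

lemma comm_group_T: "comm_group T"
 unfolding tensor_group_def by (rule tp.comm_group_presented)

lemma te_cls: "te x y = cls GH (tensor_rels G H) (fo (x, y))"
 by (simp add: tensor_elt_def presented_gen_cls)

lemma te_biadditive: "biadditive G H T te"
proof (rule biadditiveI)
 fix x y assume xy: "x : carrier G" "y : carrier H"
 show "te x y : carrier T" using xy by (simp add: te_cls tensor_group_def)
 have *: "te a b = te a1 b1 \<otimes>\<^bsub>T\<^esub> te a2 b2"
 if "fo (a, b) - fo (a1, b1) - fo (a2, b2) : tensor_rels G H" "(a, b) : GH" "(a1, b1) : GH" "(a2, b2) : GH" for a b a1 b1 a2 b2
 unfolding te_cls tensor_group_def
 using gsp_base[OF that(1)] that by (simp add: tp.cls_mult tp.cls_eq_iff fr_add fr_diff diff_diff_eq)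
 show "te (x \<otimes>\<^bsub>G\<^esub> x') y = te x y \<otimes>\<^bsub>T\<^esub> te x' y" if x': "x' : carrier G" for x'
 by (rule *) (use xy x' monoid.m_closed[OF group.is_monoid[OF grG]] in \<open>auto simp: tensor_rels_def\<close>)
 show "te x (y \<otimes>\<^bsub>H\<^esub> y') = te x y \<otimes>\<^bsub>T\<^esub> te x y'" if y': "y' : carrier H" for y'
 by (rule *) (use xy y' monoid.m_closed[OF group.is_monoid[OF grH]] in \<open>auto simp: tensor_rels_def\<close>)
qed

context
 fixes K :: "('k, 'z) monoid_scheme" and b
 assumes K: "comm_group K" and b: "biadditive G H K b"
begin

lemma biadditive_Pi: "(%(x, y). b x y) : GH \<rightarrow> carrier K"
 using biadditiveD(1)[OF b] by auto

lemma biadditive_rels: "r : tensor_rels G H ==> fev K (%(x, y). b x y) r = \<one>\<^bsub>K\<^esub>"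
proof -
 interpret K: comm_group K by (rule K)
 note f = K.fev_diff[OF biadditive_Pi] and o = K.fev_of[where b = "%(x, y). b x y"]
 have *: "fev K (%(x, y). b x y) (fo s - fo s1 - fo s2) = \<one>\<^bsub>K\<^esub>"
 if "s : GH" "s1 : GH" "s2 : GH" "(case s of (x, y) => b x y) = (case s1 of (x, y) => b x y) \<otimes>\<^bsub>K\<^esub> (case s2 of (x, y) => b x y)" for s s1 s2
 proof -
 have c: "(case s of (x, y) => b x y) : carrier K" "(case s1 of (x, y) => b x y) : carrier K" "(case s2 of (x, y) => b x y) : carrier K"
 using biadditive_Pi that(1-3) by blast+
 have "fev K (%(x, y). b x y) (fo s - fo s1 - fo s2)
 = (case s of (x, y) => b x y) \<otimes>\<^bsub>K\<^esub> inv\<^bsub>K\<^esub> (case s1 of (x, y) => b x y) \<otimes>\<^bsub>K\<^esub> inv\<^bsub>K\<^esub> (case s2 of (x, y) => b x y)"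
 using that(1-3) c by (simp add: f o fr_diff)
 then show ?thesis using K.mult_inv_cancel[OF c(2,3)] that(4) by simp
 qed
 have m: "!!x x'. x : carrier G ==> x' : carrier G ==> x \<otimes>\<^bsub>G\<^esub> x' : carrier G" "!!x x'. x : carrier H ==> x' : carrier H ==> x \<otimes>\<^bsub>H\<^esub> x' : carrier H"
 using monoid.m_closed[OF group.is_monoid[OF grG]] monoid.m_closed[OF group.is_monoid[OF grH]] by auto
 assume "r : tensor_rels G H"
 then consider x x' y where "x : carrier G" "x' : carrier G" "y : carrier H" "r = fo (x \<otimes>\<^bsub>G\<^esub> x', y) - fo (x, y) - fo (x', y)"
 | x y y' where "x : carrier G" "y : carrier H" "y' : carrier H" "r = fo (x, y \<otimes>\<^bsub>H\<^esub> y') - fo (x, y) - fo (x, y')"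
 unfolding tensor_rels_def by blast
 then show ?thesis
 proof cases
 case 1
 then show ?thesis using biadditiveD(2)[OF b] m by (intro *[of "(x \<otimes>\<^bsub>G\<^esub> x', y)" "(x, y)" "(x', y)", folded 1(4)]) auto
 next
 case 2
 then show ?thesis using biadditiveD(3)[OF b] m by (intro *[of "(x, y \<otimes>\<^bsub>H\<^esub> y')" "(x, y)" "(x, y')", folded 2(4)]) auto
 qed
qed

lemma tensor_lift_cls: "c : fr GH ==> tensor_lift K b (cls GH (tensor_rels G H) c) = fev K (%(x, y). b x y) c"
 unfolding tensor_lift_def by (rule comm_group.presented_ext_cls[OF K tp.rels biadditive_Pi biadditive_rels])

lemma tensor_lift_elt: "x : carrier G ==> y : carrier H ==> tensor_lift K b (te x y) = b x y"
 using tensor_lift_cls[of "fo (x, y)"] comm_group.fev_of[OF K, where b = "%(x, y). b x y" and s = "(x, y)"] biadditiveD(1)[OF b]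
 by (simp add: te_cls)

lemma tensor_lift_hom: "tensor_lift K b : hom T K"
proof (rule homI)
 interpret K: comm_group K by (rule K)
 fix s assume "s : carrier T"
 then obtain c where c: "c : fr GH" "s = cls GH (tensor_rels G H) c" by (auto simp: tensor_group_def tp.carrier_presented)
 show "tensor_lift K b s : carrier K" using K.fev_closed[OF biadditive_Pi c(1)] c by (simp add: tensor_lift_cls)
 fix t assume "t : carrier T"
 then obtain d where d: "d : fr GH" "t = cls GH (tensor_rels G H) d" by (auto simp: tensor_group_def tp.carrier_presented)
 show "tensor_lift K b (s \<otimes>\<^bsub>T\<^esub> t) = tensor_lift K b s \<otimes>\<^bsub>K\<^esub> tensor_lift K b t"
 using c d K.fev_add[OF biadditive_Pi c(1) d(1)] by (simp add: tensor_lift_cls tensor_group_def tp.cls_mult fr_add)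
qed

end

lemma tensor_hom_eq:
 assumes K: "comm_group K" and h: "h : hom T K" "h' : hom T K"
 and e: "!!x y. x : carrier G ==> y : carrier H ==> h (te x y) = h' (te x y)" and t: "t : carrier T"
 shows "h t = h' t"
proof -
 obtain c where c: "c : fr GH" "t = cls GH (tensor_rels G H) c" using t by (auto simp: tensor_group_def tp.carrier_presented)
 note q = tp.cls_hom[folded tensor_group_def]
 have "(h \<circ> cls GH (tensor_rels G H)) c = (h' \<circ> cls GH (tensor_rels G H)) c"
 by (rule comm_group.hom_free_eq[OF K hom_compose[OF q h(1)] hom_compose[OF q h(2)] _ c(1)])
 (use e in \<open>auto simp: te_cls\<close>)
 then show ?thesis by (simp add: c)
qed

end

locale gmod2 = s: gmod G M \<rho> + t: gmod H M' \<sigma>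
 for G :: "('g, 'y) monoid_scheme" and M :: "'m monoid" and \<rho>
 and H :: "('h, 'z) monoid_scheme" and M' :: "'n monoid" and \<sigma>
begin

sublocale tensor_pair M M' by unfold_locales

abbreviation "tact \<equiv> tensor_act M \<rho> M' \<sigma>"

lemma act_biadditive: "g : carrier G ==> h : carrier H ==> biadditive M M' T (%x y. te (\<rho> g x) (\<sigma> h y))"
 by (rule biadditiveI) (auto simp: biadditiveD[OF te_biadditive] s.rho_mult t.rho_mult)

lemma tact_elt: "g : carrier G ==> h : carrier H ==> x : carrier M ==> y : carrier M' ==>
 tact (g, h) (te x y) = te (\<rho> g x) (\<sigma> h y)"
 unfolding tensor_act_def using tensor_lift_elt[OF comm_group_T act_biadditive] by simp

lemma tact_hom: "g : carrier G ==> h : carrier H ==> tact (g, h) : hom T T"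
 unfolding tensor_act_def using tensor_lift_hom[OF comm_group_T act_biadditive] by simp

lemma gmod_tensor: "g_module (G \<times>\<times> H) T tact"
 unfolding g_module_def
proof (intro conjI ballI)
 show "group (G \<times>\<times> H)" by (rule DirProd_group[OF s.G.is_group t.G.is_group])
 show "comm_group T" by (rule comm_group_T)
 fix u assume u: "u : carrier (G \<times>\<times> H)"
 show "tact u : hom T T" using u tact_hom by (cases u) auto
 fix v t assume v: "v : carrier (G \<times>\<times> H)" and t: "t : carrier T"
 obtain g h g' h' where e: "u = (g, h)" "v = (g', h')" by (cases u; cases v)
 have c: "g : carrier G" "h : carrier H" "g' : carrier G" "h' : carrier H" using u v e by auto
 have m: "g \<otimes>\<^bsub>G\<^esub> g' : carrier G" "h \<otimes>\<^bsub>H\<^esub> h' : carrier H" using c by auto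
 have "tact (g \<otimes>\<^bsub>G\<^esub> g', h \<otimes>\<^bsub>H\<^esub> h') t = (tact (g, h) \<circ> tact (g', h')) t"
 by (rule tensor_hom_eq[OF comm_group_T tact_hom[OF m] hom_compose[OF tact_hom[OF c(3,4)] tact_hom[OF c(1,2)]] _ t])
 (simp add: tact_elt c m s.rho_comp t.rho_comp)
 then show "tact (u \<otimes>\<^bsub>G \<times>\<times> H\<^esub> v) t = tact u (tact v t)" by (simp add: e)
next
 fix t assume t: "t : carrier T"
 have "tact (\<one>\<^bsub>G\<^esub>, \<one>\<^bsub>H\<^esub>) t = (%x. x) t"
 by (rule tensor_hom_eq[OF comm_group_T tact_hom[OF s.G.one_closed t.G.one_closed] _ _ t]) (auto simp: tact_elt hom_def)
 then show "tact \<one>\<^bsub>G \<times>\<times> H\<^esub> t = t" by simp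
qed

sublocale p: gmod "G \<times>\<times> H" T tact by unfold_locales (rule gmod_tensor)

lemma gmod_map_te: "a : carrier M ==> gmod_map H M' \<sigma> (G \<times>\<times> H) T tact (Pair \<one>\<^bsub>G\<^esub>) (te a)"
proof unfold_locales
 assume a: "a : carrier M"
 show "Pair \<one>\<^bsub>G\<^esub> : hom H (G \<times>\<times> H)" by (rule homI) auto
 show "te a : hom M' T" using te_biadditive a by (simp add: biadditive_def)
 show "te a (\<sigma> g m) = tact (\<one>\<^bsub>G\<^esub>, g) (te a m)" if "g : carrier H" "m : carrier M'" for g m
 using that a tact_elt[of "\<one>\<^bsub>G\<^esub>" g a m] by simp
qed

text \<open>A chain of degree 0 has one coefficient, at the empty word, and shuffling with the empty
  word just pairs each letter with the unit. The cross product is thus the map induced by h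
  \<mapsto> (1, h) and n \<mapsto> m \<otimes> n.\<close>

lemma cross_chain_0:
 assumes x: "x : carrier (s.BC 0)" and y: "y : carrier (t.BC q)"
 shows "cross_chain G M H M' 0 q x y = bar_ext H q (p.BC q) (%v n. bar_symbol (G \<times>\<times> H) T (map (Pair \<one>\<^bsub>G\<^esub>) v) (te (x []) n)) y"
proof -
 interpret K: comm_group "p.BC q" by (rule p.cgBC)
 have a: "x [] : carrier M" using x by (auto simp: s.carrier_BC bar_words_def)
 interpret k: gmod_map H M' \<sigma> "G \<times>\<times> H" T tact "Pair \<one>\<^bsub>G\<^esub>" "te (x [])" by (rule gmod_map_te[OF a])
 let ?F = "%w m. bar_ext H q (p.BC q) (%v n. foldr (%(s, u) a. bar_symbol (G \<times>\<times> H) T u (te m n) [^]\<^bsub>p.BC q\<^esub> s \<otimes>\<^bsub>p.BC q\<^esub> a)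
 (signed_shuffles \<one>\<^bsub>G\<^esub> \<one>\<^bsub>H\<^esub> w v) \<one>\<^bsub>p.BC q\<^esub>) y"
 have yc: "y v : carrier M'" if "v : t.Wd q" for v using y that by (auto simp: t.carrier_BC)
 have sc: "bar_symbol (G \<times>\<times> H) T (map (Pair \<one>\<^bsub>G\<^esub>) v) (te (x []) (y v)) : carrier (p.BC q)" if "v : t.Wd q" for v
 using hom_in_carrier[OF k.sym_map_hom[OF that] yc[OF that]] .
 have "?F [] (x []) = k.bmap q y"
 unfolding k.bmap_def bar_ext_def
 by (rule K.gfinprod_cong) (use sc in \<open>auto simp: simp_implies_def\<close>)
 moreover have "gfinprod (p.BC q) (%w. ?F w (x w)) (bar_words G 0) = ?F [] (x [])"
 proof -
 have "bar_words G 0 = {[]}" by (auto simp: bar_words_def)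
 moreover have "?F [] (x []) : carrier (p.BC q)" using calculation \<open>?F [] (x []) = k.bmap q y\<close> hom_in_carrier[OF k.bmap_hom y] by simp
 ultimately show ?thesis by simp
 qed
 ultimately show ?thesis unfolding cross_chain_def Let_def by (simp add: bar_ext_def k.bmap_def)
qed

end

subsection \<open>Homology classes and products in terms of simplicial chains\<close>

context gl_alg begin

sublocale gm: gmod "GL n" "Grp A n" "Act A n" for n
 by unfold_locales (rule gmod)

text \<open>Over \<open>LC\<close> the index and the label carry no information; \<open>un\<close>
  forgets them and \<open>li\<close> restores them.\<close>

definition un :: "('r, 'a, unit) chain => ('r mat list \<times> 'a \<Rightarrow>\<^sub>0 int)" where
 "un = fmap (%(gs, i, a, l). (gs, a))"

definition li :: "nat => ('r mat list \<times> 'a \<Rightarrow>\<^sub>0 int) => ('r, 'a, unit) chain" where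
 "li n = fmap (%(gs, a). (gs, n, a, ()))"

lemma addv_un [simp, intro]: "addv un" by (simp add: un_def)
lemma addv_li [simp, intro]: "addv (li n)" by (simp add: li_def)
lemma un_of [simp]: "un (fo (gs, i, a, l)) = fo (gs, a)" by (simp add: un_def)
lemma li_of [simp]: "li n (fo (gs, a)) = fo (gs, n, a, ())" by (simp add: li_def)

lemma un_chn: "c : chn n q ==> un c : fr (gm.hg n q)"
 unfolding chn_def by (rule addv_fr[OF addv_un]) (auto simp: gens_def gm.hg_def smp_def)

lemma li_chn: "c : fr (gm.hg n q) ==> li n c : chn n q"
 unfolding chn_def by (rule addv_fr[OF addv_li]) (auto simp: gens_def gm.hg_def smp_def)

lemma un_li: "un (li n c) = c"
 by (rule addv_eq[of "%c. un (li n c)"]) (auto simp: addv_def addvD[OF addv_li] addvD[OF addv_un])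

lemma li_un: "c : fr (gens LC n) ==> li n (un c) = c"
 by (rule addv_eq_on[of "%c. li n (un c)"]) (auto simp: addv_def addvD[OF addv_li] addvD[OF addv_un] gens_def)

lemma un_bd: "un (bd c) = bd (un c)"
proof (rule addv_eq[of "%c. un (bd c)"])
 fix s :: "('r, 'a, unit) gen"
 obtain gs i a l where s: "s = (gs, i, a, l)" by (cases s)
 have "un (tens u (i, a, l)) = tens u a" for u
 by (rule addv_eq[of "%u. un (tens u (i, a, l))"]) (auto simp: addv_def addvD[OF addv_un])
 then show "un (bd (fo s)) = bd (un (fo s))" by (simp add: s)
qed (auto simp: addv_def addvD[OF addv_un])

lemma li_bd: "li n (bd c) = bd (li n c)"
proof (rule addv_eq[of "%c. li n (bd c)"])
 fix s :: "'r mat list \<times> 'a"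
 obtain gs a where s: "s = (gs, a)" by (cases s)
 have "li n (tens u a) = tens u (n, a, ())" for u
 by (rule addv_eq[of "%u. li n (tens u a)"]) (auto simp: addv_def addvD[OF addv_li])
 then show "li n (bd (fo s)) = bd (li n (fo s))" by (simp add: s)
qed (auto simp: addv_def addvD[OF addv_li])

lemma li_N: "c : gsp (gm.hrel n q) ==> li n c : N LC n"
 unfolding N_def
proof (rule addv_gsp[OF addv_li, of "gm.hrel n q"])
 fix r assume "r : gm.hrel n q"
 then consider gs a a' where "(gs, a) : gm.hg n q" "a' : Ag n" "r = fo (gs, a \<otimes>\<^bsub>Grp A n\<^esub> a') - fo (gs, a) - fo (gs, a')"
 | gs a h where "(gs, a) : gm.hg n q" "h : GLc n" "r = fo (rmul gs h, a) - fo (gs, Act A n h a)"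
 unfolding gm.hrel_def by auto
 then show "li n r : gsp (rels LC n)"
 proof cases
 case 1
 then have "gs : smp n" "a : Ag n" by (auto simp: gm.hg_def smp_def)
 then show ?thesis using N_add[of gs n n a a' "()" LC] 1 by (simp add: N_def addvD[OF addv_li])
 next
 case 2
 then have "gs : smp n" "a : Ag n" by (auto simp: gm.hg_def smp_def)
 then show ?thesis using N_act[of gs n n h a "()" LC] 2 by (simp add: N_def addvD[OF addv_li])
 qed
qed

text \<open>\<open>N\<close> contains relations with any number of vertices. Projecting to q + 1
  vertices fixes \<open>c\<close> and keeps only relations that belong to
  \<open>hrel q\<close>.\<close>

lemma un_N:
 assumes "c : N LC n" "c : chn n q"
 shows "un c : gsp (gm.hrel n q)"
proof -
 have "un (restr (%x. len x = Suc q) c) : gsp (gm.hrel n q)"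
 proof (rule addv_gsp[where f = "%c. un (restr (%x. len x = Suc q) c)"])
 show "addv (%c. un (restr (%x. len x = Suc q) c))" by (auto simp: addv_def addvD[OF addv_un] addvD[OF addv_restr])
 show "c : gsp (rels LC n)" using assms(1) by (simp add: N_def)
 fix r assume "r : rels LC n"
 then show "un (restr (%x. len x = Suc q) r) : gsp (gm.hrel n q)"
 proof (cases rule: rels_cases)
 case (add gs i a a' l)
 then have i: "i = n" by simp
 show ?thesis
 proof (cases "length gs = Suc q")
 case True
 then have "(gs, a) : gm.hg n q" using add i by (auto simp: gm.hg_def smp_def)
 from gm.hrel_add[OF this, of a'] show ?thesis using add i True by (simp add: addvD[OF addv_restr] addvD[OF addv_un])
 qed (simp add: add addvD[OF addv_restr] addv_zero[OF addv_un])
 next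
 case (act gs h i a l)
 then have i: "i = n" by simp
 show ?thesis
 proof (cases "length gs = Suc q")
 case True
 then have "(gs, a) : gm.hg n q" using act i by (auto simp: gm.hg_def smp_def)
 then have "fo (rmul gs h, a) - fo (gs, Act A n h a) : gsp (gm.hrel n q)"
 using act i by (intro gsp_base) (auto simp: gm.hrel_def)
 then show ?thesis using act i True by (simp add: addvD[OF addv_restr] addvD[OF addv_un])
 qed (simp add: act addvD[OF addv_restr] addv_zero[OF addv_un])
 qed
 qed
 moreover have "restr (%x. len x = Suc q) c = c" using assms(2) unfolding chn_def by (rule restr_id) auto
 ultimately show ?thesis by simp
qed

definition hc :: "nat => nat => ('r, 'a, unit) chain => ('r mat list => 'a) set" where
 "hc n q c = homology_class (gm.BC n) (gm.Bd n) q (gm.bt n q (un c))"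

lemma bt_cyc: "c : cyc n q ==> gm.bt n q (un c) : cycles (gm.BC n) (gm.Bd n) q"
proof -
 assume c: "c : cyc n q"
 then have "c : chn n q" "bd c : N LC n" by (auto simp: cyc_def)
 moreover have "bd c : chn n (q - 1)"
 proof (cases q)
 case 0
 have "c : fr {x. len x = 1}" using calculation(1) unfolding chn_def by (rule fr_mono) (auto simp: 0)
 then show ?thesis by (simp add: bd_len1 chn_closed)
 next
 case (Suc p) then show ?thesis using calculation bd_chn by simp
 qed
 ultimately show ?thesis using gm.bt_cycles[OF un_chn, of c n q] un_N[of "bd c" n "q - 1"] by (simp add: un_bd)
qed

lemma cycle_cyc: "z : cycles (gm.BC n) (gm.Bd n) q ==> \<exists>c\<in>cyc n q. z = gm.bt n q (un c)"
proof -
 assume "z : cycles (gm.BC n) (gm.Bd n) q"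
 then obtain c where c: "c : fr (gm.hg n q)" "z = gm.bt n q c" "bd c : gsp (gm.hrel n (q - 1))" using gm.cycle_bt by blast
 then have "li n c : cyc n q" using li_chn li_N[of "bd c"] by (simp add: cyc_def li_bd)
 then show ?thesis using c by (intro bexI[of _ "li n c"]) (simp_all add: un_li)
qed

lemma gl_homology_eq: "gl_homology A n q = homology (gm.BC n) (gm.Bd n) q"
 by (simp add: gl_homology_def group_homology_def)

lemma carrier_gl_homology: "carrier (gl_homology A n q) = hc n q ` cyc n q"
proof -
 have "carrier (gl_homology A n q) = homology_class (gm.BC n) (gm.Bd n) q ` cycles (gm.BC n) (gm.Bd n) q"
 unfolding gl_homology_eq by (rule gm.bar.carrier_homology)
 also have "cycles (gm.BC n) (gm.Bd n) q = (%c. gm.bt n q (un c)) ` cyc n q"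
 using cycle_cyc bt_cyc by (intro equalityI subsetI) blast+
 finally show ?thesis by (simp add: image_image hc_def)
qed

lemma hc_in: "c : cyc n q ==> hc n q c : carrier (gl_homology A n q)" by (simp add: carrier_gl_homology)

lemma comm_group_gl_homology: "comm_group (gl_homology A n q)"
 unfolding gl_homology_eq by (rule gm.bar.comm_group_homology)

lemma cyc_add: "x : cyc n q ==> y : cyc n q ==> x + y : cyc n q"
 by (simp add: cyc_def chn_closed N_plus)

lemma hc_add: "c : cyc n q ==> c' : cyc n q ==> hc n q (c + c') = hc n q c \<otimes>\<^bsub>gl_homology A n q\<^esub> hc n q c'"
 using gm.bar.class_mult[OF bt_cyc bt_cyc, of c n q c'] gm.bt_add[OF un_chn un_chn, of c n q c'] cyc_chn
 by (simp add: hc_def gl_homology_eq addv_add[OF addv_un])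

lemma boundary_iff: "c : chn n q ==> gm.bt n q (un c) : boundaries (gm.BC n) (gm.Bd n) q \<longleftrightarrow> c : BD n q"
proof -
 assume c: "c : chn n q"
 have "(\<exists>w\<in>fr (gm.hg n (Suc q)). un c - bd w : gsp (gm.hrel n q)) \<longleftrightarrow> (\<exists>w\<in>chn n (Suc q). c - bd w : N LC n)"
 proof
 assume "\<exists>w\<in>fr (gm.hg n (Suc q)). un c - bd w : gsp (gm.hrel n q)"
 then obtain w where w: "w : fr (gm.hg n (Suc q))" "un c - bd w : gsp (gm.hrel n q)" by blast
 have "li n (un c - bd w) = c - bd (li n w)" by (simp add: addvD[OF addv_li] li_bd li_un[OF chn_gens[OF c]])
 then show "\<exists>w\<in>chn n (Suc q). c - bd w : N LC n" using li_N[OF w(2)] li_chn[OF w(1)] by auto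
 next
 assume "\<exists>w\<in>chn n (Suc q). c - bd w : N LC n"
 then obtain w where w: "w : chn n (Suc q)" "c - bd w : N LC n" by blast
 then have "un (c - bd w) : gsp (gm.hrel n q)" using un_N[OF w(2), of q] c bd_chn by (simp add: chn_closed)
 then show "\<exists>w\<in>fr (gm.hg n (Suc q)). un c - bd w : gsp (gm.hrel n q)"
 using un_chn[OF w(1)] by (auto simp: addvD[OF addv_un] un_bd)
 qed
 then show ?thesis using gm.bt_boundaries[OF un_chn[OF c]] BD_iff by simp
qed

lemma hc_eq_iff: "c : cyc n q ==> c' : cyc n q ==> hc n q c = hc n q c' \<longleftrightarrow> c - c' : BD n q"
 unfolding hc_def
 using gm.bar.class_eq_iff[OF bt_cyc bt_cyc, of c n q c'] gm.bt_diff[OF un_chn un_chn, of c n q c'] cyc_chn boundary_iff[of "c - c'" n q]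
 by (simp add: addvD[OF addv_un] chn_closed)

lemma trivial_gl_homology: "trivial_group (gl_homology A n q) \<longleftrightarrow> Hz n q"
 unfolding gl_homology_eq gm.bar.trivial_iff Hz_def
proof
 assume l: "cycles (gm.BC n) (gm.Bd n) q <= boundaries (gm.BC n) (gm.Bd n) q"
 show "cyc n q <= BD n q"
 proof
 fix c assume c: "c : cyc n q"
 show "c : BD n q" using subsetD[OF l bt_cyc[OF c]] boundary_iff[OF cyc_chn[OF c]] by simp
 qed
next
 assume r: "cyc n q <= BD n q"
 show "cycles (gm.BC n) (gm.Bd n) q <= boundaries (gm.BC n) (gm.Bd n) q"
 proof
 fix z assume "z : cycles (gm.BC n) (gm.Bd n) q"
 then obtain c where c: "c : cyc n q" "z = gm.bt n q (un c)" using cycle_cyc by blast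
 show "z : boundaries (gm.BC n) (gm.Bd n) q" using subsetD[OF r c(1)] boundary_iff[OF cyc_chn[OF c(1)]] c(2) by simp
 qed
qed

end

section \<open>The product map on homology in terms of cross products of cycles\<close>

context gl_alg begin

sublocale gg: gmod2 "GL k" "Grp A k" "Act A k" "GL m" "Grp A m" "Act A m" for k m
 by unfold_locales

abbreviation "mlift k m \<equiv> tensor_lift (Grp A (k + m)) (Mul A k m)"

lemma mul_biadditive: "biadditive (Grp A k) (Grp A m) (Grp A (k + m)) (Mul A k m)"
 by (rule biadditiveI) (auto simp: mul_add1 mul_add2)

lemma mlift_elt: "a : Ag k ==> b : Ag m ==> mlift k m (tensor_elt (Grp A k) (Grp A m) a b) = Mul A k m a b"
 by (rule gg.tensor_lift_elt[OF cgA mul_biadditive])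

lemma gmod_map_mlift: "gmod_map (GL k \<times>\<times> GL m) (tensor_group (Grp A k) (Grp A m)) (tensor_act (Grp A k) (Act A k) (Grp A m) (Act A m))
 (GL (k + m)) (Grp A (k + m)) (Act A (k + m)) (%(g, h). block_sum g h) (mlift k m)"
proof (intro gmod_map.intro gmod_map_axioms.intro)
 show "gmod (GL k \<times>\<times> GL m) (tensor_group (Grp A k) (Grp A m)) (tensor_act (Grp A k) (Act A k) (Grp A m) (Act A m))"
 by (rule gg.p.gmod_axioms)
 show "gmod (GL (k + m)) (Grp A (k + m)) (Act A (k + m))" by (rule gm.gmod_axioms)
 show "(%(g, h). block_sum g h) : hom (GL k \<times>\<times> GL m) (GL (k + m))"
 by (rule homI) (auto simp: block_sum_mult)
 show mh: "mlift k m : hom (tensor_group (Grp A k) (Grp A m)) (Grp A (k + m))"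
 by (rule gg.tensor_lift_hom[OF cgA mul_biadditive])
 fix u :: "'r mat \<times> 'r mat" and t assume u: "u : carrier (GL k \<times>\<times> GL m)" and t: "t : carrier (tensor_group (Grp A k) (Grp A m))"
 obtain g h where gh: "u = (g, h)" by (cases u)
 have c: "g : GLc k" "h : GLc m" using u gh by auto
 have "(mlift k m \<circ> tensor_act (Grp A k) (Act A k) (Grp A m) (Act A m) (g, h)) t = (Act A (k + m) (block_sum g h) \<circ> mlift k m) t"
 by (rule gg.tensor_hom_eq[OF cgA hom_compose[OF gg.tact_hom[OF c] mh] hom_compose[OF mh act_hom[OF block_sum_GL[OF c]]] _ t])
 (simp add: gg.tact_elt c mlift_elt mul_act)
 then show "mlift k m (tensor_act (Grp A k) (Act A k) (Grp A m) (Act A m) u t)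
 = Act A (k + m) (case u of (g, h) => block_sum g h) (mlift k m t)" by (simp add: gh)
qed

definition vk :: "nat => 'a => ('r, 'a, unit) chain" where "vk k a = fo ([idm k], k, a, ())"

lemma vk_cyc: "a : Ag k ==> vk k a : cyc k 0"
 by (simp add: vk_def cyc_def chn_def bdl_def)

lemma class_vk: "x : carrier (gm.BC k 0) ==> x [] : Ag k & gm.bt k 0 (un (vk k (x []))) = x"
proof
 assume x: "x : carrier (gm.BC k 0)"
 have W: "gm.Wd k 0 = {[] :: 'r mat list}" by (auto simp: bar_words_def)
 show a: "x [] : Ag k" using x by (auto simp: gm.carrier_BC W)
 have "gm.bt k 0 (un (vk k (x []))) = bar_symbol (GL k) (Grp A k) ([] :: 'r mat list) (x [])"
 using gm.bt_of[of "([idm k], x [])" k 0] a by (simp add: vk_def gm.hg_def gm.bsy_def)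
 also have "... = x"
 proof (rule PiE_ext[where k = "{[] :: 'r mat list}" and s = "%_. Ag k"])
 show "x : (\<Pi>\<^sub>E i\<in>{[]}. Ag k)" using x by (auto simp: gm.carrier_BC W)
 show "bar_symbol (GL k) (Grp A k) ([] :: 'r mat list) (x []) : (\<Pi>\<^sub>E i\<in>{[]}. Ag k)" using a by (auto simp: bar_symbol_def W)
 show "bar_symbol (GL k) (Grp A k) ([] :: 'r mat list) (x []) i = x i" if "i : {[]}" for i using that by (simp add: bar_symbol_def W)
 qed
 finally show "gm.bt k 0 (un (vk k (x []))) = x" .
qed

abbreviation "cc k m i S S' \<equiv> cross_chain (GL k) (Grp A k) (GL m) (Grp A m) 0 i (SOME x. x : S) (SOME y. y : S')"

text \<open>The value of the product map on a pure tensor of classes, with the first class in degree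
  0.\<close>

definition \<theta> :: "nat => nat => nat => ('r mat list => 'a) set => ('r mat list => 'a) set => ('r mat list => 'a) set" where
 "\<theta> k m i S S' = group_homology_map (GL k \<times>\<times> GL m) (GL (k + m)) (Grp A (k + m)) (Act A (k + m)) (%(g, h). block_sum g h) (mlift k m) i
 (group_homology_class (GL k \<times>\<times> GL m) (tensor_group (Grp A k) (Grp A m)) (tensor_act (Grp A k) (Act A k) (Grp A m) (Act A m)) i (cc k m i S S'))"

text \<open>The representatives picked by SOME are replaced by homogeneous cycles, the first one by
  a single symbol \<open>vk k a\<close>. For these the composite is \<open>xp\<close>, which
  respects boundaries in both factors.\<close>

lemma cross_class:
 assumes z: "z : cyc k 0" and w: "w : cyc m i"
 shows "cc k m i (hc k 0 z) (hc m i w) : cycles (gg.p.BC k m) (gg.p.Bd k m) i"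
 and "\<theta> k m i (hc k 0 z) (hc m i w) = hc (k + m) i (xp z w)"
proof -
 define x where "x = (SOME x. x : hc k 0 z)"
 define y where "y = (SOME y. y : hc m i w)"
 have "x : hc k 0 z" unfolding x_def by (rule someI[of _ "gm.bt k 0 (un z)"]) (unfold hc_def, rule gm.bar.class_self[OF bt_cyc[OF z]])
 then have x: "x : cycles (gm.BC k) (gm.Bd k) 0" "homology_class (gm.BC k) (gm.Bd k) 0 x = hc k 0 z"
 unfolding hc_def using gm.bar.class_rep[OF bt_cyc[OF z]] by auto
 have "y : hc m i w" unfolding y_def by (rule someI[of _ "gm.bt m i (un w)"]) (unfold hc_def, rule gm.bar.class_self[OF bt_cyc[OF w]])
 then have y: "y : cycles (gm.BC m) (gm.Bd m) i" "homology_class (gm.BC m) (gm.Bd m) i y = hc m i w"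
 unfolding hc_def using gm.bar.class_rep[OF bt_cyc[OF w]] by auto
 have xc: "x : carrier (gm.BC k 0)" and yc: "y : carrier (gm.BC m i)" using gm.bar.cyc_carrier x y by auto
 define a where "a = x []"
 have a: "a : Ag k" and xa: "gm.bt k 0 (un (vk k a)) = x" using class_vk[OF xc] by (auto simp: a_def)
 have dz: "vk k a - z : BD k 0" using hc_eq_iff[OF vk_cyc[OF a] z] x(2) xa by (simp add: hc_def)
 obtain w' where w': "w' : cyc m i" "y = gm.bt m i (un w')" using cycle_cyc[OF y(1)] by blast
 have dw: "w' - w : BD m i" using hc_eq_iff[OF w'(1) w] y(2) w'(2) by (simp add: hc_def)
 interpret \<kappa>: gmod_map "GL m" "Grp A m" "Act A m" "GL k \<times>\<times> GL m" "tensor_group (Grp A k) (Grp A m)"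
 "tensor_act (Grp A k) (Act A k) (Grp A m) (Act A m)" "Pair (idm k)" "tensor_elt (Grp A k) (Grp A m) a"
 using gg.gmod_map_te[OF a, of m] by simp
 interpret \<pi>: gmod_map "GL k \<times>\<times> GL m" "tensor_group (Grp A k) (Grp A m)" "tensor_act (Grp A k) (Act A k) (Grp A m) (Act A m)"
 "GL (k + m)" "Grp A (k + m)" "Act A (k + m)" "%(g, h). block_sum g h" "mlift k m"
 by (rule gmod_map_mlift)
 have cc: "cc k m i (hc k 0 z) (hc m i w) = \<kappa>.bmap i y"
 unfolding x_def[symmetric] y_def[symmetric] using gg.cross_chain_0[OF xc yc] by (simp add: \<kappa>.bmap_def flip: a_def)
 show cy: "cc k m i (hc k 0 z) (hc m i w) : cycles (gg.p.BC k m) (gg.p.Bd k m) i"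
 unfolding cc by (rule \<kappa>.bmap_cycles[OF y(1)])
 have wf: "un w' : fr (gm.hg m i)" using un_chn cyc_chn w' by blast
 have "\<pi>.hmap (\<kappa>.hmap (un w')) = un (xp (vk k a) w')"
 proof (rule addv_eq_on[of "%c. \<pi>.hmap (\<kappa>.hmap (un c))"])
 show "w' : fr {x : gens LC m. len x = Suc i}" using cyc_chn[OF w'(1)] by (simp add: chn_def)
 fix s assume s: "s : {x : gens LC m. len x = Suc i}"
 obtain gs b where s': "s = (gs, m, b, ())" "gs : smp m" "b : Ag m" using s by (cases s) auto
 have "(%(g, h). block_sum g h) \<circ> Pair (idm k) = block_sum (idm k :: 'r mat)" by (rule ext) simp
 moreover have "gs ~= []" using s' by (simp add: smp_def)
 ultimately show "\<pi>.hmap (\<kappa>.hmap (un (fo s))) = un (xp (vk k a) (fo s))"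
 using mlift_elt[OF a s'(3)] by (simp add: s' \<pi>.hmap_def \<kappa>.hmap_def vk_def sh_single_left)
 qed (auto simp: addv_def addvD[OF addv_un] \<pi>.hmap_def \<kappa>.hmap_def)
 then have "\<pi>.bmap i (\<kappa>.bmap i y) = gm.bt (k + m) i (un (xp (vk k a) w'))"
 using \<kappa>.bmap_bt[OF wf] \<pi>.bmap_bt[OF \<kappa>.hmap_hg[OF wf]] w'(2) by simp
 then have 1: "\<theta> k m i (hc k 0 z) (hc m i w) = hc (k + m) i (xp (vk k a) w')"
 using \<pi>.homology_map_class[OF cy] unfolding \<theta>_def cc by (simp add: group_homology_class_def hc_def)
 have "xp (vk k a) w' - xp z w = xp (vk k a - z) w' + xp z (w' - w)" by simp
 moreover have "xp (vk k a - z) w' : BD (k + m) (0 + i)" by (rule BD_xp[OF dz w'(1)])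
 moreover have "xp z (w' - w) : BD (k + m) (0 + i)" by (rule BD_xp2[OF z dw])
 ultimately have "xp (vk k a) w' - xp z w : BD (k + m) i" using BD_add[of "xp (vk k a - z) w'" "k + m" i "xp z (w' - w)"] by simp
 then show "\<theta> k m i (hc k 0 z) (hc m i w) = hc (k + m) i (xp z w)"
 unfolding 1 using hc_eq_iff[of "xp (vk k a) w'" "k + m" i "xp z w"] xp_cyc[OF vk_cyc[OF a] w'(1)] xp_cyc[OF z w] by simp
qed

lemma theta_biadditive: "biadditive (gl_homology A k 0) (gl_homology A m i) (gl_homology A (k + m) i) (\<theta> k m i)"
proof -
 have x: "xp z w : cyc (k + m) i" if "z : cyc k 0" "w : cyc m i" for z w using xp_cyc[OF that] by simp
 show ?thesis
 by (rule biadditiveI) (auto simp: carrier_gl_homology cross_class(2) x cyc_add simp flip: hc_add)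
qed

definition PL :: "nat => nat => nat => ('r, 'a, unit) chain set" where
 "PL k m i = gsp {xp z w | z w. z : cyc k 0 & w : cyc m i}"

lemma PL_cyc: "s : PL k m i ==> s : cyc (k + m) i"
 unfolding PL_def
proof (induction rule: gsp.induct)
 case gsp_zero show ?case by (simp add: cyc_def chn_closed)
next
 case (gsp_base x) then show ?case using xp_cyc[of _ k 0 _ m i] by auto
qed (rule cyc_closed)

lemma product_image:
 "product_map A k m 0 i ` carrier (tensor_group (gl_homology A k 0) (gl_homology A m i)) = hc (k + m) i ` PL k m i"
proof -
 let ?E = "gl_homology A k 0" and ?H = "gl_homology A m i" and ?K = "gl_homology A (k + m) i"
 interpret h: tensor_pair ?E ?H
 by (intro tensor_pair.intro comm_group.axioms(2)[OF comm_group_gl_homology])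
 interpret K: comm_group ?K by (rule comm_group_gl_homology)
 interpret \<pi>: gmod_map "GL k \<times>\<times> GL m" "tensor_group (Grp A k) (Grp A m)" "tensor_act (Grp A k) (Act A k) (Grp A m) (Act A m)"
 "GL (k + m)" "Grp A (k + m)" "Act A (k + m)" "%(g, h). block_sum g h" "mlift k m"
 by (rule gmod_map_mlift)
 let ?P = "group_homology (GL k \<times>\<times> GL m) (tensor_group (Grp A k) (Grp A m)) (tensor_act (Grp A k) (Act A k) (Grp A m) (Act A m)) i"
 let ?b = "%S S'. group_homology_class (GL k \<times>\<times> GL m) (tensor_group (Grp A k) (Grp A m)) (tensor_act (Grp A k) (Act A k) (Grp A m) (Act A m)) i (cc k m i S S')"
 let ?h = "group_homology_map (GL k \<times>\<times> GL m) (GL (k + m)) (Grp A (k + m)) (Act A (k + m)) (%(g, h). block_sum g h) (mlift k m) i"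
 interpret P: comm_group ?P unfolding group_homology_def by (rule gg.p.bar.comm_group_homology)
 have hh: "?h : hom ?P ?K" unfolding gl_homology_def by (rule \<pi>.homology_map_hom)
 have bP: "(%(S, S'). ?b S S') : h.GH \<rightarrow> carrier ?P"
 using gg.p.bar.class_in[OF cross_class(1)] by (auto simp: carrier_gl_homology group_homology_class_def group_homology_def)
 define ev where "ev = fev ?K (%(S, S'). \<theta> k m i S S')"
 \<comment> \<open>The definition evaluates the cross product at an arbitrary representative c' of
   the tensor. Biadditivity is available for \<open>\<theta>\<close>, that is, after passing to
   GL_{k+m}; so c' and c are compared only there.\<close>
 have pm: "product_map A k m 0 i (cls h.GH (tensor_rels ?E ?H) c) = ev c" if c: "c : fr h.GH" for c
 proof -
 let ?t = "cls h.GH (tensor_rels ?E ?H) c"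
 define c' where "c' = (SOME c'. c' : ?t)"
 have "c' : ?t" unfolding c'_def by (rule someI[of _ c]) (simp add: h.tp.mem_cls)
 then have d: "c' - c : gsp (tensor_rels ?E ?H)" by (simp add: h.tp.mem_cls)
 then have "c' - c : fr h.GH" using gsp_fr[OF h.tp.rels] by auto
 then have c'S: "c' : fr h.GH" using fr_add[OF _ c, of "c' - c"] by simp
 have "?h (fev ?P (%(S, S'). ?b S S') c') = ev c'"
 proof -
 have "(?h \<circ> fev ?P (%(S, S'). ?b S S')) (fo s) = (case s of (S, S') => \<theta> k m i S S')" if "s : h.GH" for s
 proof -
 have "fev ?P (%(S, S'). ?b S S') (fo s) = (case s of (S, S') => ?b S S')"
 by (rule P.fev_of) (use bP that in blast)
 then show ?thesis by (cases s) (simp add: \<theta>_def)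
 qed
 from K.hom_eq_fev[OF hom_compose[OF P.fev_hom[OF bP] hh] c'S this] show ?thesis by (simp add: ev_def)
 qed
 moreover have "product_map A k m 0 i ?t = ?h (fev ?P (%(S, S'). ?b S S') c')"
 by (simp add: product_map_def cross_product_def tensor_lift_def presented_ext_def Let_def c'_def fev_def)
 moreover have "ev c' = ev c"
 using h.tensor_lift_cls[OF K.comm_group_axioms theta_biadditive c'S] h.tensor_lift_cls[OF K.comm_group_axioms theta_biadditive c]
 h.tp.cls_eq_iff[OF c'S c] d by (simp add: ev_def)
 ultimately show ?thesis by simp
 qed
 note th = h.biadditive_Pi[OF K.comm_group_axioms theta_biadditive]
 have ev0: "ev 0 = hc (k + m) i 0" 
 proof -
 have "(0 :: ('r, 'a, unit) chain) : cyc (k + m) i" by (simp add: cyc_def chn_closed)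
 then have "hc (k + m) i 0 : carrier ?K" "hc (k + m) i 0 = hc (k + m) i 0 \<otimes>\<^bsub>?K\<^esub> hc (k + m) i 0"
 using hc_add[of 0 "k + m" i 0] hc_in by auto
 then show ?thesis using K.l_cancel_one'[of "hc (k + m) i 0" "hc (k + m) i 0"] by (simp add: ev_def K.fev_zero)
 qed
 have hcdiff: "ev c \<otimes>\<^bsub>?K\<^esub> inv\<^bsub>?K\<^esub> ev c' = hc (k + m) i (s - s')"
 if "ev c = hc (k + m) i s" "ev c' = hc (k + m) i s'" "s : cyc (k + m) i" "s' : cyc (k + m) i" for c c' s s'
 using hc_add[OF cyc_closed[OF that(3,4)] that(4)] hc_in[OF that(3)] hc_in[OF that(4)] hc_in[OF cyc_closed[OF that(3,4)]] that(1,2)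
 by (simp add: K.m_assoc)
 have hcof: "ev (fo (hc k 0 z, hc m i w)) = hc (k + m) i (xp z w)" if "z : cyc k 0" "w : cyc m i" for z w
 using K.fev_of[where b = "%(S, S'). \<theta> k m i S S'" and s = "(hc k 0 z, hc m i w)"] cross_class(2)[OF that]
 hc_in[of "xp z w" "k + m" i] xp_cyc[OF that] by (simp add: ev_def)
 have 1: "\<exists>s\<in>PL k m i. ev c = hc (k + m) i s" if "c : fr h.GH" for c
 using that
 proof (induction rule: fr_induct)
 case zero then show ?case using ev0 by (intro bexI[of _ 0]) (simp_all add: PL_def)
 next
 case (of s)
 then obtain z w where "z : cyc k 0" "w : cyc m i" "s = (hc k 0 z, hc m i w)" by (auto simp: carrier_gl_homology)
 then show ?case using hcof by (intro bexI[of _ "xp z w"]) (auto simp: PL_def intro: gsp_base)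
 next
 case (diff c c')
 then obtain s s' where s: "s : PL k m i" "ev c = hc (k + m) i s" "s' : PL k m i" "ev c' = hc (k + m) i s'" by blast
 have "ev (c - c') = ev c \<otimes>\<^bsub>?K\<^esub> inv\<^bsub>?K\<^esub> ev c'" unfolding ev_def by (rule K.fev_diff[OF th diff(1,2)])
 then show ?case using s PL_cyc hcdiff[OF s(2,4)] by (intro bexI[of _ "s - s'"]) (auto simp: PL_def intro: gsp_diff)
 qed
 have 2: "\<exists>c\<in>fr h.GH. ev c = hc (k + m) i s" if "s : PL k m i" for s
 using that unfolding PL_def
 proof (induction rule: gsp.induct)
 case gsp_zero then show ?case using ev0 by auto
 next
 case (gsp_base s)
 then obtain z w where zw: "z : cyc k 0" "w : cyc m i" "s = xp z w" by auto
 then show ?case using hcof[OF zw(1,2)] hc_in by (intro bexI[of _ "fo (hc k 0 z, hc m i w)"]) auto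
 next
 case (gsp_diff s s')
 then obtain c c' where c: "c : fr h.GH" "ev c = hc (k + m) i s" "c' : fr h.GH" "ev c' = hc (k + m) i s'" by blast
 have "s : cyc (k + m) i" "s' : cyc (k + m) i" using gsp_diff(1,2) PL_cyc unfolding PL_def by auto
 moreover have "ev (c - c') = ev c \<otimes>\<^bsub>?K\<^esub> inv\<^bsub>?K\<^esub> ev c'" unfolding ev_def by (rule K.fev_diff[OF th c(1,3)])
 ultimately show ?case using c hcdiff[OF c(2,4)] by (intro bexI[of _ "c - c'"]) (auto intro: fr_diff)
 qed
 have "product_map A k m 0 i ` carrier (tensor_group ?E ?H) = ev ` fr h.GH"
 using pm by (auto simp: tensor_group_def h.tp.carrier_presented image_iff)
 also have "... = hc (k + m) i ` PL k m i" 
 proof (intro equalityI subsetI)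
 fix y assume "y : ev ` fr h.GH"
 then obtain c where "c : fr h.GH" "y = ev c" by blast
 then show "y : hc (k + m) i ` PL k m i" using 1[of c] by blast
 next
 fix y assume "y : hc (k + m) i ` PL k m i"
 then obtain t where t: "t : PL k m i" "y = hc (k + m) i t" by blast
 then obtain c where "c : fr h.GH" "ev c = y" using 2[of t] by blast
 then show "y : ev ` fr h.GH" by blast
 qed
 finally show ?thesis .
qed

lemma product_surjective_iff:
 "product_surjective A k m 0 i \<longleftrightarrow> (\<forall>z\<in>cyc (k + m) i. \<exists>s\<in>PL k m i. z - s : BD (k + m) i)"
 unfolding product_surjective_def product_image add_0_left carrier_gl_homology
proof
 assume e: "hc (k + m) i ` PL k m i = hc (k + m) i ` cyc (k + m) i"
 show "\<forall>z\<in>cyc (k + m) i. \<exists>s\<in>PL k m i. z - s : BD (k + m) i"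
 proof
 fix z assume z: "z : cyc (k + m) i"
 then have "hc (k + m) i z : hc (k + m) i ` PL k m i" using e by auto
 then obtain s where s: "s : PL k m i" "hc (k + m) i z = hc (k + m) i s" by auto
 then show "\<exists>s\<in>PL k m i. z - s : BD (k + m) i" using hc_eq_iff[OF z PL_cyc[OF s(1)]] by auto
 qed
next
 assume r: "\<forall>z\<in>cyc (k + m) i. \<exists>s\<in>PL k m i. z - s : BD (k + m) i"
 show "hc (k + m) i ` PL k m i = hc (k + m) i ` cyc (k + m) i"
 proof
 show "hc (k + m) i ` PL k m i <= hc (k + m) i ` cyc (k + m) i" using PL_cyc by auto
 show "hc (k + m) i ` cyc (k + m) i <= hc (k + m) i ` PL k m i"
 proof
 fix y assume "y : hc (k + m) i ` cyc (k + m) i"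
 then obtain z where z: "z : cyc (k + m) i" "y = hc (k + m) i z" by auto
 then obtain s where s: "s : PL k m i" "z - s : BD (k + m) i" using r by blast
 then show "y : hc (k + m) i ` PL k m i" using hc_eq_iff[OF z(1) PL_cyc[OF s(1)]] z(2) by auto
 qed
 qed
qed

lemma chn1_vk:
 assumes z: "z : cyc k 0" shows "\<exists>a\<in>Ag k. z - vk k a : BD k 0"
proof -
 let ?x = "gm.bt k 0 (un z)"
 have "?x : carrier (gm.BC k 0)" using gm.bt_closed[OF un_chn[OF cyc_chn[OF z]]] .
 from class_vk[OF this] have a: "?x [] : Ag k" "gm.bt k 0 (un (vk k (?x []))) = ?x" by auto
 then have "hc k 0 z = hc k 0 (vk k (?x []))" by (simp add: hc_def)
 then show ?thesis using hc_eq_iff[OF z vk_cyc[OF a(1)]] a(1) by auto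
qed

text \<open>Left translation by the block swap is homotopic to the identity, by a prism.\<close>

lemma block_swap_homotopy:
 assumes a: "a : Ag k" and w: "w : cyc m i" and s: "s : GLc (k + m)"
 shows "xp (vk k a) w - op (%j l gs. fo (map (%g. s * block_sum (idm k) g) gs)) (%j. k + j) (%j b. Mul A k j a b) (%l. l) w : BD (k + m) i"
proof -
 let ?p = "op (%j l. prism (%g. s * block_sum (idm k) g) (block_sum (idm k))) (%j. k + j) (%j b. Mul A k j a b) (%l :: unit. l)"
 let ?f = "op (%j l gs. fo (map (%g. s * block_sum (idm k) g) gs)) (%j. k + j) (%j b. Mul A k j a b) (%l :: unit. l)"
 have wc: "w : fr {x : gens LC m. len x = Suc i}" using cyc_chn[OF w] by (simp add: chn_def)
 have e: "xp (vk k a) w = op (%j l gs. fo (map (block_sum (idm k)) gs)) (%j. k + j) (%j b. Mul A k j a b) (%l. l) w"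
 by (rule addv_eq_on[OF addv_xp2 addv_op wc]) (auto simp: vk_def gens_def smp_def sh_single_left)
 have P: "prism (%g. s * block_sum (idm k) g) (block_sum (idm k)) gs : fr {\<zeta> : smp (k + m). length \<zeta> = Suc (length gs)}" if "gs : smp m" for gs
 proof (rule fr_mono[OF prism_fr])
 have "(%g. s * block_sum (idm k) g) ` set gs \<union> block_sum (idm k) ` set gs <= GLc (k + m)"
 using that s by (auto simp: smp_def)
 moreover have "ys ~= []" if "length ys = Suc (length gs)" for ys :: "'r mat list" using that by auto
 ultimately show "{ys. length ys = Suc (length gs) & set ys <= (%g. s * block_sum (idm k) g) ` set gs \<union> block_sum (idm k) ` set gs}
 <= {\<zeta> : smp (k + m). length \<zeta> = Suc (length gs)}" unfolding smp_def by blast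
 qed
 have pw: "?p w : chn (k + m) (Suc i)"
 unfolding chn_def
 proof (rule addv_fr[OF addv_op wc])
 fix x assume "x : {x : gens LC m. len x = Suc i}"
 then obtain gs b where x: "x = (gs, m, b, ())" "gs : smp m" "b : Ag m" "length gs = Suc i" by (cases x) auto
 show "?p (fo x) : fr {x : gens LC (k + m). len x = Suc (Suc i)}"
 unfolding x(1) op_of by (rule tens_fr[OF P[OF x(2)]]) (use x a in auto)
 qed
 have bN: "?p (bd w) : N LC (k + m)"
 proof (rule op_N[where \<theta> = "%j h. block_sum (idm k) h"])
 show "bd w : N LC m" using w by (simp add: cyc_def)
 show "prism (%g. s * block_sum (idm k) g) (block_sum (idm k)) gs : fr (smp (k + m))" if "gs : smp m" for gs
 by (rule fr_mono[OF P[OF that]]) auto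
 fix gs :: "'r mat list" and j and l :: unit and h :: "'r mat" assume g: "gs : smp m" "j <= m" "l : LC (m - j)" "h : GLc j"
 then have j: "j = m" by simp
 show "prism (%g. s * block_sum (idm k) g) (block_sum (idm k)) (rmul gs (block_sum h (idm (m - j))))
 = fmap (%gs. rmul gs (block_sum (block_sum (idm k) h) (idm (k + m - (k + j))))) (prism (%g. s * block_sum (idm k) g) (block_sum (idm k)) gs)"
 proof (rule prism_equivariant)
 fix x assume "x : set gs"
 then have x: "x : GLc m" "h : GLc m" using g j by (auto simp: smp_def)
 then have "block_sum (idm k) (x * h) = block_sum (idm k) x * block_sum (idm k) h"
 using block_sum_mult[of "idm k" k "idm k" x m h] by simp
 then show "block_sum (idm k) (x * block_sum h (idm (m - j))) = block_sum (idm k) x * block_sum (block_sum (idm k) h) (idm (k + m - (k + j)))"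
 "s * block_sum (idm k) (x * block_sum h (idm (m - j))) = s * block_sum (idm k) x * block_sum (block_sum (idm k) h) (idm (k + m - (k + j)))"
 using x s j GLc_assoc[of s "k + m" "block_sum (idm k) x" "block_sum (idm k) h"] by simp_all
 qed
 qed (use a in \<open>auto simp: mul_add1 mul_act1\<close>)
 have "bd (?p w) = xp (vk k a) w - ?f w - ?p (bd w)"
 unfolding e by (rule op_prism_bd) (rule fr_mono[OF wc], auto simp: gens_def smp_def)
 then have "xp (vk k a) w - ?f w = bd (?p w) + ?p (bd w)" by simp
 then show ?thesis using BD_add[OF BD_bd[OF pw] BD_N[OF bN]] by simp
qed

text \<open>Commutativity expresses b a as the swap applied to a b, up to sign. Balancing moves the
  swap into the simplex as a right translation, and there it passes the block sums to become a left
  translation, which \<open>block_swap_homotopy\<close> removes.\<close>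

lemma commute:
 assumes com: "commutative A \<or> skew_commutative A" and a: "a : Ag k" and w: "w : cyc m i"
 shows "\<exists>e. (e = 1 \<or> e = -1) & xp w (vk k a) - frag_cmul e (xp (vk k a) w) : BD (k + m) i"
proof -
 define s where "s = (block_swap m k :: 'r mat)"
 have s: "s : GLc (k + m)" using block_swap_GL[of m k] by (simp add: s_def add.commute)
 obtain e :: int where e: "e = 1 \<or> e = -1" and
 c: "!!b. b : Ag m ==> Mul A m k b a = Act A (k + m) s (Mul A k m a b) [^]\<^bsub>Grp A (k + m)\<^esub> e"
 proof (cases "commutative A")
 case True
 have "Mul A m k b a = Act A (k + m) s (Mul A k m a b) [^]\<^bsub>Grp A (k + m)\<^esub> (1 :: int)" if b: "b : Ag m" for b
 proof -
 have "Act A (k + m) s (Mul A k m a b) : Ag (k + m)" using a b s by blast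
 moreover have "Mul A m k b a = Act A (m + k) s (Mul A k m a b)"
 using True a b unfolding commutative_def s_def by blast
 ultimately show ?thesis using group.int_pow_1[OF grA] by (simp only: add.commute[of m k])
 qed
 then show ?thesis using that[of 1] by blast
 next
 case False
 then have "skew_commutative A" using com by simp
 moreover have "((-1) ^ (m * k) :: int) = 1 \<or> ((-1) ^ (m * k) :: int) = -1" using neg_one_even_power neg_one_odd_power by blast
 moreover have "Mul A m k b a = Act A (k + m) s (Mul A k m a b) [^]\<^bsub>Grp A (k + m)\<^esub> ((-1) ^ (m * k) :: int)" if b: "b : Ag m" for b
 proof -
 have "Mul A m k b a = Act A (m + k) s (Mul A k m a b) [^]\<^bsub>Grp A (m + k)\<^esub> ((-1) ^ (m * k) :: int)"
 using calculation(1) a b unfolding skew_commutative_def s_def by blast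
 then show ?thesis by (simp only: add.commute[of m k])
 qed
 ultimately show ?thesis using that[of "(-1) ^ (m * k)"] by blast
 qed
 let ?f = "op (%j l gs. fo (map (%g. s * block_sum (idm k) g) gs)) (%j. k + j) (%j b. Mul A k j a b) (%l :: unit. l)"
 have wc: "w : fr {x : gens LC m. len x = Suc i}" using cyc_chn[OF w] by (simp add: chn_def)
 have "xp w (vk k a) - frag_cmul e (?f w) : N LC (k + m)"
 proof (rule addv_cong_N[OF addv_xp1 addv_frag_cmul[OF addv_op] wc])
 fix x assume "x : {x : gens LC m. len x = Suc i}"
 then obtain gs b where x: "x = (gs, m, b, ())" "gs : smp m" "b : Ag m" by (cases x) auto
 let ?g = "map (%g. block_sum g (idm k)) gs"
 have g: "?g : smp (k + m)" using x(2) by (auto simp: smp_def add.commute)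
 have sg: "rmul ?g s = map (%g. s * block_sum (idm k) g) gs"
 proof -
 have "block_sum g (idm k) * s = s * block_sum (idm k) g" if "g : set gs" for g
 proof -
 have "g : carrier_mat m m" using that x(2) by (auto simp: smp_def)
 then show ?thesis unfolding s_def using block_swap_mult_block_sum[of g m "idm k" k] by simp
 qed
 then show ?thesis by simp
 qed
 let ?c = "Mul A k m a b"
 have cc: "?c : Ag (k + m)" "Act A (k + m) s ?c : Ag (k + m)" using a x s by auto
 have l: "xp (fo x) (vk k a) = fo (?g, k + m, Mul A m k b a, ())"
 using x by (simp add: vk_def sh_single_right smp_def add.commute)
 have r: "?f (fo x) = fo (rmul ?g s, k + m, ?c, ())" unfolding sg using x by simp
 have act: "fo (rmul ?g s, k + m, ?c, ()) - fo (?g, k + m, Act A (k + m) s ?c, ()) : N LC (k + m)"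
 using N_act[OF g _ s cc(1), of "()" LC] by simp
 have "fo (?g, k + m, Mul A m k b a, ()) - frag_cmul e (fo (?g, k + m, Act A (k + m) s ?c, ())) : N LC (k + m)"
 proof (cases "e = 1")
 case True
 then show ?thesis using c[OF x(3)] cc grA by (simp add: group.int_pow_1)
 next
 case False
 \<comment> \<open>The sign is an inverse in the coefficient group; additivity against the trivial
   coefficient turns it into a sign of chains.\<close>
 have e': "e = -1" using e False by simp
 have m: "Mul A m k b a = inv\<^bsub>Grp A (k + m)\<^esub> Act A (k + m) s ?c" using c[OF x(3)] cc using group.int_pow_neg[OF grA, of _ "k + m" 1] by (simp add: e' group.int_pow_1[OF grA])
 have "fo (?g, k + m, \<one>\<^bsub>Grp A (k + m)\<^esub>, ()) - fo (?g, k + m, Act A (k + m) s ?c, ()) - fo (?g, k + m, Mul A m k b a, ()) : N LC (k + m)"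
 using N_add[OF g le_refl cc(2), of "Mul A m k b a" "()" LC] cc(2) by (simp add: m)
 moreover have "fo (?g, k + m, \<one>\<^bsub>Grp A (k + m)\<^esub>, ()) : N LC (k + m)" using N_one[OF g le_refl, of "()" LC] by simp
 ultimately have "fo (?g, k + m, \<one>\<^bsub>Grp A (k + m)\<^esub>, ()) - (fo (?g, k + m, \<one>\<^bsub>Grp A (k + m)\<^esub>, ()) - fo (?g, k + m, Act A (k + m) s ?c, ()) - fo (?g, k + m, Mul A m k b a, ())) : N LC (k + m)"
 by (rule N_diff[rotated])
 then show ?thesis by (simp add: e' algebra_simps)
 qed
 from N_diff[OF this N_cmul[OF act, of e]]
 show "xp (fo x) (vk k a) - frag_cmul e (?f (fo x)) : N LC (k + m)"
 unfolding l r by (simp add: addvD[OF addv_frag_cmul[OF addv_id]] del: map_map)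
 qed
 then have "xp w (vk k a) - frag_cmul e (?f w) : BD (k + m) i" by (rule BD_N)
 from BD_diff[OF this BD_cmul[OF block_swap_homotopy[OF a w s], of e]]
 have "xp w (vk k a) - frag_cmul e (xp (vk k a) w) : BD (k + m) i"
 by (simp add: addvD[OF addv_frag_cmul[OF addv_id]])
 then show ?thesis using e by blast
qed

lemma vk_vt: "vk (Suc 0) a = vt a" by (simp add: vk_def vt_def)

text \<open>Products with A_1 from the left and from the right agree up to sign modulo boundaries,
  hence generate the same subgroup of homology.\<close>

lemma product_surjective_RG:
 assumes com: "commutative A \<or> skew_commutative A"
 shows "product_surjective A 1 m 0 i \<longleftrightarrow> RG m i"
proof -
 have lr: "\<exists>s'\<in>PR m i. s - s' : BD (Suc m) i" if "s : PL (Suc 0) m i" for s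
 using that unfolding PL_def
 proof (induction rule: gsp.induct)
 case gsp_zero show ?case by (intro bexI[of _ 0]) (simp_all add: PR_def)
 next
 case (gsp_base s)
 then obtain z w where zw: "z : cyc (Suc 0) 0" "w : cyc m i" "s = xp z w" by auto
 obtain a where a: "a : Ag (Suc 0)" "z - vt a : BD (Suc 0) 0" using chn1_vk[OF zw(1)] by (auto simp: vk_vt)
 obtain e where e: "e = 1 \<or> e = -1" "xp w (vt a) - frag_cmul e (xp (vt a) w) : BD (Suc m) i"
 using commute[OF com a(1) zw(2)] by (auto simp: vk_vt)
 have 1: "frag_cmul e (xp w (vt a)) - xp (vt a) w : BD (Suc m) i"
 using BD_cmul[OF e(2), of e] e(1) by (auto simp: addvD[OF addv_frag_cmul[OF addv_id]])
 have "xp (z - vt a) w : BD (Suc 0 + m) (0 + i)" by (rule BD_xp[OF a(2) zw(2)])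
 then have "s - xp (vt a) w : BD (Suc m) i" by (simp add: zw)
 from BD_diff[OF this 1] have "s - frag_cmul e (xp w (vt a)) : BD (Suc m) i" by simp
 moreover have "frag_cmul e (xp w (vt a)) : PR m i"
 unfolding PR_def by (rule gsp_cmul, rule gsp.gsp_base) (use a zw in auto)
 ultimately show ?case by blast
 next
 case (gsp_diff s t)
 then obtain s' t' where h: "s' : PR m i" "s - s' : BD (Suc m) i" "t' : PR m i" "t - t' : BD (Suc m) i" by blast
 have "s - t - (s' - t') = (s - s') - (t - t')" by simp
 then have "s - t - (s' - t') : BD (Suc m) i" using BD_diff[OF h(2,4)] by (simp only:)
 then show ?case using h gsp.gsp_diff by (intro bexI[of _ "s' - t'"]) (auto simp: PR_def)
 qed
 have rl: "\<exists>s'\<in>PL (Suc 0) m i. s - s' : BD (Suc m) i" if "s : PR m i" for s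
 using that unfolding PR_def
 proof (induction rule: gsp.induct)
 case gsp_zero show ?case by (intro bexI[of _ 0]) (simp_all add: PL_def)
 next
 case (gsp_base s)
 then obtain w a where wa: "w : cyc m i" "a : Ag (Suc 0)" "s = xp w (vt a)" by auto
 obtain e where e: "xp w (vt a) - frag_cmul e (xp (vt a) w) : BD (Suc m) i"
 using commute[OF com wa(2,1)] by (auto simp: vk_vt)
 moreover have "frag_cmul e (xp (vt a) w) : PL (Suc 0) m i"
 unfolding PL_def by (rule gsp_cmul, rule gsp.gsp_base) (use wa vt_cyc in auto)
 ultimately show ?case using wa by blast
 next
 case (gsp_diff s t)
 then obtain s' t' where h: "s' : PL (Suc 0) m i" "s - s' : BD (Suc m) i" "t' : PL (Suc 0) m i" "t - t' : BD (Suc m) i" by blast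
 have "s - t - (s' - t') = (s - s') - (t - t')" by simp
 then have "s - t - (s' - t') : BD (Suc m) i" using BD_diff[OF h(2,4)] by (simp only:)
 then show ?case using h gsp.gsp_diff by (intro bexI[of _ "s' - t'"]) (auto simp: PL_def)
 qed
 have tr: "x - z : BD (Suc m) i" if "x - y : BD (Suc m) i" "y - z : BD (Suc m) i" for x y z
 using BD_add[OF that] by simp
 have "product_surjective A (Suc 0) m 0 i \<longleftrightarrow> (\<forall>z\<in>cyc (Suc m) i. \<exists>s\<in>PL (Suc 0) m i. z - s : BD (Suc m) i)"
 using product_surjective_iff[of "Suc 0" m i] by simp
 also have "... \<longleftrightarrow> RG m i"
 unfolding RG_def using lr rl tr by meson
 finally show ?thesis by simp
qed

end

subsection \<open>Free modules in terms of chains\<close>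

lemma day_rels_cases [consumes 1, case_names x y h]:
 assumes "r : day_rels M N n"
 obtains g i x x' y where "r = fo (g, i, x \<otimes>\<^bsub>Grp M i\<^esub> x', y) - fo (g, i, x, y) - fo (g, i, x', y)"
 "g : GLc n" "i <= n" "x : carrier (Grp M i)" "x' : carrier (Grp M i)" "y : carrier (Grp N (n - i))"
 | g i x y y' where "r = fo (g, i, x, y \<otimes>\<^bsub>Grp N (n - i)\<^esub> y') - fo (g, i, x, y) - fo (g, i, x, y')"
 "g : GLc n" "i <= n" "x : carrier (Grp M i)" "y : carrier (Grp N (n - i))" "y' : carrier (Grp N (n - i))"
 | g h k i x y where "r = fo (g * block_sum h k, i, x, y) - fo (g, i, Act M i h x, Act N (n - i) k y)"
 "g : GLc n" "i <= n" "h : GLc i" "k : GLc (n - i)" "x : carrier (Grp M i)" "y : carrier (Grp N (n - i))"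
proof -
 have "r : day_rels M N n ==> thesis"
 unfolding day_rels_def
 apply (elim UnE CollectE exE conjE)
 apply (rule that(1), assumption+)
 apply (rule that(2), assumption+)
 apply (rule that(3), assumption+)
 done
 then show thesis using assms by blast
qed

text \<open>The group action, the module action and the maps of tensor products are all of this
  shape, so the three families of relations are checked once for all of them.\<close>

lemma day_rels_map:
 assumes r: "r : day_rels M N n"
 and G: "!!g. g : GLc n ==> G g : GLc n'"
 and \<iota>: "!!i. i <= n ==> \<iota> i <= n' & n' - \<iota> i = n - i"
 and f: "!!i x. i <= n ==> x : carrier (Grp M i) ==> f i x : carrier (Grp M' (\<iota> i))"
 "!!i x x'. i <= n ==> x : carrier (Grp M i) ==> x' : carrier (Grp M i) ==> f i (x \<otimes>\<^bsub>Grp M i\<^esub> x') = f i x \<otimes>\<^bsub>Grp M' (\<iota> i)\<^esub> f i x'"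
 "!!i h x. i <= n ==> h : GLc i ==> x : carrier (Grp M i) ==> f i (Act M i h x) = Act M' (\<iota> i) (\<theta> i h) (f i x)"
 and f': "!!k y. k <= n ==> y : carrier (Grp N k) ==> f' k y : carrier (Grp N' k)"
 "!!k y y'. k <= n ==> y : carrier (Grp N k) ==> y' : carrier (Grp N k) ==> f' k (y \<otimes>\<^bsub>Grp N k\<^esub> y') = f' k y \<otimes>\<^bsub>Grp N' k\<^esub> f' k y'"
 "!!k h y. k <= n ==> h : GLc k ==> y : carrier (Grp N k) ==> f' k (Act N k h y) = Act N' k h (f' k y)"
 and \<theta>: "!!i h. i <= n ==> h : GLc i ==> \<theta> i h : GLc (\<iota> i)"
 "!!g i h k. g : GLc n ==> i <= n ==> h : GLc i ==> k : GLc (n - i) ==> G (g * block_sum h k) = G g * block_sum (\<theta> i h) k"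
 shows "fex (%(g, i, x, y). fo (G g, \<iota> i, f i x, f' (n - i) y)) r : day_rels M' N' n'"
proof -
 note s = G \<iota> f f' \<theta>(1)
 show ?thesis using r
 proof (cases rule: day_rels_cases)
 case (x g i x x' y)
 show ?thesis unfolding day_rels_def
 by (rule UnI1, rule UnI1, rule CollectI, rule exI[of _ "G g"], rule exI[of _ "\<iota> i"], rule exI[of _ "f i x"], rule exI[of _ "f i x'"],
 rule exI[of _ "f' (n - i) y"]) (use x s in \<open>simp add: frag_extend_diff\<close>)
 next
 case (y g i x y y')
 show ?thesis unfolding day_rels_def
 by (rule UnI1, rule UnI2, rule CollectI, rule exI[of _ "G g"], rule exI[of _ "\<iota> i"], rule exI[of _ "f i x"], rule exI[of _ "f' (n - i) y"],
 rule exI[of _ "f' (n - i) y'"]) (use y s in \<open>simp add: frag_extend_diff\<close>)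
 next
 case (h g h k i x y)
 show ?thesis unfolding day_rels_def
 by (rule UnI2, rule CollectI, rule exI[of _ "G g"], rule exI[of _ "\<theta> i h"], rule exI[of _ k], rule exI[of _ "\<iota> i"], rule exI[of _ "f i x"],
 rule exI[of _ "f' (n - i) y"]) (use h s \<theta>(2)[OF h(2-5)] in \<open>simp add: frag_extend_diff\<close>)
 qed
qed

lemma free_object_simps [simp]:
 "carrier (Grp (free_object C) n) = fr (C n \<times> GLc n)" "y \<otimes>\<^bsub>Grp (free_object C) n\<^esub> y' = y + y'"
 "Act (free_object C) n g (fo (b, h)) = fo (b, g * h)" "addv (Act (free_object C) n g)"
 by (simp_all add: free_object_def)

lemma presentation_day:
 assumes "!!i. monoid (Grp M i)" "!!i. monoid (Grp N i)"
 "!!i h x. h : GLc i ==> x : carrier (Grp M i) ==> Act M i h x : carrier (Grp M i)"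
 "!!i h x. h : GLc i ==> x : carrier (Grp N i) ==> Act N i h x : carrier (Grp N i)"
 shows "presentation (day_gens M N n) (day_rels M N n)"
 by unfold_locales (auto simp: day_rels_def day_gens_def assms monoid.m_closed[OF assms(1)] monoid.m_closed[OF assms(2)] intro!: fr_diff)

locale frees = gl_alg A for A :: "('r::comm_ring_1, 'a) gl_monoid" +
 fixes B :: "nat => nat => 'b set"
begin

abbreviation "Dg p \<equiv> day_gens A (free_object (B p))"
abbreviation "Dr p \<equiv> day_rels A (free_object (B p))"
abbreviation "Fm p \<equiv> free_left_module A (B p)"

sublocale pr: presentation "Dg p n" "Dr p n" for p n
 by (rule presentation_day)
 (auto simp: group.is_monoid[OF grA] free_object_def[of "B p"] group.is_monoid[OF group_free_Abelian_group] intro!: fr_extend)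

lemma Fm_Grp: "Grp (Fm p) n = presented (Dg p n) (Dr p n)" by (simp add: free_left_module_def day_tensor_def)

text \<open>A single vertex with label b corresponds to the generator with module entry (b, 1). The
  map \<open>psi\<close> goes back by absorbing the matrix h of an entry (b, h) into the group
  element.\<close>

definition jj :: "('r, 'a, 'b lbl) chain => (('r, 'a, ('b \<times> 'r mat) \<Rightarrow>\<^sub>0 int) day_gen \<Rightarrow>\<^sub>0 int)" where
 "jj = fmap (%(gs, i, a, p, k, b). (hd gs, i, a, fo (b, idm k)))"

definition psi :: "nat => nat => (('r, 'a, ('b \<times> 'r mat) \<Rightarrow>\<^sub>0 int) day_gen \<Rightarrow>\<^sub>0 int) => ('r, 'a, 'b lbl) chain" where
 "psi p n = fex (%(g, i, a, y). fex (%(b, h). fo ([g * block_sum (idm i) h], i, a, p, n - i, b)) y)"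

lemma addv_jj [simp, intro]: "addv jj" by (simp add: jj_def)
lemma addv_psi [simp, intro]: "addv (psi p n)" by (simp add: psi_def)
lemma jj_of [simp]: "jj (fo (gs, i, a, p, k, b)) = fo (hd gs, i, a, fo (b, idm k))" by (simp add: jj_def)
lemma psi_of: "psi p n (fo (g, i, a, y)) = fex (%(b, h). fo ([g * block_sum (idm i) h], i, a, p, n - i, b)) y" by (simp add: psi_def)

lemma gens1_LT_cases:
 assumes "x : gens1 (LT B p) n"
 obtains g i a b where "x = ([g], i, a, p, n - i, b)" "g : GLc n" "i <= n" "a : Ag i" "b : B p (n - i)"
 using assms by (auto simp: gens1_def LT_def)

lemma jj_fr: "c : fr (gens1 (LT B p) n) ==> jj c : fr (Dg p n)"
 by (rule addv_fr[OF addv_jj]) (auto simp: day_gens_def elim!: gens1_LT_cases)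

lemma psi_of_fr:
 assumes "g : GLc n" "i <= n" "a : Ag i" "y : fr (B p (n - i) \<times> GLc (n - i))"
 shows "psi p n (fo (g, i, a, y)) : fr (gens1 (LT B p) n)"
 unfolding psi_of by (rule fr_extend[OF assms(4)]) (use assms in \<open>auto simp: gens1_def\<close>)

lemma psi_fr: "c : fr (Dg p n) ==> psi p n c : fr (gens1 (LT B p) n)"
 by (rule addv_fr[OF addv_psi]) (auto simp: day_gens_def intro!: psi_of_fr)

lemma psi_jj: "c : fr (gens1 (LT B p) n) ==> psi p n (jj c) = c"
 by (rule addv_eq_on[of "%c. psi p n (jj c)"]) (auto simp: addv_def addvD[OF addv_jj] addvD[OF addv_psi] psi_of elim!: gens1_LT_cases)

lemma Dr_add: "g : GLc n ==> i <= n ==> x : Ag i ==> x' : Ag i ==> y : fr (B p (n - i) \<times> GLc (n - i))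
 ==> fo (g, i, x \<otimes>\<^bsub>Grp A i\<^esub> x', y) - fo (g, i, x, y) - fo (g, i, x', y) : gsp (Dr p n)"
 "g : GLc n ==> i <= n ==> x : Ag i ==> y : fr (B p (n - i) \<times> GLc (n - i)) ==> y' : fr (B p (n - i) \<times> GLc (n - i))
 ==> fo (g, i, x, y + y') - fo (g, i, x, y) - fo (g, i, x, y') : gsp (Dr p n)"
 "g : GLc n ==> i <= n ==> h : GLc i ==> k : GLc (n - i) ==> x : Ag i ==> y : fr (B p (n - i) \<times> GLc (n - i))
 ==> fo (g * block_sum h k, i, x, y) - fo (g, i, Act A i h x, Act (free_object (B p)) (n - i) k y) : gsp (Dr p n)"
proof -
 show "fo (g, i, x \<otimes>\<^bsub>Grp A i\<^esub> x', y) - fo (g, i, x, y) - fo (g, i, x', y) : gsp (Dr p n)"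
 if "g : GLc n" "i <= n" "x : Ag i" "x' : Ag i" "y : fr (B p (n - i) \<times> GLc (n - i))"
 by (rule gsp_base, unfold day_rels_def, rule UnI1, rule UnI1, rule CollectI, intro exI conjI, rule refl) (use that in simp_all)
 show "fo (g, i, x, y + y') - fo (g, i, x, y) - fo (g, i, x, y') : gsp (Dr p n)"
 if "g : GLc n" "i <= n" "x : Ag i" "y : fr (B p (n - i) \<times> GLc (n - i))" "y' : fr (B p (n - i) \<times> GLc (n - i))"
 by (rule gsp_base, unfold day_rels_def free_object_simps, rule UnI1, rule UnI2, rule CollectI, intro exI conjI, rule refl) (use that in simp_all)
 show "fo (g * block_sum h k, i, x, y) - fo (g, i, Act A i h x, Act (free_object (B p)) (n - i) k y) : gsp (Dr p n)"
 if "g : GLc n" "i <= n" "h : GLc i" "k : GLc (n - i)" "x : Ag i" "y : fr (B p (n - i) \<times> GLc (n - i))"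
 by (rule gsp_base, unfold day_rels_def, rule UnI2, rule CollectI, intro exI conjI, rule refl) (use that in simp_all)
qed

lemma psi_Dr:
 assumes "r : Dr p n" shows "psi p n r : N (LT B p) n"
proof -
 let ?F = "free_object (B p)"
 show ?thesis using assms
 proof (cases rule: day_rels_cases)
 case (x g i x x' y)
 let ?e = "%x. fex (%(b, h). fo ([g * block_sum (idm i) h], i, x, p, n - i, b))"
 have "?e (x \<otimes>\<^bsub>Grp A i\<^esub> x') y - ?e x y - ?e x' y : N (LT B p) n"
 by (rule addv_fr_N[OF _ x(6)[unfolded free_object_simps]]) (use x in \<open>auto simp: addv_def frag_extend_diff intro!: N_add\<close>)
 then show ?thesis by (simp add: x(1) addvD[OF addv_psi] psi_of)
 next
 case (y g i x y y')
 then show ?thesis by (simp add: addvD[OF addv_psi] psi_of frag_extend_add)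
 next
 case (h g h k i x y)
 have "psi p n (fo (g * block_sum h k, i, x, y)) - psi p n (fo (g, i, Act A i h x, Act ?F (n - i) k y)) : N (LT B p) n"
 unfolding psi_of
 proof (rule addv_fr_N[OF _ h(7)[unfolded free_object_simps]])
 fix s :: "'b \<times> 'r mat" assume "s : B p (n - i) \<times> GLc (n - i)"
 then obtain b l where s: "s = (b, l)" "b : B p (n - i)" "l : GLc (n - i)" by blast
 \<comment> \<open>The factor 1 \<oplus> kl goes into the vertex, and h \<oplus> 1, which commutes
   with it, is left on the right for balancing.\<close>
 have "block_sum h k * block_sum (idm i) l = block_sum (idm i) (k * l) * block_sum h (idm (n - i))"
 using block_sum_mult[of h i "idm i" k "n - i" l] block_sum_mult[of "idm i" i h "k * l" "n - i" "idm (n - i)"] h s by simp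
 then have "g * block_sum h k * block_sum (idm i) l = g * block_sum (idm i) (k * l) * block_sum h (idm (n - i))"
 using GLc_assoc[of g n "block_sum h k" "block_sum (idm i) l"] GLc_assoc[of g n "block_sum (idm i) (k * l)" "block_sum h (idm (n - i))"] h s by simp
 then show "fex (%(b, h'). fo ([g * block_sum h k * block_sum (idm i) h'], i, x, p, n - i, b)) (fo s)
 - fex (%(b, h'). fo ([g * block_sum (idm i) h'], i, Act A i h x, p, n - i, b)) (Act ?F (n - i) k (fo s)) : N (LT B p) n"
 using N_act[of "[g * block_sum (idm i) (k * l)]" n i h x "(p, n - i, b)" "LT B p"] h s by simp
 qed (auto simp: addv_def frag_extend_diff addvD[OF free_object_simps(4)])
 then show ?thesis by (simp add: h(1) addvD[OF addv_psi])
 qed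
qed

lemma jj_N:
 assumes "c : N (LT B p) n" "c : fr (gens1 (LT B p) n)" shows "jj c : gsp (Dr p n)"
proof -
 have "jj (restr (%x. len x = 1) c) : gsp (Dr p n)"
 proof (rule addv_gsp[where f = "%c. jj (restr (%x. len x = 1) c)"])
 show "addv (%c. jj (restr (%x. len x = 1) c))" by (auto simp: addv_def addvD[OF addv_jj] addvD[OF addv_restr])
 show "c : gsp (rels (LT B p) n)" using assms(1) by (simp add: N_def)
 fix r assume "r : rels (LT B p) n"
 then show "jj (restr (%x. len x = 1) r) : gsp (Dr p n)"
 proof (cases rule: rels_cases)
 case (add gs i a a' l)
 then obtain b where l: "l = (p, n - i, b)" "b : B p (n - i)" by (auto simp: LT_def)
 show ?thesis using add l Dr_add(1)[of "hd gs" n i a a' "fo (b, idm (n - i))" p] addv_zero[OF addv_jj]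
 by (simp add: addvD[OF addv_jj] addvD[OF addv_restr])
 next
 case (act gs h i a l)
 then obtain b where l: "l = (p, n - i, b)" "b : B p (n - i)" by (auto simp: LT_def)
 have "hd (rmul gs k) = hd gs * k" for k using act(1) by (simp add: smp_def hd_map)
 then show ?thesis using act l Dr_add(3)[of "hd gs" n i h "idm (n - i)" a "fo (b, idm (n - i))" p] addv_zero[OF addv_jj]
 by (simp add: addvD[OF addv_jj] addvD[OF addv_restr])
 qed
 qed
 moreover have "restr (%x. len x = 1) c = c" using assms(2) by (rule restr_id) (auto simp: gens1_iff)
 ultimately show ?thesis by simp
qed

text \<open>Additivity in the module entry reduces to a single pair (b, h), and balancing with 1
  \<oplus> h normalizes it to (b, 1).\<close>

lemma jj_psi: "c : fr (Dg p n) ==> c - jj (psi p n c) : gsp (Dr p n)"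
proof (rule addv_fr_gsp[of "%c. c - jj (psi p n c)"])
 fix s assume "s : Dg p n"
 then obtain g i a y where s: "s = (g, i, a, y)" "g : GLc n" "i <= n" "a : Ag i" "y : fr (B p (n - i) \<times> GLc (n - i))" by (auto simp: day_gens_def)
 let ?q = "%y. fo (g, i, a, y)"
 have z: "?q 0 : gsp (Dr p n)" using Dr_add(2)[OF s(2-4), of 0 p 0] gsp_minus_iff[of "?q 0"] by simp
 have "?q y - jj (psi p n (?q y)) : gsp (Dr p n)" using s(5)
 proof (induction rule: fr_induct)
 case zero then show ?case using z by (simp add: psi_of addv_zero[OF addv_jj])
 next
 case (of t)
 then obtain b h where t: "t = (b, h)" "b : B p (n - i)" "h : GLc (n - i)" by blast
 show ?case using Dr_add(3)[OF s(2,3) GLc_one t(3) s(4), of "fo (b, idm (n - i))" p] s t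
 gsp_diff_commute[of "?q (fo t)"] by (simp add: psi_of)
 next
 case (diff y y')
 have "?q y - ?q (y - y') - ?q y' : gsp (Dr p n)" using Dr_add(2)[OF s(2-4) fr_diff[OF diff(1,2)] diff(2)] by simp
 from gsp_diff[OF gsp_diff[OF diff(3,4)] this]
 show ?case by (simp add: psi_of frag_extend_diff addvD[OF addv_jj] algebra_simps)
 qed
 then show "fo s - jj (psi p n (fo s)) : gsp (Dr p n)" by (simp add: s)
qed (auto simp: addv_def addvD[OF addv_jj] addvD[OF addv_psi])

text \<open>Identifies the chains of single vertices modulo \<open>N\<close> with the degree n part
  of the p-th free module; see \<open>kk_eq_iff\<close> and \<open>kk_surj\<close>.\<close>

definition kk :: "nat => nat => ('r, 'a, 'b lbl) chain => ('r, 'a, 'b) free_elt" where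
 "kk p n c = cls (Dg p n) (Dr p n) (jj c)"

lemma kk_in [simp]: "c : fr (gens1 (LT B p) n) ==> kk p n c : carrier (Grp (Fm p) n)"
 by (simp add: kk_def Fm_Grp jj_fr)

lemma psi_gsp: "c : gsp (Dr p n) ==> psi p n c : N (LT B p) n"
 unfolding N_def by (rule addv_gsp[OF addv_psi]) (use psi_Dr in \<open>auto simp: N_def\<close>)

lemma kk_eq_iff:
 assumes c: "c : fr (gens1 (LT B p) n)" "c' : fr (gens1 (LT B p) n)"
 shows "kk p n c = kk p n c' \<longleftrightarrow> c - c' : N (LT B p) n"
 unfolding kk_def pr.cls_eq_iff[OF jj_fr[OF c(1)] jj_fr[OF c(2)]] addvD[OF addv_jj, symmetric]
 using jj_N[of "c - c'" p n] psi_gsp[of "jj (c - c')" p n] psi_jj[of "c - c'" p n] fr_diff[OF c] by auto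

lemma kk_surj: "x : carrier (Grp (Fm p) n) ==> \<exists>c\<in>fr (gens1 (LT B p) n). x = kk p n c"
proof -
 assume "x : carrier (Grp (Fm p) n)"
 then obtain c where c: "c : fr (Dg p n)" "x = cls (Dg p n) (Dr p n) c" by (auto simp: Fm_Grp pr.carrier_presented)
 then show ?thesis
 using jj_psi[OF c(1)] pr.cls_eq_iff[OF c(1) jj_fr[OF psi_fr[OF c(1)]]] by (intro bexI[of _ "psi p n c"]) (simp_all add: kk_def psi_fr)
qed

lemma kk_add: "c : fr (gens1 (LT B p) n) ==> c' : fr (gens1 (LT B p) n) ==>
 kk p n c \<otimes>\<^bsub>Grp (Fm p) n\<^esub> kk p n c' = kk p n (c + c')"
 by (simp add: kk_def Fm_Grp pr.cls_mult jj_fr addv_add[OF addv_jj])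

lemma cg_Fm: "comm_group (Grp (Fm p) n)" by (simp add: Fm_Grp pr.comm_group_presented)

lemma kk_0: "kk p n 0 = \<one>\<^bsub>Grp (Fm p) n\<^esub>" by (simp add: kk_def Fm_Grp pr.one_presented addv_zero[OF addv_jj])

lemma kk_one_iff: "c : fr (gens1 (LT B p) n) ==> kk p n c = \<one>\<^bsub>Grp (Fm p) n\<^esub> \<longleftrightarrow> c : N (LT B p) n"
 using kk_eq_iff[of c p n 0] by (simp add: kk_0)

lemma psi_some:
 assumes c: "c : fr (gens1 (LT B p) n)"
 shows "psi p n (SOME t. t : kk p n c) : fr (gens1 (LT B p) n)" "psi p n (SOME t. t : kk p n c) - c : N (LT B p) n"
proof -
 let ?t = "SOME t. t : kk p n c"
 have "?t : kk p n c" by (rule someI[of _ "jj c"]) (simp add: kk_def pr.mem_cls)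
 then have d: "?t - jj c : gsp (Dr p n)" by (simp add: kk_def pr.mem_cls)
 then have "?t - jj c : fr (Dg p n)" using gsp_fr[OF pr.rels] by auto
 from fr_add[OF this jj_fr[OF c]] show "psi p n ?t : fr (gens1 (LT B p) n)" by (simp add: psi_fr)
 show "psi p n ?t - c : N (LT B p) n" using psi_gsp[OF d] by (simp add: addvD[OF addv_psi] psi_jj[OF c])
qed

definition lm :: "'r mat => ('r, 'a, 'b lbl) chain => ('r, 'a, 'b lbl) chain" where
 "lm h = fmap (%(gs, x). (map ((*) h) gs, x))"

lemma addv_lm [simp, intro]: "addv (lm h)" by (simp add: lm_def)
lemma lm_of [simp]: "lm h (fo (gs, x)) = fo (map ((*) h) gs, x)" by (simp add: lm_def)

lemma lm_fr: "h : GLc n ==> c : fr (gens1 (LT B p) n) ==> lm h c : fr (gens1 (LT B p) n)"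
 by (rule addv_fr[OF addv_lm]) (auto simp: gens1_def)

lemma kk_act:
 assumes h: "h : GLc n" and c: "c : fr (gens1 (LT B p) n)"
 shows "Act (Fm p) n h (kk p n c) = kk p n (lm h c)"
proof -
 let ?b = "%(g, i, x, y). fo (h * g, i, x, y)"
 have "Act (Fm p) n h (kk p n c) = cls (Dg p n) (Dr p n) (fex ?b (jj c))"
 unfolding kk_def free_left_module_def day_tensor_def gl_seq.simps gl_left_module.simps
 proof (rule pr.presented_ext_presented[OF pr.rels jj_fr[OF c]])
 show "fex ?b r : gsp (Dr p n)" if "r : Dr p n" for r
 by (rule gsp_base, rule day_rels_map[where G = "(*) h" and \<iota> = "%i. i" and f = "%i x. x" and f' = "%k y. y" and \<theta> = "%i h. h", OF that])
 (use h in \<open>auto simp: GLc_assoc\<close>)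
 qed (use h in \<open>auto simp: day_gens_def day_elt_def presented_gen_cls\<close>)
 also have "fex ?b (jj c) = jj (lm h c)"
 by (rule addv_eq_on[OF _ _ c]) (auto simp: addv_def frag_extend_diff addvD[OF addv_jj] addvD[OF addv_lm] elim!: gens1_LT_cases)
 finally show ?thesis by (simp add: kk_def)
qed

lemma bil1_fr: "i <= n ==> g : GLc n ==> a : Ag i ==> c : fr (gens1 L (n - i)) ==> bil [g] i a c : fr (gens1 L n)"
 using bil_fr[of "[g]" n i a c L] by (auto elim!: fr_mono simp: gens1_iff)

lemma kk_lact:
 assumes a: "a : Ag i" and c: "c : fr (gens1 (LT B p) j)"
 shows "LAct (Fm p) i j a (kk p j c) = kk p (i + j) (bil [idm (i + j)] i a c)"
proof -
 let ?b = "%(g, l, x, y). fo (block_sum (idm i) g, i + l, Mul A i l a x, y)"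
 have "LAct (Fm p) i j a (kk p j c) = cls (Dg p (i + j)) (Dr p (i + j)) (fex ?b (jj c))"
 unfolding kk_def free_left_module_def day_tensor_def gl_seq.simps gl_left_module.simps
 proof (rule pr.presented_ext_presented[OF pr.rels jj_fr[OF c]])
 show "fex ?b r : gsp (Dr p (i + j))" if "r : Dr p j" for r
 proof (rule gsp_base, rule day_rels_map[where G = "block_sum (idm i)" and \<iota> = "%l. i + l" and f = "%l x. Mul A i l a x" and f' = "%k y. y"
 and \<theta> = "%l h. block_sum (idm i) h", OF that])
 fix g h k :: "'r mat" and l assume g: "g : GLc j" "l <= j" "h : GLc l" "k : GLc (j - l)"
 then have "block_sum h k : GLc j" using block_sum_GL[of h l k "j - l"] by simp
 with g show "block_sum (idm i) (g * block_sum h k) = block_sum (idm i) g * block_sum (block_sum (idm i) h) k"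
 using block_sum_mult[of "idm i" i "idm i" g j "block_sum h k"] g by (simp add: block_sum_assoc)
 qed (use a in \<open>auto simp: mul_add1 mul_act1\<close>)
 qed (use a in \<open>auto simp: day_gens_def day_elt_def presented_gen_cls\<close>)
 also have "fex ?b (jj c) = jj (bil [idm (i + j)] i a c)"
 by (rule addv_eq_on[OF _ _ c]) (auto simp: addv_def frag_extend_diff addvD[OF addv_jj] addvD[OF addv_bil] elim!: gens1_LT_cases)
 finally show ?thesis by (simp add: kk_def)
qed

lemma lm_bil: "g : GLc n ==> h : GLc n ==> i <= n ==> c : fr (gens1 L (n - i)) ==> lm g (bil [h] i a c) = bil [g * h] i a c"
 by (rule addv_eq_on[of "%c. lm g (bil [h] i a c)"]) (auto simp: addv_def addvD[OF addv_lm] addvD[OF addv_bil] gens1_def GLc_assoc[of g n h])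

text \<open>Each generator arises from a basis element by the action of A and then of GL_n, so an
  A-linear equivariant map can be computed from basis elements, as in \<open>d_kk\<close>.\<close>

lemma kk_gen:
 assumes "g : GLc n" "i <= n" "a : Ag i" "c : fr (gens1 (LT B p) (n - i))"
 shows "Act (Fm p) n g (LAct (Fm p) i (n - i) a (kk p (n - i) c)) = kk p n (bil [g] i a c)"
 using kk_lact[OF assms(3,4)] kk_act[OF assms(1) bil1_fr[OF assms(2) GLc_one assms(3,4)]] lm_bil[OF assms(1) GLc_one assms(2,4)] assms(1,2) by simp

end

section \<open>Augmentations and resolutions of the unit object\<close>

lemma addv_cmul_int: "addv f ==> f (frag_cmul k c) = k * (f c :: int)"
proof (induction k rule: int_induct[of _ 0])
 case (step1 i) then show ?case using addv_add[of f] by (simp add: frag_cmul_distrib algebra_simps)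
next
 case (step2 i)
 have "frag_cmul (i - 1) c = frag_cmul i c - c" using frag_cmul_distrib[of "i - 1" 1 c] by simp
 then have "f (frag_cmul (i - 1) c) = f (frag_cmul i c) - f c" by (simp only: addvD[OF step2.prems])
 then show ?case using step2 by (simp add: algebra_simps)
qed (simp add: addv_zero)

lemma addv_gsp_0: "addv f ==> (!!r. r : R ==> f r = 0) ==> x : gsp R ==> f x = 0"
 by (rotate_tac 2, induction rule: gsp.induct) (auto simp: addv_zero addvD)

definition ev :: "('s => int) => ('s \<Rightarrow>\<^sub>0 int) => int" where "ev w = fev integer_group w"

lemma addv_ev [simp, intro]: "addv (ev w)"
 unfolding addv_def ev_def
 using comm_group.fev_diff[OF abelian_integer_group, of w UNIV] by (simp add: fr_def)

lemma ev_of [simp]: "ev w (fo s) = w s"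
 unfolding ev_def using comm_group.fev_of[OF abelian_integer_group, of w s] by simp

locale aug_alg = gl_alg A for A :: "('r::comm_ring_1, 'a) gl_monoid" +
 fixes \<epsilon> :: "nat => 'a => int"
 assumes augm: "augmentation A \<epsilon>"
begin

lemma eps_hom: "\<epsilon> n : hom (Grp A n) (unit_grp n)" and eps_act: "g : GLc n ==> a : Ag n ==> \<epsilon> n (Act A n g a) = \<epsilon> n a"
 and eps_unt: "\<epsilon> 0 (Unt A) = 1" and eps_mul: "a : Ag i ==> b : Ag j ==> \<epsilon> (i + j) (Mul A i j a b) = \<epsilon> i a * \<epsilon> j b"
 and eps_surj: "\<epsilon> n ` Ag n = carrier (unit_grp n)" and eps_ker: "a : Ag 0 ==> \<epsilon> 0 a = 0 ==> a = \<one>\<^bsub>Grp A 0\<^esub>"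
proof -
 have m: "monoid_hom A unit_monoid \<epsilon>" and s: "!!n. \<epsilon> n ` Ag n = carrier (unit_grp n)"
 and k: "kernel (Grp A 0) (unit_grp 0) (\<epsilon> 0) = {\<one>\<^bsub>Grp A 0\<^esub>}" using augm by (auto simp: augmentation_def)
 have h: "gl_hom A unit_monoid \<epsilon>" using m by (simp add: monoid_hom_def)
 show "\<epsilon> n : hom (Grp A n) (unit_grp n)" using h by (simp add: gl_hom_def unit_monoid_def)
 show "g : GLc n ==> a : Ag n ==> \<epsilon> n (Act A n g a) = \<epsilon> n a" using h by (simp add: gl_hom_def unit_monoid_def)
 show "\<epsilon> 0 (Unt A) = 1" using m by (simp add: monoid_hom_def unit_monoid_def)
 show "a : Ag i ==> b : Ag j ==> \<epsilon> (i + j) (Mul A i j a b) = \<epsilon> i a * \<epsilon> j b" using m by (simp add: monoid_hom_def unit_monoid_def)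
 show "\<epsilon> n ` Ag n = carrier (unit_grp n)" by (rule s)
 show "a : Ag 0 ==> \<epsilon> 0 a = 0 ==> a = \<one>\<^bsub>Grp A 0\<^esub>" using k by (auto simp: kernel_def unit_grp_def)
qed

lemma eps_add: "a : Ag 0 ==> b : Ag 0 ==> \<epsilon> 0 (a \<otimes>\<^bsub>Grp A 0\<^esub> b) = \<epsilon> 0 a + \<epsilon> 0 b"
 using hom_mult[OF eps_hom[of 0]] by (simp add: unit_grp_def)

lemma eps_pos: "a : Ag i ==> i > 0 ==> \<epsilon> i a = 0"
 using eps_surj[of i] by (auto simp: unit_grp_def singleton_group_def)

lemma comm_group_unit_grp: "comm_group (unit_grp n)"
 by (simp add: unit_grp_def abelian_integer_group)

definition ec :: "('r, 'a, 'l) chain => int" where "ec = ev (%(gs, i, a, l). \<epsilon> 0 a)"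
lemma addv_ec [simp, intro]: "addv ec" by (simp add: ec_def)
lemma ec_of [simp]: "ec (fo (gs, i, a, l)) = \<epsilon> 0 a" by (simp add: ec_def)

lemma ec_N: "c : N L 0 ==> ec c = 0"
proof (rule addv_gsp_0[OF addv_ec])
 fix r assume "r : rels L 0"
 then show "ec r = 0" by (cases rule: rels_cases) (auto simp: addvD[OF addv_ec] eps_add eps_act)
qed (simp add: N_def)

text \<open>GL_0 is trivial, so a chain of single vertices in degree 0 reduces to one symbol; and
  the augmentation is injective on A_0.\<close>

lemma ec_LC: "c : fr (gens1 LC 0) ==> c : N LC 0 \<longleftrightarrow> ec c = 0"
proof
 assume c: "c : fr (gens1 LC 0)" and e: "ec c = 0"
 have "\<exists>a\<in>Ag 0. c - vk 0 a : N LC 0" using c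
 proof (induction rule: fr_induct)
 case zero
 have "vk 0 \<one>\<^bsub>Grp A 0\<^esub> : N LC 0" unfolding vk_def by (rule N_one) auto
 then show ?case by (intro bexI[of _ "\<one>\<^bsub>Grp A 0\<^esub>"]) simp_all
 next
 case (of s)
 then obtain a where "s = ([idm 0], 0, a, ())" "a : Ag 0" by (auto simp: gens1_def GLc_0)
 then show ?case by (intro bexI[of _ a]) (simp_all add: vk_def)
 next
 case (diff c c')
 then obtain a b where ab: "a : Ag 0" "b : Ag 0" "c - vk 0 a : N LC 0" "c' - vk 0 b : N LC 0" by blast
 let ?d = "a \<otimes>\<^bsub>Grp A 0\<^esub> inv\<^bsub>Grp A 0\<^esub> b"
 have d: "?d : Ag 0" "?d \<otimes>\<^bsub>Grp A 0\<^esub> b = a"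
 using ab(1,2) by (auto simp: monoid.m_assoc[OF group.is_monoid[OF grA]] group.l_inv[OF grA] monoid.r_one[OF group.is_monoid[OF grA]])
 have "vk 0 a - vk 0 ?d - vk 0 b : N LC 0" using N_add[of "[idm 0]" 0 0 ?d b "()" LC] ab d by (simp add: vk_def)
 from N_plus[OF N_diff[OF ab(3,4)] this] show ?case using d by (intro bexI[of _ ?d]) (auto simp: algebra_simps)
 qed
 then obtain a where a: "a : Ag 0" "c - vk 0 a : N LC 0" by blast
 then have "\<epsilon> 0 a = 0" using ec_N[OF a(2)] e by (simp add: addvD[OF addv_ec] vk_def)
 then have "vk 0 a : N LC 0" using eps_ker[OF a(1)] N_one[of "[idm 0]" 0 0 "()" LC] by (simp add: vk_def)
 from N_plus[OF a(2) this] show "c : N LC 0" by simp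
qed (rule ec_N)

end

locale free_res = aug_alg A \<epsilon> + frees A B
 for A :: "('r::comm_ring_1, 'a) gl_monoid" and \<epsilon> and B :: "nat => nat => 'b set" +
 fixes d :: "nat => nat => ('r, 'a, 'b) free_elt => ('r, 'a, 'b) free_elt" and \<eta> :: "nat => ('r, 'a, 'b) free_elt => int"
 assumes free: "free_resolution A (unit_left \<epsilon>) B d \<eta>"
begin

lemma d_left: "left_hom A (Fm (Suc p)) (Fm p) (d (Suc p))" and eta_left: "left_hom A (Fm 0) (unit_left \<epsilon>) \<eta>"
 and eta_surj: "\<eta> n ` carrier (Grp (Fm 0) n) = carrier (unit_grp n)"
 and d_ker0: "d (Suc 0) n ` carrier (Grp (Fm (Suc 0)) n) = kernel (Grp (Fm 0) n) (unit_grp n) (\<eta> n)"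
 and d_ker: "d (Suc (Suc p)) n ` carrier (Grp (Fm (Suc (Suc p))) n) = kernel (Grp (Fm (Suc p)) n) (Grp (Fm p) n) (d (Suc p) n)"
 using free by (simp_all add: free_resolution_def Let_def unit_left_def)

lemma d_hom: "d (Suc p) n : hom (Grp (Fm (Suc p)) n) (Grp (Fm p) n)" using d_left by (simp add: left_hom_def gl_hom_def)

lemma d_gen:
 assumes "g : GLc n" "i <= n" "a : Ag i" "x : carrier (Grp (Fm (Suc p)) (n - i))" "LAct (Fm (Suc p)) i (n - i) a x : carrier (Grp (Fm (Suc p)) n)"
 shows "d (Suc p) n (Act (Fm (Suc p)) n g (LAct (Fm (Suc p)) i (n - i) a x)) = Act (Fm p) n g (LAct (Fm p) i (n - i) a (d (Suc p) (n - i) x))"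
proof -
 have "d (Suc p) (i + (n - i)) (LAct (Fm (Suc p)) i (n - i) a x) = LAct (Fm p) i (n - i) a (d (Suc p) (n - i) x)"
 using d_left assms(3,4) unfolding left_hom_def by blast
 then show ?thesis using d_left assms unfolding left_hom_def gl_hom_def by simp
qed

text \<open>A chain representing the differential of a basis element; it has to be chosen, since
  \<open>kk\<close> is injective only modulo relations.\<close>

definition \<delta> :: "'b lbl => ('r, 'a, 'b lbl) chain" where
 "\<delta> = (%(p, k, b). case p of 0 => 0
 | Suc q => (SOME c. c : fr (gens1 (LT B q) k) & kk q k c = d p k (kk p k (inc k (p, k, b)))))"

lemma delta:
 assumes "b : B (Suc p) k"
 shows "\<delta> (Suc p, k, b) : fr (gens1 (LT B p) k)" "kk p k (\<delta> (Suc p, k, b)) = d (Suc p) k (kk (Suc p) k (inc k (Suc p, k, b)))"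
proof -
 have "kk (Suc p) k (inc k (Suc p, k, b)) : carrier (Grp (Fm (Suc p)) k)" by (rule kk_in) (rule inc_fr, use assms in simp)
 then have "\<exists>c\<in>fr (gens1 (LT B p) k). d (Suc p) k (kk (Suc p) k (inc k (Suc p, k, b))) = kk p k c"
 by (intro kk_surj hom_in_carrier[OF d_hom])
 then have "\<exists>c. c : fr (gens1 (LT B p) k) & kk p k c = d (Suc p) k (kk (Suc p) k (inc k (Suc p, k, b)))" by metis
 from someI_ex[OF this] show "\<delta> (Suc p, k, b) : fr (gens1 (LT B p) k)" "kk p k (\<delta> (Suc p, k, b)) = d (Suc p) k (kk (Suc p) k (inc k (Suc p, k, b)))"
 by (auto simp: \<delta>_def)
qed

lemma map_delta: "mapping (LT B (Suc p)) (LT B p) \<delta>"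
 unfolding mapping_def using delta(1) by (auto simp: LT_def)

lemma d_kk:
 assumes c: "c : fr (gens1 (LT B (Suc p)) n)" shows "d (Suc p) n (kk (Suc p) n c) = kk p n (xt \<delta> c)"
proof (rule comm_group.hom_free_eq[OF cg_Fm, of "%c. d (Suc p) n (kk (Suc p) n c)" _ _ _ "%c. kk p n (xt \<delta> c)", OF _ _ _ c])
 have k: "kk (Suc p) n : hom (free_Abelian_group (gens1 (LT B (Suc p)) n)) (Grp (Fm (Suc p)) n)"
 by (rule homI) (simp_all add: kk_add)
 show "(%c. d (Suc p) n (kk (Suc p) n c)) : hom (free_Abelian_group (gens1 (LT B (Suc p)) n)) (Grp (Fm p) n)"
 using hom_compose[OF k d_hom] by (simp add: comp_def)
 show "(%c. kk p n (xt \<delta> c)) : hom (free_Abelian_group (gens1 (LT B (Suc p)) n)) (Grp (Fm p) n)"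
 by (rule homI) (simp_all add: kk_add xt_fr1[OF map_delta])
 fix s assume "s : gens1 (LT B (Suc p)) n"
 then obtain g i a b where s: "s = ([g], i, a, Suc p, n - i, b)" "g : GLc n" "i <= n" "a : Ag i" "b : B (Suc p) (n - i)" by (rule gens1_LT_cases)
 let ?u = "inc (n - i) (Suc p, n - i, b) :: ('r, 'a, 'b lbl) chain"
 have u: "?u : fr (gens1 (LT B (Suc p)) (n - i))" by (rule inc_fr) (use s in simp)
 have e: "fo s = bil [g] i a ?u" using s by (simp add: inc_def)
 have l: "LAct (Fm (Suc p)) i (n - i) a (kk (Suc p) (n - i) ?u) : carrier (Grp (Fm (Suc p)) n)"
 using kk_lact[OF s(4) u] kk_in[OF bil1_fr[OF s(3) GLc_one s(4) u]] s(3) by simp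
 have "d (Suc p) n (kk (Suc p) n (fo s)) = Act (Fm p) n g (LAct (Fm p) i (n - i) a (kk p (n - i) (\<delta> (Suc p, n - i, b))))"
 unfolding e kk_gen[OF s(2-4) u, symmetric] d_gen[OF s(2-4) kk_in[OF u] l] delta(2)[OF s(5)] ..
 also have "... = kk p n (xt \<delta> (fo s))"
 unfolding kk_gen[OF s(2-4) delta(1)[OF s(5)]] by (simp add: s(1))
 finally show "d (Suc p) n (kk (Suc p) n (fo s)) = kk p n (xt \<delta> (fo s))" .
qed

lemma image_xt:
 assumes "kk p n z : d (Suc p) n ` carrier (Grp (Fm (Suc p)) n)" "z : fr (gens1 (LT B p) n)"
 shows "\<exists>w\<in>fr (gens1 (LT B (Suc p)) n). z - xt \<delta> w : N (LT B p) n"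
proof -
 obtain w where w: "w : fr (gens1 (LT B (Suc p)) n)" "kk p n z = d (Suc p) n (kk (Suc p) n w)" using assms(1) kk_surj by blast
 then show ?thesis using kk_eq_iff[OF assms(2) xt_fr1[OF map_delta w(1)]] d_kk[OF w(1)] by auto
qed

lemma exact_Suc: "z : fr (gens1 (LT B (Suc p)) n) ==> xt \<delta> z : N (LT B p) n
 ==> \<exists>w\<in>fr (gens1 (LT B (Suc (Suc p))) n). z - xt \<delta> w : N (LT B (Suc p)) n"
 by (rule image_xt) (simp_all add: d_ker kernel_def d_kk kk_one_iff xt_fr1[OF map_delta])

lemma xt_delta_inc: "b : B (Suc p) k ==> xt \<delta> (inc k (Suc p, k, b)) = \<delta> (Suc p, k, b)"
 using xt_inc[OF delta(1), of b p k \<delta> "(Suc p, k, b)"] by simp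

lemma dd: "b : B (Suc (Suc p)) k ==> xt \<delta> (\<delta> (Suc (Suc p), k, b)) : N (LT B p) k"
proof -
 assume b: "b : B (Suc (Suc p)) k"
 let ?u = "inc k (Suc (Suc p), k, b) :: ('r, 'a, 'b lbl) chain"
 have u: "?u : fr (gens1 (LT B (Suc (Suc p))) k)" by (rule inc_fr) (use b in simp)
 have "d (Suc (Suc p)) k (kk (Suc (Suc p)) k ?u) : kernel (Grp (Fm (Suc p)) k) (Grp (Fm p) k) (d (Suc p) k)"
 unfolding d_ker[symmetric] by (rule imageI) (rule kk_in[OF u])
 then show ?thesis
 using d_kk[OF u] d_kk[OF delta(1)[OF b]] xt_delta_inc[OF b] kk_one_iff[OF xt_fr1[OF map_delta delta(1)[OF b]]] by (simp add: kernel_def)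
qed

lemma kk_eta0: "z : fr (gens1 (LT B 0) n) ==> \<eta> n (kk 0 n z) = \<one>\<^bsub>unit_grp n\<^esub> ==> \<exists>w\<in>fr (gens1 (LT B (Suc 0)) n). z - xt \<delta> w : N (LT B 0) n"
 by (rule image_xt) (simp_all add: d_ker0 kernel_def)

lemma exact_0: "n >= 1 ==> z : fr (gens1 (LT B 0) n) ==> \<exists>w\<in>fr (gens1 (LT B (Suc 0)) n). z - xt \<delta> w : N (LT B 0) n"
proof (rule kk_eta0)
 assume "n >= 1" "z : fr (gens1 (LT B 0) n)"
 then have "\<eta> n (kk 0 n z) : carrier (unit_grp n)" unfolding eta_surj[symmetric] by auto
 then show "\<eta> n (kk 0 n z) = \<one>\<^bsub>unit_grp n\<^esub>" using \<open>n >= 1\<close> by (auto simp: unit_grp_def singleton_group_def)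
qed

definition wt :: "'b => int" where "wt b = \<eta> 0 (kk 0 0 (inc 0 (0, 0, b)))"

lemma aug_gens: "c : fr (gens1 (LT B 0) 0) ==> aug wt c : fr (gens1 LC 0)"
 by (rule addv_fr[OF addv_aug]) (auto simp: aug_def gens1_def LT_def intro!: fr_cmul)

lemma eta_kk:
 assumes c: "c : fr (gens1 (LT B 0) 0)" shows "\<eta> 0 (kk 0 0 c) = ec (aug wt c)"
proof (rule comm_group.hom_free_eq[OF abelian_integer_group, of "%c. \<eta> 0 (kk 0 0 c)" _ "%c. ec (aug wt c)", OF _ _ _ c])
 have k: "kk 0 0 : hom (free_Abelian_group (gens1 (LT B 0) 0)) (Grp (Fm 0) 0)"
 by (rule homI) (simp_all add: kk_add)
 have "\<eta> 0 : hom (Grp (Fm 0) 0) (unit_grp 0)" using eta_left by (simp add: left_hom_def gl_hom_def unit_left_def)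
 then have "\<eta> 0 : hom (Grp (Fm 0) 0) integer_group" by (simp add: unit_grp_def)
 from hom_compose[OF k this] show "(%c. \<eta> 0 (kk 0 0 c)) : hom (free_Abelian_group (gens1 (LT B 0) 0)) integer_group" by (simp add: comp_def)
 show "(%c. ec (aug wt c)) : hom (free_Abelian_group (gens1 (LT B 0) 0)) integer_group"
 by (rule homI) (simp_all add: addv_add[OF addv_ec] addv_add[OF addv_aug])
 fix s assume "s : gens1 (LT B 0) 0"
 then obtain g i a b where "s = ([g], i, a, 0, 0 - i, b)" "g : GLc 0" "i <= 0" "a : Ag i" "b : B 0 (0 - i)" by (rule gens1_LT_cases)
 then have s: "s = ([idm 0], 0, a, 0, 0, b)" "a : Ag 0" "b : B 0 0" by (auto simp: GLc_0)
 let ?u = "inc 0 (0, 0, b) :: ('r, 'a, 'b lbl) chain"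
 have u: "?u : fr (gens1 (LT B 0) 0)" by (rule inc_fr) (use s in simp)
 have e: "fo s = bil [idm (0 + 0)] 0 a ?u" using s by (simp add: inc_def)
 have "\<eta> (0 + 0) (LAct (Fm 0) 0 0 a (kk 0 0 ?u)) = LAct (unit_left \<epsilon> :: ('r, 'a, int) gl_left_module) 0 0 a (\<eta> 0 (kk 0 0 ?u))"
 using eta_left s(2) kk_in[OF u] unfolding left_hom_def by blast
 then have "\<eta> 0 (kk 0 0 (fo s)) = \<epsilon> 0 a * wt b" unfolding e wt_def using kk_lact[OF s(2) u] by (simp add: unit_left_def)
 then show "\<eta> 0 (kk 0 0 (fo s)) = ec (aug wt (fo s))" by (simp add: s(1) aug_def addv_cmul_int[OF addv_ec])
qed

lemma aug_N_iff: "z : fr (gens1 (LT B 0) 0) ==> aug wt z : N LC 0 \<longleftrightarrow> \<eta> 0 (kk 0 0 z) = 0"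
 using ec_LC[OF aug_gens] eta_kk by simp

lemma aug_exact: "z : fr (gens1 (LT B 0) 0) ==> aug wt z : N LC 0 ==> \<exists>w\<in>fr (gens1 (LT B (Suc 0)) 0). z - xt \<delta> w : N (LT B 0) 0"
 by (rule kk_eta0) (simp_all add: aug_N_iff unit_grp_def)

lemma aug_delta: "b : B (Suc 0) 0 ==> aug wt (\<delta> (Suc 0, 0, b)) : N LC 0"
proof -
 assume b: "b : B (Suc 0) 0"
 let ?u = "inc 0 (Suc 0, 0, b) :: ('r, 'a, 'b lbl) chain"
 have u: "?u : fr (gens1 (LT B (Suc 0)) 0)" by (rule inc_fr) (use b in simp)
 have "d (Suc 0) 0 (kk (Suc 0) 0 ?u) : kernel (Grp (Fm 0) 0) (unit_grp 0) (\<eta> 0)"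
 unfolding d_ker0[symmetric] by (rule imageI) (rule kk_in[OF u])
 then show ?thesis using d_kk[OF u] xt_delta_inc[OF b] aug_N_iff[OF delta(1)[OF b]] by (simp add: kernel_def unit_grp_def)
qed

text \<open>A preimage of 1 under the augmentation of F_0. Injectivity on A_0 turns the equation of
  integers into one modulo relations.\<close>

lemma f0_ex: "\<exists>f0\<in>fr (gens1 (LT B 0) 0). aug wt f0 - inc 0 () : N LC 0"
proof -
 have "(1 :: int) : \<eta> 0 ` carrier (Grp (Fm 0) 0)" unfolding eta_surj by (simp add: unit_grp_def)
 then obtain x where x: "1 = \<eta> 0 x" "x : carrier (Grp (Fm 0) 0)" by (rule imageE)
 obtain f where f': "f : fr (gens1 (LT B 0) 0)" "x = kk 0 0 f" using kk_surj[OF x(2)] by blast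
 have f: "f : fr (gens1 (LT B 0) 0)" "\<eta> 0 (kk 0 0 f) = 1" using x(1) f' by simp_all
 have "ec (aug wt f - inc 0 ()) = 0" using f eta_kk[OF f(1)] by (simp add: addvD[OF addv_ec] inc_def eps_unt)
 moreover have "inc 0 () : fr (gens1 LC 0)" by (rule inc_fr) simp
 ultimately have "aug wt f - inc 0 () : N LC 0" using ec_LC[OF fr_diff[OF aug_gens[OF f(1)]]] by blast
 then show ?thesis using f(1) by blast
qed

end

text \<open>Taking every chain in the kernel as a basis element of the next module yields a resolution.\<close>

locale bar_res = aug_alg A \<epsilon> for A :: "('r::comm_ring_1, 'a) gl_monoid" and \<epsilon> +
 fixes dec :: "'b => ('r, 'a, 'b lbl) chain" and b0 :: 'b
 assumes dec: "surj dec"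
begin

definition dl :: "'b lbl => ('r, 'a, 'b lbl) chain" where
 "dl = (%(p, k, b). case p of 0 => 0 | Suc q => dec b)"

text \<open>The first module has one basis element, in degree 0, hence is A. A kernel condition on
  F_p takes values in relations over F_{p-1}, whose labels this recursion does not provide;
  relations over all labels are used instead, which \<open>N_UNIV\<close> justifies.\<close>

primrec Bx :: "nat => nat => 'b set" where
 "Bx 0 = (%k. if k = 0 then {b0} else {})"
| "Bx (Suc p) = (%k. {b. dec b : fr (gens1 (%k. {(p, k, b') | b'. b' : Bx p k}) k) &
 (case p of 0 => k = 0 --> ec (dec b) = 0 | Suc q => xt dl (dec b) : N (%_. UNIV) k)})"

lemma Bx_Suc: "b : Bx (Suc p) k \<longleftrightarrow> dec b : fr (gens1 (LT Bx p) k) &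
 (case p of 0 => k = 0 --> ec (dec b) = 0 | Suc q => xt dl (dec b) : N (%_. UNIV) k)"
 by (simp add: LT_def[abs_def])

declare Bx.simps [simp del]

lemma map_dl: "mapping (LT Bx (Suc p)) (LT Bx p) dl"
 unfolding mapping_def by (auto simp: LT_def[of Bx "Suc p"] dl_def Bx_Suc)

text \<open>Projecting to the admissible labels maps relations to relations and fixes
  \<open>c\<close>.\<close>

lemma N_UNIV: "c : N (%_. UNIV) k ==> c : fr (gens1 L k) ==> c : N L k"
proof -
 assume c: "c : N (%_. UNIV) k" "c : fr (gens1 L k)"
 have "restr (%(gs, i, a, l). l : L (k - i)) c : N L k"
 by (rule restr_N'[OF c(1), where Q = "%_ i l. l : L (k - i)"]) auto
 moreover have "restr (%(gs, i, a, l). l : L (k - i)) c = c" using c(2) by (rule restr_id) (auto simp: gens1_def)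
 ultimately show ?thesis by simp
qed

sublocale frees A Bx by unfold_locales

lemma dec_N: "b : Bx (Suc (Suc p)) k ==> xt dl (dec b) : N (LT Bx p) k"
 using N_UNIV[OF _ xt_fr1[OF map_dl, of "dec b" p k]] by (simp add: Bx_Suc)

text \<open>Every kernel chain has a code that is itself a basis element of the next module, so it
  is hit exactly and not only modulo relations.\<close>

lemma cover:
 assumes "z : fr (gens1 (LT Bx p) n)" "case p of 0 => n = 0 --> ec z = 0 | Suc q => xt dl z : N (LT Bx q) n"
 shows "\<exists>w\<in>fr (gens1 (LT Bx (Suc p)) n). xt dl w = z"
proof -
 obtain b where b: "dec b = z" using dec by (metis surjD)
 have "b : Bx (Suc p) n" using assms b N_mono[of z] by (auto simp: Bx_Suc split: nat.splits elim!: N_mono)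
 then show ?thesis
 using xt_inc[OF assms(1), of dl "(Suc p, n, b)"] b by (intro bexI[of _ "inc n (Suc p, n, b)"]) (auto simp: dl_def intro!: inc_fr)
qed

lemma dl_dl: "c : fr (gens1 (LT Bx (Suc (Suc p))) n) ==> xt dl (xt dl c) : N (LT Bx p) n"
proof -
 assume c: "c : fr (gens1 (LT Bx (Suc (Suc p))) n)"
 have "xt (%l. xt dl (dl l)) c : N (LT Bx p) n"
 proof (rule addv_fr_N[OF addv_xt c])
 fix s assume "s : gens1 (LT Bx (Suc (Suc p))) n"
 then obtain g i a b where s: "s = ([g], i, a, Suc (Suc p), n - i, b)" "g : GLc n" "i <= n" "a : Ag i" "b : Bx (Suc (Suc p)) (n - i)" by (rule gens1_LT_cases)
 then show "xt (%l. xt dl (dl l)) (fo s) : N (LT Bx p) n"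
 using bil_N[OF _ s(3,4) dec_N[OF s(5)], of "[g]"] by (simp add: dl_def)
 qed
 then show ?thesis using xt_xt[OF map_dl map_dl gens1_gens[OF c]] by simp
qed

lemma ec_bil: "c : fr (gens1 L 0) ==> a : Ag 0 ==> ec (bil [g] 0 a c) = \<epsilon> 0 a * ec c"
 by (rule addv_eq_on[of "%c. ec (bil [g] 0 a c)"])
 (use eps_mul[of a 0 _ 0] in \<open>auto simp: addv_def addvD[OF addv_ec] addvD[OF addv_bil] gens1_def algebra_simps\<close>)

lemma ec_dl: "c : fr (gens1 (LT Bx (Suc 0)) 0) ==> ec (xt dl c) = 0"
proof (rule addv_eq_on[of "%c. ec (xt dl c)" "%_. 0"])
 fix s assume "s : gens1 (LT Bx (Suc 0)) 0"
 then obtain g i a b where s: "s = ([g], i, a, Suc 0, 0 - i, b)" "g : GLc 0" "i <= 0" "a : Ag i" "b : Bx (Suc 0) (0 - i)" by (rule gens1_LT_cases)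
 then show "ec (xt dl (fo s)) = 0" using ec_bil[of "dec b" "LT Bx 0" a g] by (simp add: Bx_Suc dl_def)
qed (auto simp: addv_def addvD[OF addv_ec])

lemma xt_bil:
 assumes "mapping K L f" "a : Ag i" "c : fr (gens1 K j)"
 shows "xt f (bil [idm (i + j)] i a c) = bil [idm (i + j)] i a (xt f c)"
proof -
 have "mapping (%n. if n = j then {()} else {}) K (%_. c)" using assms(3) by (simp add: mapping_def)
 moreover have "fo ([idm (i + j)], i, a, ()) : fr (gens (%n. if n = j then {()} else {}) (i + j))" using assms(2) by simp
 ultimately show ?thesis using xt_xt[OF _ assms(1)] by fastforce
qed

lemma xt_lm: "g : GLc n ==> c : fr (gens1 (LT Bx (Suc p)) n) ==> xt dl (lm g c) = lm g (xt dl c)"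
proof (rule addv_eq_on[of "%c. xt dl (lm g c)"])
 fix s assume g: "g : GLc n" and "s : gens1 (LT Bx (Suc p)) n"
 from this(2) obtain h i a b where s: "s = ([h], i, a, Suc p, n - i, b)" "h : GLc n" "i <= n" "a : Ag i" "b : Bx (Suc p) (n - i)" by (rule gens1_LT_cases)
 then show "xt dl (lm g (fo s)) = lm g (xt dl (fo s))"
 using lm_bil[OF g s(2,3), of "dec b" "LT Bx p" a] by (simp add: Bx_Suc dl_def)
qed (auto simp: addv_def addvD[OF addv_lm])

definition dx :: "nat => nat => ('r, 'a, 'b) free_elt => ('r, 'a, 'b) free_elt" where
 "dx p n S = kk (p - 1) n (xt dl (psi p n (SOME t. t : S)))"

definition ex :: "nat => ('r, 'a, 'b) free_elt => int" where
 "ex n S = (if n = 0 then ec (psi 0 0 (SOME t. t : S)) else 0)"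

lemma dx_kk: "c : fr (gens1 (LT Bx (Suc p)) n) ==> dx (Suc p) n (kk (Suc p) n c) = kk p n (xt dl c)"
proof -
 assume c: "c : fr (gens1 (LT Bx (Suc p)) n)"
 note t = psi_some[OF c]
 have "xt dl (psi (Suc p) n (SOME t. t : kk (Suc p) n c) - c) : N (LT Bx p) n" by (rule xt_N[OF map_dl t(2)])
 then show ?thesis using kk_eq_iff[OF xt_fr1[OF map_dl t(1)] xt_fr1[OF map_dl c]] by (simp add: dx_def)
qed

lemma dx_image: "y : dx (Suc p) n ` carrier (Grp (Fm (Suc p)) n) \<longleftrightarrow> (\<exists>c\<in>fr (gens1 (LT Bx (Suc p)) n). y = kk p n (xt dl c))"
proof
 assume "y : dx (Suc p) n ` carrier (Grp (Fm (Suc p)) n)"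
 then obtain x where x: "y = dx (Suc p) n x" "x : carrier (Grp (Fm (Suc p)) n)" by (rule imageE)
 obtain c where c: "c : fr (gens1 (LT Bx (Suc p)) n)" "x = kk (Suc p) n c" using kk_surj[OF x(2)] by blast
 show "\<exists>c\<in>fr (gens1 (LT Bx (Suc p)) n). y = kk p n (xt dl c)" using x(1) dx_kk[OF c(1)] c by auto
next
 assume "\<exists>c\<in>fr (gens1 (LT Bx (Suc p)) n). y = kk p n (xt dl c)"
 then obtain c where c: "c : fr (gens1 (LT Bx (Suc p)) n)" "y = kk p n (xt dl c)" by blast
 show "y : dx (Suc p) n ` carrier (Grp (Fm (Suc p)) n)" unfolding c(2) dx_kk[OF c(1), symmetric] by (rule imageI[OF kk_in[OF c(1)]])
qed

lemma ex_kk: "c : fr (gens1 (LT Bx 0) n) ==> ex n (kk 0 n c) = (if n = 0 then ec c else 0)"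
 using psi_some(2)[of c 0 n] ec_N[of "psi 0 0 (SOME t. t : kk 0 0 c) - c" "LT Bx 0"] by (cases "n = 0") (simp_all add: ex_def addvD[OF addv_ec])

lemma ec_lm: "ec (lm g c) = ec c"
 by (rule addv_eq[of "%c. ec (lm g c)"]) (auto simp: addv_def addvD[OF addv_ec] addvD[OF addv_lm])

lemma ex_left: "left_hom A (Fm 0) (unit_left \<epsilon>) ex"
 unfolding left_hom_def gl_hom_def
proof (intro conjI allI ballI)
 fix n
 show "ex n : hom (Grp (Fm 0) n) (Grp (unit_left \<epsilon>) n)"
 proof (rule homI)
 fix x assume "x : carrier (Grp (Fm 0) n)"
 then obtain c where c: "c : fr (gens1 (LT Bx 0) n)" "x = kk 0 n c" using kk_surj by blast
 show "ex n x : carrier (Grp (unit_left \<epsilon>) n)" by (simp add: c ex_kk unit_left_def unit_grp_def singleton_group_def)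
 fix y assume "y : carrier (Grp (Fm 0) n)"
 then obtain c' where c': "c' : fr (gens1 (LT Bx 0) n)" "y = kk 0 n c'" using kk_surj by blast
 show "ex n (x \<otimes>\<^bsub>Grp (Fm 0) n\<^esub> y) = ex n x \<otimes>\<^bsub>Grp (unit_left \<epsilon>) n\<^esub> ex n y"
 using c c' by (simp add: kk_add ex_kk fr_add addv_add[OF addv_ec] unit_left_def unit_grp_def singleton_group_def)
 qed
 fix g :: "'r mat" and x assume g: "g : GLc n" and "x : carrier (Grp (Fm 0) n)"
 then obtain c where c: "c : fr (gens1 (LT Bx 0) n)" "x = kk 0 n c" using kk_surj by blast
 show "ex n (Act (Fm 0) n g x) = Act (unit_left \<epsilon>) n g (ex n x)"
 using c g by (simp add: kk_act ex_kk lm_fr ec_lm unit_left_def)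
next
 fix i j a x assume a: "a : Ag i" and "x : carrier (Grp (Fm 0) j)"
 then obtain c where c: "c : fr (gens1 (LT Bx 0) j)" "x = kk 0 j c" using kk_surj by blast
 have b: "bil [idm (i + j)] i a c : fr (gens1 (LT Bx 0) (i + j))" by (rule bil1_fr) (use a c in auto)
 have "ex (i + j) (LAct (Fm 0) i j a x) = (if i + j = 0 then ec (bil [idm (i + j)] i a c) else 0)"
 unfolding c(2) kk_lact[OF a c(1)] by (rule ex_kk[OF b])
 also have "... = \<epsilon> i a * ex j x"
 using a c eps_pos[OF a] ec_bil[of c "LT Bx 0" a] by (auto simp: ex_kk)
 finally show "ex (i + j) (LAct (Fm 0) i j a x) = LAct (unit_left \<epsilon>) i j a (ex j x)" by (simp add: unit_left_def)
qed

lemma dx_left: "left_hom A (Fm (Suc p)) (Fm p) (dx (Suc p))"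
 unfolding left_hom_def gl_hom_def
proof (intro conjI allI ballI)
 fix n
 show "dx (Suc p) n : hom (Grp (Fm (Suc p)) n) (Grp (Fm p) n)"
 proof (rule homI)
 fix x assume "x : carrier (Grp (Fm (Suc p)) n)"
 then obtain c where c: "c : fr (gens1 (LT Bx (Suc p)) n)" "x = kk (Suc p) n c" using kk_surj by blast
 show "dx (Suc p) n x : carrier (Grp (Fm p) n)" using c by (simp add: dx_kk xt_fr1[OF map_dl])
 fix y assume "y : carrier (Grp (Fm (Suc p)) n)"
 then obtain c' where c': "c' : fr (gens1 (LT Bx (Suc p)) n)" "y = kk (Suc p) n c'" using kk_surj by blast
 show "dx (Suc p) n (x \<otimes>\<^bsub>Grp (Fm (Suc p)) n\<^esub> y) = dx (Suc p) n x \<otimes>\<^bsub>Grp (Fm p) n\<^esub> dx (Suc p) n y"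
 unfolding c(2) c'(2) kk_add[OF c(1) c'(1)] dx_kk[OF fr_add[OF c(1) c'(1)]] dx_kk[OF c(1)] dx_kk[OF c'(1)]
 kk_add[OF xt_fr1[OF map_dl c(1)] xt_fr1[OF map_dl c'(1)]] by simp
 qed
 fix g :: "'r mat" and x assume g: "g : GLc n" and "x : carrier (Grp (Fm (Suc p)) n)"
 then obtain c where c: "c : fr (gens1 (LT Bx (Suc p)) n)" "x = kk (Suc p) n c" using kk_surj by blast
 show "dx (Suc p) n (Act (Fm (Suc p)) n g x) = Act (Fm p) n g (dx (Suc p) n x)"
 unfolding c(2) kk_act[OF g c(1)] dx_kk[OF lm_fr[OF g c(1)]] dx_kk[OF c(1)] kk_act[OF g xt_fr1[OF map_dl c(1)]] xt_lm[OF g c(1)] ..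
next
 fix i j a x assume a: "a : Ag i" and "x : carrier (Grp (Fm (Suc p)) j)"
 then obtain c where c: "c : fr (gens1 (LT Bx (Suc p)) j)" "x = kk (Suc p) j c" using kk_surj by blast
 have b: "bil [idm (i + j)] i a c : fr (gens1 (LT Bx (Suc p)) (i + j))" by (rule bil1_fr) (use a c in auto)
 show "dx (Suc p) (i + j) (LAct (Fm (Suc p)) i j a x) = LAct (Fm p) i j a (dx (Suc p) j x)"
 unfolding c(2) kk_lact[OF a c(1)] dx_kk[OF b] dx_kk[OF c(1)] kk_lact[OF a xt_fr1[OF map_dl c(1)]] xt_bil[OF map_dl a c(1)] ..
qed

text \<open>\<open>Tor\<close> is formed from a resolution picked by SOME; existence over this basis
  type makes that pick a genuine resolution.\<close>

theorem free_resolution_exists: "free_resolution A (unit_left \<epsilon>) Bx dx ex"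
 unfolding free_resolution_def Let_def
proof (intro conjI allI ex_left dx_left)
 fix n
 have U: "Grp (unit_left \<epsilon>) n = unit_grp n" by (simp add: unit_left_def)
 have one: "\<one>\<^bsub>unit_grp n\<^esub> = 0" by (simp add: unit_grp_def singleton_group_def)
 show "ex n ` carrier (Grp (Fm 0) n) = carrier (Grp (unit_left \<epsilon>) n)"
 proof (intro equalityI subsetI)
 fix z assume "z : ex n ` carrier (Grp (Fm 0) n)"
 then obtain x where x: "z = ex n x" "x : carrier (Grp (Fm 0) n)" by (rule imageE)
 have h: "ex n : hom (Grp (Fm 0) n) (unit_grp n)" using ex_left by (simp add: left_hom_def gl_hom_def unit_left_def)
 show "z : carrier (Grp (unit_left \<epsilon>) n)" unfolding U x(1) by (rule hom_in_carrier[OF h x(2)])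
 next
 fix z assume z: "z : carrier (Grp (unit_left \<epsilon>) n)"
 then have "z : \<epsilon> n ` Ag n" unfolding U eps_surj .
 then obtain a where a: "a : Ag n" "z = \<epsilon> n a" by blast
 define c :: "('r, 'a, 'b lbl) chain" where "c = (if n = 0 then fo ([idm 0], 0, a, 0, 0, b0) else 0)"
 have c: "c : fr (gens1 (LT Bx 0) n)" using a by (auto simp: c_def gens1_def Bx.simps)
 have "z = ex n (kk 0 n c)" unfolding ex_kk[OF c] using a eps_pos[OF a(1)] by (auto simp: c_def)
 then show "z : ex n ` carrier (Grp (Fm 0) n)" by (rule image_eqI) (rule kk_in[OF c])
 qed
 show "dx 1 n ` carrier (Grp (Fm 1) n) = kernel (Grp (Fm 0) n) (Grp (unit_left \<epsilon>) n) (ex n)"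
 unfolding U One_nat_def
 proof (intro equalityI subsetI)
 fix y assume "y : dx (Suc 0) n ` carrier (Grp (Fm (Suc 0)) n)"
 then obtain c where c: "c : fr (gens1 (LT Bx (Suc 0)) n)" "y = kk 0 n (xt dl c)" unfolding dx_image by blast
 note x = xt_fr1[OF map_dl c(1)]
 have "ex n y = 0" unfolding c(2) ex_kk[OF x] using c(1) ec_dl by auto
 then show "y : kernel (Grp (Fm 0) n) (unit_grp n) (ex n)" using kk_in[OF x] by (simp add: kernel_def one c(2))
 next
 fix y assume "y : kernel (Grp (Fm 0) n) (unit_grp n) (ex n)"
 then have y: "y : carrier (Grp (Fm 0) n)" "ex n y = 0" by (simp_all add: kernel_def one)
 obtain z where z': "z : fr (gens1 (LT Bx 0) n)" "y = kk 0 n z" using kk_surj[OF y(1)] by blast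
 have z: "z : fr (gens1 (LT Bx 0) n)" "y = kk 0 n z" "n = 0 --> ec z = 0" using z' y(2) ex_kk[OF z'(1)] by auto
 obtain w where "w : fr (gens1 (LT Bx (Suc 0)) n)" "xt dl w = z" using cover[OF z(1)] z(3) by auto
 then show "y : dx (Suc 0) n ` carrier (Grp (Fm (Suc 0)) n)" unfolding dx_image using z(2) by blast
 qed
 fix p
 show "dx (Suc (Suc p)) n ` carrier (Grp (Fm (Suc (Suc p))) n) = kernel (Grp (Fm (Suc p)) n) (Grp (Fm p) n) (dx (Suc p) n)"
 proof (intro equalityI subsetI)
 fix y assume "y : dx (Suc (Suc p)) n ` carrier (Grp (Fm (Suc (Suc p))) n)"
 then obtain c where c: "c : fr (gens1 (LT Bx (Suc (Suc p))) n)" "y = kk (Suc p) n (xt dl c)" unfolding dx_image by blast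
 note x = xt_fr1[OF map_dl c(1)]
 show "y : kernel (Grp (Fm (Suc p)) n) (Grp (Fm p) n) (dx (Suc p) n)"
 using x xt_fr1[OF map_dl x] dl_dl[OF c(1)] by (simp add: kernel_def c(2) dx_kk kk_one_iff)
 next
 fix y assume y: "y : kernel (Grp (Fm (Suc p)) n) (Grp (Fm p) n) (dx (Suc p) n)"
 then have "y : carrier (Grp (Fm (Suc p)) n)" by (simp add: kernel_def)
 from kk_surj[OF this] obtain z where z: "z : fr (gens1 (LT Bx (Suc p)) n)" "y = kk (Suc p) n z" by blast
 then have "xt dl z : N (LT Bx p) n" using y xt_fr1[OF map_dl z(1)] by (simp add: kernel_def dx_kk kk_one_iff)
 then obtain w where "w : fr (gens1 (LT Bx (Suc (Suc p))) n)" "xt dl w = z" using cover[OF z(1)] by auto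
 then show "y : dx (Suc (Suc p)) n ` carrier (Grp (Fm (Suc (Suc p))) n)" unfolding dx_image using z(2) by blast
 qed
qed

end

subsection \<open>Coding chains by lists\<close>

type_synonym ('r, 'a) code = "('r \<times> 'a \<times> int) list"

text \<open>Each list is preceded by its length, so the concatenation can be taken apart again;
  nested data thereby fit into one list type.\<close>

definition cat :: "('r, 'a) code list => ('r, 'a) code" where
 "cat ls = concat (map (%l. (undefined, undefined, int (length l)) # l) ls)"

lemma inj_cat: "inj (cat :: ('r, 'a) code list => _)"
proof (rule injI)
 fix ls ms :: "('r, 'a) code list"
 show "cat ls = cat ms ==> ls = ms"
 proof (induction ls arbitrary: ms)
 case Nil then show ?case by (cases ms) (auto simp: cat_def)
 next
 case (Cons l ls) then show ?case by (cases ms) (auto simp: cat_def)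
 qed
qed

definition cpair :: "('s => ('r, 'a) code) => ('t => ('r, 'a) code) => 's \<times> 't => ('r, 'a) code" where
 "cpair f g = (%(x, y). cat [f x, g y])"

lemma inj_cpair: "inj f ==> inj g ==> inj (cpair f g)"
 by (auto simp: cpair_def inj_on_def dest: injD[OF inj_cat])

lemma inj_clist: "inj f ==> inj (cat \<circ> map f)"
 by (rule inj_compose[OF inj_cat inj_mapI])

lemma inj_mat: "inj (%g :: 'r mat. (dim_row g, dim_col g, map (%i. map (%j. g $$ (i, j)) [0..<dim_col g]) [0..<dim_row g]))"
 by (rule injI, rule eq_matI) (auto simp: map_eq_conv)

lemma inj_frag: "inj (%c :: 's \<Rightarrow>\<^sub>0 int. map (%s. (s, Poly_Mapping.lookup c s)) (SOME xs. set xs = Poly_Mapping.keys c))"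
proof (rule injI)
 fix c c' :: "'s \<Rightarrow>\<^sub>0 int"
 let ?e = "%c :: 's \<Rightarrow>\<^sub>0 int. map (%s. (s, Poly_Mapping.lookup c s)) (SOME xs. set xs = Poly_Mapping.keys c)"
 assume e: "?e c = ?e c'"
 have s: "set (?e c) = (%s. (s, Poly_Mapping.lookup c s)) ` Poly_Mapping.keys c" for c :: "'s \<Rightarrow>\<^sub>0 int"
 using someI_ex[OF finite_list[OF finite_keys[of c]]] by simp
 have i: "(%s. (s, Poly_Mapping.lookup c s)) ` Poly_Mapping.keys c = (%s. (s, Poly_Mapping.lookup c' s)) ` Poly_Mapping.keys c'"
 using e s[of c] s[of c'] by simp
 show "c = c'"
 proof (rule poly_mapping_eqI)
 fix k
 have 1: "Poly_Mapping.lookup c k = Poly_Mapping.lookup c' k" if k: "k : Poly_Mapping.keys c"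
 proof -
 have "(k, Poly_Mapping.lookup c k) : (%s. (s, Poly_Mapping.lookup c' s)) ` Poly_Mapping.keys c'"
 unfolding i[symmetric] by (rule imageI[OF k])
 then show ?thesis by (elim imageE) simp
 qed
 have 2: "Poly_Mapping.lookup c' k = Poly_Mapping.lookup c k" if k: "k : Poly_Mapping.keys c'"
 proof -
 have "(k, Poly_Mapping.lookup c' k) : (%s. (s, Poly_Mapping.lookup c s)) ` Poly_Mapping.keys c"
 unfolding i by (rule imageI[OF k])
 then show ?thesis by (elim imageE) simp
 qed
 show "Poly_Mapping.lookup c k = Poly_Mapping.lookup c' k"
 proof (cases "k : Poly_Mapping.keys c")
 case False
 then have "Poly_Mapping.lookup c k = 0" by (simp add: in_keys_iff)
 then show ?thesis using 2 by (cases "k : Poly_Mapping.keys c'") (simp_all add: in_keys_iff)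
 qed (rule 1)
 qed
qed

text \<open>A chain is finite data built from integers and elements of \<open>'r\<close> and
  \<open>'a\<close>, hence injects into lists; a left inverse is the surjection. The list type is
  the one that \<open>Tor\<close> prescribes for bases when the module is the unit.\<close>

lemma ex_decoding: "\<exists>dec :: ('r, 'a) code => ('r, 'a, ('r, 'a) code lbl) chain. surj dec"
proof -
 define cz :: "int => ('r, 'a) code" where "cz = (%k. [(undefined, undefined, k)])"
 define cn :: "nat => ('r, 'a) code" where "cn = cz \<circ> int"
 define cr :: "'r => ('r, 'a) code" where "cr = (%r. [(r, undefined, 0)])"
 define ca :: "'a => ('r, 'a) code" where "ca = (%a. [(undefined, a, 0)])"
 have b: "inj cz" "inj cn" "inj cr" "inj ca" by (auto simp: inj_on_def cz_def cn_def cr_def ca_def)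
 have i: "inj (%x. x)" for x :: "('r, 'a) code" by (rule injI)
 note m = inj_compose[OF inj_cpair[OF b(2) inj_cpair[OF b(2) inj_clist[OF inj_clist[OF b(3)]]]] inj_mat]
 note g = inj_cpair[OF inj_clist[OF m] inj_cpair[OF b(2) inj_cpair[OF b(4) inj_cpair[OF b(2) inj_cpair[OF b(2) inj_on_id2[of UNIV]]]]]]
 note c = inj_compose[OF inj_clist[OF inj_cpair[OF g b(1)]] inj_frag]
 from inj_imp_surj_inv[OF c] show ?thesis by blast
qed

subsection \<open>The Koszul condition on chains\<close>

lemma gsp_Un: "x : gsp (R \<union> Q) \<longleftrightarrow> (\<exists>q\<in>gsp Q. x - q : gsp R)"
proof
 assume "x : gsp (R \<union> Q)"
 then show "\<exists>q\<in>gsp Q. x - q : gsp R"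
 proof (induction rule: gsp.induct)
 case gsp_zero show ?case by (intro bexI[of _ 0]) auto
 next
 case (gsp_base x)
 then show ?case
 proof
 assume "x : R" then show ?thesis by (intro bexI[of _ 0]) (auto intro: gsp.gsp_base)
 next
 assume "x : Q" then show ?thesis by (intro bexI[of _ x]) (auto intro: gsp.gsp_base)
 qed
 next
 case (gsp_diff x y)
 then obtain q q' where "q : gsp Q" "x - q : gsp R" "q' : gsp Q" "y - q' : gsp R" by blast
 then show ?case using gsp_diff_diff[of x q R y q'] by (intro bexI[of _ "q - q'"]) (auto intro: gsp.gsp_diff)
 qed
next
 assume "\<exists>q\<in>gsp Q. x - q : gsp R"
 then obtain q where q: "q : gsp Q" "x - q : gsp R" by blast
 have "q : gsp (R \<union> Q)" "x - q : gsp (R \<union> Q)" using q gsp_mono[of Q "R \<union> Q"] gsp_mono[of R "R \<union> Q"] by auto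
 from gsp_add[OF this] show "x : gsp (R \<union> Q)" by simp
qed

context presentation
begin

context
 fixes Q assumes Q: "Q <= fr S"
begin

text \<open>The subgroup generated by the classes of further relations \<open>Q\<close>; by
  \<open>qcl_eq_iff\<close> the quotient behaves like the group presented by both sets of relations.
  With the coequalizer relations as \<open>Q\<close> it describes \<int> \<otimes>_A F.\<close>

definition qsub where "qsub = generate (presented S Rs) (cls S Rs ` Q)"
definition qcl where "qcl c = qsub #>\<^bsub>presented S Rs\<^esub> cls S Rs c"

lemma qsub: "qsub = cls S Rs ` gsp Q"
proof
 interpret P: comm_group "presented S Rs" by (rule comm_group_presented)
 have f: "!!c. c : gsp Q ==> c : fr S" using gsp_fr[OF Q] by auto
 show "qsub <= cls S Rs ` gsp Q"
 proof
 fix x assume "x : qsub"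
 then show "x : cls S Rs ` gsp Q" unfolding qsub_def
 proof (induction rule: generate.induct)
 case one show ?case by (rule image_eqI[of _ _ 0]) (simp_all add: one_presented)
 next
 case (incl h) then show ?case by (auto intro: gsp_base)
 next
 case (inv h)
 then obtain x where x: "x : Q" "h = cls S Rs x" by blast
 show ?case by (rule image_eqI[of _ _ "- x"]) (use x Q in \<open>auto simp: cls_inv intro: gsp_base\<close>)
 next
 case (eng h k) then show ?case using f by (auto simp: cls_mult intro!: gsp_add)
 qed
 qed
 show "cls S Rs ` gsp Q <= qsub"
 proof
 fix x assume "x : cls S Rs ` gsp Q"
 then obtain c where c: "c : gsp Q" "x = cls S Rs c" by blast
 have sg: "subgroup qsub (presented S Rs)" unfolding qsub_def by (rule P.generate_is_subgroup) (use Q in auto)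
 have "cls S Rs c : qsub" using c(1)
 proof (induction rule: gsp.induct)
 case gsp_zero show ?case using subgroup.one_closed[OF sg] by (simp add: one_presented)
 next
 case (gsp_base x) then show ?case by (auto simp: qsub_def intro: generate.incl)
 next
 case (gsp_diff x y)
 have "cls S Rs (x - y) = cls S Rs x \<otimes>\<^bsub>presented S Rs\<^esub> inv\<^bsub>presented S Rs\<^esub> cls S Rs y"
 using f[OF gsp_diff(1)] f[OF gsp_diff(2)] by (simp add: cls_inv cls_mult fr_minus)
 then show ?case using gsp_diff subgroup.m_closed[OF sg] subgroup.m_inv_closed[OF sg] by simp
 qed
 then show "x : qsub" by (simp add: c)
 qed
qed

lemma qsub_subgroup: "subgroup qsub (presented S Rs)"
 unfolding qsub_def by (rule group.generate_is_subgroup[OF comm_group.axioms(2)[OF comm_group_presented]]) (use Q in auto)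

lemma qcl_eq_iff: "c : fr S ==> c' : fr S ==> qcl c = qcl c' \<longleftrightarrow> c - c' : gsp (Rs \<union> Q)"
proof -
 assume c: "c : fr S" "c' : fr S"
 have "qcl c = qcl c' \<longleftrightarrow> cls S Rs (c - c') : cls S Rs ` gsp Q"
 unfolding qcl_def qsub[symmetric]
 using group.r_coset_eq_iff[OF comm_group.axioms(2)[OF comm_group_presented] qsub_subgroup cls_in[OF c(1)] cls_in[OF c(2)]] c
 by (simp add: cls_inv cls_mult fr_minus)
 also have "... \<longleftrightarrow> c - c' : gsp (Rs \<union> Q)"
 unfolding gsp_Un using cls_eq_iff[OF fr_diff[OF c]] gsp_fr[OF Q] by (auto simp: image_iff)
 finally show ?thesis .
qed

lemma carrier_quot: "carrier (presented S Rs Mod qsub) = qcl ` fr S"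
 by (auto simp: FactGroup_def RCOSETS_def carrier_presented qcl_def)

lemma quot_comm: "comm_group (presented S Rs Mod qsub)"
 by (rule comm_group.abelian_FactGroup[OF comm_group_presented qsub_subgroup])

lemma qcl_mult: "c : fr S ==> c' : fr S ==> qcl c \<otimes>\<^bsub>presented S Rs Mod qsub\<^esub> qcl c' = qcl (c + c')"
 using normal.rcos_sum[OF comm_group.subgroup_imp_normal[OF comm_group_presented qsub_subgroup], of "cls S Rs c" "cls S Rs c'"]
 by (simp add: FactGroup_def qcl_def cls_mult)

lemma qcl_one: "\<one>\<^bsub>presented S Rs Mod qsub\<^esub> = qcl 0"
 using group.coset_mult_one[OF comm_group.axioms(2)[OF comm_group_presented], of qsub] subgroup.subset[OF qsub_subgroup]
 by (simp add: FactGroup_def qcl_def flip: one_presented)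

lemma qcl_rep:
 assumes c: "c : fr S"
 shows "\<exists>c'\<in>fr S. (SOME t. t : qcl c) = cls S Rs c' & c' - c : gsp (Rs \<union> Q)"
proof -
 interpret P: comm_group "presented S Rs" by (rule comm_group_presented)
 have "cls S Rs c : qcl c" unfolding qcl_def by (rule P.rcos_self[OF cls_in[OF c] qsub_subgroup])
 then have "(SOME t. t : qcl c) : qcl c" by (rule someI)
 then obtain q where q: "q : gsp Q" "(SOME t. t : qcl c) = cls S Rs q \<otimes>\<^bsub>presented S Rs\<^esub> cls S Rs c"
 unfolding qcl_def r_coset_def qsub by auto
 have qf: "q : fr S" using q(1) gsp_fr[OF Q] by auto
 have "q : gsp (Rs \<union> Q)" using q(1) gsp_mono[of Q "Rs \<union> Q"] by auto
 then show ?thesis using q qf c by (intro bexI[of _ "q + c"]) (auto simp: cls_mult intro: fr_add)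
qed

end

end

context gl_alg
begin

lemma N_pow:
 assumes "gs : smp n" "i <= n" "b : Ag i" "l : L (n - i)"
 shows "fo (gs, i, b [^]\<^bsub>Grp A i\<^esub> (k :: int), l) - frag_cmul k (fo (gs, i, b, l)) : N L n"
proof -
 interpret G: group "Grp A i" by (rule grA)
 let ?f = "%a. fo (gs, i, a, l)"
 have s: "?f (b [^]\<^bsub>Grp A i\<^esub> (k + 1)) - ?f (b [^]\<^bsub>Grp A i\<^esub> k) - ?f b : N L n" for k :: int
 using N_add[of gs n i "b [^]\<^bsub>Grp A i\<^esub> k" b l L] assms group.int_pow_mult[OF grA assms(3), of k 1] group.int_pow_1[OF grA assms(3)] by simp
 show ?thesis
 proof (induction k rule: int_induct[of _ 0])
 case base then show ?case using N_one[of gs n i l L] assms by simp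
 next
 case (step1 k) from N_plus[OF s[of k] step1(2)] show ?case by (simp add: frag_cmul_distrib algebra_simps)
 next
 case (step2 k)
 have e: "frag_cmul (k - 1) (?f b) = frag_cmul k (?f b) - ?f b" using frag_cmul_distrib[of "k - 1" 1 "?f b"] by simp
 show ?case unfolding e using N_diff[OF step2(2) s[of "k - 1"]] by (simp add: algebra_simps)
 qed
qed

end

text \<open>The augmentation is injective on A_0, so \<open>a\<close> is the multiple
  \<open>\<epsilon> 0 a\<close> of the unit and acts as that integer.\<close>

lemma (in aug_alg) unit_act:
 assumes a: "a : Ag 0" and c: "c : fr (gens1 L n)" shows "bil [idm n] 0 a c - frag_cmul (\<epsilon> 0 a) c : N L n"
proof (rule addv_cong_N[OF addv_bil addv_frag_cmul[OF addv_id] c])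
 fix s assume "s : gens1 L n"
 then obtain g j b l where s: "s = ([g], j, b, l)" "g : GLc n" "j <= n" "b : Ag j" "l : L (n - j)" by (auto simp: gens1_def)
 let ?k = "\<epsilon> 0 a"
 have u: "Unt A [^]\<^bsub>Grp A 0\<^esub> k : Ag 0" for k :: int using A_closed(4)[OF unt] .
 interpret h: group_hom "Grp A 0" integer_group "\<epsilon> 0"
 using eps_hom[of 0] grA by (simp add: group_hom_def group_hom_axioms_def unit_grp_def)
 have "\<epsilon> 0 (Unt A [^]\<^bsub>Grp A 0\<^esub> ?k) = ?k" using h.hom_int_pow[of "Unt A" ?k] by (simp add: eps_unt)
 then have "\<epsilon> 0 (a \<otimes>\<^bsub>Grp A 0\<^esub> inv\<^bsub>Grp A 0\<^esub> (Unt A [^]\<^bsub>Grp A 0\<^esub> ?k)) = 0" using a u by simp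
 then have "a \<otimes>\<^bsub>Grp A 0\<^esub> inv\<^bsub>Grp A 0\<^esub> (Unt A [^]\<^bsub>Grp A 0\<^esub> ?k) = \<one>\<^bsub>Grp A 0\<^esub>" using a u by (intro eps_ker) auto
 moreover have "a \<otimes>\<^bsub>Grp A 0\<^esub> inv\<^bsub>Grp A 0\<^esub> (Unt A [^]\<^bsub>Grp A 0\<^esub> ?k) \<otimes>\<^bsub>Grp A 0\<^esub> (Unt A [^]\<^bsub>Grp A 0\<^esub> ?k) = a"
 using a u by (simp add: monoid.m_assoc[OF group.is_monoid[OF grA]] group.l_inv[OF grA] monoid.r_one[OF group.is_monoid[OF grA]])
 ultimately have ae: "a = Unt A [^]\<^bsub>Grp A 0\<^esub> ?k" using u[of ?k] monoid.l_one[OF group.is_monoid[OF grA]] by simp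
 interpret m: group_hom "Grp A 0" "Grp A j" "%a. Mul A 0 j a b"
 using mul_hom2[OF s(4), of 0] grA by (simp add: group_hom_def group_hom_axioms_def)
 have "Mul A 0 j a b = b [^]\<^bsub>Grp A j\<^esub> ?k" using m.hom_int_pow[of "Unt A" ?k] ae s(4) by simp
 then show "bil [idm n] 0 a (fo s) - frag_cmul ?k (fo s) : N L n"
 using N_pow[of "[g]" n j b l L ?k] s by simp
qed

context free_res
begin

abbreviation "UR \<equiv> (unit_right \<epsilon> :: ('r, 'a, int) gl_right_module)"
abbreviation "Tg p n \<equiv> day_gens UR (Fm p) n"
abbreviation "Tr p n \<equiv> day_rels UR (Fm p) n"

lemma UR_simps [simp]: "Grp UR = unit_grp" "Act UR n g z = z" "RAct UR i j z a = z * \<epsilon> j a"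
 by (simp_all add: unit_right_def)

lemma Fm_act_closed: "h : GLc n ==> y : carrier (Grp (Fm p) n) ==> Act (Fm p) n h y : carrier (Grp (Fm p) n)"
 using kk_surj[of y p n] by (auto simp: kk_act lm_fr)

lemma LAct_closed: "a : Ag i ==> y : carrier (Grp (Fm p) j) ==> LAct (Fm p) i j a y : carrier (Grp (Fm p) (i + j))"
 using kk_surj[of y p j] bil1_fr[of i "i + j" "idm (i + j)" a _ "LT B p"] by (auto simp: kk_lact)

sublocale tr: presentation "Tg p n" "Tr p n" for p n
 by (rule presentation_day)
 (auto simp: Fm_act_closed group.is_monoid[OF comm_group.axioms(2)[OF comm_group_unit_grp]] group.is_monoid[OF comm_group.axioms(2)[OF cg_Fm]])

definition Qr :: "nat => nat => (('r, int, ('r, 'a, 'b) free_elt) day_gen \<Rightarrow>\<^sub>0 int) set" where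
 "Qr p n = {fo (g, i + j, z * \<epsilon> j a, y) - fo (g, i, z, LAct (Fm p) j k a y) | g i j k z a y. n = i + j + k &
 g : GLc n & z : carrier (unit_grp i) & a : Ag j & y : carrier (Grp (Fm p) k)}"

lemma unit_mult_closed: "z : carrier (unit_grp i) ==> a : Ag j ==> z * \<epsilon> j a : carrier (unit_grp (i + j))"
 using eps_pos[of a j] by (auto simp: unit_grp_def singleton_group_def split: if_splits)

lemma Qr_fr: "Qr p n <= fr (Tg p n)"
 by (auto simp: Qr_def day_gens_def unit_mult_closed add.assoc LAct_closed intro!: fr_diff)

lemma coeq: "coeq_subgroup A UR (Fm p) n = tr.qsub p n (Qr p n)"
proof -
 have "{day_elt UR (Fm p) n (g, i + j, RAct UR i j x a, y)
 \<otimes>\<^bsub>Grp (day_tensor UR (Fm p)) n\<^esub> inv\<^bsub>Grp (day_tensor UR (Fm p)) n\<^esub> day_elt UR (Fm p) n (g, i, x, LAct (Fm p) j k a y)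
 | g i j k x a y. n = i + j + k & g : GLc n & x : carrier (Grp UR i) & a : Ag j & y : carrier (Grp (Fm p) k)}
 = cls (Tg p n) (Tr p n) ` Qr p n" (is "?X = _")
 proof -
 have e: "day_elt UR (Fm p) n s \<otimes>\<^bsub>Grp (day_tensor UR (Fm p)) n\<^esub> inv\<^bsub>Grp (day_tensor UR (Fm p)) n\<^esub> day_elt UR (Fm p) n s'
 = cls (Tg p n) (Tr p n) (fo s - fo s')" if "s : Tg p n" "s' : Tg p n" for s s'
 using that by (simp add: day_elt_def presented_gen_cls day_tensor_def tr.cls_inv tr.cls_mult fr_minus)
 have g: "(g, i + j, z * \<epsilon> j a, y) : Tg p n" "(g, i, z, LAct (Fm p) j k a y) : Tg p n"
 if "n = i + j + k" "g : GLc n" "z : carrier (unit_grp i)" "a : Ag j" "y : carrier (Grp (Fm p) k)" for g i j k z a y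
 using that by (auto simp: day_gens_def unit_mult_closed add.assoc LAct_closed)
 show ?thesis
 proof (intro equalityI subsetI)
 fix t assume "t : ?X"
 then obtain g i j k z a y where s: "n = i + j + k" "g : GLc n" "z : carrier (unit_grp i)" "a : Ag j" "y : carrier (Grp (Fm p) k)"
 and t: "t = day_elt UR (Fm p) n (g, i + j, z * \<epsilon> j a, y) \<otimes>\<^bsub>Grp (day_tensor UR (Fm p)) n\<^esub> inv\<^bsub>Grp (day_tensor UR (Fm p)) n\<^esub> day_elt UR (Fm p) n (g, i, z, LAct (Fm p) j k a y)"
 unfolding UR_simps by (elim CollectE exE conjE) (rule that; assumption)
 show "t : cls (Tg p n) (Tr p n) ` Qr p n" unfolding t e[OF g[OF s]] by (rule imageI, unfold Qr_def, rule CollectI, intro exI conjI, rule refl) (use s in auto)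
 next
 fix t assume "t : cls (Tg p n) (Tr p n) ` Qr p n"
 then obtain g i j k z a y where s: "n = i + j + k" "g : GLc n" "z : carrier (unit_grp i)" "a : Ag j" "y : carrier (Grp (Fm p) k)"
 and t: "t = cls (Tg p n) (Tr p n) (fo (g, i + j, z * \<epsilon> j a, y) - fo (g, i, z, LAct (Fm p) j k a y))"
 unfolding Qr_def by (elim imageE CollectE exE conjE) (rule that; simp)
 show "t : ?X" unfolding t e[OF g[OF s], symmetric] UR_simps by (rule CollectI, intro exI conjI, rule refl) (use s in auto)
 qed
 qed
 then show ?thesis by (simp add: coeq_subgroup_def tr.qsub_def[OF Qr_fr] day_tensor_def)
qed

abbreviation "W p n \<equiv> gsp (Tr p n \<union> Qr p n)"
abbreviation "qc p n \<equiv> tr.qcl p n (Qr p n)"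
abbreviation "tt p n y \<equiv> fo (idm n, 0 :: nat, 1 :: int, y :: ('r, 'a, 'b) free_elt)"
abbreviation "Fc p n \<equiv> carrier (Grp (Fm p) n)"

lemma module_tensor_eq: "module_tensor A UR (Fm p) n = presented (Tg p n) (Tr p n) Mod tr.qsub p n (Qr p n)"
 by (simp add: module_tensor_def coeq day_tensor_def)

lemma Wx: "g : GLc n ==> i <= n ==> z : carrier (unit_grp i) ==> z' : carrier (unit_grp i) ==> y : Fc p (n - i)
 ==> fo (g, i, z \<otimes>\<^bsub>unit_grp i\<^esub> z', y) - fo (g, i, z, y) - fo (g, i, z', y) : W p n"
 by (rule gsp_base, rule UnI1, unfold day_rels_def UR_simps, rule UnI1, rule UnI1, rule CollectI, intro exI conjI, rule refl, simp_all)

lemma Wy: "g : GLc n ==> i <= n ==> z : carrier (unit_grp i) ==> y : Fc p (n - i) ==> y' : Fc p (n - i)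
 ==> fo (g, i, z, y \<otimes>\<^bsub>Grp (Fm p) (n - i)\<^esub> y') - fo (g, i, z, y) - fo (g, i, z, y') : W p n"
 by (rule gsp_base, rule UnI1, unfold day_rels_def UR_simps, rule UnI1, rule UnI2, rule CollectI, intro exI conjI, rule refl, simp_all)

lemma Wh: "g : GLc n ==> z : carrier (unit_grp 0) ==> y : Fc p n ==> fo (g, 0, z, y) - fo (idm n, 0, z, Act (Fm p) n g y) : W p n"
 by (rule gsp_base, rule UnI1, unfold day_rels_def, rule UnI2, rule CollectI, rule exI[of _ "idm n"], rule exI[of _ "idm 0"], rule exI[of _ g],
 rule exI[of _ 0], rule exI[of _ z], rule exI[of _ y], simp)

lemma Wq: "g : GLc n ==> j <= n ==> a : Ag j ==> y : Fc p (n - j) ==> fo (g, j, \<epsilon> j a, y) - fo (g, 0, 1, LAct (Fm p) j (n - j) a y) : W p n"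
 by (rule gsp_base, rule UnI2, unfold Qr_def, rule CollectI, rule exI[of _ g], rule exI[of _ 0], rule exI[of _ j], rule exI[of _ "n - j"],
 rule exI[of _ 1], rule exI[of _ a], rule exI[of _ y]) (simp add: unit_grp_def)

lemma one_unit: "1 : carrier (unit_grp 0)" by (simp add: unit_grp_def)

lemma tt_fr: "c : fr (gens1 (LT B p) n) ==> tt p n (kk p n c) : fr (Tg p n)"
 by (simp add: day_gens_def one_unit)

lemma tt_diff: "c : fr (gens1 (LT B p) n) ==> c' : fr (gens1 (LT B p) n)
 ==> tt p n (kk p n (c - c')) - (tt p n (kk p n c) - tt p n (kk p n c')) : W p n"
 using gsp_minus[OF Wy[of "idm n" n 0 1 "kk p n (c - c')" p "kk p n c'"]] by (simp add: kk_add fr_diff one_unit algebra_simps)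

lemma W_zero: "g : GLc n ==> i <= n ==> i > 0 ==> y : Fc p (n - i) ==> fo (g, i, 0, y) : W p n"
 using Wx[of g n i 0 0 y p] gsp_minus_iff[of "fo (g, i, 0, y)"] by (simp add: unit_grp_def singleton_group_def)

lemma tt_W0: "tt p n (kk p n 0) : W p n"
 using Wy[of "idm n" n 0 1 "kk p n 0" p "kk p n 0"] gsp_minus_iff[of "tt p n (kk p n 0)"] by (simp add: kk_add one_unit)

lemma tt_W_diff: "c : fr (gens1 (LT B p) n) ==> c' : fr (gens1 (LT B p) n) ==> tt p n (kk p n c) : W p n
 ==> tt p n (kk p n c') : W p n ==> tt p n (kk p n (c - c')) : W p n"
 using gsp_add[OF tt_diff[of c p n c'] gsp_diff[of "tt p n (kk p n c)" _ "tt p n (kk p n c')"]] by simp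

text \<open>\<open>tt p n y\<close> is the tensor 1 \<otimes> y. Since \<int> lives in degree 0,
  tensors with i > 0 vanish; for i = 0 the matrix moves into y, and an integer z = \<epsilon>(a)
  with a in A_0 moves across the tensor sign.\<close>

lemma tt_surj: "t : fr (Tg p n) ==> \<exists>c\<in>fr (gens1 (LT B p) n). t - tt p n (kk p n c) : W p n"
proof (induction rule: fr_induct)
 case zero then show ?case using tt_W0 by (intro bexI[of _ 0]) auto
next
 case (of s)
 then obtain g i z y where s: "s = (g, i, z, y)" "g : GLc n" "i <= n" "z : carrier (unit_grp i)" "y : Fc p (n - i)" by (auto simp: day_gens_def)
 show ?case
 proof (cases "i = 0")
 case True
 obtain a where a: "a : Ag 0" "\<epsilon> 0 a = z" using s(4) True unfolding eps_surj[symmetric] by auto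
 have y: "y : Fc p n" "Act (Fm p) n g y : Fc p n" using s True Fm_act_closed by auto
 have l: "LAct (Fm p) 0 n a (Act (Fm p) n g y) : Fc p n" using LAct_closed[OF a(1) y(2)] by simp
 obtain c where c: "c : fr (gens1 (LT B p) n)" "LAct (Fm p) 0 n a (Act (Fm p) n g y) = kk p n c" using kk_surj[OF l] by blast
 have "fo s - fo (idm n, 0, z, Act (Fm p) n g y) : W p n" using Wh[OF s(2) _ y(1), of z] s True by simp
 moreover have "fo (idm n, 0, z, Act (Fm p) n g y) - tt p n (kk p n c) : W p n"
 using Wq[of "idm n" n 0 a "Act (Fm p) n g y" p] a y c(2) by simp
 ultimately show ?thesis using c(1) gsp_diff_trans by blast
 next
 case False
 then have "z = 0" using s(4) by (simp add: unit_grp_def singleton_group_def)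
 moreover have "fo (g, i, 0, y) - tt p n (kk p n 0) : W p n"
 by (rule gsp_diff[OF W_zero[OF s(2,3) _ s(5)] tt_W0]) (use False in simp)
 ultimately show ?thesis using s(1) by (intro bexI[of _ 0]) simp_all
 qed
next
 case (diff t t')
 then obtain c c' where c: "c : fr (gens1 (LT B p) n)" "t - tt p n (kk p n c) : W p n" "c' : fr (gens1 (LT B p) n)" "t' - tt p n (kk p n c') : W p n" by blast
 from gsp_diff[OF gsp_diff_diff[OF c(2,4)] tt_diff[OF c(1,3)]]
 show ?case using fr_diff[OF c(1,3)] by (intro bexI[of _ "c - c'"]) simp_all
qed

lemma lm_N: "g : GLc n ==> c : fr (gens1 (LT B p) n) ==> c : N (LT B p) n ==> lm g c : N (LT B p) n"
 using kk_act[of g n c p] kk_act[of g n 0 p] kk_eq_iff[of c p n 0] kk_eq_iff[of "lm g c" p n "lm g 0"] lm_fr[of g n c p]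
 by (simp add: addv_zero[OF addv_lm])

lemma restr0_N: "c : N L n ==> restr0 c : N L n"
 by (rule restr_N[where Q = "%_ i _. i = 0"]) simp_all

definition kinv :: "nat => nat => ('r, 'a, 'b) free_elt => ('r, 'a, 'b lbl) chain" where
 "kinv p n y = (SOME c. c : fr (gens1 (LT B p) n) & kk p n c = y)"

lemma kinv: assumes "y : Fc p n" shows "kinv p n y : fr (gens1 (LT B p) n)" "kk p n (kinv p n y) = y"
 using someI_ex[of "%c. c : fr (gens1 (LT B p) n) & kk p n c = y"] kk_surj[OF assms] unfolding kinv_def by blast+

text \<open>A map back from \<int> \<otimes> F to chains: z \<otimes> y goes to z times the part of
  y with coefficient in A_0. It serves to show that 1 \<otimes> y vanishes only for the evident
  reason.\<close>

definition Ph :: "nat => nat => (('r, int, ('r, 'a, 'b) free_elt) day_gen \<Rightarrow>\<^sub>0 int) => ('r, 'a, 'b lbl) chain" where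
 "Ph p n = fex (%(g, i, z, y). if i = 0 then frag_cmul z (restr0 (lm g (kinv p n y))) else 0)"

lemma addv_Ph [simp, intro]: "addv (Ph p n)" by (simp add: Ph_def)
lemma Ph_of [simp]: "Ph p n (fo (g, i, z, y)) = (if i = 0 then frag_cmul z (restr0 (lm g (kinv p n y))) else 0)" by (simp add: Ph_def)

lemma Ph_eq:
 assumes "g : GLc n" "c : fr (gens1 (LT B p) n)" "c : N (LT B p) n"
 shows "frag_cmul z (restr0 (lm g c)) : N (LT B p) n"
 by (intro N_cmul restr0_N lm_N assms)

text \<open>For the coequalizer relations: multiplying by A_j with j > 0 leaves nothing of index 0,
  in accordance with \<epsilon> = 0 there, and A_0 acts through integers by
  \<open>unit_act\<close>.\<close>

lemma Ph_W: "w : W p n ==> Ph p n w : N (LT B p) n"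
 unfolding N_def
proof (rule addv_gsp[OF addv_Ph], fold N_def)
 note dist = addvD[OF addv_Ph] addvD[OF addv_lm, symmetric] addvD[OF addv_restr, symmetric] addvD[OF addv_frag_cmul[OF addv_id], symmetric]
 fix r assume "r : Tr p n \<union> Qr p n"
 then show "Ph p n r : N (LT B p) n"
 proof
 assume "r : Tr p n"
 then show ?thesis
 proof (cases rule: day_rels_cases)
 case (x g i z z' y)
 then show ?thesis by (cases "i = 0") (simp_all add: addvD[OF addv_Ph] frag_cmul_distrib unit_grp_def)
 next
 case (y g i z y y')
 show ?thesis
 proof (cases "i = 0")
 case True
 then have yy: "y : Fc p n" "y' : Fc p n" "y \<otimes>\<^bsub>Grp (Fm p) n\<^esub> y' : Fc p n"
 using y monoid.m_closed[OF group.is_monoid[OF comm_group.axioms(2)[OF cg_Fm]]] by auto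
 let ?c = "kinv p n (y \<otimes>\<^bsub>Grp (Fm p) n\<^esub> y') - kinv p n y - kinv p n y'"
 note k = kinv[OF yy(1)] kinv[OF yy(2)] kinv[OF yy(3)]
 have f: "kinv p n y + kinv p n y' : fr (gens1 (LT B p) n)" "?c : fr (gens1 (LT B p) n)" using k by (auto intro: fr_add fr_diff)
 have "kk p n (kinv p n y + kinv p n y') = y \<otimes>\<^bsub>Grp (Fm p) n\<^esub> y'" using kk_add[OF k(1,3)] k by simp
 then have "?c : N (LT B p) n" using kk_eq_iff[OF k(5) f(1)] k(6) by (simp add: diff_diff_eq)
 from Ph_eq[OF y(2) f(2) this, of z] show ?thesis by (simp add: y(1) True dist del: addvD)
 qed (simp add: y(1) addvD[OF addv_Ph])
 next
 case (h g h k i z y)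
 show ?thesis
 proof (cases "i = 0")
 case True
 then have h': "h = idm 0" "k : GLc n" "y : Fc p n" using h by (auto simp: GLc_0)
 note a = Fm_act_closed[OF h'(2,3)]
 let ?c = "lm k (kinv p n y) - kinv p n (Act (Fm p) n k y)"
 have f: "lm k (kinv p n y) : fr (gens1 (LT B p) n)" using lm_fr[OF h'(2)] kinv(1)[OF h'(3)] .
 have "?c : N (LT B p) n"
 using kk_eq_iff[OF f kinv(1)[OF a]] kk_act[OF h'(2) kinv(1)[OF h'(3)]] kinv(2)[OF h'(3)] kinv(2)[OF a] by simp
 from Ph_eq[OF h(2) fr_diff[OF f kinv(1)[OF a]] this, of z]
 have "frag_cmul z (restr0 (lm g ?c)) : N (LT B p) n" .
 moreover have "lm g (lm k (kinv p n y)) = lm (g * k) (kinv p n y)"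
 by (rule addv_eq_on[OF _ _ kinv(1)[OF h'(3)]]) (use GLc_assoc[OF h(2) h'(2)] in \<open>auto simp: addv_def addvD[OF addv_lm] gens1_def\<close>)
 ultimately show ?thesis by (simp add: h(1) True h' addvD[OF addv_Ph] addvD[OF addv_lm] addvD[OF addv_restr] addvD[OF addv_frag_cmul[OF addv_id]])
 qed (simp add: h(1) addvD[OF addv_Ph])
 qed
 next
 assume "r : Qr p n"
 then obtain g i j k z a y where r: "r = fo (g, i + j, z * \<epsilon> j a, y) - fo (g, i, z, LAct (Fm p) j k a y)"
 "n = i + j + k" "g : GLc n" "a : Ag j" "y : Fc p k" unfolding Qr_def by (elim CollectE exE conjE) (rule that; assumption)
 show ?thesis
 proof (cases "i = 0")
 case True
 then have n: "n = j + k" using r by simp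
 note l = LAct_closed[OF r(4,5), folded n] and c = kinv(1)[OF r(5)]
 let ?b = "bil [idm n] j a (kinv p k y)"
 have b: "?b : fr (gens1 (LT B p) n)" by (rule bil1_fr) (use r n c in auto)
 have kb: "kinv p n (LAct (Fm p) j k a y) - ?b : N (LT B p) n"
 using kk_eq_iff[OF kinv(1)[OF l] b] kk_lact[OF r(4) c] kinv(2)[OF l] kinv(2)[OF r(5)] n by simp
 have 1: "frag_cmul z (restr0 (lm g (kinv p n (LAct (Fm p) j k a y)))) - frag_cmul z (restr0 (lm g ?b)) : N (LT B p) n"
 using Ph_eq[OF r(3) fr_diff[OF kinv(1)[OF l] b] kb, of z] by (simp add: addvD[OF addv_lm] addvD[OF addv_restr] addvD[OF addv_frag_cmul[OF addv_id]])
 show ?thesis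
 proof (cases "j = 0")
 case j: True
 then have e: "?b - frag_cmul (\<epsilon> 0 a) (kinv p n y) : N (LT B p) n" "kinv p n y : fr (gens1 (LT B p) n)"
 using unit_act[of a "kinv p n y" "LT B p" n] r n c by auto
 have "frag_cmul z (restr0 (lm g ?b)) - frag_cmul (z * \<epsilon> 0 a) (restr0 (lm g (kinv p n y))) : N (LT B p) n"
 using Ph_eq[OF r(3) fr_diff[OF b fr_cmul[OF e(2)]] e(1), of z]
 by (simp add: addvD[OF addv_lm] addvD[OF addv_restr] addvD[OF addv_frag_cmul[OF addv_id]] addv_cmul[OF addv_lm] addv_cmul[OF addv_restr])
 from iffD1[OF N_commute N_trans[OF 1 this]] show ?thesis using True j r n by (simp add: addvD[OF addv_Ph])
 next
 case False
 have "restr0 (lm g ?b) = 0"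
 by (rule addv_eq_on[of "%c. restr0 (lm g (bil [idm n] j a c))" "%_. 0", OF _ _ c])
 (use False in \<open>auto simp: addv_def addvD[OF addv_lm] addvD[OF addv_restr] addvD[OF addv_bil] gens1_def\<close>)
 moreover have "frag_cmul (- z) (restr0 (lm g (kinv p n (LAct (Fm p) j k a y)))) - frag_cmul (- z) (restr0 (lm g ?b)) : N (LT B p) n"
 using Ph_eq[OF r(3) fr_diff[OF kinv(1)[OF l] b] kb, of "- z"] by (simp add: addvD[OF addv_lm] addvD[OF addv_restr] addvD[OF addv_frag_cmul[OF addv_id]])
 ultimately show ?thesis using True False r by (simp add: addvD[OF addv_Ph])
 qed
 qed (simp add: r(1) addvD[OF addv_Ph])
 qed
qed

text \<open>\<int> \<otimes>_A F is F modulo the multiples of A_j with j > 0, which leaves the part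
  with coefficient in A_0. One direction is \<open>Ph_W\<close>; for the other, a generator of
  positive index is a times a basis element, and 1 \<otimes> a y = \<epsilon>(a) \<otimes> y =
  0.\<close>

lemma tt_W_iff:
 assumes c: "c : fr (gens1 (LT B p) n)" shows "tt p n (kk p n c) : W p n \<longleftrightarrow> restr0 c : N (LT B p) n"
proof
 assume w: "tt p n (kk p n c) : W p n"
 note k = kinv[OF kk_in[OF c]]
 have "lm (idm n) (kinv p n (kk p n c)) = kinv p n (kk p n c)"
 by (rule addv_eq_on[OF addv_lm addv_id k(1)]) (auto simp: gens1_def)
 then have "restr0 (kinv p n (kk p n c)) : N (LT B p) n" using Ph_W[OF w] by simp
 moreover have "restr0 (kinv p n (kk p n c) - c) : N (LT B p) n" using kk_eq_iff[OF k(1) c] k(2) by (intro restr0_N) simp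
 ultimately show "restr0 c : N (LT B p) n" using N_mem[of "restr0 (kinv p n (kk p n c))" "restr0 c"] by (simp add: addvD[OF addv_restr])
next
 assume r: "restr0 c : N (LT B p) n"
 have f: "restr0 c : fr (gens1 (LT B p) n)" "restr (%x. idx x ~= 0) c : fr {x : gens1 (LT B p) n. idx x ~= 0}"
 using c by (auto intro: restr_fr' restr_fr)
 have "tt p n (kk p n (restr0 c)) : W p n" using kk_eq_iff[OF f(1) fr_zero] r tt_W0 by simp
 moreover have "tt p n (kk p n u) : W p n" if "u : fr {x : gens1 (LT B p) n. idx x ~= 0}" for u
 using that
 proof (induction rule: fr_induct)
 case zero show ?case by (rule tt_W0)
 next
 case (of s)
 then obtain g i a b where s: "s = ([g], i, a, p, n - i, b)" "g : GLc n" "i <= n" "a : Ag i" "b : B p (n - i)" "i > 0" by (auto elim!: gens1_LT_cases)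
 let ?u = "inc (n - i) (p, n - i, b) :: ('r, 'a, 'b lbl) chain"
 have u: "?u : fr (gens1 (LT B p) (n - i))" by (rule inc_fr) (use s in simp)
 have e: "fo s = bil [g] i a ?u" using s by (simp add: inc_def)
 let ?y = "LAct (Fm p) i (n - i) a (kk p (n - i) ?u)"
 have y: "?y : Fc p n" using LAct_closed[OF s(4) kk_in[OF u]] s(3) by simp
 have "fo (g, 0, 1, ?y) : W p n"
 using gsp_diff_mem[OF Wq[OF s(2-4) kk_in[OF u]]] W_zero[OF s(2,3,6) kk_in[OF u]] eps_pos[OF s(4,6)] by simp
 then show ?case using gsp_diff_mem[OF Wh[OF s(2) one_unit y]] kk_gen[OF s(2-4) u] by (simp add: e)
 next
 case (diff u u')
 then show ?case by (intro tt_W_diff) (auto elim!: fr_mono)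
 qed
 ultimately have "tt p n (kk p n (restr0 c - (- restr (%x. idx x ~= 0) c))) : W p n"
 using f by (intro tt_W_diff) (auto intro!: fr_minus elim!: fr_mono)
 then show "tt p n (kk p n c) : W p n" using restr_split[of "%x. idx x = 0" c] by simp
qed

definition be :: "nat => nat => (('r, int, ('r, 'a, 'b) free_elt) day_gen \<Rightarrow>\<^sub>0 int) => (('r, int, ('r, 'a, 'b) free_elt) day_gen \<Rightarrow>\<^sub>0 int)" where
 "be p n = fex (%(g, i, z, y). fo (g, i, z, d p (n - i) y))"

lemma addv_be [simp, intro]: "addv (be p n)" by (simp add: be_def)

lemma d_closed: "y : Fc (Suc p) n ==> d (Suc p) n y : Fc p n" using hom_in_carrier[OF d_hom] .

lemma be_fr: "t : fr (Tg (Suc p) n) ==> be (Suc p) n t : fr (Tg p n)"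
 by (rule addv_fr[OF addv_be]) (auto simp: be_def day_gens_def d_closed)

lemma be_Tr: "r : Tr (Suc p) n ==> be (Suc p) n r : Tr p n"
 unfolding be_def
 by (rule day_rels_map[where G = "%g. g" and \<iota> = "%i. i" and f = "%i x. x" and f' = "d (Suc p)" and \<theta> = "%i h. h"])
 (use d_left[of p] hom_mult[OF d_hom] in \<open>auto simp: d_closed left_hom_def gl_hom_def\<close>)

lemma be_W: "t : W (Suc p) n ==> be (Suc p) n t : W p n"
proof (rule addv_gsp[OF addv_be])
 fix r assume "r : Tr (Suc p) n \<union> Qr (Suc p) n"
 then show "be (Suc p) n r : W p n"
 proof
 assume "r : Tr (Suc p) n" then show ?thesis using be_Tr by (blast intro: gsp_base)
 next
 assume "r : Qr (Suc p) n"
 then obtain g i j k z a y where r: "r = fo (g, i + j, z * \<epsilon> j a, y) - fo (g, i, z, LAct (Fm (Suc p)) j k a y)"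
 "n = i + j + k" "g : GLc n" "z : carrier (unit_grp i)" "a : Ag j" "y : Fc (Suc p) k" unfolding Qr_def by (elim CollectE exE conjE) (rule that; assumption)
 have "d (Suc p) (j + k) (LAct (Fm (Suc p)) j k a y) = LAct (Fm p) j k a (d (Suc p) k y)" using d_left r(5,6) unfolding left_hom_def by blast
 then have "be (Suc p) n r = fo (g, i + j, z * \<epsilon> j a, d (Suc p) k y) - fo (g, i, z, LAct (Fm p) j k a (d (Suc p) k y))"
 using r(1,2) by (simp add: be_def frag_extend_diff add.assoc)
 also have "... : Qr p n" unfolding Qr_def by (rule CollectI, intro exI conjI, rule refl) (use r d_closed in auto)
 finally show ?thesis by (blast intro: gsp_base)
 qed
qed

abbreviation "MT n p \<equiv> module_tensor A UR (Fm p) n"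
abbreviation "MD n p \<equiv> module_tensor_map A UR (Fm (p - 1)) (d p) n"

lemma MD_qc: "t : fr (Tg (Suc p) n) ==> MD n (Suc p) (qc (Suc p) n t) = qc p n (be (Suc p) n t)"
proof -
 assume t: "t : fr (Tg (Suc p) n)"
 obtain t' where t': "t' : fr (Tg (Suc p) n)" "(SOME s. s : qc (Suc p) n t) = cls (Tg (Suc p) n) (Tr (Suc p) n) t'" "t' - t : W (Suc p) n"
 using tr.qcl_rep[OF Qr_fr t] by blast
 have "presented_ext (presented (Tg p n) (Tr p n)) (%(g, i, x, y). day_elt UR (Fm p) n (g, i, x, d (Suc p) (n - i) y)) (cls (Tg (Suc p) n) (Tr (Suc p) n) t')
 = cls (Tg p n) (Tr p n) (be (Suc p) n t')"
 unfolding be_def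
 by (rule tr.presented_ext_presented[OF tr.rels t'(1)])
 (use be_Tr[unfolded be_def] in \<open>auto simp: day_elt_def presented_gen_cls day_gens_def d_closed intro!: gsp_base\<close>)
 then have "MD n (Suc p) (qc (Suc p) n t) = qc p n (be (Suc p) n t')"
 by (simp add: module_tensor_map_def coeq day_tensor_def t'(2)) (simp add: tr.qcl_def[OF Qr_fr])
 also have "... = qc p n (be (Suc p) n t)"
 using tr.qcl_eq_iff[OF Qr_fr be_fr[OF t'(1)] be_fr[OF t]] be_W[OF t'(3)] by (simp add: addvD[OF addv_be])
 finally show ?thesis .
qed

abbreviation "tq p n c \<equiv> qc p n (tt p n (kk p n c))"

lemma MD_tq: "c : fr (gens1 (LT B (Suc p)) n) ==> MD n (Suc p) (tq (Suc p) n c) = tq p n (xt \<delta> c)"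
 using MD_qc[OF tt_fr[of c "Suc p" n]] by (simp add: be_def d_kk)

lemma tq_surj: "x : carrier (MT n p) ==> \<exists>c\<in>fr (gens1 (LT B p) n). x = tq p n c"
 unfolding module_tensor_eq tr.carrier_quot[OF Qr_fr]
proof (elim imageE)
 fix t assume t: "x = qc p n t" "t : fr (Tg p n)"
 obtain c where c: "c : fr (gens1 (LT B p) n)" "t - tt p n (kk p n c) : W p n" using tt_surj[OF t(2)] by blast
 then show ?thesis using tr.qcl_eq_iff[OF Qr_fr t(2) tt_fr[OF c(1)]] t(1) by auto
qed

lemma tq_in: "c : fr (gens1 (LT B p) n) ==> tq p n c : carrier (MT n p)"
 unfolding module_tensor_eq tr.carrier_quot[OF Qr_fr] using tt_fr by blast

lemma tq_eq_iff:
 assumes c: "c : fr (gens1 (LT B p) n)" "c' : fr (gens1 (LT B p) n)"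
 shows "tq p n c = tq p n c' \<longleftrightarrow> restr0 (c - c') : N (LT B p) n"
 unfolding tr.qcl_eq_iff[OF Qr_fr tt_fr[OF c(1)] tt_fr[OF c(2)]] tt_W_iff[OF fr_diff[OF c], symmetric]
 using gsp_diff_mem[OF tt_diff[OF c]] by simp

lemma tq_one_iff:
 assumes c: "c : fr (gens1 (LT B p) n)" shows "tq p n c = \<one>\<^bsub>MT n p\<^esub> \<longleftrightarrow> restr0 c : N (LT B p) n"
proof -
 have "\<one>\<^bsub>MT n p\<^esub> = qc p n 0" unfolding module_tensor_eq by (rule tr.qcl_one[OF Qr_fr])
 then show ?thesis using tr.qcl_eq_iff[OF Qr_fr tt_fr[OF c] fr_zero] tt_W_iff[OF c] by simp
qed

lemma MT_complex: "abelian_complex (MT n) (MD n)"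
proof (rule abelian_complex.intro)
 show "comm_group (MT n p)" for p unfolding module_tensor_eq by (rule tr.quot_comm[OF Qr_fr])
 fix p
 show "MD n (Suc p) : hom (MT n (Suc p)) (MT n p)"
 proof (rule homI)
 fix x assume "x : carrier (MT n (Suc p))"
 then obtain t where t: "t : fr (Tg (Suc p) n)" "x = qc (Suc p) n t" unfolding module_tensor_eq tr.carrier_quot[OF Qr_fr] by blast
 show "MD n (Suc p) x : carrier (MT n p)"
 unfolding t(2) MD_qc[OF t(1)] module_tensor_eq tr.carrier_quot[OF Qr_fr] using be_fr[OF t(1)] by blast
 fix y assume "y : carrier (MT n (Suc p))"
 then obtain u where u: "u : fr (Tg (Suc p) n)" "y = qc (Suc p) n u" unfolding module_tensor_eq tr.carrier_quot[OF Qr_fr] by blast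
 have "x \<otimes>\<^bsub>MT n (Suc p)\<^esub> y = qc (Suc p) n (t + u)" unfolding t(2) u(2) module_tensor_eq by (rule tr.qcl_mult[OF Qr_fr t(1) u(1)])
 moreover have "qc p n (be (Suc p) n t) \<otimes>\<^bsub>MT n p\<^esub> qc p n (be (Suc p) n u) = qc p n (be (Suc p) n (t + u))"
 unfolding module_tensor_eq addv_add[OF addv_be] by (rule tr.qcl_mult[OF Qr_fr be_fr[OF t(1)] be_fr[OF u(1)]])
 ultimately show "MD n (Suc p) (x \<otimes>\<^bsub>MT n (Suc p)\<^esub> y) = MD n (Suc p) x \<otimes>\<^bsub>MT n p\<^esub> MD n (Suc p) y"
 using MD_qc[OF t(1)] MD_qc[OF u(1)] MD_qc[OF fr_add[OF t(1) u(1)]] t(2) u(2) by simp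
 qed
 fix x assume "x : carrier (MT n (Suc (Suc p)))"
 then obtain c where c: "c : fr (gens1 (LT B (Suc (Suc p))) n)" "x = tq (Suc (Suc p)) n c" using tq_surj by blast
 note x = xt_fr1[OF map_delta c(1)]
 have "d (Suc (Suc p)) n (kk (Suc (Suc p)) n c) : kernel (Grp (Fm (Suc p)) n) (Grp (Fm p) n) (d (Suc p) n)"
 unfolding d_ker[symmetric] by (rule imageI[OF kk_in[OF c(1)]])
 then have "xt \<delta> (xt \<delta> c) : N (LT B p) n" using kk_one_iff[OF xt_fr1[OF map_delta x]] by (simp add: kernel_def d_kk c(1) x)
 then show "MD n (Suc p) (MD n (Suc (Suc p)) x) = \<one>\<^bsub>MT n p\<^esub>"
 using MD_tq[OF c(1)] MD_tq[OF x] tq_one_iff[OF xt_fr1[OF map_delta x]] restr0_N c(2) by simp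
qed

text \<open>By \<open>tq_one_iff\<close> and \<open>MD_tq\<close> the complex defining Tor consists
  of chains of single vertices modulo those whose part of index 0 is a relation, with
  \<open>xt \<delta>\<close> as differential; cycles and boundaries translate accordingly.\<close>

lemma koszul_exact:
 assumes t: "trivial_group (homology (MT n) (MD n) p)" and z: "z : fr (gens1 (LT B p) n)" "restr0 (xt \<delta> z) : N (LA B) n"
 shows "\<exists>w\<in>fr (gens1 (LT B (Suc p)) n). restr0 (z - xt \<delta> w) : N (LT B p) n"
proof -
 have "tq p n z : cycles (MT n) (MD n) p"
 proof (cases p)
 case 0 then show ?thesis using tq_in[OF z(1)] by (simp add: cycles_def)
 next
 case (Suc q)
 then have x: "xt \<delta> z : fr (gens1 (LT B q) n)" using xt_fr1[OF map_delta] z(1) by blast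
 \<comment> \<open>The hypothesis allows relations over all labels; projecting to resolution degree
   q makes them relations over F_q.\<close>
 have "restr (%x. pl x = q) (restr0 (xt \<delta> z)) : N (LT B q) n"
 by (rule restr_N'[OF z(2), where Q = "%_ _ l. fst l = q"]) (auto simp: LA_def LT_def pl_def)
 moreover have "restr (%x. pl x = q) (restr0 (xt \<delta> z)) = restr0 (xt \<delta> z)"
 by (rule restr_id[OF restr_fr[OF x]]) (auto elim!: gens1_LT_cases)
 ultimately have "tq q n (xt \<delta> z) = \<one>\<^bsub>MT n q\<^esub>" using tq_one_iff[OF x] by simp
 then show ?thesis using tq_in[OF z(1)] MD_tq[of z q n] z(1) Suc by (simp add: cycles_def kernel_def)
 qed
 then have "tq p n z : boundaries (MT n) (MD n) p" using t abelian_complex.trivial_iff[OF MT_complex] by blast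
 then obtain x where x: "tq p n z = MD n (Suc p) x" "x : carrier (MT n (Suc p))" unfolding boundaries_def by (rule imageE)
 obtain w where w: "w : fr (gens1 (LT B (Suc p)) n)" "x = tq (Suc p) n w" using tq_surj[OF x(2)] by blast
 have "tq p n z = tq p n (xt \<delta> w)" using x(1) w MD_tq by simp
 then show ?thesis using tq_eq_iff[OF z(1) xt_fr1[OF map_delta w(1)]] w(1) by blast
qed

end

theorem theorem1p8:
  fixes A :: "('r :: idom, 'a) gl_monoid"
  assumes "principal_domain (class_ring :: 'r ring)"
    and "is_monoid A"
    and "commutative A \<or> skew_commutative A"
    and "koszul A"
    and "trivial_group (gl_homology A 2 0)"
    and "product_surjective A 1 2 0 1"
  shows "(\<forall>i n. n \<ge> 2 * i + 1 \<longrightarrow> product_surjective A 1 (n - 1) 0 i) \<and>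
         (\<forall>i n. n \<ge> 2 * i + 2 \<longrightarrow> trivial_group (gl_homology A n i))"
proof -
  interpret gl_alg A by unfold_locales (rule assms(2))
  obtain \<epsilon> where \<epsilon>: "augmentation A \<epsilon>"
    and tor: "\<And>p n. n \<noteq> p \<Longrightarrow> trivial_group (Tor A (unit_right \<epsilon>) (unit_left \<epsilon>) p n)"
    using assms(4) unfolding koszul_def by blast
  obtain dec :: "('r \<times> 'a \<times> int) list \<Rightarrow> ('r, 'a, ('r \<times> 'a \<times> int) list lbl) chain" where dec: "surj dec"
    using ex_decoding by blast
  \<comment> \<open>Any code can name the generator in degree 0.\<close>
  interpret b: bar_res A \<epsilon> dec undefined by unfold_locales (rule \<epsilon> dec)+
  \<comment> \<open>The very choice made inside \<open>Tor\<close>, named so that unfolding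
    \<open>Tor\<close> yields the complex of this particular resolution.\<close>
  define R where "R = (SOME (B, d). \<exists>\<eta>. free_resolution A (unit_left \<epsilon> :: ('r, 'a, int) gl_left_module)
     (B :: nat \<Rightarrow> nat \<Rightarrow> ('r \<times> 'a \<times> int) list set) d \<eta>)"
  obtain B d where R: "R = (B, d)" by (cases R)
  have "case R of (B, d) \<Rightarrow> \<exists>\<eta>. free_resolution A (unit_left \<epsilon> :: ('r, 'a, int) gl_left_module) B d \<eta>"
    unfolding R_def by (rule someI[of _ "(b.Bx, b.dx)"]) (use b.free_resolution_exists in auto)
  then obtain \<eta> where \<eta>: "free_resolution A (unit_left \<epsilon> :: ('r, 'a, int) gl_left_module) B d \<eta>" unfolding R by auto
  interpret f: free_res A \<epsilon> B d \<eta> by unfold_locales (rule \<eta>)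
  have kz: "trivial_group (homology (f.MT n) (f.MD n) p)" if "n \<noteq> p" for n p
    using tor[OF that] unfolding Tor_def R_def[symmetric] R by simp
  obtain f0 where f0: "f0 \<in> fr (gens1 (LT B 0) 0)" "aug f.wt f0 - inc 0 () \<in> N LC 0" using f.f0_ex by blast
  interpret r: resolution A B f.\<delta> f.wt f0
  proof unfold_locales
    show "f.\<delta> (0, k, b) = 0" for k b by (simp add: f.\<delta>_def)
    show "\<exists>w\<in>fr (gens1 (LT B (Suc p)) k). restr0 (z - xt f.\<delta> w) \<in> N (LT B p) k"
      if "p < k" "z \<in> fr (gens1 (LT B p) k)" "restr0 (xt f.\<delta> z) \<in> N (LA B) k" for p k z
      by (rule f.koszul_exact[OF kz that(2,3)]) (use that in simp)
  qed (fact f.delta(1) f.dd f.exact_Suc f.exact_0 f0 f.aug_delta f.aug_exact)+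
  \<comment> \<open>Hypothesis (b) is about GL_3, hence the parameter 2 of \<open>RG\<close>; (skew)
    commutativity enters here, to pass from left to right products.\<close>
  have "Hz 2 0" "RG (Suc (Suc 0)) 1"
    using assms(5,6) trivial_gl_homology product_surjective_RG[OF assms(3)] by (simp_all add: numeral_2_eq_2)
  note s = r.stability[OF this]
  show ?thesis
  proof (intro conjI allI impI)
    fix i n :: nat
    show "product_surjective A 1 (n - 1) 0 i" if "n \<ge> 2 * i + 1"
      unfolding product_surjective_RG[OF assms(3)] using s[of i] that by auto
    show "trivial_group (gl_homology A n i)" if "n \<ge> 2 * i + 2"
      unfolding trivial_gl_homology using s[of i] that by auto
  qed
qed

end
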